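(* Let $\epsilon\in\{-1,1\}$ and $H>0$ with $4H^2+\epsilon>0$. There exists a $1$-parameter family $\{S_\lambda(H):\lambda\in[0,\pi/2]\}$ of complete (immersed) constant mean curvature $H$ surfaces in $M^2(\epsilon)\times\mathbb{R}$ such that every $S_\lambda(H)$ has a horizontal plane of symmetry, and is invariant under a discrete $1$-parameter group of isometries of $M^2(\epsilon)\times\mathbb{R}$ acting trivially on the factor $\mathbb{R}$, i.e. a group generated by a single isometry, consisting of rotations if $\epsilon=1$ or of hyperbolic translations if $\epsilon=-1$ (this group being nontrivial for $\lambda\in[0,\pi/2)$). Furthermore: (i) $S_0(H)$ is the constant mean curvature $H$ rotationally invariant torus if $\epsilon=1$ (resp. the horizontal cylinder invariant under hyperbolic translations if $\epsilon=-1$), and $S_{\pi/2}(H)$ is the constant mean curvature $H$ sphere. (ii) If $\epsilon=-1$, all the surfaces in the family are embedded. (iii) If $\epsilon=1$ and $H<1/2$, there exists $\lambda^*\in[0,\pi/2)$ such that for all $\lambda\in[\lambda^*,\pi/2)$ the surface $S_\lambda(H)$ is not embedded. Moreover, the maximum height of $S_\lambda(H)$ varies continuously with $\lambda$ between the maximum height of the upper half of the horizontal cylinder (torus) $S_0(H)$ and the maximum height of the hemisphere (upper half of the sphere $S_{\pi/2}(H)$).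
   Context: $M^2(1)=\mathbb{S}^2$ is the unit round sphere and $M^2(-1)=\mathbb{H}^2$ is the hyperbolic plane of curvature $-1$; $M^2(\epsilon)\times\mathbb{R}$ carries the Riemannian product metric. A horizontal plane (slice) is $M^2(\epsilon)\times\{t_0\}$. Height is the $\mathbb{R}$-coordinate, normalized so that the horizontal plane of symmetry is at height $0$. The mean curvature is half the trace of the shape operator. The constant mean curvature $H$ sphere is the (unique up to ambient isometry) immersed constant mean curvature $H$ sphere, rotationally invariant about a vertical axis; its hemisphere is its upper half with respect to its horizontal plane of symmetry. The rotationally invariant torus (case $\epsilon=1$) or horizontal cylinder (case $\epsilon=-1$) is the constant mean curvature $H$ surface invariant under the $1$-parameter group of rotations (resp. hyperbolic translations) of $M^2(\epsilon)$ along a fixed geodesic $\Gamma\subset M^2(\epsilon)$, extended trivially to the factor $\mathbb{R}$, which is symmetric with respect to the slice $M^2(\epsilon)\times\{0\}$ and to the vertical plane $\Gamma\times\mathbb{R}$, meets the slice orthogonally, and whose upper half is a graph over the tubular neighbourhood of $\Gamma$ of radius $\arctan(1/(2H))$ if $\epsilon=1$, or $\operatorname{arctanh}(1/(2H))$ if $\epsilon=-1$. Both in the case of $\mathbb{S}^2\times\mathbb{R}$ and of $\mathbb{H}^2\times\mathbb{R}$ it is referred to as the horizontal cylinder. *)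

theory Defs
  imports "HOL-Analysis.Analysis"
begin

section \<open>The ambient space\<close>

text \<open>
  For \<open>\<epsilon> = 1\<close> the surface \<open>M2 \<epsilon>\<close> is the unit sphere in Euclidean 3-space; for \<open>\<epsilon> = -1\<close> it is
  the upper sheet of the hyperboloid in Minkowski 3-space. The Riemannian metric of
  \<open>M2 \<epsilon> \<times> \<real>\<close> is the restriction of \<open>pform \<epsilon>\<close> to the tangent spaces.
\<close>

type_synonym ambient = "(real^3) \<times> real"

definition mform :: "real \<Rightarrow> real^3 \<Rightarrow> real^3 \<Rightarrow> real" where
  "mform \<epsilon> x y = x$1 * y$1 + x$2 * y$2 + \<epsilon> * (x$3 * y$3)"

definition M2 :: "real \<Rightarrow> (real^3) set" where
  "M2 \<epsilon> = {p. mform \<epsilon> p p = \<epsilon> \<and> (\<epsilon> = -1 \<longrightarrow> p$3 > 0)}"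

definition pform :: "real \<Rightarrow> ambient \<Rightarrow> ambient \<Rightarrow> real" where
  "pform \<epsilon> a b = mform \<epsilon> (fst a) (fst b) + snd a * snd b"

definition mdistance :: "real \<Rightarrow> real^3 \<Rightarrow> real^3 \<Rightarrow> real" where
  "mdistance \<epsilon> p q = (if \<epsilon> = 1 then arccos (mform \<epsilon> p q) else arcosh (- mform \<epsilon> p q))"

text \<open>
  Orthogonal projection of a vector at \<open>a\<close> onto the tangent space of \<open>M2 \<epsilon> \<times> \<real>\<close>; the normal
  direction of \<open>M2 \<epsilon> \<times> \<real>\<close> is spanned by \<open>(fst a, 0)\<close>, whose square is \<open>\<epsilon> = 1/\<epsilon>\<close>.
\<close>

definition tangent_proj :: "real \<Rightarrow> ambient \<Rightarrow> ambient \<Rightarrow> ambient" where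
  "tangent_proj \<epsilon> a w = (fst w - (\<epsilon> * mform \<epsilon> (fst w) (fst a)) *\<^sub>R fst a, snd w)"


section \<open>Isometries acting on the factors\<close>

text \<open>A point \<open>p\<close> with an orthonormal basis \<open>v, n\<close> of the tangent plane at \<open>p\<close>.\<close>

definition frame :: "real \<Rightarrow> real^3 \<Rightarrow> real^3 \<Rightarrow> real^3 \<Rightarrow> bool" where
  "frame \<epsilon> p v n \<longleftrightarrow> p \<in> M2 \<epsilon> \<and> mform \<epsilon> v v = 1 \<and> mform \<epsilon> n n = 1 \<and>
     mform \<epsilon> p v = 0 \<and> mform \<epsilon> p n = 0 \<and> mform \<epsilon> v n = 0"

definition gcos :: "real \<Rightarrow> real \<Rightarrow> real" where
  "gcos \<epsilon> t = (if \<epsilon> = 1 then cos t else cosh t)"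

definition gsin :: "real \<Rightarrow> real \<Rightarrow> real" where
  "gsin \<epsilon> t = (if \<epsilon> = 1 then sin t else sinh t)"

text \<open>The geodesic through \<open>p\<close> with unit velocity \<open>v\<close>, and its open tubular neighbourhoods.\<close>

definition geodesic :: "real \<Rightarrow> real^3 \<Rightarrow> real^3 \<Rightarrow> (real^3) set" where
  "geodesic \<epsilon> p v = range (\<lambda>t. gcos \<epsilon> t *\<^sub>R p + gsin \<epsilon> t *\<^sub>R v)"

definition tube :: "real \<Rightarrow> (real^3) set \<Rightarrow> real \<Rightarrow> (real^3) set" where
  "tube \<epsilon> \<Gamma> r = {x \<in> M2 \<epsilon>. \<exists>y\<in>\<Gamma>. mdistance \<epsilon> x y < r}"

text \<open>
  Translation by \<open>t\<close> along the geodesic through \<open>p\<close> with velocity \<open>v\<close>: in the basis \<open>p, v, n\<close> it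
  maps \<open>p\<close> to \<open>C p + S v\<close>, \<open>v\<close> to \<open>- \<epsilon> S p + C v\<close> and fixes \<open>n\<close>. It is a rotation with axis \<open>n\<close> if
  \<open>\<epsilon> = 1\<close> and a hyperbolic translation if \<open>\<epsilon> = -1\<close>.
\<close>

definition along :: "real \<Rightarrow> real^3 \<Rightarrow> real^3 \<Rightarrow> real^3 \<Rightarrow> real \<Rightarrow> real^3 \<Rightarrow> real^3" where
  "along \<epsilon> p v n t x =
     (\<epsilon> * mform \<epsilon> x p) *\<^sub>R (gcos \<epsilon> t *\<^sub>R p + gsin \<epsilon> t *\<^sub>R v) +
     mform \<epsilon> x v *\<^sub>R ((- \<epsilon> * gsin \<epsilon> t) *\<^sub>R p + gcos \<epsilon> t *\<^sub>R v) +
     mform \<epsilon> x n *\<^sub>R n"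

text \<open>Rotation of \<open>M2 \<epsilon>\<close> by the angle \<open>\<theta>\<close> about the point \<open>p\<close>.\<close>

definition rotation :: "real \<Rightarrow> real^3 \<Rightarrow> real^3 \<Rightarrow> real^3 \<Rightarrow> real \<Rightarrow> real^3 \<Rightarrow> real^3" where
  "rotation \<epsilon> p v n \<theta> x =
     (\<epsilon> * mform \<epsilon> x p) *\<^sub>R p +
     mform \<epsilon> x v *\<^sub>R (cos \<theta> *\<^sub>R v + sin \<theta> *\<^sub>R n) +
     mform \<epsilon> x n *\<^sub>R (- sin \<theta> *\<^sub>R v + cos \<theta> *\<^sub>R n)"

text \<open>Reflection in the geodesic orthogonal to \<open>n\<close>.\<close>

definition reflection :: "real \<Rightarrow> real^3 \<Rightarrow> real^3 \<Rightarrow> real^3" where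
  "reflection \<epsilon> n x = x - (2 * mform \<epsilon> x n) *\<^sub>R n"

definition horizontal :: "(real^3 \<Rightarrow> real^3) \<Rightarrow> ambient \<Rightarrow> ambient" where
  "horizontal T a = (T (fst a), snd a)"

definition flip_height :: "ambient \<Rightarrow> ambient" where
  "flip_height a = (fst a, - snd a)"


section \<open>Immersed surfaces\<close>

text \<open>\<open>Ck_on k f U\<close>: \<open>f\<close> is of class \<open>C^k\<close> on \<open>U\<close>; meant for open \<open>U\<close>.\<close>

primrec Ck_on :: "nat \<Rightarrow> ('a::euclidean_space \<Rightarrow> 'b::real_normed_vector) \<Rightarrow> 'a set \<Rightarrow> bool" where
  "Ck_on 0 f U \<longleftrightarrow> continuous_on U f"
| "Ck_on (Suc k) f U \<longleftrightarrow> (\<forall>u\<in>U. f differentiable (at u)) \<and>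
     (\<forall>v. Ck_on k (\<lambda>u. frechet_derivative f (at u) v) U)"

definition smooth_on :: "('a::euclidean_space \<Rightarrow> 'b::real_normed_vector) \<Rightarrow> 'a set \<Rightarrow> bool" where
  "smooth_on f U \<longleftrightarrow> (\<forall>k. Ck_on k f U)"

text \<open>
  A surface consists of a topological space, an atlas of local parametrizations \<open>(V, \<phi>)\<close> with \<open>V\<close>
  an open subset of the plane, and a map to the ambient space.
\<close>

record 'a surface =
  dom :: "'a topology"
  atlas :: "((real^2) set \<times> (real^2 \<Rightarrow> 'a)) set"
  imm :: "'a \<Rightarrow> ambient"

definition second_countable_space :: "'a topology \<Rightarrow> bool" where
  "second_countable_space X \<longleftrightarrow> (\<exists>B. countable B \<and> (\<forall>U\<in>B. openin X U) \<and>
     (\<forall>U x. openin X U \<and> x \<in> U \<longrightarrow> (\<exists>W\<in>B. x \<in> W \<and> W \<subseteq> U)))"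

definition smooth_2_manifold ::
  "'a topology \<Rightarrow> ((real^2) set \<times> (real^2 \<Rightarrow> 'a)) set \<Rightarrow> bool" where
  "smooth_2_manifold X A \<longleftrightarrow>
     Hausdorff_space X \<and> second_countable_space X \<and>
     (\<forall>(V, \<phi>)\<in>A. open V \<and> openin X (\<phi> ` V) \<and>
        homeomorphic_map (top_of_set V) (subtopology X (\<phi> ` V)) \<phi>) \<and>
     (\<Union>(V, \<phi>)\<in>A. \<phi> ` V) = topspace X \<and>
     (\<forall>(V, \<phi>)\<in>A. \<forall>(W, \<psi>)\<in>A. smooth_on (inv_into W \<psi> \<circ> \<phi>) {u \<in> V. \<phi> u \<in> \<psi> ` W})"

definition immersed_surface :: "real \<Rightarrow> 'a surface \<Rightarrow> bool" where
  "immersed_surface \<epsilon> S \<longleftrightarrow>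
     smooth_2_manifold (dom S) (atlas S) \<and>
     connected_space (dom S) \<and> topspace (dom S) \<noteq> {} \<and>
     imm S ` topspace (dom S) \<subseteq> M2 \<epsilon> \<times> UNIV \<and>
     (\<forall>(V, \<phi>)\<in>atlas S. smooth_on (imm S \<circ> \<phi>) V \<and>
        (\<forall>u\<in>V. inj (frechet_derivative (imm S \<circ> \<phi>) (at u))))"

definition image_of :: "'a surface \<Rightarrow> ambient set" where
  "image_of S = imm S ` topspace (dom S)"

definition embedded :: "'a surface \<Rightarrow> bool" where
  "embedded S \<longleftrightarrow> embedding_map (dom S) euclidean (imm S)"

text \<open>
  Lengths of piecewise \<open>C^1\<close> paths in the surface and the distance of the induced metric. Since
  \<open>imm S\<close> is an immersion and \<open>\<gamma>\<close> is continuous, \<open>\<gamma>\<close> is \<open>C^1\<close> wherever \<open>imm S \<circ> \<gamma>\<close> is. The library's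
  notion of piecewise \<open>C^1\<close> does not bound the derivative near the break points; \<open>has_integral\<close>
  forces the length to be finite.
\<close>

definition path_length :: "real \<Rightarrow> 'a surface \<Rightarrow> (real \<Rightarrow> 'a) \<Rightarrow> real \<Rightarrow> bool" where
  "path_length \<epsilon> S \<gamma> L \<longleftrightarrow>
     pathin (dom S) \<gamma> \<and> (imm S \<circ> \<gamma>) piecewise_C1_differentiable_on {0..1} \<and>
     ((\<lambda>t. let w = vector_derivative (imm S \<circ> \<gamma>) (at t) in sqrt (pform \<epsilon> w w))
        has_integral L) {0..1}"

definition intrinsic_dist :: "real \<Rightarrow> 'a surface \<Rightarrow> 'a \<Rightarrow> 'a \<Rightarrow> real" where
  "intrinsic_dist \<epsilon> S x y = Inf {L. \<exists>\<gamma>. \<gamma> 0 = x \<and> \<gamma> 1 = y \<and> path_length \<epsilon> S \<gamma> L}"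

definition complete_surface :: "real \<Rightarrow> 'a surface \<Rightarrow> bool" where
  "complete_surface \<epsilon> S \<longleftrightarrow>
     Metric_space.mcomplete (topspace (dom S)) (intrinsic_dist \<epsilon> S)"


section \<open>Mean curvature\<close>

text \<open>\<open>\<eta>\<close> is a unit vector tangent to \<open>M2 \<epsilon> \<times> \<real>\<close> and normal to the parametrized surface \<open>F\<close> at \<open>u\<close>.\<close>

definition unit_normal :: "real \<Rightarrow> (real^2 \<Rightarrow> ambient) \<Rightarrow> real^2 \<Rightarrow> ambient \<Rightarrow> bool" where
  "unit_normal \<epsilon> F u \<eta> \<longleftrightarrow>
     mform \<epsilon> (fst (F u)) (fst \<eta>) = 0 \<and> pform \<epsilon> \<eta> \<eta> = 1 \<and>
     (\<forall>w. pform \<epsilon> (frechet_derivative F (at u) w) \<eta> = 0)"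

text \<open>
  \<open>A\<close> is the matrix, in the coordinates \<open>u\<close>, of the shape operator: \<open>dF (A w)\<close> is minus the
  covariant derivative in \<open>M2 \<epsilon> \<times> \<real>\<close> of the normal field \<open>N\<close> (given in coordinates) in direction \<open>w\<close>.
\<close>

definition shape_matrix ::
  "real \<Rightarrow> (real^2 \<Rightarrow> ambient) \<Rightarrow> (real^2 \<Rightarrow> ambient) \<Rightarrow> real^2 \<Rightarrow> real^2^2 \<Rightarrow> bool" where
  "shape_matrix \<epsilon> F N u A \<longleftrightarrow>
     (\<forall>w. frechet_derivative F (at u) (A *v w) =
          - tangent_proj \<epsilon> (F u) (frechet_derivative N (at u) w))"

definition cmc_surface :: "real \<Rightarrow> real \<Rightarrow> 'a surface \<Rightarrow> bool" where
  "cmc_surface \<epsilon> H S \<longleftrightarrow>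
     immersed_surface \<epsilon> S \<and>
     (\<exists>N. continuous_map (dom S) euclidean N \<and>
        (\<forall>(V, \<phi>)\<in>atlas S. smooth_on (N \<circ> \<phi>) V \<and>
           (\<forall>u\<in>V. unit_normal \<epsilon> (imm S \<circ> \<phi>) u (N (\<phi> u)) \<and>
              (\<exists>A. shape_matrix \<epsilon> (imm S \<circ> \<phi>) (N \<circ> \<phi>) u A \<and> trace A / 2 = H))))"


section \<open>Symmetries, cylinders and spheres\<close>

text \<open>
  Invariance under an ambient isometry \<open>g\<close>, up to reparametrization of the surface. As \<open>imm S\<close> is an
  immersion, the homeomorphism \<open>\<tau>\<close> is automatically a diffeomorphism.
\<close>

definition invariant_under :: "'a surface \<Rightarrow> (ambient \<Rightarrow> ambient) \<Rightarrow> bool" where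
  "invariant_under S g \<longleftrightarrow>
     (\<exists>\<tau>. homeomorphic_map (dom S) (dom S) \<tau> \<and> (\<forall>x\<in>topspace (dom S). g (imm S x) = imm S (\<tau> x)))"

text \<open>The symmetry plane is at height \<open>0\<close>.\<close>

definition horizontally_symmetric :: "'a surface \<Rightarrow> bool" where
  "horizontally_symmetric S \<longleftrightarrow> invariant_under S flip_height"

definition orthogonal_to_slice :: "real \<Rightarrow> 'a surface \<Rightarrow> bool" where
  "orthogonal_to_slice \<epsilon> S \<longleftrightarrow>
     (\<forall>(V, \<phi>)\<in>atlas S. \<forall>u\<in>V. snd (imm S (\<phi> u)) = 0 \<longrightarrow>
        (\<forall>\<eta>. unit_normal \<epsilon> (imm S \<circ> \<phi>) u \<eta> \<longrightarrow> pform \<epsilon> \<eta> (0, 1) = 0))"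

definition upper_half :: "'a surface \<Rightarrow> 'a set" where
  "upper_half S = {x \<in> topspace (dom S). snd (imm S x) > 0}"

definition upper_half_graph_over :: "'a surface \<Rightarrow> (real^3) set \<Rightarrow> bool" where
  "upper_half_graph_over S \<Omega> \<longleftrightarrow>
     homeomorphic_map (subtopology (dom S) (upper_half S)) (top_of_set \<Omega>) (fst \<circ> imm S)"

definition cylinder_radius :: "real \<Rightarrow> real \<Rightarrow> real" where
  "cylinder_radius \<epsilon> H = (if \<epsilon> = 1 then arctan (1 / (2 * H)) else artanh (1 / (2 * H)))"

definition is_horizontal_cylinder :: "real \<Rightarrow> real \<Rightarrow> 'a surface \<Rightarrow> bool" where
  "is_horizontal_cylinder \<epsilon> H S \<longleftrightarrow>
     cmc_surface \<epsilon> H S \<and> complete_surface \<epsilon> S \<and>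
     (\<exists>p v n. frame \<epsilon> p v n \<and>
        (\<forall>t. invariant_under S (horizontal (along \<epsilon> p v n t))) \<and>
        horizontally_symmetric S \<and>
        invariant_under S (horizontal (reflection \<epsilon> n)) \<and>
        orthogonal_to_slice \<epsilon> S \<and>
        upper_half_graph_over S (tube \<epsilon> (geodesic \<epsilon> p v) (cylinder_radius \<epsilon> H)))"

definition is_cmc_sphere :: "real \<Rightarrow> real \<Rightarrow> 'a surface \<Rightarrow> bool" where
  "is_cmc_sphere \<epsilon> H S \<longleftrightarrow>
     cmc_surface \<epsilon> H S \<and>
     dom S homeomorphic_space top_of_set (sphere (0::real^3) 1) \<and>
     horizontally_symmetric S \<and>
     (\<exists>p v n. frame \<epsilon> p v n \<and> (\<forall>\<theta>. invariant_under S (horizontal (rotation \<epsilon> p v n \<theta>))))"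

text \<open>
  Invariance under the cyclic group generated by the translation of length \<open>t\<close> along a geodesic;
  its \<open>k\<close>-th power is the translation of length \<open>k t\<close>. The group is trivial iff the generator acts
  as the identity on \<open>M2 \<epsilon>\<close>.
\<close>

definition cyclic_invariant ::
  "real \<Rightarrow> 'a surface \<Rightarrow> real^3 \<Rightarrow> real^3 \<Rightarrow> real^3 \<Rightarrow> real \<Rightarrow> bool" where
  "cyclic_invariant \<epsilon> S p v n t \<longleftrightarrow>
     (\<forall>k::int. invariant_under S (horizontal (along \<epsilon> p v n (of_int k * t))))"

definition acts_nontrivially :: "real \<Rightarrow> (real^3 \<Rightarrow> real^3) \<Rightarrow> bool" where
  "acts_nontrivially \<epsilon> T \<longleftrightarrow> (\<exists>x\<in>M2 \<epsilon>. T x \<noteq> x)"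

definition is_max_height :: "'a surface \<Rightarrow> real \<Rightarrow> bool" where
  "is_max_height S h \<longleftrightarrow> h \<in> snd ` image_of S \<and> (\<forall>y\<in>snd ` image_of S. y \<le> h)"

end

theory Submission
  imports Defs
begin

text \<open>
  The curvature \<open>\<epsilon>\<close> of the theorem is written \<open>\<e>\<close> in the lemmas.

  Put \<open>c = sqrt (4 H\<^sup>2 + \<e>)\<close>. The profile of the family is explicit: let \<open>t(x)\<close> and \<open>q(y)\<close> be the elliptic
  functions with \<open>t\<close> oscillating between \<open>\<sigma>\<close> and \<open>\<tau>\<close>, where \<open>\<sigma> (c - \<e> \<tau>) = 1 - c \<tau>\<close>, and \<open>q = sn\<close> of
  modulus \<open>m = \<sigma> \<tau>\<close>. Then the surface of height \<open>(4 H / c) artanh (t q)\<close> (\<open>arctan\<close> if \<open>\<e> = -1\<close>) can be completed by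
  a horizontal component, written in the moving frame of a fixed geodesic, to a conformal immersion of
  the plane with constant mean curvature \<open>H\<close>. Everything reduces to polynomial identities between
  the profile functions and their derivatives: the shape operator is read off from the second derivatives of a conformal map.
  The parameter \<open>\<tau>\<close> runs from \<open>1 / (c + 2 H)\<close>, where \<open>\<sigma> = \<tau>\<close> and \<open>t\<close> is constant (the cylinder), to
  \<open>1 / c\<close>, where \<open>\<sigma>\<close> vanishes and the period of \<open>t\<close> becomes infinite (the sphere). The maximum
  height is \<open>(4 H / c) artanh \<tau>\<close>, which is monotone in \<open>\<tau>\<close>.

  If \<open>\<e> = -1\<close> two points with the same image differ by a period of \<open>q\<close>, so the quotient is embedded. If
  \<open>\<e> = 1\<close> and \<open>H < 1/2\<close>, near the sphere the translation along the geodesic passes the angle \<open>\<pi>\<close>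
  inside a half period; there the surface meets its mirror image transversally, which is impossible
  for the image of an embedded surface. For \<open>\<e> = 1\<close> and \<open>\<sigma> \<noteq> \<tau>\<close> the surface is taken to be the whole plane; the period of \<open>t\<close>
  need not be commensurable with \<open>\<pi>\<close>, but the half turn about a point of the geodesic is always a symmetry.
\<close>

section \<open>Smooth maps\<close>

text \<open>Two obstacles shape the proof. The first is the zero set of the vertical component of
  the normal: the height alone determines the normal and the mean curvature where that component is
  nonzero, and the rest follows by density, so the second derivatives of the horizontal part are
  never written out. The second is the carrier. A metric space is asked to have a nonnegative
  distance at all points of the type, while the natural models live on the plane, on a subset of the
  ambient space or on the round sphere; each is therefore pulled back along a bare bijection with
  \<open>real^3\<close>.

  The endpoints of the range of \<tau> come from c^2 - 4 H^2 = \<epsilon>, which factors the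
  quadratic that compares \<sigma> with \<tau>. The bound 1/2 on H enters through the angle covered
  in half a period of t: it tends to 2 arctan(1/(2H)), which exceeds \<pi>/2 exactly if H < 1/2. The
  sphere is built separately, because the flow that defines t needs the positive lower bound
  \<sigma>. Nonembeddedness is shown for every immersed surface with the same image, so it can rest
  only on the velocities of curves in that image.\<close>

lemma Ck_on_cong:
 assumes "open U" "\<And>u. u \<in> U ==> f u = g u" "Ck_on k f U"
 shows "Ck_on k g U"
 using assms(2,3)
proof (induction k arbitrary: f g)
 case 0
 then show ?case using continuous_on_cong[of U U f g] by simp
next
 case (Suc k)
 have der: "(g has_derivative frechet_derivative f (at u)) (at u)" if "u \<in> U" for u
  by (rule has_derivative_transform_within_open[OF _ assms(1) that, of f])
    (use Suc.prems that in \<open>simp_all add: frechet_derivative_works[symmetric]\<close>)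
 have eq: "frechet_derivative g (at u) = frechet_derivative f (at u)" if "u \<in> U" for u
  using frechet_derivative_at[OF der[OF that]] by simp
 have "Ck_on k (%u. frechet_derivative g (at u) v) U" for v
  by (rule Suc.IH[of "%u. frechet_derivative f (at u) v"]) (use Suc.prems eq in auto)
 moreover have "\<forall>u\<in>U. g differentiable (at u)" using der differentiableI by blast
 ultimately show ?case by simp
qed

text \<open>Accepts any explicit formula for the derivative, so that
  \<open>frechet_derivative\<close> need not be computed.\<close>

lemma Ck_on_SucI:
 assumes "open U" "\<And>u. u \<in> U ==> (f has_derivative f' u) (at u)"
  and "\<And>v. Ck_on k (%u. f' u v) U"
 shows "Ck_on (Suc k) f U"
proof -
 have "frechet_derivative f (at u) = f' u" if "u \<in> U" for u
  using frechet_derivative_at[OF assms(2)[OF that]] by simp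
 then have "Ck_on k (%u. frechet_derivative f (at u) v) U" for v
  by (intro Ck_on_cong[OF assms(1) _ assms(3)[of v]]) simp
 then show ?thesis using assms(2) differentiableI by fastforce
qed

lemma Ck_on_SucD: "Ck_on (Suc k) f U ==> Ck_on k f U"
proof (induction k arbitrary: f)
 case 0
 then show ?case
  by (auto intro!: continuous_at_imp_continuous_on differentiable_imp_continuous_within)
next
 case (Suc k)
 then show ?case by (metis Ck_on.simps(2))
qed

lemma Ck_on_subset: "Ck_on k f U ==> V \<subseteq> U ==> Ck_on k f V"
 by (induction k arbitrary: f) (auto intro: continuous_on_subset)

lemma Ck_on_const: "open U ==> Ck_on k (%_. c) U"
proof (induction k arbitrary: c)
 case (Suc k)
 then show ?case by (intro Ck_on_SucI[where f' = "%_ _. 0"]) auto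
qed auto

lemma Ck_on_linear:
 assumes "open U" "bounded_linear f"
 shows "Ck_on k f U"
proof (cases k)
 case 0
 then show ?thesis using assms by (auto intro: linear_continuous_on)
next
 case (Suc n)
 then show ?thesis
  using assms Ck_on_SucI[of U f "%_. f" n] Ck_on_const bounded_linear_imp_has_derivative by blast
qed

lemma Ck_on_add:
 assumes "open U" "Ck_on k f U" "Ck_on k g U"
 shows "Ck_on k (%u. f u + g u) U"
 using assms(2,3)
proof (induction k arbitrary: f g)
 case 0
 then show ?case by (auto intro: continuous_on_add)
next
 case (Suc k)
 show ?case
  by (rule Ck_on_SucI[OF assms(1), where f' = "%u v. frechet_derivative f (at u) v + frechet_derivative g (at u) v"])
    (use Suc in \<open>auto intro!: has_derivative_add simp: frechet_derivative_works\<close>)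
qed

text \<open>One induction serves scalar multiples and real products alike: the Leibniz rule leaves a
  sum of products of \<open>C^k\<close> maps.\<close>

lemma (in bounded_bilinear) Ck_on:
 assumes "open U" "Ck_on k f U" "Ck_on k g U"
 shows "Ck_on k (%u. prod (f u) (g u)) U"
 using assms(2,3)
proof (induction k arbitrary: f g)
 case 0
 then show ?case by (auto intro: continuous_on)
next
 case (Suc k)
 have 1: "Ck_on k f U" "Ck_on k g U" using Suc.prems Ck_on_SucD by blast+
 show ?case
  by (rule Ck_on_SucI[OF assms(1), where f' = "%u v. prod (f u) (frechet_derivative g (at u) v) + prod (frechet_derivative f (at u) v) (g u)"])
    (use Suc 1 in \<open>auto intro!: FDERIV Ck_on_add[OF assms(1)] simp: frechet_derivative_works\<close>)
qed

text \<open>As the outer map has a real argument, the chain rule gives a real factor times the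
  derivative of \<open>g\<close> at \<open>f u\<close>; the induction runs over \<open>g\<close>
  with \<open>f\<close> fixed.\<close>

lemma Ck_on_compose_real:
 fixes g :: "real => 'c::real_normed_vector" and f :: "'a::euclidean_space => real"
 assumes "open U" "open V" "\<And>u. u \<in> U ==> f u \<in> V" "Ck_on k f U" "Ck_on k g V"
 shows "Ck_on k (%u. g (f u)) U"
 using assms(4,5)
proof (induction k arbitrary: g)
 case 0
 then show ?case using assms(3)
  by (auto intro: continuous_on_compose2)
next
 case (Suc k)
 have 1: "Ck_on k f U" using Suc.prems Ck_on_SucD by blast
 show ?case
 proof (rule Ck_on_SucI[OF assms(1), where f' = "%u v. frechet_derivative f (at u) v *\<^sub>R frechet_derivative g (at (f u)) 1"])
  fix u assume u: "u \<in> U"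
  have f: "(f has_derivative frechet_derivative f (at u)) (at u)"
   using Suc.prems u by (auto simp: frechet_derivative_works)
  have g: "(g has_derivative frechet_derivative g (at (f u))) (at (f u))"
   using Suc.prems assms(3) u by (auto simp: frechet_derivative_works)
  have "frechet_derivative g (at (f u)) r = r *\<^sub>R frechet_derivative g (at (f u)) 1" for r
   using linear_scale[OF has_derivative_linear[OF g], of r 1] by simp
  then show "((%u. g (f u)) has_derivative
    (%v. frechet_derivative f (at u) v *\<^sub>R frechet_derivative g (at (f u)) 1)) (at u)"
   using has_derivative_compose[OF f g] by (metis (no_types, lifting) ext)
 next
  fix v
  show "Ck_on k (%u. frechet_derivative f (at u) v *\<^sub>R frechet_derivative g (at (f u)) 1) U"
   using Suc.prems Suc.IH[OF 1, of "%y. frechet_derivative g (at y) 1"]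
   by (intro bounded_bilinear.Ck_on[OF bounded_bilinear_scaleR assms(1)]) auto
 qed
qed

named_theorems smooth_intros

lemma smooth_on_cong:
 "open U ==> (\<And>u. u \<in> U ==> f u = g u) ==> smooth_on f U ==> smooth_on g U"
 unfolding smooth_on_def by (metis Ck_on_cong)

lemma smooth_on_subset: "smooth_on f U ==> V \<subseteq> U ==> smooth_on f V"
 by (auto simp: smooth_on_def intro: Ck_on_subset)

text \<open>Needed because the transition maps between charts are translations only locally.\<close>

lemma smooth_on_local:
 assumes "\<And>u. u \<in> U ==> \<exists>W. open W & u \<in> W & W \<subseteq> U & smooth_on f W"
 shows "smooth_on f U"
proof -
 have "Ck_on k f U" if "\<And>u. u \<in> U ==> \<exists>W. open W & u \<in> W & W \<subseteq> U & Ck_on k f W" for k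
  using that
 proof (induction k arbitrary: f)
  case 0
  have "isCont f u" if "u \<in> U" for u
   using 0[OF that] continuous_on_eq_continuous_at by auto
  then show ?case by (auto intro: continuous_at_imp_continuous_on)
 next
  case (Suc k)
  have "f differentiable (at u)" if "u \<in> U" for u using Suc.prems[OF that] by auto
  moreover have "Ck_on k (%u. frechet_derivative f (at u) v) U" for v
  proof (rule Suc.IH)
   fix u assume "u \<in> U"
   then obtain W where "open W" "u \<in> W" "W \<subseteq> U" "Ck_on (Suc k) f W" using Suc.prems by blast
   then show "\<exists>W. open W & u \<in> W & W \<subseteq> U & Ck_on k (%u. frechet_derivative f (at u) v) W"
    by (intro exI[of _ W]) simp
  qed
  ultimately show ?case by simp
 qed
 then show ?thesis using assms unfolding smooth_on_def by meson
qed

lemma smooth_on_const [smooth_intros]: "open U ==> smooth_on (%_. c) U"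
 by (simp add: smooth_on_def Ck_on_const)

lemma smooth_on_linear: "open U ==> bounded_linear f ==> smooth_on f U"
 by (simp add: smooth_on_def Ck_on_linear)

lemma smooth_on_add [smooth_intros]:
 "open U ==> smooth_on f U ==> smooth_on g U ==> smooth_on (%u. f u + g u) U"
 by (simp add: smooth_on_def Ck_on_add)

lemma smooth_on_scaleR [smooth_intros]:
 "open U ==> smooth_on f U ==> smooth_on g U ==> smooth_on (%u. f u *\<^sub>R g u) U"
 by (simp add: smooth_on_def bounded_bilinear.Ck_on[OF bounded_bilinear_scaleR])

lemma smooth_on_mult [smooth_intros]:
 fixes f g :: "'a::euclidean_space => real"
 shows "open U ==> smooth_on f U ==> smooth_on g U ==> smooth_on (%u. f u * g u) U"
 by (simp add: smooth_on_def bounded_bilinear.Ck_on[OF bounded_bilinear_mult])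

lemma smooth_on_minus [smooth_intros]:
 "open U ==> smooth_on f U ==> smooth_on (%u. - f u) U"
 using smooth_on_scaleR[of U "%_. -1" f] smooth_on_const[of U "-1::real"] by simp

lemma smooth_on_diff [smooth_intros]:
 "open U ==> smooth_on f U ==> smooth_on g U ==> smooth_on (%u. f u - g u) U"
 using smooth_on_add[of U f "%u. - g u"] smooth_on_minus[of U g] by simp

lemma smooth_on_power [smooth_intros]:
 fixes f :: "'a::euclidean_space => real"
 shows "open U ==> smooth_on f U ==> smooth_on (%u. f u ^ n) U"
 by (induction n) (simp_all add: smooth_on_const smooth_on_mult)

lemma smooth_on_compose_real:
 fixes g :: "real => 'c::real_normed_vector"
 shows "smooth_on g V ==> open U ==> open V ==> (\<And>u. u \<in> U ==> f u \<in> V) ==> smooth_on f U ==>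
  smooth_on (%u. g (f u)) U"
 by (simp add: smooth_on_def Ck_on_compose_real)

lemma smooth_on_real_deriv:
 fixes g :: "real => 'c::real_normed_vector"
 assumes "open V" "\<And>y. y \<in> V ==> (g has_vector_derivative g' y) (at y)" "smooth_on g' V"
 shows "smooth_on g V"
 unfolding smooth_on_def
proof
 fix k
 have "Ck_on (Suc k) g V"
 proof (rule Ck_on_SucI[OF assms(1), where f' = "%u v. v *\<^sub>R g' u"])
  show "Ck_on k (%u. v *\<^sub>R g' u) V" for v
   using assms(1,3)
   by (intro bounded_bilinear.Ck_on[OF bounded_bilinear_scaleR] Ck_on_const) (auto simp: smooth_on_def)
 qed (use assms(2) in \<open>simp add: has_vector_derivative_def\<close>)
 then show "Ck_on k g V" by (rule Ck_on_SucD)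
qed

text \<open>For solutions of autonomous systems: each derivative gains a degree from the right-hand side.\<close>

lemma smooth_on_ode:
 fixes f f' :: "'i => real => real"
 assumes "open V" "\<And>i y. y \<in> V ==> (f i has_real_derivative f' i y) (at y)"
  and "\<And>k i. (\<And>j. Ck_on k (f j) V) ==> Ck_on k (f' i) V"
 shows "smooth_on (f i) V"
proof -
 have "\<forall>i. Ck_on k (f i) V" for k
 proof (induction k)
  case 0
  then show ?case using assms(2) by (auto intro!: continuous_at_imp_continuous_on DERIV_isCont)
 next
  case (Suc k)
  show ?case
  proof
   fix i
   show "Ck_on (Suc k) (f i) V"
    using Suc assms(3)[of k i]
    by (intro Ck_on_SucI[OF assms(1), where f' = "%u v. f' i u * v"]
       bounded_bilinear.Ck_on[OF bounded_bilinear_mult assms(1) _ Ck_on_const])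
      (use assms(1,2) in \<open>auto simp: has_field_derivative_def\<close>)
  qed
 qed
 then show ?thesis by (simp add: smooth_on_def)
qed

section \<open>Smoothness of the elementary functions\<close>

lemma smooth_on_sin_cos: "smooth_on (sin :: real => real) UNIV" "smooth_on (cos :: real => real) UNIV"
proof -
 \<comment> \<open>Sine and cosine are the two unknowns of a single autonomous system, indexed by
   \<open>bool\<close>.\<close>
 have "smooth_on ((%b::bool. if b then sin else cos) i :: real => real) UNIV" for i
 proof (rule smooth_on_ode[where f' = "%b. if b then cos else (%x. -1 * sin x)"])
  fix k and i :: bool
  assume *: "\<And>j. Ck_on k ((%b. if b then sin else cos :: real => real) j) UNIV"
  show "Ck_on k (if i then cos else (%x. -1 * sin x) :: real => real) UNIV"
   using *[of False] *[of True]
    bounded_bilinear.Ck_on[OF bounded_bilinear_mult open_UNIV Ck_on_const[OF open_UNIV, of k "-1"] *[of True]]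
   by simp
 qed (auto intro!: derivative_eq_intros)
 from this[of True] this[of False] show "smooth_on (sin :: real => real) UNIV"
  "smooth_on (cos :: real => real) UNIV" by auto
qed

lemma smooth_on_sinh_cosh: "smooth_on (sinh :: real => real) UNIV" "smooth_on (cosh :: real => real) UNIV"
proof -
 have "smooth_on ((%b::bool. if b then sinh else cosh) i :: real => real) UNIV" for i
 proof (rule smooth_on_ode[where f' = "%b. if b then cosh else sinh"])
  fix k and i :: bool
  assume *: "\<And>j. Ck_on k ((%b. if b then sinh else cosh :: real => real) j) UNIV"
  show "Ck_on k (if i then cosh else sinh :: real => real) UNIV"
   using *[of False] *[of True] by simp
 qed (auto intro!: derivative_eq_intros)
 from this[of True] this[of False] show "smooth_on (sinh :: real => real) UNIV"
  "smooth_on (cosh :: real => real) UNIV" by auto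
qed

lemma smooth_on_inverse_real: "smooth_on (inverse :: real => real) (- {0})"
proof -
 have "smooth_on ((%_::unit. inverse) i :: real => real) (- {0})" for i
 proof (rule smooth_on_ode[where f' = "%_ x. -1 * (inverse x * inverse x)"])
  fix k assume *: "\<And>j. Ck_on k ((%_::unit. inverse :: real => real) j) (- {0})"
  show "Ck_on k (%x::real. -1 * (inverse x * inverse x)) (- {0})"
   using * by (intro bounded_bilinear.Ck_on[OF bounded_bilinear_mult] Ck_on_const) auto
 qed (auto intro!: derivative_eq_intros simp: power2_eq_square)
 then show ?thesis by simp
qed

lemma smooth_on_inverse [smooth_intros]:
 fixes f :: "'a::euclidean_space => real"
 assumes "open U" "\<And>u. u \<in> U ==> f u \<noteq> 0" "smooth_on f U"
 shows "smooth_on (%u. inverse (f u)) U"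
 using smooth_on_compose_real[OF smooth_on_inverse_real assms(1) _ _ assms(3)] assms(2) by auto

lemma smooth_on_divide [smooth_intros]:
 fixes f g :: "'a::euclidean_space => real"
 assumes "open U" "smooth_on f U" "smooth_on g U" "\<And>u. u \<in> U ==> g u \<noteq> 0"
 shows "smooth_on (%u. f u / g u) U"
 using smooth_on_mult[OF assms(1,2) smooth_on_inverse[OF assms(1) _ assms(3)]] assms(4)
 by (simp add: divide_inverse)

lemma smooth_on_arctan: "smooth_on (arctan :: real => real) UNIV"
proof (rule smooth_on_real_deriv[OF open_UNIV])
 show "smooth_on (%x::real. inverse (1 + x * x)) UNIV"
 proof (intro smooth_intros open_UNIV smooth_on_linear bounded_linear_ident)
  fix u :: real show "1 + u * u \<noteq> 0" by (metis add_nonneg_eq_0_iff zero_le_one zero_le_square zero_neq_one)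
 qed
qed (auto intro!: derivative_eq_intros simp: has_real_derivative_iff_has_vector_derivative[symmetric] power2_eq_square)

lemma smooth_on_artanh: "smooth_on (artanh :: real => real) {-1<..<1}"
proof (rule smooth_on_real_deriv)
 have ne: "1 - u * u \<noteq> 0" if "u \<in> {-1<..<1}" for u :: real
  using that by (metis abs_square_less_1 abs_less_iff diff_gt_0_iff_gt greaterThanLessThan_iff
    less_irrefl minus_less_iff power2_eq_square)
 then show "smooth_on (%x::real. inverse (1 - x * x)) {-1<..<1}"
  by (intro smooth_intros smooth_on_linear bounded_linear_ident) auto
 show "(artanh has_vector_derivative inverse (1 - y * y)) (at y)" if "y \<in> {-1<..<1}" for y :: real
  using that ne[OF that]
  by (auto intro!: derivative_eq_intros simp: has_real_derivative_iff_has_vector_derivative[symmetric]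
    power2_eq_square divide_simps abs_less_iff)
qed auto

section \<open>Conformal immersions and mean curvature\<close>

text \<open>Schwarz's theorem: the second difference over a square of side s is s^2 times a value of
  either mixed derivative, by two applications of the mean value theorem in either order; continuity
  at the corner lets s tend to 0.\<close>

lemma mixed_partials_eq:
 fixes g gx gy gxy gyx :: "real => real => real"
 assumes gx: "\<And>x y. ((%x. g x y) has_real_derivative gx x y) (at x)"
  and gy: "\<And>x y. ((%y. g x y) has_real_derivative gy x y) (at y)"
  and gxy: "\<And>x y. ((%y. gx x y) has_real_derivative gxy x y) (at y)"
  and gyx: "\<And>x y. ((%x. gy x y) has_real_derivative gyx x y) (at x)"
  and cont: "isCont (%z. gxy (fst z) (snd z)) (a, b)" "isCont (%z. gyx (fst z) (snd z)) (a, b)"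
 shows "gxy a b = gyx a b"
proof -
 define \<Delta> where "\<Delta> s = g (a + s) (b + s) - g (a + s) b - g a (b + s) + g a b" for s
 have *: "\<exists>\<xi> \<eta>. a < \<xi> & \<xi> < a + s & b < \<eta> & \<eta> < b + s & \<Delta> s = s * s * gxy \<xi> \<eta>" if "s > 0" for s
 proof -
  have "\<exists>\<xi>>a. \<xi> < a + s &
    (g (a + s) (b + s) - g (a + s) b) - (g a (b + s) - g a b) = (a + s - a) * (gx \<xi> (b + s) - gx \<xi> b)"
   using that by (intro MVT2 DERIV_diff gx) auto
  then obtain \<xi> where \<xi>: "a < \<xi>" "\<xi> < a + s"
   "(g (a + s) (b + s) - g (a + s) b) - (g a (b + s) - g a b) = (a + s - a) * (gx \<xi> (b + s) - gx \<xi> b)"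
   by blast
  have "\<exists>\<eta>>b. \<eta> < b + s & gx \<xi> (b + s) - gx \<xi> b = (b + s - b) * gxy \<xi> \<eta>"
   using that by (intro MVT2 gxy) auto
  then obtain \<eta> where \<eta>: "b < \<eta>" "\<eta> < b + s" "gx \<xi> (b + s) - gx \<xi> b = (b + s - b) * gxy \<xi> \<eta>"
   by blast
  show ?thesis
   by (rule exI[of _ \<xi>], rule exI[of _ \<eta>]) (use \<xi> \<eta> in \<open>auto simp: \<Delta>_def algebra_simps\<close>)
 qed
 have **: "\<exists>\<xi> \<eta>. a < \<xi> & \<xi> < a + s & b < \<eta> & \<eta> < b + s & \<Delta> s = s * s * gyx \<xi> \<eta>" if "s > 0" for s
 proof -
  have "\<exists>\<eta>>b. \<eta> < b + s &
    (g (a + s) (b + s) - g a (b + s)) - (g (a + s) b - g a b) = (b + s - b) * (gy (a + s) \<eta> - gy a \<eta>)"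
   using that by (intro MVT2 DERIV_diff gy) auto
  then obtain \<eta> where \<eta>: "b < \<eta>" "\<eta> < b + s"
   "(g (a + s) (b + s) - g a (b + s)) - (g (a + s) b - g a b) = (b + s - b) * (gy (a + s) \<eta> - gy a \<eta>)"
   by blast
  have "\<exists>\<xi>>a. \<xi> < a + s & gy (a + s) \<eta> - gy a \<eta> = (a + s - a) * gyx \<xi> \<eta>"
   using that by (intro MVT2 gyx) auto
  then obtain \<xi> where \<xi>: "a < \<xi>" "\<xi> < a + s" "gy (a + s) \<eta> - gy a \<eta> = (a + s - a) * gyx \<xi> \<eta>"
   by blast
  show ?thesis
   by (rule exI[of _ \<xi>], rule exI[of _ \<eta>]) (use \<xi> \<eta> in \<open>auto simp: \<Delta>_def algebra_simps\<close>)
 qed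
 have lim: "((%s. \<Delta> s / (s * s)) \<longlongrightarrow> G a b) (at_right 0)"
  if ex: "\<And>s. s > 0 ==> \<exists>\<xi> \<eta>. a < \<xi> & \<xi> < a + s & b < \<eta> & \<eta> < b + s & \<Delta> s = s * s * G \<xi> \<eta>"
   and c: "isCont (%z. G (fst z) (snd z)) (a, b)" for G :: "real => real => real"
 proof (rule tendstoI)
  fix e :: real assume "e > 0"
  then obtain d where d: "d > 0" "\<And>z. dist z (a, b) < d ==> dist (G (fst z) (snd z)) (G a b) < e"
   using c[unfolded continuous_at_eps_delta] by auto
  have "dist (\<Delta> s / (s * s)) (G a b) < e" if s: "0 < s" "s < d / 2" for s
  proof -
   obtain \<xi> \<eta> where \<xi>: "a < \<xi>" "\<xi> < a + s" "b < \<eta>" "\<eta> < b + s" "\<Delta> s = s * s * G \<xi> \<eta>"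
    using ex[OF s(1)] by blast
   have "dist (\<xi>, \<eta>) (a, b) \<le> \<bar>\<xi> - a\<bar> + \<bar>\<eta> - b\<bar>"
    by (simp add: dist_prod_def dist_real_def sqrt_sum_squares_le_sum_abs)
   then have "dist (\<xi>, \<eta>) (a, b) < d" using \<xi> s by linarith
   from d(2)[OF this] show ?thesis using \<xi>(5) s by simp
  qed
  then show "\<forall>\<^sub>F s in at_right 0. dist (\<Delta> s / (s * s)) (G a b) < e"
   unfolding eventually_at_right_field using d(1) by (intro exI[of _ "d/2"]) auto
 qed
 show ?thesis
  using tendsto_unique[OF _ lim[OF * cont(1)] lim[OF ** cont(2)]] by auto
qed

abbreviation dx :: "(real^2 => 'b::real_normed_vector) => real^2 => 'b" where
 "dx F u \<equiv> frechet_derivative F (at u) (axis 1 1)"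

abbreviation dy :: "(real^2 => 'b::real_normed_vector) => real^2 => 'b" where
 "dy F u \<equiv> frechet_derivative F (at u) (axis 2 1)"

lemma smooth_on_differentiable: "smooth_on F U ==> u \<in> U ==> F differentiable (at u)"
 unfolding smooth_on_def by (metis Ck_on.simps(2))

lemma smooth_on_frechet: "smooth_on F U ==> smooth_on (%u. frechet_derivative F (at u) v) U"
 unfolding smooth_on_def by (metis Ck_on.simps(2))

lemma smooth_on_continuous: "smooth_on F U ==> continuous_on U F"
 unfolding smooth_on_def by (metis Ck_on.simps(1))

lemma vec2_decomp: "(v::real^2) = v$1 *\<^sub>R axis 1 1 + v$2 *\<^sub>R axis 2 1"
 by (simp add: vec_eq_iff forall_2 axis_def)

lemma frechet_partials:
 assumes "F differentiable (at u)"
 shows "frechet_derivative F (at u) v = v$1 *\<^sub>R dx F u + v$2 *\<^sub>R dy F u"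
proof -
 have "linear (frechet_derivative F (at u))"
  using assms linear_frechet_derivative by blast
 then show ?thesis
  by (subst vec2_decomp[of v]) (simp add: linear_add linear_scale)
qed

lemma partials_eqI:
 assumes "(F has_derivative (%v. v$1 *\<^sub>R X + v$2 *\<^sub>R Y)) (at u)"
 shows "dx F u = X" "dy F u = Y"
 using frechet_derivative_at[OF assms, symmetric] by (simp_all add: axis_def)

text \<open>Schwarz's theorem applied to each real component \<open>F u \<bullet> b\<close>.\<close>

lemma smooth_mixed_partials:
 fixes F :: "real^2 => 'b::euclidean_space"
 assumes F: "smooth_on F UNIV"
 shows "dy (dx F) u = dx (dy F) u"
proof (rule euclidean_eqI)
 fix b :: 'b assume "b \<in> Basis"
 have vd: "((%x. vector [x, y] :: real^2) has_derivative (%h. h *\<^sub>R axis 1 1)) (at x)"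
  "((%y. vector [x, y] :: real^2) has_derivative (%h. h *\<^sub>R axis 2 1)) (at y)" for x y :: real
 proof -
  have *: "(vector [x, y] :: real^2) = x *\<^sub>R axis 1 1 + y *\<^sub>R axis 2 1" for x y
   by (simp add: vec_eq_iff forall_2 axis_def)
  show "((%x. vector [x, y] :: real^2) has_derivative (%h. h *\<^sub>R axis 1 1)) (at x)"
   "((%y. vector [x, y] :: real^2) has_derivative (%h. h *\<^sub>R axis 2 1)) (at y)"
   unfolding * by (auto intro!: derivative_eq_intros)
 qed
 have chain: "((%x. G (vector [x, y]) \<bullet> b) has_real_derivative dx G (vector [x, y]) \<bullet> b) (at x)"
  "((%y. G (vector [x, y]) \<bullet> b) has_real_derivative dy G (vector [x, y]) \<bullet> b) (at y)"
  if "smooth_on G UNIV" for G :: "real^2 => 'b" and x y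
 proof -
  have G: "(G has_derivative frechet_derivative G (at z)) (at z)" for z
   using smooth_on_differentiable[OF that] frechet_derivative_works by blast
  have lin: "frechet_derivative G (at z) (h *\<^sub>R w) = h *\<^sub>R frechet_derivative G (at z) w" for z h w
   using linear_scale[OF has_derivative_linear[OF G]] by simp
  show "((%x. G (vector [x, y]) \<bullet> b) has_real_derivative dx G (vector [x, y]) \<bullet> b) (at x)"
   "((%y. G (vector [x, y]) \<bullet> b) has_real_derivative dy G (vector [x, y]) \<bullet> b) (at y)"
   using bounded_linear.has_derivative[OF bounded_linear_inner_left[of b] has_derivative_compose[OF vd(1)[of y x] G]]
    bounded_linear.has_derivative[OF bounded_linear_inner_left[of b] has_derivative_compose[OF vd(2)[of x y] G]]
   by (simp_all add: has_field_derivative_def lin mult.commute[of _ "_ \<bullet> b"] fun_eq_iff)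
 qed
 have cont: "isCont (%z. G (vector [fst z, snd z]) \<bullet> b) (a, a')" if "smooth_on G UNIV"
  for G :: "real^2 => 'b" and a a' :: real
 proof -
  have *: "(vector [x, y] :: real^2) = x *\<^sub>R axis 1 1 + y *\<^sub>R axis 2 1" for x y
   by (simp add: vec_eq_iff forall_2 axis_def)
  have "continuous_on UNIV G" using smooth_on_continuous[OF that] .
  then have "isCont G w" for w by (simp add: continuous_on_eq_continuous_at)
  then have "isCont (%z. G (fst z *\<^sub>R axis 1 1 + snd z *\<^sub>R axis 2 1)) (a, a')"
   by (intro continuous_at_compose[of _ "%z. fst z *\<^sub>R axis 1 1 + snd z *\<^sub>R axis 2 1" G, unfolded o_def]
     continuous_intros) auto
  then show ?thesis unfolding * by (intro continuous_intros)
 qed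
 have s: "smooth_on (dx F) UNIV" "smooth_on (dy F) UNIV" "smooth_on (dy (dx F)) UNIV" "smooth_on (dx (dy F)) UNIV"
  using smooth_on_frechet[OF F] smooth_on_frechet[OF smooth_on_frechet[OF F]] by auto
 have u: "vector [u$1, u$2] = u" by (simp add: vec_eq_iff forall_2)
 show "dy (dx F) u \<bullet> b = dx (dy F) u \<bullet> b"
  using mixed_partials_eq[of "%x y. F (vector [x, y]) \<bullet> b" "%x y. dx F (vector [x, y]) \<bullet> b"
    "%x y. dy F (vector [x, y]) \<bullet> b" "%x y. dy (dx F) (vector [x, y]) \<bullet> b"
    "%x y. dx (dy F) (vector [x, y]) \<bullet> b" "u$1" "u$2",
    OF chain(1)[OF F] chain(2)[OF F] chain(2)[OF s(1)] chain(1)[OF s(2)] cont[OF s(3)] cont[OF s(4)]]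
  by (simp add: u)
qed

section \<open>The bilinear forms and the expansion of a vector in an adapted frame\<close>

lemma mform_simps [simp]:
 "mform \<e> (x + y) z = mform \<e> x z + mform \<e> y z" "mform \<e> z (x + y) = mform \<e> z x + mform \<e> z y"
 "mform \<e> (x - y) z = mform \<e> x z - mform \<e> y z" "mform \<e> z (x - y) = mform \<e> z x - mform \<e> z y"
 "mform \<e> (r *\<^sub>R x) z = r * mform \<e> x z" "mform \<e> z (r *\<^sub>R x) = r * mform \<e> z x"
 "mform \<e> 0 z = 0" "mform \<e> z 0 = 0"
 "mform \<e> (- x) z = - mform \<e> x z" "mform \<e> z (- x) = - mform \<e> z x"
 by (simp_all add: mform_def algebra_simps)

lemma pform_simps [simp]:
 "pform \<e> (x + y) z = pform \<e> x z + pform \<e> y z" "pform \<e> z (x + y) = pform \<e> z x + pform \<e> z y"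
 "pform \<e> (x - y) z = pform \<e> x z - pform \<e> y z" "pform \<e> z (x - y) = pform \<e> z x - pform \<e> z y"
 "pform \<e> (r *\<^sub>R x) z = r * pform \<e> x z" "pform \<e> z (r *\<^sub>R x) = r * pform \<e> z x"
 "pform \<e> 0 z = 0" "pform \<e> z 0 = 0"
 "pform \<e> (- x) z = - pform \<e> x z" "pform \<e> z (- x) = - pform \<e> z x"
 by (simp_all add: pform_def algebra_simps)

lemma mform_commute: "mform \<e> x y = mform \<e> y x"
 by (simp add: mform_def mult.commute)

lemma pform_commute: "pform \<e> x y = pform \<e> y x"
 by (simp add: pform_def mform_commute mult.commute)

lemma bounded_bilinear_pform: "bounded_bilinear (pform \<e>)"
proof (rule bilinear_conv_bounded_bilinear[THEN iffD1])
 show "bilinear (pform \<e>)"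
  by (simp add: bilinear_def linear_iff)
qed

lemma bounded_bilinear_mform: "bounded_bilinear (mform \<e>)"
proof (rule bilinear_conv_bounded_bilinear[THEN iffD1])
 show "bilinear (mform \<e>)"
  by (simp add: bilinear_def linear_iff)
qed

text \<open>The form may be indefinite, so the expansion is obtained by dimension: the linear map
  \<open>L\<close> reads off the four pairings, an explicit preimage shows that it is onto, hence it
  is injective on a space of dimension four, and both sides have the same pairings.\<close>

lemma frame_expansion:
 fixes X Y N w :: ambient and p :: "real^3"
 assumes e: "\<e> \<in> {-1, 1}" and p: "mform \<e> p p = \<e>"
  and t: "mform \<e> p (fst X) = 0" "mform \<e> p (fst Y) = 0" "mform \<e> p (fst N) = 0"
  and m: "pform \<e> X X = lam" "pform \<e> Y Y = lam" "pform \<e> X Y = 0" "lam > 0"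
  and n: "pform \<e> N N = 1" "pform \<e> X N = 0" "pform \<e> Y N = 0"
 shows "w = (\<e> * mform \<e> p (fst w)) *\<^sub>R (p, 0) + (pform \<e> w X / lam) *\<^sub>R X
  + (pform \<e> w Y / lam) *\<^sub>R Y + pform \<e> w N *\<^sub>R N"
proof -
 define L :: "ambient => ambient" where
  "L w = (vector [mform \<e> p (fst w), pform \<e> w X, pform \<e> w Y], pform \<e> w N)" for w
 have P: "pform \<e> (q, 0) v = mform \<e> q (fst v)" for q v by (simp add: pform_def)
 have lin: "linear L"
  by (rule linearI) (auto simp: L_def vec_eq_iff forall_3)
 note facts = t m n pform_commute[of \<e> Y X] pform_commute[of \<e> N X] pform_commute[of \<e> N Y] p
 have ee: "\<e> * \<e> = 1" using e by auto
 have "surj L"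
 proof (rule surjI)
  fix z :: ambient
  show "L ((\<e> * fst z $ 1) *\<^sub>R (p, 0) + (fst z $ 2 / lam) *\<^sub>R X + (fst z $ 3 / lam) *\<^sub>R Y + snd z *\<^sub>R N) = z"
   using facts ee by (auto simp: L_def prod_eq_iff vec_eq_iff forall_3 P)
 qed
 then have inj: "inj L" using lin linear_surjective_imp_injective by blast
 have "L w = L ((\<e> * mform \<e> p (fst w)) *\<^sub>R (p, 0) + (pform \<e> w X / lam) *\<^sub>R X
  + (pform \<e> w Y / lam) *\<^sub>R Y + pform \<e> w N *\<^sub>R N)"
  using facts ee by (auto simp: L_def prod_eq_iff vec_eq_iff forall_3 P)
 then show ?thesis using inj by (simp add: inj_eq)
qed

lemma pform_has_derivative:
 assumes "(F has_derivative F') (at u)" "(G has_derivative G') (at u)"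
 shows "((%u. pform \<e> (F u) (G u)) has_derivative (%v. pform \<e> (F u) (G' v) + pform \<e> (F' v) (G u))) (at u)"
 by (rule bounded_bilinear.FDERIV[OF bounded_bilinear_pform assms])

text \<open>Differentiates an identity between two pairings that differ by a constant; with zero
  fields on the right it treats pairings that are constant.\<close>

lemma pform_const_deriv:
 assumes F: "F differentiable (at u)" and G: "G differentiable (at u)"
  and F': "F' differentiable (at u)" and G': "G' differentiable (at u)"
  and eq: "\<And>u. pform \<e> (F u) (G u) = pform \<e> (F' u) (G' u) + c"
 shows "pform \<e> (F u) (frechet_derivative G (at u) v) + pform \<e> (frechet_derivative F (at u) v) (G u)
  = pform \<e> (F' u) (frechet_derivative G' (at u) v) + pform \<e> (frechet_derivative F' (at u) v) (G' u)"
proof -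
 note 1 = pform_has_derivative[OF F[unfolded frechet_derivative_works] G[unfolded frechet_derivative_works], of \<e>]
 note 2 = has_derivative_add[OF pform_has_derivative[OF F'[unfolded frechet_derivative_works] G'[unfolded frechet_derivative_works], of \<e>] has_derivative_const[of c]]
 have "(%u. pform \<e> (F u) (G u)) = (%u. pform \<e> (F' u) (G' u) + c)" using eq by simp
 with 2 have "((%u. pform \<e> (F u) (G u)) has_derivative (%v. pform \<e> (F' u) (frechet_derivative G' (at u) v) +
   pform \<e> (frechet_derivative F' (at u) v) (G' u) + 0)) (at u)" by metis
 from fun_cong[OF has_derivative_unique[OF 1 this], of v] show ?thesis by simp
qed

lemma zero_on_dense:
 fixes f :: "'a::topological_space => 'b::t1_space"
 assumes "continuous_on UNIV f" "\<And>u. u \<in> S ==> f u = c" "closure S = UNIV"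
 shows "f u = c"
proof -
 have "closed {u. f u = c}"
  using continuous_closed_preimage_constant[OF assms(1) closed_UNIV] by simp
 moreover have "S \<subseteq> {u. f u = c}" using assms(2) by auto
 ultimately have "closure S \<subseteq> {u. f u = c}" by (rule closure_minimal[rotated])
 then show ?thesis using assms(3) by auto
qed

text \<open>The analytic assumptions involve the metric and the height only. \<open>normal\<close>
  is the splitting of the vertical unit field into its tangential part and \<open>snd (N u)\<close>
  times \<open>N u\<close>, multiplied by \<open>lam\<close>; \<open>height\<close> is the vertical
  component of the equation that the Laplacian of the immersion is \<open>2 H lam N\<close> up to
  the position vector. Both determine \<open>N\<close> and the mean curvature only where
  \<open>snd (N u)\<close> is nonzero, hence \<open>dense\<close>.\<close>

locale conformal_immersion =
 fixes \<e> H :: real and F N :: "real^2 => ambient" and lam :: "real^2 => real"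
 assumes eps: "\<e> \<in> {-1, 1}"
  and smooth_F: "smooth_on F UNIV" and smooth_N: "smooth_on N UNIV"
  and in_M2: "\<And>u. fst (F u) \<in> M2 \<e>"
  and lam_pos: "\<And>u. lam u > 0"
  and conf: "\<And>u. pform \<e> (dx F u) (dx F u) = lam u" "\<And>u. pform \<e> (dy F u) (dy F u) = lam u"
   "\<And>u. pform \<e> (dx F u) (dy F u) = 0"
  and normal: "\<And>u. (lam u * snd (N u)) *\<^sub>R N u =
   lam u *\<^sub>R (0, 1) - snd (dx F u) *\<^sub>R dx F u - snd (dy F u) *\<^sub>R dy F u"
  and height: "\<And>u. snd (dx (dx F) u) + snd (dy (dy F) u) = 2 * H * lam u * snd (N u)"
  and dense: "closure {u. snd (N u) \<noteq> 0} = UNIV"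
begin

lemma diff_F: "F differentiable (at u)" and diff_N: "N differentiable (at u)"
 and diff_X: "dx F differentiable (at u)" and diff_Y: "dy F differentiable (at u)"
 by (auto intro!: smooth_on_differentiable[of _ UNIV] smooth_F smooth_N smooth_on_frechet)

lemma cont_F: "continuous_on UNIV F" and cont_N: "continuous_on UNIV N"
 and cont_X: "continuous_on UNIV (dx F)" and cont_Y: "continuous_on UNIV (dy F)"
 and cont_NX: "continuous_on UNIV (dx N)" and cont_NY: "continuous_on UNIV (dy N)"
 by (auto intro!: smooth_on_continuous smooth_F smooth_N smooth_on_frechet)

lemmas cont_pform = bounded_bilinear.continuous_on[OF bounded_bilinear_pform]
lemmas cont_mform = bounded_bilinear.continuous_on[OF bounded_bilinear_mform]

lemma tangent: "mform \<e> (fst (F u)) (fst (frechet_derivative F (at u) v)) = 0"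
proof -
 have d: "((%u. fst (F u)) has_derivative (%v. fst (frechet_derivative F (at u) v))) (at u)"
  using diff_F[of u] by (auto simp: frechet_derivative_works intro!: derivative_eq_intros)
 have c: "(%u. mform \<e> (fst (F u)) (fst (F u))) = (%u. \<e>)"
  using in_M2 by (auto simp: M2_def)
 have "((%u. \<e>) has_derivative (%v. mform \<e> (fst (F u)) (fst (frechet_derivative F (at u) v)) +
   mform \<e> (fst (frechet_derivative F (at u) v)) (fst (F u)))) (at u)"
  using bounded_bilinear.FDERIV[OF bounded_bilinear_mform d d, of \<e>] unfolding c .
 from fun_cong[OF has_derivative_unique[OF this has_derivative_const], of v]
 have "mform \<e> (fst (F u)) (fst (frechet_derivative F (at u) v)) +
   mform \<e> (fst (frechet_derivative F (at u) v)) (fst (F u)) = 0" by simp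
 then show ?thesis by (simp add: mform_commute)
qed

text \<open>Pairing \<open>normal\<close> with the two tangent vectors, with \<open>N\<close> and
  with the position vector gives each relation multiplied by \<open>lam\<close> times the vertical
  component of \<open>N\<close>. That factor is cancelled where it is nonzero; continuity and
  density do the rest.\<close>

lemma N_normal: "pform \<e> (dx F u) (N u) = 0" "pform \<e> (dy F u) (N u) = 0" "pform \<e> (N u) (N u) = 1"
 "mform \<e> (fst (F u)) (fst (N u)) = 0"
proof -
 have vert: "pform \<e> v (0, r) = r * snd v" "pform \<e> (0, r) v = r * snd v" for v r
  by (simp_all add: pform_def)
 have *: "pform \<e> (dx F u) (N u) = 0 & pform \<e> (dy F u) (N u) = 0 & pform \<e> (N u) (N u) = 1 &
  mform \<e> (fst (F u)) (fst (N u)) = 0" if "snd (N u) \<noteq> 0" for u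
 proof -
  have nz: "lam u * snd (N u) \<noteq> 0" using that lam_pos[of u] by simp
  note c = conf[of u] pform_commute[of \<e> "dy F u" "dx F u"]
  have "lam u * snd (N u) * pform \<e> (dx F u) (N u) = 0"
   using arg_cong[OF normal[of u], of "pform \<e> (dx F u)"] c by (simp add: vert mult.commute)
  moreover have "lam u * snd (N u) * pform \<e> (dy F u) (N u) = 0"
   using arg_cong[OF normal[of u], of "pform \<e> (dy F u)"] c by (simp add: vert mult.commute)
  ultimately have 1: "pform \<e> (dx F u) (N u) = 0" "pform \<e> (dy F u) (N u) = 0" using nz by auto
  have "lam u * snd (N u) * pform \<e> (N u) (N u) = lam u * snd (N u) * 1"
   using arg_cong[OF normal[of u], of "%w. pform \<e> w (N u)"] 1 by (simp add: vert)
  then have 2: "pform \<e> (N u) (N u) = 1" using nz by simp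
  have "lam u * snd (N u) * mform \<e> (fst (F u)) (fst (N u)) = 0"
   using arg_cong[OF normal[of u], of "%w. mform \<e> (fst (F u)) (fst w)"] tangent by simp
  then show ?thesis using 1 2 nz by auto
 qed
 show "pform \<e> (dx F u) (N u) = 0"
  by (rule zero_on_dense[OF _ _ dense, of "%u. pform \<e> (dx F u) (N u)"])
    (use * in \<open>auto intro!: cont_pform cont_X cont_N\<close>)
 show "pform \<e> (dy F u) (N u) = 0"
  by (rule zero_on_dense[OF _ _ dense, of "%u. pform \<e> (dy F u) (N u)"])
    (use * in \<open>auto intro!: cont_pform cont_Y cont_N\<close>)
 show "pform \<e> (N u) (N u) = 1"
  by (rule zero_on_dense[OF _ _ dense, of "%u. pform \<e> (N u) (N u)"])
    (use * in \<open>auto intro!: cont_pform cont_N\<close>)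
 show "mform \<e> (fst (F u)) (fst (N u)) = 0"
  by (rule zero_on_dense[OF _ _ dense, of "%u. mform \<e> (fst (F u)) (fst (N u))"])
    (use * in \<open>auto intro!: cont_mform continuous_on_fst cont_F cont_N\<close>)
qed

lemma unit_normal: "unit_normal \<e> F u (N u)"
proof -
 have "pform \<e> (frechet_derivative F (at u) w) (N u) = 0" for w
  unfolding frechet_partials[OF diff_F, of u w] by (simp add: N_normal)
 then show ?thesis by (simp add: unit_normal_def N_normal)
qed

lemma expansion:
 "w = (\<e> * mform \<e> (fst (F u)) (fst w)) *\<^sub>R (fst (F u), 0) + (pform \<e> w (dx F u) / lam u) *\<^sub>R dx F u
  + (pform \<e> w (dy F u) / lam u) *\<^sub>R dy F u + pform \<e> w (N u) *\<^sub>R N u"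
 using in_M2[of u] by (intro frame_expansion) (auto simp: eps[simplified] tangent N_normal conf lam_pos M2_def)

text \<open>Differentiating the conformality relations shows that \<open>L\<close> is orthogonal to
  both tangent vectors. Modulo the position vector it is thus a multiple of \<open>N\<close>, and
  its known vertical component fixes the multiple. The sum of pairings is
  \<open>- pform L N\<close>, because \<open>N\<close> stays orthogonal to the tangent
  vectors.\<close>

lemma laplace: "pform \<e> (dx N u) (dx F u) + pform \<e> (dy N u) (dy F u) = - (2 * H * lam u)"
proof -
 \<comment> \<open>\<open>lam\<close> is replaced here by \<open>pform (dx F) (dx F)\<close>,
   because the density argument needs continuity and none is assumed of \<open>lam\<close>.\<close>
 define tr where "tr u = pform \<e> (dx N u) (dx F u) + pform \<e> (dy N u) (dy F u) +
  2 * H * pform \<e> (dx F u) (dx F u)" for u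
 have "tr u = 0" if nz: "snd (N u) \<noteq> 0" for u
 proof -
  define L where "L = dx (dx F) u + dy (dy F) u"
  have mp: "dy (dx F) u = dx (dy F) u" by (rule smooth_mixed_partials[OF smooth_F])
  note pc = pform_commute
  have a: "pform \<e> (dx F u) (frechet_derivative (dx F) (at u) v) = pform \<e> (dy F u) (frechet_derivative (dy F) (at u) v)" for v
   using pform_const_deriv[OF diff_X diff_X diff_Y diff_Y, of \<e> 0 u v] conf by (simp add: pc)
  have b: "pform \<e> (dx F u) (frechet_derivative (dy F) (at u) v) + pform \<e> (dy F u) (frechet_derivative (dx F) (at u) v) = 0" for v
   using pform_const_deriv[of "dx F" u "dy F" "%_. 0" "%_. 0" \<e> 0 v] diff_X diff_Y conf by (simp add: pc)
  have LX: "pform \<e> L (dx F u) = 0"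
   using a[of "axis 1 1"] b[of "axis 2 1"] by (simp add: L_def pc mp)
  have LY: "pform \<e> L (dy F u) = 0"
   using a[of "axis 2 1"] b[of "axis 1 1"] by (simp add: L_def pc mp)
  have c: "pform \<e> (dx F u) (frechet_derivative N (at u) v) + pform \<e> (frechet_derivative (dx F) (at u) v) (N u) = 0"
   "pform \<e> (dy F u) (frechet_derivative N (at u) v) + pform \<e> (frechet_derivative (dy F) (at u) v) (N u) = 0" for v
   using pform_const_deriv[of "dx F" u N "%_. 0" "%_. 0" \<e> 0 v]
    pform_const_deriv[of "dy F" u N "%_. 0" "%_. 0" \<e> 0 v] diff_X diff_Y diff_N N_normal by simp_all
  have LN: "pform \<e> (dx N u) (dx F u) + pform \<e> (dy N u) (dy F u) = - pform \<e> L (N u)"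
   using c(1)[of "axis 1 1"] c(2)[of "axis 2 1"] by (simp add: L_def pc)
  have z: "pform \<e> L (0, 0) = 0" by (simp add: pform_def)
  \<comment> \<open>In the expansion of the vertical vector the coefficient of the position vector
    is 0, and \<open>L\<close> is orthogonal to the tangent vectors; only the normal term
    survives.\<close>
  have "pform \<e> L (0, 1) = pform \<e> L (N u) * snd (N u)"
   by (subst expansion[of "(0, 1)" u])
     (use LX LY z in \<open>simp add: pform_def[of \<e> "(0, 1)"]\<close>)
  moreover have "pform \<e> L (0, 1) = 2 * H * lam u * snd (N u)"
   using height[of u] by (simp add: pform_def L_def)
  ultimately have "pform \<e> L (N u) = 2 * H * lam u" using nz by simp
  then show ?thesis using LN by (simp add: tr_def conf)
 qed
 moreover have "continuous_on UNIV tr"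
  unfolding tr_def by (intro continuous_intros cont_pform cont_X cont_Y cont_NX cont_NY)
 ultimately have "tr u = 0" using zero_on_dense[OF _ _ dense, of tr] by blast
 then show ?thesis by (simp add: tr_def conf)
qed

text \<open>In the orthogonal frame \<open>dx F\<close>, \<open>dy F\<close> of common square
  \<open>lam\<close> the entries of the matrix are minus the pairings of the derivatives of
  \<open>N\<close> with the frame, divided by \<open>lam\<close>. The projection removes the
  component along the position vector, and a unit field has no derivative along itself.\<close>

lemma shape: "\<exists>A. shape_matrix \<e> F N u A & trace A / 2 = H"
proof -
 let ?p = "fst (F u)"
 define a where "a V W = - pform \<e> V W / lam u" for V W
 define A :: "real^2^2" where "A = (\<chi> i j. a (if j = 1 then dx N u else dy N u) (if i = 1 then dx F u else dy F u))"
 have "frechet_derivative F (at u) (A *v w) = - tangent_proj \<e> (F u) (frechet_derivative N (at u) w)" for w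
 proof -
  let ?n = "frechet_derivative N (at u) w" and ?t = "tangent_proj \<e> (F u) (frechet_derivative N (at u) w)"
  have nN: "pform \<e> ?n (N u) = 0"
   using pform_const_deriv[of N u N "%_. 0" "%_. 0" \<e> 1 w] diff_N N_normal
   by (simp add: pform_commute[of \<e> "N u" ?n])
  have t: "?t = ?n - (\<e> * mform \<e> ?p (fst ?n)) *\<^sub>R (?p, 0)"
   by (simp add: tangent_proj_def prod_eq_iff mform_commute)
  have "?n - (\<e> * mform \<e> ?p (fst ?n)) *\<^sub>R (?p, 0) =
    (pform \<e> ?n (dx F u) / lam u) *\<^sub>R dx F u + (pform \<e> ?n (dy F u) / lam u) *\<^sub>R dy F u"
  proof -
   have "n = q + a + b + z *\<^sub>R N u ==> z = 0 ==> n - q = a + b" for n q a b z by simp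
   from this[OF expansion nN] show ?thesis .
  qed
  then have "- ?t = - ((pform \<e> ?n (dx F u) / lam u) *\<^sub>R dx F u + (pform \<e> ?n (dy F u) / lam u) *\<^sub>R dy F u)"
   unfolding t by (rule arg_cong)
  also have "\<dots> = a ?n (dx F u) *\<^sub>R dx F u + a ?n (dy F u) *\<^sub>R dy F u"
   by (simp add: a_def)
  also have "\<dots> = frechet_derivative F (at u) (A *v w)"
  proof -
   have "(A *v w) $ 1 = a ?n (dx F u)" "(A *v w) $ 2 = a ?n (dy F u)"
    using lam_pos[of u] frechet_partials[OF diff_N, of u w]
    by (simp_all add: A_def matrix_vector_mult_def sum_2 a_def field_simps)
   then show ?thesis unfolding frechet_partials[OF diff_F, of u "A *v w"] by simp
  qed
  finally show ?thesis by simp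
 qed
 moreover have "trace A = 2 * H"
  using laplace[of u] lam_pos[of u] by (simp add: trace_def sum_2 A_def a_def field_simps)
 ultimately have "shape_matrix \<e> F N u A & trace A / 2 = H" by (simp add: shape_matrix_def)
 then show ?thesis ..
qed

lemma immersion: "inj (frechet_derivative F (at u))"
proof -
 have lin: "linear (frechet_derivative F (at u))" using diff_F linear_frechet_derivative by blast
 have "v = 0" if "frechet_derivative F (at u) v = 0" for v
 proof -
  have z: "v$1 *\<^sub>R dx F u + v$2 *\<^sub>R dy F u = 0" using that frechet_partials[OF diff_F, of u v] by simp
  have "v$1 * lam u = 0" using arg_cong[OF z, of "pform \<e> (dx F u)"] conf[of u] by simp
  moreover have "v$2 * lam u = 0" using arg_cong[OF z, of "pform \<e> (dy F u)"] conf[of u]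
    pform_commute[of \<e> "dx F u" "dy F u"] by simp
  ultimately show "v = 0" using lam_pos[of u] by (simp add: vec_eq_iff forall_2)
 qed
 then show ?thesis using linear_injective_0[OF lin] by blast
qed

end

section \<open>Completeness\<close>

definition speed :: "real => (real => ambient) => real => real" where
 "speed \<e> f t = sqrt (pform \<e> (vector_derivative f (at t)) (vector_derivative f (at t)))"

lemma path_length_speed:
 "path_length \<e> S \<gamma> L \<longleftrightarrow> pathin (dom S) \<gamma> & (imm S \<circ> \<gamma>) piecewise_C1_differentiable_on {0..1} &
   (speed \<e> (imm S \<circ> \<gamma>) has_integral L) {0..1}"
 by (simp add: path_length_def speed_def[abs_def] Let_def)

text \<open>On the hyperboloid the tangency relation and Cauchy-Schwarz give
  \<open>c^2 p3^2 \<le> (a^2 + b^2) (p3^2 - 1)\<close>: the form is nonnegative on tangent vectors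
  and dominates the Euclidean norm up to a factor that grows with \<open>p3\<close>. The third
  estimate will bound the logarithmic derivative of \<open>p3\<close> along a path.\<close>

lemma tangent_norm_bound:
 assumes eps: "\<e> \<in> {-1, 1}" and p: "p \<in> M2 \<e>" and w: "mform \<e> p (fst w) = 0"
 shows "0 \<le> pform \<e> w w" "norm w \<le> (2 * \<bar>p$3\<bar> + 1) * sqrt (pform \<e> w w)"
  "\<e> = -1 ==> \<bar>fst w $ 3\<bar> \<le> p$3 * sqrt (pform \<e> w w)"
proof -
 have nw: "norm w ^ 2 = fst w $ 1 ^ 2 + fst w $ 2 ^ 2 + fst w $ 3 ^ 2 + snd w ^ 2"
  by (simp add: norm_prod_def norm_vec_def L2_set_def sum_3 power2_eq_square real_sqrt_mult_self)
 have "0 \<le> pform \<e> w w & norm w \<le> (2 * \<bar>p$3\<bar> + 1) * sqrt (pform \<e> w w) &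
  (\<e> = -1 --> \<bar>fst w $ 3\<bar> \<le> p$3 * sqrt (pform \<e> w w))"
 proof (cases "\<e> = 1")
  case True
  have "pform \<e> w w = norm w ^ 2" using True nw by (simp add: pform_def mform_def power2_eq_square)
  then show ?thesis using True by (simp add: mult_le_cancel_right1)
 next
  case False
  then have e: "\<e> = -1" using eps by auto
  define a b c r q where "a = fst w $ 1" and "b = fst w $ 2" and "c = fst w $ 3"
   and "r = p$1 ^ 2 + p$2 ^ 2" and "q = a^2 + b^2 - c^2"
  have p3: "p$3 > 0" "p$3 ^ 2 = 1 + r"
   using p e by (auto simp: M2_def mform_def r_def power2_eq_square)
  have orth: "c * p$3 = a * p$1 + b * p$2"
   using w e by (simp add: mform_def a_def b_def c_def mult.commute)
  have "(a * p$1 + b * p$2)^2 + (a * p$2 - b * p$1)^2 = (a^2 + b^2) * r"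
   by (simp add: r_def power2_eq_square algebra_simps)
  then have cs: "(c * p$3)^2 \<le> (a^2 + b^2) * r" unfolding orth by (metis le_add_same_cancel1 zero_le_power2)
  have r0: "r \<ge> 0" by (simp add: r_def)
  have pq: "q * p$3^2 \<ge> a^2 + b^2"
  proof -
   have "q * p$3^2 = (a^2 + b^2) * (1 + r) - (c * p$3)^2"
    by (simp add: q_def p3(2)[symmetric] power_mult_distrib algebra_simps)
   then show ?thesis using cs by (simp add: algebra_simps)
  qed
  have q0: "q \<ge> 0"
   using pq p3 by (smt (verit) mult_neg_pos not_sum_power2_lt_zero zero_less_power)
  have cq: "c^2 \<le> p$3^2 * q"
  proof -
   have "c^2 \<le> a^2 + b^2" using q0 by (simp add: q_def)
   then show ?thesis using pq by (simp add: mult.commute)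
  qed
  have pf: "pform \<e> w w = q + snd w ^ 2"
   using e by (simp add: pform_def mform_def q_def a_def b_def c_def power2_eq_square)
  have p1: "p$3^2 \<ge> 1" using p3 r0 by simp
  have "norm w ^ 2 \<le> 2 * (p$3^2 * q) + snd w^2"
   unfolding nw using pq cq by (simp add: a_def b_def c_def mult.commute)
  also have "\<dots> \<le> (2 * p$3)^2 * pform \<e> w w"
  proof -
   have "snd w ^ 2 \<le> 4 * p$3^2 * snd w ^ 2" using p1 mult_right_mono[of 1 "4 * p$3^2" "snd w ^ 2"] by simp
   moreover have "0 \<le> q * (2 * p$3^2)" using q0 by simp
   ultimately show ?thesis by (simp add: pf algebra_simps power_mult_distrib)
  qed
  also have "\<dots> = (2 * p$3 * sqrt (pform \<e> w w))^2"
   using q0 by (simp add: power_mult_distrib pf)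
  finally have "norm w \<le> 2 * p$3 * sqrt (pform \<e> w w)"
   by (rule power2_le_imp_le) (use p3 q0 pf in simp)
  then have 1: "norm w \<le> (2 * \<bar>p$3\<bar> + 1) * sqrt (pform \<e> w w)"
   using p3 q0 pf by (simp add: algebra_simps) (smt (verit) real_sqrt_ge_0_iff zero_le_power2)
  have "c^2 \<le> (p$3 * sqrt (pform \<e> w w))^2"
  proof -
   have "p$3^2 * q \<le> p$3^2 * pform \<e> w w" by (rule mult_left_mono) (simp_all add: pf)
   then show ?thesis using cq q0 by (simp add: power_mult_distrib pf)
  qed
  then have "\<bar>c\<bar> \<le> p$3 * sqrt (pform \<e> w w)"
   using p3 q0 pf by (metis abs_le_square_iff abs_of_nonneg less_imp_le mult_nonneg_nonneg
     real_sqrt_ge_0_iff add_nonneg_nonneg zero_le_power2)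
  then show ?thesis using 1 q0 pf e by (simp add: c_def)
 qed
 then show "0 \<le> pform \<e> w w" "norm w \<le> (2 * \<bar>p$3\<bar> + 1) * sqrt (pform \<e> w w)"
  "\<e> = -1 ==> \<bar>fst w $ 3\<bar> \<le> p$3 * sqrt (pform \<e> w w)" by auto
qed

text \<open>The integrands are set to 0 at the exceptional points and at the endpoints, where
  neither the derivative nor its bound is known; the integrals do not change.\<close>

lemma dominated_increment:
 fixes g :: "real => 'b::euclidean_space"
 assumes K: "finite K" and c: "continuous_on {0..1} g"
  and d: "\<And>t. t \<in> {0<..<1} - K ==> (g has_vector_derivative g' t) (at t)"
  and b: "\<And>t. t \<in> {0<..<1} - K ==> norm (g' t) \<le> C * v t"
  and v: "\<And>t. t \<in> {0<..<1} - K ==> 0 \<le> v t" and L: "(v has_integral L) {0..1}"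
  and s: "s \<in> {0..1}" and C: "C \<ge> 0"
 shows "norm (g s - g 0) \<le> C * L"
proof -
 define w where "w t = (if t \<in> {0<..<1} - K then v t else 0)" for t
 define h where "h t = (if t \<in> {0<..<1} - K then g' t else 0)" for t
 have w: "(w has_integral L) {0..1}"
  by (rule has_integral_spike_finite[OF _ _ L, of "K \<union> {0, 1}"]) (auto simp: w_def K)
 have h: "(h has_integral g s - g 0) {0..s}"
 proof (rule fundamental_theorem_of_calculus_interior_strong[of K])
  show "(g has_vector_derivative h x) (at x)" if "x \<in> {0<..<s} - K" for x
   using d[of x] that s by (auto simp: h_def)
 qed (use K s c in \<open>auto intro: continuous_on_subset\<close>)
 have ws: "w integrable_on {0..s}"
  using integrable_subinterval_real[of w 0 1 0 s] w s by auto
 have "norm (g s - g 0) \<le> integral {0..s} (%t. C * w t)"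
 proof -
  have "norm (integral {0..s} h) \<le> integral {0..s} (%t. C * w t)"
   using h b by (intro integral_norm_bound_integral integrable_on_mult_right ws)
    (auto simp: w_def h_def)
  then show ?thesis using h by (simp add: integral_unique)
 qed
 also have "\<dots> = C * integral {0..s} w" by simp
 also have "integral {0..s} w \<le> integral {0..1} w"
  by (rule integral_subset_le) (use s ws w v in \<open>auto simp: w_def has_integral_integrable\<close>)
 finally show ?thesis using C w by (simp add: integral_unique mult_left_mono)
qed

lemma path_tangent:
 assumes M: "imm S ` topspace (dom S) \<subseteq> M2 \<e> \<times> UNIV" and eps: "\<e> \<in> {-1, 1}"
  and P: "path_length \<e> S \<gamma> L"
 obtains K where "finite K" "continuous_on {0..1} (imm S \<circ> \<gamma>)"
  "\<And>t. t \<in> {0..1} ==> fst (imm S (\<gamma> t)) \<in> M2 \<e>"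
  "\<And>t. t \<in> {0<..<1} - K ==> (imm S \<circ> \<gamma> has_vector_derivative vector_derivative (imm S \<circ> \<gamma>) (at t)) (at t)"
  "\<And>t. t \<in> {0<..<1} - K ==> mform \<e> (fst (imm S (\<gamma> t))) (fst (vector_derivative (imm S \<circ> \<gamma>) (at t))) = 0"
proof -
 let ?f = "imm S \<circ> \<gamma>"
 obtain K where K: "finite K" "?f C1_differentiable_on {0..1} - K" and c: "continuous_on {0..1} ?f"
  using P unfolding path_length_def piecewise_C1_differentiable_on_def by blast
 have in_top: "\<gamma> t \<in> topspace (dom S)" if "t \<in> {0..1}" for t
  using P that unfolding path_length_def pathin_def by (auto simp: continuous_map_def Pi_iff)
 then have M2: "fst (?f t) \<in> M2 \<e>" if "t \<in> {0..1}" for t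
  using M that by (force simp: image_subset_iff mem_Times_iff)
 have d: "(?f has_vector_derivative vector_derivative ?f (at t)) (at t)" if "t \<in> {0<..<1} - K" for t
  using K(2) that by (auto simp: C1_differentiable_on_eq vector_derivative_works[symmetric])
 have "mform \<e> (fst (?f t)) (fst (vector_derivative ?f (at t))) = 0" if t: "t \<in> {0<..<1} - K" for t
 proof -
  let ?v = "fst (vector_derivative ?f (at t))"
  have f1: "((%t. fst (?f t)) has_vector_derivative ?v) (at t)"
   using bounded_linear.has_vector_derivative[OF bounded_linear_fst d[OF t]] .
  have "((%t. mform \<e> (fst (?f t)) (fst (?f t))) has_vector_derivative
   mform \<e> (fst (?f t)) ?v + mform \<e> ?v (fst (?f t))) (at t)"
   using bounded_bilinear.has_vector_derivative[OF bounded_bilinear_mform f1 f1] .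
  moreover have "((%t. mform \<e> (fst (?f t)) (fst (?f t))) has_vector_derivative 0) (at t)"
  proof (rule has_vector_derivative_transform_within_open[where f = "%_. \<e>" and S = "{0<..<1}"])
   show "\<e> = mform \<e> (fst (?f s)) (fst (?f s))" if "s \<in> {0<..<1}" for s
    using M2[of s] that by (auto simp: M2_def)
  qed (use t in auto)
  ultimately have "mform \<e> (fst (?f t)) ?v + mform \<e> ?v (fst (?f t)) = 0"
   using vector_derivative_unique_at by blast
  then show ?thesis by (simp add: mform_commute[of \<e> ?v])
 qed
 then show thesis using that K(1) c M2 d by (auto simp: o_def)
qed

text \<open>On the sphere \<open>|p3| \<le> 1\<close>; on the hyperboloid \<open>ln p3\<close>
  changes at a rate not exceeding the speed, so \<open>p3\<close> grows at most by the factor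
  \<open>exp L\<close>. The summand 1 in the auxiliary bound covers the spherical case, and
  \<open>3 = 2 * 1 + 1\<close> then comes from the factor \<open>2 |p3| + 1\<close> of the tangent
  bound.\<close>

lemma path_extrinsic:
 assumes M: "imm S ` topspace (dom S) \<subseteq> M2 \<e> \<times> UNIV" and eps: "\<e> \<in> {-1, 1}"
  and P: "path_length \<e> S \<gamma> L" and s: "s \<in> {0..1}"
 shows "0 \<le> L" "norm (imm S (\<gamma> s) - imm S (\<gamma> 0)) \<le> (2 * \<bar>fst (imm S (\<gamma> 0)) $ 3\<bar> * exp L + 3) * L"
proof -
 let ?f = "imm S \<circ> \<gamma>" and ?v = "speed \<e> (imm S \<circ> \<gamma>)"
 obtain K where K: "finite K" "continuous_on {0..1} ?f"
  "\<And>t. t \<in> {0..1} ==> fst (?f t) \<in> M2 \<e>"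
  "\<And>t. t \<in> {0<..<1} - K ==> (?f has_vector_derivative vector_derivative ?f (at t)) (at t)"
  "\<And>t. t \<in> {0<..<1} - K ==> mform \<e> (fst (?f t)) (fst (vector_derivative ?f (at t))) = 0"
  using path_tangent[OF M eps P] by (auto simp: o_def)
 have L: "(?v has_integral L) {0..1}" using P path_length_speed by blast
 have bnd: "0 \<le> ?v t" "norm (vector_derivative ?f (at t)) \<le> (2 * \<bar>fst (?f t) $ 3\<bar> + 1) * ?v t"
  "\<e> = -1 ==> \<bar>fst (vector_derivative ?f (at t)) $ 3\<bar> \<le> fst (?f t) $ 3 * ?v t"
  if "t \<in> {0<..<1} - K" for t
  using tangent_norm_bound[OF eps K(3) K(5), of t] that by (auto simp: speed_def)
 have c3: "continuous_on {0..1} (%t. fst (?f t) $ 3)"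
  by (intro continuous_intros K(2))
 show L0: "0 \<le> L"
  using dominated_increment[of K "%_. 0::real" "%_. 0" 1 ?v L 1] K(1) bnd(1) L by auto
 have p3: "\<bar>fst (?f t) $ 3\<bar> \<le> \<bar>fst (?f 0) $ 3\<bar> * exp L + 1" if t: "t \<in> {0..1}" for t
 proof (cases "\<e> = 1")
  case True
  then have "(fst (?f t) $ 3)^2 \<le> 1"
   using K(3)[OF t] by (simp add: M2_def mform_def power2_eq_square)
    (smt (verit) zero_le_square)
  then have "\<bar>fst (?f t) $ 3\<bar> \<le> 1" using abs_square_le_1 by blast
  then show ?thesis by (smt (verit) mult_nonneg_nonneg exp_ge_zero)
 next
  case False
  then have e: "\<e> = -1" using eps by auto
  have pos: "fst (?f t) $ 3 > 0" if "t \<in> {0..1}" for t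
   using K(3)[OF that] e by (simp add: M2_def)
  let ?g = "%t. ln (fst (?f t) $ 3)"
  have "norm (?g t - ?g 0) \<le> 1 * L"
  proof (rule dominated_increment[where g' = "%t. fst (vector_derivative ?f (at t)) $ 3 / fst (?f t) $ 3" and v = ?v and K = K])
   show "continuous_on {0..1} ?g" using pos by (intro continuous_on_ln c3) force
   fix s assume s: "s \<in> {0<..<1} - K"
   have "((%t. fst (?f t) $ 3) has_vector_derivative fst (vector_derivative ?f (at s)) $ 3) (at s)"
    using bounded_linear.has_vector_derivative[OF bounded_linear_compose[OF bounded_linear_vec_nth bounded_linear_fst] K(4)[OF s], of 3]
    by (simp add: o_def)
   then have "((%t. fst (?f t) $ 3) has_real_derivative fst (vector_derivative ?f (at s)) $ 3) (at s)"
    by (simp add: has_real_derivative_iff_has_vector_derivative)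
   then show "(?g has_vector_derivative fst (vector_derivative ?f (at s)) $ 3 / fst (?f s) $ 3) (at s)"
    using pos[of s] s unfolding has_real_derivative_iff_has_vector_derivative[symmetric]
    by (auto intro!: derivative_eq_intros)
   show "norm (fst (vector_derivative ?f (at s)) $ 3 / fst (?f s) $ 3) \<le> 1 * ?v s"
    using bnd(3)[OF s e] pos[of s] s by (simp add: divide_le_eq mult.commute)
   show "0 \<le> ?v s" using bnd(1)[OF s] .
  qed (use K(1) L t in auto)
  then have "ln (fst (?f t) $ 3) \<le> ln (fst (?f 0) $ 3) + L" by simp
  then have "fst (?f t) $ 3 \<le> exp (ln (fst (?f 0) $ 3) + L)"
   using pos[OF t] ln_ge_iff ln_le_cancel_iff by (metis exp_gt_zero ln_exp)
  then show ?thesis using pos[OF t] pos[of 0] by (simp add: exp_add)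
 qed
 have "norm (?f s - ?f 0) \<le> (2 * \<bar>fst (?f 0) $ 3\<bar> * exp L + 3) * L"
 proof (rule dominated_increment[where g' = "%t. vector_derivative ?f (at t)" and v = ?v and K = K])
  fix t assume t: "t \<in> {0<..<1} - K"
  have "(2 * \<bar>fst (?f t) $ 3\<bar> + 1) * ?v t \<le> (2 * \<bar>fst (?f 0) $ 3\<bar> * exp L + 3) * ?v t"
   using p3[of t] t bnd(1)[OF t] by (intro mult_right_mono) auto
  then show "norm (vector_derivative ?f (at t)) \<le> (2 * \<bar>fst (?f 0) $ 3\<bar> * exp L + 3) * ?v t"
   using bnd(2)[OF t] by simp
  show "(?f has_vector_derivative vector_derivative ?f (at t)) (at t)" using K(4)[OF t] .
  show "0 \<le> ?v t" using bnd(1)[OF t] .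
 qed (use K(1,2) L s in simp_all)
 then show "norm (imm S (\<gamma> s) - imm S (\<gamma> 0)) \<le> (2 * \<bar>fst (imm S (\<gamma> 0)) $ 3\<bar> * exp L + 3) * L"
  by simp
qed

section \<open>Reparametrization, reversal and concatenation of paths\<close>

lemma speed_reparam:
 assumes f: "(f has_vector_derivative w) (at (m * t + c))"
  and U: "open U" "t \<in> U" "\<And>s. s \<in> U ==> g s = f (m * s + c)"
 shows "speed \<e> g t = \<bar>m\<bar> * speed \<e> f (m * t + c)"
proof -
 have "((%s. m * s + c) has_vector_derivative m) (at t)"
  by (auto intro!: derivative_eq_intros)
 from vector_diff_chain_at[OF this f] have "((%s. f (m * s + c)) has_vector_derivative m *\<^sub>R w) (at t)"
  by (simp add: o_def)
 then have "(g has_vector_derivative m *\<^sub>R w) (at t)"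
  using has_vector_derivative_transform_within_open[OF _ U(1,2), of "%s. f (m * s + c)" _ g] U(3) by simp
 then have "speed \<e> g t = sqrt (m^2 * pform \<e> w w)"
  by (simp add: speed_def vector_derivative_at power2_eq_square mult.assoc)
 also have "\<dots> = \<bar>m\<bar> * sqrt (pform \<e> w w)" by (simp add: real_sqrt_mult)
 finally show ?thesis using f by (simp add: speed_def vector_derivative_at)
qed

text \<open>The lengths whose infimum is the distance; symmetry, concatenation and transport become
  statements about a relation, free of infima.\<close>

definition joined :: "real => 'a surface => 'a => 'a => real => bool" where
 "joined \<e> S x y L \<longleftrightarrow> (\<exists>\<gamma>. \<gamma> 0 = x & \<gamma> 1 = y & path_length \<e> S \<gamma> L)"

lemma joined_topspace: "joined \<e> S x y L ==> x \<in> topspace (dom S) & y \<in> topspace (dom S)"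
 unfolding joined_def path_length_def by (auto dest: path_start_in_topspace path_finish_in_topspace)

lemma joined_refl:
 assumes "x \<in> topspace (dom S)"
 shows "joined \<e> S x x 0"
 unfolding joined_def path_length_speed
 using assms has_integral_0[of "{0..1::real}"]
 by (intro exI[of _ "%_. x"])
  (simp add: o_def speed_def[abs_def] C1_differentiable_imp_piecewise)

lemma joined_sym:
 assumes "joined \<e> S x y L"
 shows "joined \<e> S y x L"
proof -
 obtain \<gamma> where \<gamma>: "\<gamma> 0 = x" "\<gamma> 1 = y" and P: "pathin (dom S) \<gamma>"
  "(imm S \<circ> \<gamma>) piecewise_C1_differentiable_on {0..1}" "(speed \<e> (imm S \<circ> \<gamma>) has_integral L) {0..1}"
  using assms unfolding joined_def path_length_speed by blast
 let ?f = "imm S \<circ> \<gamma>" and ?r = "%t::real. \<gamma> (1 - t)"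
 have vp: "valid_path ?f" using P(2) by (simp add: valid_path_def)
 have rev: "imm S \<circ> ?r = reversepath ?f" by (auto simp: reversepath_def)
 obtain K where K: "finite K" "?f C1_differentiable_on {0..1} - K"
  using P(2) unfolding piecewise_C1_differentiable_on_def by blast
 have "pathin (dom S) ?r"
  using P(1) unfolding pathin_def
  by (rule continuous_map_compose[of _ "top_of_set {0..1}" "%t::real. 1 - t", unfolded o_def, rotated])
    (auto intro!: continuous_intros)
 moreover have "(imm S \<circ> ?r) piecewise_C1_differentiable_on {0..1}"
  using valid_path_imp_reverse[OF vp] by (simp add: rev valid_path_def)
 moreover have "(speed \<e> (imm S \<circ> ?r) has_integral L) {0..1}"
 proof -
  have "((%t. speed \<e> ?f (- 1 * t + 1)) has_integral L) {0..1}"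
   using has_integral_affinity[of "speed \<e> ?f" L 0 1 "-1" 1] P(3) by (simp add: image_affinity_atLeastAtMost_diff)
  moreover have "speed \<e> (imm S \<circ> ?r) t = speed \<e> ?f (- 1 * t + 1)" if "t \<in> {0..1} - (%t. 1 - t) ` K" for t
  proof -
   have "1 - t \<in> {0..1} - K" using that by (auto simp: image_iff)
   then have d: "(?f has_vector_derivative vector_derivative ?f (at (- 1 * t + 1))) (at (- 1 * t + 1))"
    using K(2) by (auto simp: C1_differentiable_on_eq vector_derivative_works[symmetric])
   show ?thesis
    using speed_reparam[OF d, of UNIV "imm S \<circ> ?r" \<e>] by simp
  qed
  ultimately show ?thesis
   using K(1) by (rule_tac has_integral_spike_finite[of "(%t. 1 - t) ` K"]) simp_all
 qed
 ultimately show ?thesis using \<gamma> unfolding joined_def path_length_speed by (intro exI[of _ ?r]) simp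
qed

lemma pathin_join:
 assumes "pathin X g" "pathin X h" "g 1 = h 0"
 shows "pathin X (%t. if t \<le> 1/2 then g (2 * t) else h (2 * t - 1))"
proof -
 have "continuous_map (top_of_set {0..1}) X (%x. if x \<le> 1/2 then (g \<circ> (%x. 2 * x)) x else (h \<circ> (%x. 2 * x - 1)) x)"
 proof (rule continuous_map_cases_le)
  show "continuous_map (subtopology (top_of_set {0..1}) {x \<in> topspace (top_of_set {0..1}). x \<le> 1/2}) X (g \<circ> (%x::real. 2 * x))"
   using assms(1) unfolding pathin_def
   by (rule continuous_map_compose[rotated])
     (auto simp: subtopology_subtopology continuous_map_in_subtopology intro!: continuous_intros)
  show "continuous_map (subtopology (top_of_set {0..1}) {x \<in> topspace (top_of_set {0..1}). 1/2 \<le> x}) X (h \<circ> (%x::real. 2 * x - 1))"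
   using assms(2) unfolding pathin_def
   by (rule continuous_map_compose[rotated])
     (auto simp: subtopology_subtopology continuous_map_in_subtopology intro!: continuous_intros)
  show "(g \<circ> (%x. 2 * x)) x = (h \<circ> (%x. 2 * x - 1)) x" if "x = 1/2" for x
   unfolding that using assms(3) by simp
 qed auto
 then show ?thesis unfolding pathin_def o_def .
qed

text \<open>On each half the path runs at double speed for half the time. The junction and the
  rescaled break points form a finite set that the integrals ignore.\<close>

lemma joined_trans:
 assumes "joined \<e> S x y L" "joined \<e> S y z M"
 shows "joined \<e> S x z (L + M)"
proof -
 obtain g where g: "g 0 = x" "g 1 = y" and P: "pathin (dom S) g"
  "(imm S \<circ> g) piecewise_C1_differentiable_on {0..1}" "(speed \<e> (imm S \<circ> g) has_integral L) {0..1}"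
  using assms unfolding joined_def path_length_speed by blast
 obtain h where h: "h 0 = y" "h 1 = z" and Q: "pathin (dom S) h"
  "(imm S \<circ> h) piecewise_C1_differentiable_on {0..1}" "(speed \<e> (imm S \<circ> h) has_integral M) {0..1}"
  using assms unfolding joined_def path_length_speed by blast
 let ?f = "imm S \<circ> g" and ?h = "imm S \<circ> h" and ?j = "imm S \<circ> (%t. if t \<le> 1/2 then g (2 * t) else h (2 * t - 1))"
 have j: "?j = ?f +++ ?h" by (auto simp: joinpaths_def)
 obtain K where K: "finite K" "?f C1_differentiable_on {0..1} - K"
  using P(2) unfolding piecewise_C1_differentiable_on_def by blast
 obtain K' where K': "finite K'" "?h C1_differentiable_on {0..1} - K'"
  using Q(2) unfolding piecewise_C1_differentiable_on_def by blast
 have 1: "(speed \<e> ?j has_integral L) {0..1/2}"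
 proof -
  have "((%t. speed \<e> ?f (2 * t + 0)) has_integral L / 2) {0..1/2}"
   using has_integral_affinity[of "speed \<e> ?f" L 0 1 2 0] P(3) by (simp add: image_mult_atLeastAtMost)
  from has_integral_mult_right[OF this, of 2]
  have "((%t. \<bar>2\<bar> * speed \<e> ?f (2 * t + 0)) has_integral L) {0..1/2}" by simp
  moreover have "speed \<e> ?j t = \<bar>2\<bar> * speed \<e> ?f (2 * t + 0)" if "t \<in> {0..1/2} - ((%t. t / 2) ` K \<union> {1/2})" for t
  proof -
   have "2 * t + 0 \<in> {0..1} - K" using that by (auto simp: image_iff mult.commute[of 2])
   then have d: "(?f has_vector_derivative vector_derivative ?f (at (2 * t + 0))) (at (2 * t + 0))"
    using K(2) by (auto simp: C1_differentiable_on_eq vector_derivative_works[symmetric])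
   show ?thesis
    by (rule speed_reparam[OF d, of "{..<1/2}"]) (use that in \<open>auto simp: joinpaths_def\<close>)
  qed
  ultimately show ?thesis
   using K(1) by (rule_tac has_integral_spike_finite[of "(%t. t / 2) ` K \<union> {1/2}"]) simp_all
 qed
 have 2: "(speed \<e> ?j has_integral M) {1/2..1}"
 proof -
  have img: "(%x. x / 2 + 1 / 2) ` {0..1} = {1/2..1::real}"
  proof
   show "{1/2..1} \<subseteq> (%x. x / 2 + 1 / 2) ` {0..1::real}"
   proof
    fix x :: real assume "x \<in> {1/2..1}"
    then show "x \<in> (%x. x / 2 + 1 / 2) ` {0..1}"
     by (intro image_eqI[of _ _ "2 * x - 1"]) (auto simp: field_simps)
   qed
  qed auto
  have "((%t. speed \<e> ?h (2 * t + -1)) has_integral M / 2) {1/2..1}"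
   using has_integral_affinity[of "speed \<e> ?h" M 0 1 2 "-1"] Q(3)
   by (simp add: img)
  from has_integral_mult_right[OF this, of 2]
  have "((%t. \<bar>2\<bar> * speed \<e> ?h (2 * t + -1)) has_integral M) {1/2..1}" by simp
  moreover have "speed \<e> ?j t = \<bar>2\<bar> * speed \<e> ?h (2 * t + -1)" if "t \<in> {1/2..1} - ((%t. (t + 1) / 2) ` K' \<union> {1/2})" for t
  proof -
   have "2 * t + -1 \<in> {0..1} - K'" using that by (auto simp: image_iff)
   then have d: "(?h has_vector_derivative vector_derivative ?h (at (2 * t + -1))) (at (2 * t + -1))"
    using K'(2) by (auto simp: C1_differentiable_on_eq vector_derivative_works[symmetric])
   show ?thesis
    by (rule speed_reparam[OF d, of "{1/2<..}"]) (use that in \<open>auto simp: joinpaths_def\<close>)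
  qed
  ultimately show ?thesis
   using K'(1) by (rule_tac has_integral_spike_finite[of "(%t. (t + 1) / 2) ` K' \<union> {1/2}"]) simp_all
 qed
 have "(speed \<e> ?j has_integral L + M) {0..1}"
  using has_integral_combine[OF _ _ 1 2] by simp
 moreover have "?j piecewise_C1_differentiable_on {0..1}"
  using valid_path_join[of ?f ?h] P(2) Q(2) g h unfolding j by (simp add: valid_path_def pathfinish_def pathstart_def)
 moreover have "pathin (dom S) (%t. if t \<le> 1/2 then g (2 * t) else h (2 * t - 1))" by (rule pathin_join[OF P(1) Q(1)]) (simp add: g h)
 ultimately show ?thesis unfolding joined_def path_length_speed using g h by (intro exI[of _ "%t. if t \<le> 1/2 then g (2 * t) else h (2 * t - 1)"]) simp
qed

section \<open>Paths inside charts and between arbitrary points\<close>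

lemma pform_le_norm: "\<e> \<in> {-1, 1} ==> pform \<e> w w \<le> norm w ^ 2"
 by (auto simp: norm_prod_def norm_vec_def L2_set_def sum_3 pform_def mform_def power2_eq_square)

lemma chart_facts:
 assumes S: "immersed_surface \<e> S" and c: "(V, \<phi>) \<in> atlas S"
 shows "open V" "openin (dom S) (\<phi> ` V)" "continuous_map (top_of_set V) (dom S) \<phi>" "inj_on \<phi> V"
  "\<And>B. open B ==> B \<subseteq> V ==> openin (dom S) (\<phi> ` B)" "smooth_on (imm S \<circ> \<phi>) V"
  "\<And>u. u \<in> V ==> inj (frechet_derivative (imm S \<circ> \<phi>) (at u))"
  "homeomorphic_map (top_of_set V) (subtopology (dom S) (\<phi> ` V)) \<phi>"
proof -
 show V: "open V" and o: "openin (dom S) (\<phi> ` V)"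
  and h: "homeomorphic_map (top_of_set V) (subtopology (dom S) (\<phi> ` V)) \<phi>"
  and "smooth_on (imm S \<circ> \<phi>) V" "\<And>u. u \<in> V ==> inj (frechet_derivative (imm S \<circ> \<phi>) (at u))"
  using S c by (auto simp: immersed_surface_def smooth_2_manifold_def)
 show "continuous_map (top_of_set V) (dom S) \<phi>"
  using homeomorphic_imp_continuous_map[OF h] continuous_map_in_subtopology by blast
 show "inj_on \<phi> V" using homeomorphic_imp_injective_map[OF h] by simp
 show "openin (dom S) (\<phi> ` B)" if "open B" "B \<subseteq> V" for B
 proof -
  have "openin (top_of_set V) B" using that by (simp add: open_subset)
  then have "openin (subtopology (dom S) (\<phi> ` V)) (\<phi> ` B)"
   using homeomorphic_imp_open_map[OF h] by (simp add: open_map_def)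
  then show ?thesis using o openin_open_subtopology by blast
 qed
qed

lemma chart_cover:
 assumes "immersed_surface \<e> S" "x \<in> topspace (dom S)"
 obtains V \<phi> u where "(V, \<phi>) \<in> atlas S" "u \<in> V" "\<phi> u = x"
proof -
 have "topspace (dom S) = (\<Union>(V, \<phi>)\<in>atlas S. \<phi> ` V)"
  using assms(1) unfolding immersed_surface_def smooth_2_manifold_def by simp
 then show thesis using assms(2) that by auto
qed

text \<open>Images of straight segments: the partial derivatives of the immersion are bounded on a
  compact ball, so the length is at most a multiple of the distance in the parameter plane.\<close>

lemma chart_joined:
 fixes u :: "real^2"
 assumes S: "immersed_surface \<e> S" and eps: "\<e> \<in> {-1, 1}" and c: "(V, \<phi>) \<in> atlas S" and u: "u \<in> V"
 obtains r M where "r > 0" "M \<ge> 0" "ball u r \<subseteq> V"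
  "\<And>v. v \<in> ball u r ==> \<exists>L. joined \<e> S (\<phi> u) (\<phi> v) L & L \<le> M * dist u v"
proof -
 note ch = chart_facts[OF S c]
 let ?G = "imm S \<circ> \<phi>"
 obtain r where r: "r > 0" "cball u r \<subseteq> V" using ch(1) u open_contains_cball by blast
 have diff: "?G differentiable (at z)" if "z \<in> V" for z
  using smooth_on_differentiable[OF ch(6) that] .
 have cX: "continuous_on V (dx ?G)" "continuous_on V (dy ?G)"
  using smooth_on_continuous[OF smooth_on_frechet[OF ch(6)]] by auto
 have "compact (dx ?G ` cball u r)" "compact (dy ?G ` cball u r)"
  using cX r by (auto intro!: compact_continuous_image elim: continuous_on_subset)
 then obtain B C where B: "\<forall>z\<in>cball u r. norm (dx ?G z) \<le> B"
  and C: "\<forall>z\<in>cball u r. norm (dy ?G z) \<le> C"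
  by (auto dest!: compact_imp_bounded simp: bounded_iff)
 have nB: "norm (frechet_derivative ?G (at z) w) \<le> (\<bar>B\<bar> + \<bar>C\<bar>) * norm w" if z: "z \<in> cball u r" for z w
 proof -
  have "norm (frechet_derivative ?G (at z) w) \<le> \<bar>w$1\<bar> * norm (dx ?G z) + \<bar>w$2\<bar> * norm (dy ?G z)"
   unfolding frechet_partials[OF diff, OF subsetD[OF r(2) z], of w]
   by (rule norm_triangle_le) simp
  also have "\<dots> \<le> norm w * \<bar>B\<bar> + norm w * \<bar>C\<bar>"
   using bspec[OF B z] bspec[OF C z] component_le_norm_cart[of w]
   by (intro add_mono mult_mono) auto
  finally show ?thesis by (simp add: algebra_simps)
 qed
 have "\<exists>L. joined \<e> S (\<phi> u) (\<phi> v) L & L \<le> (\<bar>B\<bar> + \<bar>C\<bar>) * dist u v" if v: "v \<in> ball u r" for v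
 proof -
  define l where "l t = u + t *\<^sub>R (v - u)" for t :: real
  have l: "l t \<in> cball u r" if "t \<in> {0..1}" for t
  proof -
   have "dist u (l t) = t * norm (v - u)" using that by (simp add: l_def dist_norm)
   also have "\<dots> \<le> norm (v - u)" using that by (simp add: mult_left_le_one_le)
   finally show ?thesis using v by (simp add: dist_norm norm_minus_commute)
  qed
  have lV: "l t \<in> V" if "t \<in> {0..1}" for t using l[OF that] r by auto
  have cl: "continuous_on T l" for T unfolding l_def by (intro continuous_intros)
  have dl: "(l has_vector_derivative (v - u)) (at t)" for t
   unfolding l_def by (auto intro!: derivative_eq_intros)
  let ?f = "imm S \<circ> (%t. \<phi> (l t))" and ?f' = "%t. frechet_derivative ?G (at (l t)) (v - u)"
  have df: "(?f has_vector_derivative ?f' t) (at t)" if "t \<in> {0..1}" for t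
  proof -
   have "(?G has_derivative frechet_derivative ?G (at (l t))) (at (l t) within l ` UNIV)"
    using diff[OF lV[OF that]] frechet_derivative_works has_derivative_at_withinI by blast
   from vector_derivative_diff_chain_within[OF dl this] show ?thesis by (simp add: o_def)
  qed
  have cf': "continuous_on {0..1} ?f'"
   by (intro continuous_on_compose2[OF smooth_on_continuous[OF smooth_on_frechet[OF ch(6)]] cl])
    (use lV in auto)
  have C1: "?f piecewise_C1_differentiable_on {0..1}"
   using df cf' by (intro C1_differentiable_imp_piecewise) (auto simp: C1_differentiable_on_def intro!: exI[of _ ?f'])
  have sp: "speed \<e> ?f t = sqrt (pform \<e> (?f' t) (?f' t))" if "t \<in> {0..1}" for t
   using vector_derivative_at[OF df[OF that]] by (simp add: speed_def)
  have "continuous_on {0..1} (%t. sqrt (pform \<e> (?f' t) (?f' t)))"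
   by (intro continuous_on_real_sqrt bounded_bilinear.continuous_on[OF bounded_bilinear_pform] cf')
  then have "continuous_on {0..1} (speed \<e> ?f)"
   using continuous_on_cong[of "{0..1}" "{0..1}" "speed \<e> ?f", OF refl sp] by metis
  then have int: "speed \<e> ?f integrable_on {0..1}" by (rule integrable_continuous_real)
  define L where "L = integral {0..1} (speed \<e> ?f)"
  have "L \<le> integral {0..1::real} (%_. (\<bar>B\<bar> + \<bar>C\<bar>) * dist u v)"
   unfolding L_def
  proof (intro integral_le int)
   fix t :: real assume t: "t \<in> {0..1}"
   have "speed \<e> ?f t \<le> sqrt (norm (?f' t) ^ 2)"
    unfolding sp[OF t] by (intro real_sqrt_le_mono pform_le_norm eps)
   also have "\<dots> \<le> (\<bar>B\<bar> + \<bar>C\<bar>) * dist u v"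
    using nB[OF l[OF t], of "v - u"] by (simp add: dist_norm norm_minus_commute)
   finally show "speed \<e> ?f t \<le> (\<bar>B\<bar> + \<bar>C\<bar>) * dist u v" .
  qed auto
  moreover have "joined \<e> S (\<phi> u) (\<phi> v) L"
   unfolding joined_def path_length_speed
  proof (intro exI[of _ "%t. \<phi> (l t)"] conjI)
   show "pathin (dom S) (%t. \<phi> (l t))"
    unfolding pathin_def
    by (rule continuous_map_compose[OF _ ch(3), of _ l, unfolded o_def]) (use cl lV in auto)
   show "(speed \<e> ?f has_integral L) {0..1}"
    using int by (simp add: L_def integrable_integral)
  qed (use C1 in \<open>auto simp: l_def\<close>)
  ultimately show ?thesis by (intro exI[of _ L]) simp
 qed
 then show thesis using that[of r "\<bar>B\<bar> + \<bar>C\<bar>"] r ball_subset_cball[of u r] by (meson abs_ge_zero add_nonneg_nonneg subset_trans)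
qed

text \<open>The points reachable from \<open>x\<close> form a set that is open and closed, because
  every point reaches a whole neighbourhood of itself.\<close>

lemma surface_joined:
 assumes S: "immersed_surface \<e> S" and eps: "\<e> \<in> {-1, 1}"
  and xy: "x \<in> topspace (dom S)" "y \<in> topspace (dom S)"
 shows "\<exists>L. joined \<e> S x y L"
proof -
 have nb: "\<exists>T. openin (dom S) T & y \<in> T & (\<forall>z\<in>T. \<exists>L. joined \<e> S y z L)" if yt: "y \<in> topspace (dom S)" for y
 proof -
  obtain V \<phi> u where c: "(V, \<phi>) \<in> atlas S" "u \<in> V" "\<phi> u = y" using chart_cover[OF S yt] by metis
  obtain r M where r: "r > 0" "ball u r \<subseteq> V"
   "\<And>v. v \<in> ball u r ==> \<exists>L. joined \<e> S (\<phi> u) (\<phi> v) L & L \<le> M * dist u v"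
   using chart_joined[OF S eps c(1,2)] by metis
  show ?thesis
   using chart_facts(5)[OF S c(1), of "ball u r"] r c(3) by (intro exI[of _ "\<phi> ` ball u r"]) fastforce
 qed
 define U where "U = {y \<in> topspace (dom S). \<exists>L. joined \<e> S x y L}"
 have "openin (dom S) U"
 proof (subst openin_subopen, rule ballI)
  fix y assume y: "y \<in> U"
  then obtain T where T: "openin (dom S) T" "y \<in> T" "\<forall>z\<in>T. \<exists>L. joined \<e> S y z L"
   using nb[of y] by (auto simp: U_def)
  moreover have "T \<subseteq> U"
  proof
   fix z assume "z \<in> T"
   then show "z \<in> U" using y T(3) joined_trans openin_subset[OF T(1)] by (fastforce simp: U_def)
  qed
  ultimately show "\<exists>T. openin (dom S) T & y \<in> T & T \<subseteq> U" by blast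
 qed
 moreover have "openin (dom S) (topspace (dom S) - U)"
 proof (subst openin_subopen, rule ballI)
  fix y assume y: "y \<in> topspace (dom S) - U"
  then obtain T where T: "openin (dom S) T" "y \<in> T" "\<forall>z\<in>T. \<exists>L. joined \<e> S y z L"
   using nb[of y] by auto
  moreover have "T \<subseteq> topspace (dom S) - U"
  proof
   fix z assume "z \<in> T"
   then show "z \<in> topspace (dom S) - U"
    using y T(3) joined_trans[OF _ joined_sym] openin_subset[OF T(1)] by (fastforce simp: U_def)
  qed
  ultimately show "\<exists>T. openin (dom S) T & y \<in> T & T \<subseteq> topspace (dom S) - U" by blast
 qed
 moreover have "connected_space (dom S)" using S by (simp add: immersed_surface_def)
 moreover have "U \<subseteq> topspace (dom S)" by (auto simp: U_def)
 ultimately have "U = {} \<or> U = topspace (dom S)"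
  unfolding connected_space_clopen_in closedin_def by blast
 moreover have "x \<in> U" using joined_refl[OF xy(1)] xy(1) by (auto simp: U_def)
 ultimately show ?thesis using xy(2) by (auto simp: U_def)
qed

section \<open>Completeness from uniformly compact balls\<close>

lemma intrinsic_dist_joined: "intrinsic_dist \<e> S x y = Inf {L. joined \<e> S x y L}"
 by (simp add: intrinsic_dist_def joined_def)

definition seq_compactin :: "'a topology => 'a set => bool" where
 "seq_compactin X K \<longleftrightarrow> (\<forall>\<sigma>. range \<sigma> \<subseteq> K -->
   (\<exists>l r. strict_mono (r::nat=>nat) & limitin X (\<sigma> \<circ> r) l sequentially))"

text \<open>What completeness takes besides the smooth structure: distinct points are not joined by
  arbitrarily short paths, and balls of one fixed radius are relatively sequentially compact. Both
  are stated through \<open>joined\<close>, so they pass through a bijection.\<close>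

definition tame :: "real => 'a surface => bool" where
 "tame \<e> S \<longleftrightarrow> \<e> \<in> {-1, 1} & immersed_surface \<e> S &
  (\<forall>x y. x \<noteq> y --> (\<exists>e>0. \<forall>L. joined \<e> S x y L --> e \<le> L)) &
  (\<exists>\<rho>>0. \<forall>x\<in>topspace (dom S). \<exists>K. (\<forall>y L. joined \<e> S x y L --> L < \<rho> --> y \<in> K) &
    seq_compactin (dom S) K)"

text \<open>A Cauchy sequence ends up in one ball of radius \<open>\<rho>\<close>, has a subsequence
  that converges in the topology, and converges in the distance because nearby points of a chart are
  joined by short segments. The carrier has to be the whole type: \<open>Metric_space\<close>
  demands nonnegativity at all points, whereas off the carrier the distance is the infimum of an
  empty set.\<close>

lemma tame_complete:
 assumes t: "tame \<e> S" and U: "topspace (dom S) = UNIV"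
 shows "complete_surface \<e> S"
proof -
 let ?d = "intrinsic_dist \<e> S"
 have eps: "\<e> \<in> {-1, 1}" and S: "immersed_surface \<e> S"
  and sep: "\<And>x y. x \<noteq> y ==> \<exists>e>0. \<forall>L. joined \<e> S x y L --> e \<le> L"
  using t by (simp_all add: tame_def)
 have M: "imm S ` topspace (dom S) \<subseteq> M2 \<e> \<times> UNIV" using S by (simp add: immersed_surface_def)
 have ex: "\<exists>L. joined \<e> S x y L" for x y using surface_joined[OF S eps, of x y] U by simp
 have ge0: "joined \<e> S x y L ==> 0 \<le> L" for x y L
  using path_extrinsic(1)[OF M eps, of _ L 0] by (auto simp: joined_def)
 have bdd: "bdd_below {L. joined \<e> S x y L}" for x y using ge0 by (auto intro!: bdd_belowI[of _ 0])
 have le: "?d x y \<le> L" if "joined \<e> S x y L" for x y L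
  unfolding intrinsic_dist_joined using that bdd by (auto intro: cInf_lower)
 have lt: "\<exists>L. joined \<e> S x y L & L < e" if "?d x y < e" for x y e
  using that cInf_less_iff[OF _ bdd, of x y e] ex by (auto simp: intrinsic_dist_joined)
 have greatest: "e \<le> ?d x y" if "\<And>L. joined \<e> S x y L ==> e \<le> L" for x y e
  unfolding intrinsic_dist_joined using that ex by (auto intro!: cInf_greatest)
 interpret m: Metric_space UNIV ?d
 proof
  show "0 \<le> ?d x y" for x y by (rule greatest[OF ge0])
  show "?d x y = ?d y x" for x y
  proof -
   have "joined \<e> S x y = joined \<e> S y x" using joined_sym[of \<e> S x y] joined_sym[of \<e> S y x] by (intro ext iffI)
   then show ?thesis by (simp add: intrinsic_dist_joined)
  qed
  show "(?d x y = 0) = (x = y)" for x y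
  proof
   assume d0: "?d x y = 0"
   show "x = y"
   proof (rule ccontr)
    assume "x \<noteq> y"
    then obtain e where "e > 0" "\<And>L. joined \<e> S x y L ==> e \<le> L" using sep by blast
    then show False using greatest[of x y e] d0 by simp
   qed
  next
   assume "x = y"
   moreover have "?d x x \<le> 0" by (rule le[OF joined_refl]) (simp add: U)
   moreover have "0 \<le> ?d x x" by (rule greatest[OF ge0])
   ultimately show "?d x y = 0" by simp
  qed
  show "?d x z \<le> ?d x y + ?d y z" for x y z
  proof (rule field_le_epsilon)
   fix e :: real assume "e > 0"
   then have "?d x y < ?d x y + e/2" "?d y z < ?d y z + e/2" by auto
   from lt[OF this(1)] lt[OF this(2)]
   obtain L M where LM: "joined \<e> S x y L" "L < ?d x y + e/2" "joined \<e> S y z M" "M < ?d y z + e/2"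
    by (elim exE conjE)
   from le[OF joined_trans[OF LM(1,3)]] show "?d x z \<le> ?d x y + ?d y z + e" using LM(2,4) by linarith
  qed
 qed
 have "\<exists>\<rho>>0. \<forall>x\<in>topspace (dom S). \<exists>K. (\<forall>y L. joined \<e> S x y L --> L < \<rho> --> y \<in> K) &
    seq_compactin (dom S) K"
  using t by (simp only: tame_def)
 then obtain \<rho> where \<rho>: "\<rho> > 0" and K: "\<And>x. \<exists>K. (\<forall>y L. joined \<e> S x y L --> L < \<rho> --> y \<in> K) &
    seq_compactin (dom S) K"
  unfolding U by blast
 have near: "\<forall>\<^sub>F n in sequentially. ?d (\<sigma> n) l < e" if l: "limitin (dom S) \<sigma> l sequentially" and e: "e > 0"
  for \<sigma> l e
 proof -
  have "l \<in> topspace (dom S)" using U by simp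
  then obtain V \<phi> u where c: "(V, \<phi>) \<in> atlas S" "u \<in> V" "\<phi> u = l" using chart_cover[OF S] by metis
  obtain r C where r: "r > 0" "C \<ge> 0" "ball u r \<subseteq> V"
   "\<And>v. v \<in> ball u r ==> \<exists>L. joined \<e> S (\<phi> u) (\<phi> v) L & L \<le> C * dist u v"
   using chart_joined[OF S eps c(1,2)] by metis
  \<comment> \<open>\<open>C + 1\<close> instead of \<open>C\<close> avoids a division by 0 and
    makes the estimate strict.\<close>
  define s where "s = min r (e / (C + 1))"
  have s: "s > 0" "s \<le> r" using r e by (auto simp: s_def)
  have "?d y l < e" if y: "y \<in> \<phi> ` ball u s" for y
  proof -
   obtain v where v: "v \<in> ball u s" "y = \<phi> v" using y by auto
   then obtain L where L: "joined \<e> S l y L" "L \<le> C * dist u v" using r(4)[of v] s c(3) by auto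
   have "C * dist u v \<le> C * (e / (C + 1))" using v r by (intro mult_left_mono) (auto simp: s_def)
   also have "\<dots> < e" using r e by (simp add: field_simps)
   finally show ?thesis using le[OF joined_sym[OF L(1)]] L(2) by simp
  qed
  note * = this
  have "openin (dom S) (\<phi> ` ball u s)"
   using chart_facts(5)[OF S c(1), of "ball u s"] r(3) subset_ball[OF s(2), of u] by auto
  moreover have "l \<in> \<phi> ` ball u s" using s c by auto
  ultimately have "\<forall>\<^sub>F n in sequentially. \<sigma> n \<in> \<phi> ` ball u s" using l by (simp add: limitin_def)
  then show ?thesis by (rule eventually_mono) (rule *)
 qed
 show ?thesis unfolding complete_surface_def U m.mcomplete_def
 proof (intro allI impI)
  fix \<sigma> assume C: "m.MCauchy \<sigma>"
  then obtain n where n: "\<And>i j. n \<le> i ==> n \<le> j ==> ?d (\<sigma> i) (\<sigma> j) < \<rho>"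
   using \<rho> unfolding m.MCauchy_def by blast
  from K[of "\<sigma> n"] obtain K where K: "(\<forall>y L. joined \<e> S (\<sigma> n) y L --> L < \<rho> --> y \<in> K) &
    seq_compactin (dom S) K"
   by (rule exE)
  have sub: "range (%i. \<sigma> (i + n)) \<subseteq> K"
  proof
   fix y assume "y \<in> range (%i. \<sigma> (i + n))"
   then have "?d (\<sigma> n) y < \<rho>" using n[of n] by auto
   from lt[OF this] obtain L where "joined \<e> S (\<sigma> n) y L" "L < \<rho>" by (elim exE conjE)
   then show "y \<in> K" using K[THEN conjunct1, rule_format] by simp
  qed
  obtain l r where r: "strict_mono (r::nat=>nat)" "limitin (dom S) ((%i. \<sigma> (i + n)) \<circ> r) l sequentially"
   using K[THEN conjunct2, unfolded seq_compactin_def, rule_format, OF sub] by (elim exE conjE)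
  define q where "q i = r i + n" for i
  have q: "strict_mono q"
   unfolding q_def by (intro strict_monoI add_strict_right_mono strict_monoD[OF r(1)])
  have lim: "limitin (dom S) (\<sigma> \<circ> q) l sequentially"
   using r(2) by (simp add: q_def o_def)
  have "limitin m.mtopology (\<sigma> \<circ> q) l sequentially"
   unfolding m.limitin_metric using near[OF lim] by simp
  from m.MCauchy_convergent_subsequence[OF C q this]
  show "\<exists>x. limitin m.mtopology \<sigma> x sequentially" by blast
 qed
qed

section \<open>Surfaces covered by the plane\<close>

text \<open>Each chart may come from its own immersion of the plane, whereas the normal has to be
  one field on the whole surface; \<open>NN\<close> is that field.\<close>

lemma cmc_surfaceI:
 assumes man: "smooth_2_manifold (dom S) (atlas S)" and con: "connected_space (dom S)" "topspace (dom S) \<noteq> {}"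
  and im: "imm S ` topspace (dom S) \<subseteq> M2 \<e> \<times> UNIV"
  and NN: "continuous_map (dom S) euclidean NN"
  and conf: "\<And>V \<phi>. (V, \<phi>) \<in> atlas S ==> \<exists>F N lam. conformal_immersion \<e> H F N lam &
   (\<forall>u\<in>V. imm S (\<phi> u) = F u & NN (\<phi> u) = N u)"
 shows "cmc_surface \<e> H S"
proof -
 have *: "smooth_on (imm S \<circ> \<phi>) V & smooth_on (NN \<circ> \<phi>) V &
   (\<forall>u\<in>V. inj (frechet_derivative (imm S \<circ> \<phi>) (at u)) & unit_normal \<e> (imm S \<circ> \<phi>) u (NN (\<phi> u)) &
     (\<exists>A. shape_matrix \<e> (imm S \<circ> \<phi>) (NN \<circ> \<phi>) u A & trace A / 2 = H))"
  if c: "(V, \<phi>) \<in> atlas S" for V \<phi>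
 proof -
  from conf[OF c] obtain F N lam where ci: "conformal_immersion \<e> H F N lam"
   and "\<forall>u\<in>V. imm S (\<phi> u) = F u & NN (\<phi> u) = N u" by (elim exE conjE)
  then have eq: "\<And>u. u \<in> V ==> imm S (\<phi> u) = F u" "\<And>u. u \<in> V ==> NN (\<phi> u) = N u" by simp_all
  interpret conformal_immersion \<e> H F N lam by (rule ci)
  have V: "open V"
   using man[unfolded smooth_2_manifold_def, THEN conjunct2, THEN conjunct2, THEN conjunct1] c by blast
  have d: "frechet_derivative (imm S \<circ> \<phi>) (at u) = frechet_derivative F (at u)"
   "frechet_derivative (NN \<circ> \<phi>) (at u) = frechet_derivative N (at u)" if u: "u \<in> V" for u
  proof -
   have "(imm S \<circ> \<phi> has_derivative frechet_derivative F (at u)) (at u)"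
    by (rule has_derivative_transform_within_open[OF _ V u, of F])
     (simp_all add: diff_F eq frechet_derivative_works[symmetric])
   from frechet_derivative_at[OF this]
   show "frechet_derivative (imm S \<circ> \<phi>) (at u) = frechet_derivative F (at u)" by simp
   have "(NN \<circ> \<phi> has_derivative frechet_derivative N (at u)) (at u)"
    by (rule has_derivative_transform_within_open[OF _ V u, of N])
     (simp_all add: diff_N eq frechet_derivative_works[symmetric])
   from frechet_derivative_at[OF this]
   show "frechet_derivative (NN \<circ> \<phi>) (at u) = frechet_derivative N (at u)" by simp
  qed
  have "smooth_on (imm S \<circ> \<phi>) V"
   by (rule smooth_on_cong[OF V _ smooth_on_subset[OF smooth_F]]) (simp_all add: eq)
  moreover have "smooth_on (NN \<circ> \<phi>) V"
   by (rule smooth_on_cong[OF V _ smooth_on_subset[OF smooth_N]]) (simp_all add: eq)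
  moreover have "inj (frechet_derivative (imm S \<circ> \<phi>) (at u)) & unit_normal \<e> (imm S \<circ> \<phi>) u (NN (\<phi> u)) &
     (\<exists>A. shape_matrix \<e> (imm S \<circ> \<phi>) (NN \<circ> \<phi>) u A & trace A / 2 = H)" if u: "u \<in> V" for u
  proof -
   have "unit_normal \<e> (imm S \<circ> \<phi>) u (NN (\<phi> u)) = unit_normal \<e> F u (N u)"
    by (simp add: unit_normal_def d[OF u] eq[OF u])
   moreover have "shape_matrix \<e> (imm S \<circ> \<phi>) (NN \<circ> \<phi>) u A = shape_matrix \<e> F N u A" for A
    by (simp add: shape_matrix_def d[OF u] eq[OF u])
   ultimately show ?thesis using immersion[of u] unit_normal[of u] shape[of u] d(1)[OF u] by simp
  qed
  ultimately show ?thesis by (intro conjI ballI) simp_all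
 qed
 have "immersed_surface \<e> S"
  unfolding immersed_surface_def
 proof (intro conjI)
  show "\<forall>(V, \<phi>)\<in>atlas S. smooth_on (imm S \<circ> \<phi>) V & (\<forall>u\<in>V. inj (frechet_derivative (imm S \<circ> \<phi>) (at u)))"
   using * by fast
 qed (rule man con im)+
 moreover have "\<forall>(V, \<phi>)\<in>atlas S. smooth_on (NN \<circ> \<phi>) V &
      (\<forall>u\<in>V. unit_normal \<e> (imm S \<circ> \<phi>) u (NN (\<phi> u)) &
       (\<exists>A. shape_matrix \<e> (imm S \<circ> \<phi>) (NN \<circ> \<phi>) u A & trace A / 2 = H))"
  using * by fast
 ultimately show ?thesis unfolding cmc_surface_def using NN by (intro conjI exI[of _ NN])
qed

text \<open>Records that every chart is a restriction of a conformal immersion of the plane. This is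
  the form in which the curvature condition is carried along a bijection.\<close>

definition conformal_surface :: "real => real => 'a surface => bool" where
 "conformal_surface \<e> H S \<longleftrightarrow> smooth_2_manifold (dom S) (atlas S) & connected_space (dom S) &
   topspace (dom S) \<noteq> {} & imm S ` topspace (dom S) \<subseteq> M2 \<e> \<times> UNIV &
   (\<exists>NN. continuous_map (dom S) euclidean NN & (\<forall>V \<phi>. (V, \<phi>) \<in> atlas S -->
    (\<exists>F N lam. conformal_immersion \<e> H F N lam & (\<forall>u\<in>V. imm S (\<phi> u) = F u & NN (\<phi> u) = N u))))"

lemma conformal_surface_cmc: "conformal_surface \<e> H S ==> cmc_surface \<e> H S"
 unfolding conformal_surface_def
proof (elim conjE exE)
 fix NN
 assume a: "smooth_2_manifold (dom S) (atlas S)" "connected_space (dom S)" "topspace (dom S) \<noteq> {}"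
  "imm S ` topspace (dom S) \<subseteq> M2 \<e> \<times> UNIV" "continuous_map (dom S) euclidean NN"
  and c: "\<forall>V \<phi>. (V, \<phi>) \<in> atlas S -->
    (\<exists>F N lam. conformal_immersion \<e> H F N lam & (\<forall>u\<in>V. imm S (\<phi> u) = F u & NN (\<phi> u) = N u))"
 show ?thesis by (rule cmc_surfaceI[OF a c[rule_format]])
qed

lemma second_countable_top_of_set: "second_countable_space (top_of_set (D::'b::second_countable_topology set))"
proof -
 from ex_countable_basis obtain B :: "'b set set" where "countable B & topological_basis B" by (rule exE)
 then have B: "countable B" "topological_basis B" by simp_all
 show ?thesis unfolding second_countable_space_def
 proof (intro exI[of _ "(%W. D \<inter> W) ` B"] conjI ballI allI impI)
  show "countable ((%W. D \<inter> W) ` B)" using B by simp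
  show "openin (top_of_set D) U" if UB: "U \<in> (%W. D \<inter> W) ` B" for U
  proof -
   obtain W where "W \<in> B" "U = D \<inter> W" using UB by blast
   then show ?thesis using topological_basis_open[OF B(2)] by (simp add: openin_open_Int)
  qed
  fix U x assume "openin (top_of_set D) U & x \<in> U"
  then obtain O' where O': "open O'" "U = D \<inter> O'" "x \<in> O'" "x \<in> D" by (auto simp: openin_open)
  obtain W where "W \<in> B" "x \<in> W" "W \<subseteq> O'"
   by (elim topological_basisE[OF B(2) O'(1,3)])
  then show "\<exists>W\<in>(%W. D \<inter> W) ` B. x \<in> W & W \<subseteq> U"
   using O' by (intro bexI[of _ "D \<inter> W"] imageI) auto
 qed
qed

text \<open>
 Surfaces parametrized by the plane: the parametrization \<open>p\<close> identifies points that differ by an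
 element of \<open>\<Lambda>\<close>, so that its restrictions to balls of radius \<open>\<delta>\<close> are charts.
\<close>

definition psurf :: "(real^2 => 'b::metric_space) => ('b => ambient) => real => 'b surface" where
 "psurf p I \<delta> = \<lparr>dom = top_of_set (range p), atlas = {(ball u \<delta>, p) | u. True}, imm = I\<rparr>"

text \<open>\<open>\<Lambda>\<close> is the set of periods. Two points of a ball of radius
  \<open>\<delta>\<close> differ by less than \<open>2 * \<delta>\<close>, so \<open>p\<close> is
  injective there. Openness of \<open>p\<close> makes its range, with the subspace topology, the
  quotient of the plane.\<close>

locale plane_covering =
 fixes p :: "real^2 => 'b::{metric_space, second_countable_topology}" and \<Lambda> :: "(real^2) set" and \<delta> :: real
 assumes cont_p: "continuous_on UNIV p"
  and open_p: "\<And>V. open V ==> openin (top_of_set (range p)) (p ` V)"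
  and p_eq: "\<And>u v. p u = p v \<longleftrightarrow> v - u \<in> \<Lambda>"
  and delta: "\<delta> > 0" "\<And>l. l \<in> \<Lambda> ==> norm l < 2 * \<delta> ==> l = 0"
begin

lemma inj_on_ball: "inj_on p (ball u \<delta>)"
proof (rule inj_onI)
 fix v w assume vw: "v \<in> ball u \<delta>" "w \<in> ball u \<delta>" "p v = p w"
 have "norm (w - v) < 2 * \<delta>"
  using dist_triangle_less_add[of w u \<delta> v \<delta>] vw by (simp add: dist_norm norm_minus_commute)
 then show "v = w" using delta(2)[of "w - v"] p_eq vw(3) by simp
qed

lemma continuous_map_descend:
 fixes f :: "real^2 => 'c::topological_space"
 assumes f: "continuous_on UNIV f" and g: "\<And>u. g (p u) = f u"
 shows "continuous_map (top_of_set (range p)) euclidean g"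
 unfolding continuous_map
proof (intro conjI allI impI)
 fix U :: "'c set" assume "openin euclidean U"
 then have "open U" by simp
 from open_vimage[OF this f] have "open (f -` U)" .
 from open_p[OF this] have "openin (top_of_set (range p)) (p ` (f -` U))" .
 moreover have "p ` (f -` U) = {x \<in> topspace (top_of_set (range p)). g x \<in> U}" using g by auto
 ultimately show "openin (top_of_set (range p)) {x \<in> topspace (top_of_set (range p)). g x \<in> U}" by simp
qed auto

lemma chart_homeomorphic: "homeomorphic_map (top_of_set (ball u \<delta>)) (subtopology (top_of_set (range p)) (p ` ball u \<delta>)) p"
proof -
 have s: "subtopology (top_of_set (range p)) (p ` ball u \<delta>) = top_of_set (p ` ball u \<delta>)"
  by (simp add: subtopology_subtopology Int_absorb1 image_mono)
 show ?thesis
  unfolding s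
 proof (rule bijective_open_imp_homeomorphic_map)
  show "continuous_map (top_of_set (ball u \<delta>)) (top_of_set (p ` ball u \<delta>)) p"
   using continuous_on_subset[OF cont_p] by simp
  show "open_map (top_of_set (ball u \<delta>)) (top_of_set (p ` ball u \<delta>)) p"
   unfolding open_map_def
  proof (intro allI impI)
   fix W assume "openin (top_of_set (ball u \<delta>)) W"
   then have W: "open W" "W \<subseteq> ball u \<delta>" using openin_open_eq[of "ball u \<delta>" W] by simp_all
   have "p ` W \<subseteq> p ` ball u \<delta>" "p ` ball u \<delta> \<subseteq> range p" using W by auto
   then show "openin (top_of_set (p ` ball u \<delta>)) (p ` W)"
    by (rule openin_subset_trans[OF open_p[OF W(1)]])
  qed
  show "p ` topspace (top_of_set (ball u \<delta>)) = topspace (top_of_set (p ` ball u \<delta>))"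
   by (simp only: topspace_euclidean_subtopology)
  show "inj_on p (topspace (top_of_set (ball u \<delta>)))"
   by (simp only: topspace_euclidean_subtopology inj_on_ball)
 qed
qed

text \<open>Near \<open>u\<close> the transition is the translation by a period \<open>l\<close>;
  the period may change from point to point, hence the localization.\<close>

lemma transition_smooth:
 "smooth_on (inv_into (ball b \<delta>) p \<circ> p) {u \<in> ball a \<delta>. p u \<in> p ` ball b \<delta>}" (is "smooth_on ?t ?O")
proof (rule smooth_on_local)
 fix u assume u: "u \<in> ?O"
 then obtain w where w: "w \<in> ball b \<delta>" "p u = p w" by auto
 define l where "l = w - u"
 have l: "l \<in> \<Lambda>" using w p_eq by (simp add: l_def)
 define U where "U = ball a \<delta> \<inter> (%v. v + l) -` ball b \<delta>"
 have "open ((%v. v + l) -` ball b \<delta>)" by (intro open_vimage continuous_intros open_ball)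
 then have oU: "open U" by (simp add: U_def open_Int)
 have pv: "p v = p (v + l)" for v using p_eq[of v "v + l"] l by simp
 have t: "v + l = ?t v" if "v \<in> U" for v
  using that inv_into_f_f[OF inj_on_ball, of "v + l" b] pv[of v] by (simp add: U_def)
 have "smooth_on (%v. v + l) U"
  by (intro smooth_on_add[OF oU] smooth_on_linear[OF oU] smooth_on_const[OF oU] bounded_linear_ident)
 from smooth_on_cong[OF oU t this] have 1: "smooth_on ?t U" .
 have 2: "u \<in> U" using u w by (simp add: U_def l_def)
 have 3: "U \<subseteq> ?O"
 proof
  fix v assume "v \<in> U"
  then show "v \<in> ?O" using pv[of v] by (simp add: U_def)
 qed
 from oU 1 2 3 show "\<exists>W. open W & u \<in> W & W \<subseteq> ?O & smooth_on ?t W" by (intro exI[of _ U] conjI)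
qed

lemma manifold: "smooth_2_manifold (top_of_set (range p)) {(ball u \<delta>, p) | u. True}"
 unfolding smooth_2_manifold_def
proof (intro conjI)
 show "Hausdorff_space (top_of_set (range p))"
  by (simp add: Hausdorff_space_subtopology)
 show "second_countable_space (top_of_set (range p))" by (rule second_countable_top_of_set)
 show "\<forall>(V, \<phi>)\<in>{(ball u \<delta>, p) |u. True}. open V & openin (top_of_set (range p)) (\<phi> ` V) &
    homeomorphic_map (top_of_set V) (subtopology (top_of_set (range p)) (\<phi> ` V)) \<phi>"
  using chart_homeomorphic open_p[OF open_ball] by (clarsimp simp: split_def)
 show "(\<Union>(V, \<phi>)\<in>{(ball u \<delta>, p) |u. True}. \<phi> ` V) = topspace (top_of_set (range p))"
 proof -
  have "p u \<in> (\<Union>(V, \<phi>)\<in>{(ball u \<delta>, p) |u. True}. \<phi> ` V)" for u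
   by (rule UN_I[of "(ball u \<delta>, p)"]) (auto simp: delta(1))
  then show ?thesis by auto
 qed
 show "\<forall>(V, \<phi>)\<in>{(ball u \<delta>, p) |u. True}. \<forall>(W, \<psi>)\<in>{(ball u \<delta>, p) |u. True}.
    smooth_on (inv_into W \<psi> \<circ> \<phi>) {u \<in> V. \<phi> u \<in> \<psi> ` W}"
  using transition_smooth by (clarsimp simp: split_def)
qed

lemma psurf_conformal:
 assumes ci: "conformal_immersion \<e> H F N lam" and I: "\<And>u. I (p u) = F u"
  and N: "\<And>u v. p u = p v ==> N u = N v"
 shows "conformal_surface \<e> H (psurf p I \<delta>)"
 unfolding conformal_surface_def
proof (intro conjI)
 interpret conformal_immersion \<e> H F N lam by (rule ci)
 \<comment> \<open>Any preimage will do, because \<open>N\<close> is constant on the fibres of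
   \<open>p\<close>.\<close>
 define NN where "NN z = N (SOME u. p u = z)" for z
 have NN: "NN (p u) = N u" for u
 proof -
  have "p (SOME v. p v = p u) = p u" by (rule someI[of "%v. p v = p u" u]) (rule refl)
  from N[OF this] show ?thesis by (simp add: NN_def)
 qed
 have "continuous_map (dom (psurf p I \<delta>)) euclidean NN"
  using continuous_map_descend[OF cont_N NN] by (simp add: psurf_def)
 moreover have "\<exists>F N lam. conformal_immersion \<e> H F N lam & (\<forall>u\<in>V. imm (psurf p I \<delta>) (\<phi> u) = F u & NN (\<phi> u) = N u)"
  if "(V, \<phi>) \<in> atlas (psurf p I \<delta>)" for V \<phi>
  by (rule exI[of _ F], rule exI[of _ N], rule exI[of _ lam])
   (use that I NN ci in \<open>simp add: psurf_def\<close>)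
 ultimately show "\<exists>NN. continuous_map (dom (psurf p I \<delta>)) euclidean NN & (\<forall>V \<phi>. (V, \<phi>) \<in> atlas (psurf p I \<delta>) -->
    (\<exists>F N lam. conformal_immersion \<e> H F N lam & (\<forall>u\<in>V. imm (psurf p I \<delta>) (\<phi> u) = F u & NN (\<phi> u) = N u)))"
  by (intro exI[of _ NN] conjI allI impI)
 show "connected_space (dom (psurf p I \<delta>))"
  using connected_continuous_image[OF cont_p connected_UNIV]
  by (simp add: psurf_def connected_space_subtopology)
 show "imm (psurf p I \<delta>) ` topspace (dom (psurf p I \<delta>)) \<subseteq> M2 \<e> \<times> UNIV"
 proof -
  have "F u \<in> M2 \<e> \<times> UNIV" for u using in_M2[of u] by (simp add: mem_Times_iff)
  then show ?thesis by (simp add: psurf_def I image_subset_iff)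
 qed
qed (use manifold in \<open>auto simp: psurf_def\<close>)

text \<open>A homeomorphism of the plane that respects the fibres of \<open>p\<close> in both
  directions descends to the surface.\<close>

lemma psurf_invariant:
 assumes f: "continuous_on UNIV f" "continuous_on UNIV f'" "\<And>u. f (f' u) = u" "\<And>u. f' (f u) = u"
  and eq: "\<And>u v. p u = p v \<longleftrightarrow> p (f u) = p (f v)" and g: "\<And>u. g (I (p u)) = I (p (f u))"
 shows "invariant_under (psurf p I \<delta>) g"
proof -
 define lift where "lift h z = p (h (SOME u. p u = z))" for h z
 have some: "p (SOME v. p v = p u) = p u" for u by (rule someI[of "%v. p v = p u" u]) (rule refl)
 have eq': "p u = p v \<longleftrightarrow> p (f' u) = p (f' v)" for u v using eq[of "f' u" "f' v"] f by simp
 have lf: "lift f (p u) = p (f u)" "lift f' (p u) = p (f' u)" for u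
  using some[of u] eq eq' by (auto simp: lift_def)
 have cm: "continuous_map (top_of_set (range p)) (top_of_set (range p)) (lift h)"
  if ch: "continuous_on UNIV h" and lh: "\<And>u. lift h (p u) = p (h u)" for h
 proof -
  have "continuous_on UNIV (%u. p (h u))"
   using continuous_on_compose2[OF cont_p ch] by simp
  from continuous_map_descend[OF this lh] have "continuous_map (top_of_set (range p)) euclidean (lift h)" .
  moreover have "lift h \<in> topspace (top_of_set (range p)) \<rightarrow> range p" using lh by auto
  ultimately show ?thesis by (simp only: continuous_map_in_subtopology)
 qed
 have "homeomorphic_maps (top_of_set (range p)) (top_of_set (range p)) (lift f) (lift f')"
  unfolding homeomorphic_maps_def
 proof (intro conjI ballI)
  show "continuous_map (top_of_set (range p)) (top_of_set (range p)) (lift f)" by (rule cm[OF f(1) lf(1)])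
  show "continuous_map (top_of_set (range p)) (top_of_set (range p)) (lift f')" by (rule cm[OF f(2) lf(2)])
 qed (use lf f in auto)
 then have "homeomorphic_map (top_of_set (range p)) (top_of_set (range p)) (lift f)"
  by (rule homeomorphic_maps_imp_map)
 moreover have "\<forall>x\<in>range p. g (I x) = I (lift f x)" using lf g by auto
 ultimately show ?thesis
  unfolding invariant_under_def by (intro exI[of _ "lift f"]) (simp add: psurf_def)
qed

end

section \<open>Transport of structure\<close>

text \<open>\<open>\<beta>\<close> is a mere bijection and the whole structure of \<open>S\<close>
  is pulled back along it. The purpose is a carrier that is all of a type fixed in advance.\<close>

definition transport :: "('a => 'b) => 'b surface => 'a surface" where
 "transport \<beta> S = \<lparr>dom = pullback_topology UNIV \<beta> (dom S),
   atlas = (%(V, \<phi>). (V, inv_into UNIV \<beta> \<circ> \<phi>)) ` atlas S, imm = imm S \<circ> \<beta>\<rparr>"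

locale surface_transport =
 fixes \<beta> :: "'a => 'b" and S :: "'b surface"
 assumes bij: "bij_betw \<beta> UNIV (topspace (dom S))"
begin

abbreviation "S' \<equiv> transport \<beta> S"
abbreviation "\<beta>' \<equiv> inv_into UNIV \<beta>"

lemma inj_beta: "inj \<beta>" and range_beta: "range \<beta> = topspace (dom S)"
 using bij by (simp_all add: bij_betw_def)

lemma beta_in [simp]: "\<beta> x \<in> topspace (dom S)"
 using range_beta by blast

lemma inv_beta [simp]: "\<beta>' (\<beta> x) = x"
 by (rule inv_into_f_f[OF inj_beta UNIV_I])

lemma beta_inv [simp]: "y \<in> topspace (dom S) ==> \<beta> (\<beta>' y) = y"
 by (rule f_inv_into_f) (simp add: range_beta)

lemma inv_beta_inj: "inj_on \<beta>' (topspace (dom S))"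
 by (rule inj_on_inverseI[of _ \<beta>]) simp

lemma topspace_transport [simp]: "topspace (dom S') = UNIV"
 by (simp add: transport_def topspace_pullback_topology vimage_def)

lemma imm_transport [simp]: "imm S' x = imm S (\<beta> x)"
 by (simp add: transport_def)

lemma homeo: "homeomorphic_maps (dom S') (dom S) \<beta> \<beta>'"
 unfolding homeomorphic_maps_def
proof (intro conjI ballI)
 have "continuous_map (dom S) (dom S) id" by simp
 from continuous_map_pullback[OF this, of UNIV \<beta>]
 show "continuous_map (dom S') (dom S) \<beta>" by (simp add: transport_def)
 show "continuous_map (dom S) (dom S') \<beta>'"
  unfolding transport_def surface.simps
 proof (rule continuous_map_pullback')
  show "continuous_map (dom S) (dom S) (\<beta> \<circ> \<beta>')"
   by (rule continuous_map_eq[of _ _ id]) auto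
 qed auto
qed auto

lemma homeo_beta: "homeomorphic_map (dom S') (dom S) \<beta>"
 and homeo_inv: "homeomorphic_map (dom S) (dom S') \<beta>'"
 using homeo homeomorphic_maps_imp_map homeomorphic_maps_sym by blast+

lemma cont_beta: "continuous_map (dom S') (dom S) \<beta>" and cont_inv: "continuous_map (dom S) (dom S') \<beta>'"
 using homeo by (simp_all add: homeomorphic_maps_def)

lemma atlasE:
 assumes "(V, \<psi>) \<in> atlas S'"
 obtains \<phi> where "(V, \<phi>) \<in> atlas S" "\<psi> = \<beta>' \<circ> \<phi>"
 using assms by (auto simp: transport_def)

lemma second_countable: "second_countable_space (dom S) ==> second_countable_space (dom S')"
 unfolding second_countable_space_def
proof (elim exE conjE)
 fix B assume B: "countable B" "\<forall>U\<in>B. openin (dom S) U"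
  "\<forall>U x. openin (dom S) U & x \<in> U --> (\<exists>W\<in>B. x \<in> W & W \<subseteq> U)"
 show "\<exists>B. countable B & (\<forall>U\<in>B. openin (dom S') U) &
   (\<forall>U x. openin (dom S') U & x \<in> U --> (\<exists>W\<in>B. x \<in> W & W \<subseteq> U))"
 proof (rule exI[of _ "(%U. \<beta> -` U) ` B"], intro conjI allI impI ballI)
  show "countable ((%U. \<beta> -` U) ` B)" using B(1) by simp
  show "openin (dom S') U" if "U \<in> (%U. \<beta> -` U) ` B" for U
   using that B(2) by (auto simp: transport_def openin_pullback_topology)
  fix U x assume "openin (dom S') U & x \<in> U"
  then obtain O' where O': "openin (dom S) O'" "U = \<beta> -` O'" "\<beta> x \<in> O'"
   by (auto simp: transport_def openin_pullback_topology)
  then obtain W where "W \<in> B" "\<beta> x \<in> W" "W \<subseteq> O'" using B(3) by blast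
  then show "\<exists>W\<in>(%U. \<beta> -` U) ` B. x \<in> W & W \<subseteq> U"
   using O' by (intro bexI[of _ "\<beta> -` W"] imageI) auto
 qed
qed

lemma manifold_transport:
 assumes M: "smooth_2_manifold (dom S) (atlas S)"
 shows "smooth_2_manifold (dom S') (atlas S')"
proof -
 have 1: "Hausdorff_space (dom S)" "second_countable_space (dom S)"
  and 2: "\<And>V \<phi>. (V, \<phi>) \<in> atlas S ==> open V & openin (dom S) (\<phi> ` V) &
    homeomorphic_map (top_of_set V) (subtopology (dom S) (\<phi> ` V)) \<phi>"
  and 3: "(\<Union>(V, \<phi>)\<in>atlas S. \<phi> ` V) = topspace (dom S)"
  and 4: "\<And>V \<phi> W \<psi>. (V, \<phi>) \<in> atlas S ==> (W, \<psi>) \<in> atlas S ==>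
    smooth_on (inv_into W \<psi> \<circ> \<phi>) {u \<in> V. \<phi> u \<in> \<psi> ` W}"
  using M unfolding smooth_2_manifold_def by fast+
 have sub: "\<phi> u \<in> topspace (dom S)" if "(V, \<phi>) \<in> atlas S" "u \<in> V" for V \<phi> u
  using 3 that by blast
 show ?thesis unfolding smooth_2_manifold_def
 proof (intro conjI)
  show "Hausdorff_space (dom S')"
   using 1(1) homeomorphic_Hausdorff_space homeo unfolding homeomorphic_space_def by blast
  show "second_countable_space (dom S')" using second_countable 1(2) .
  show "\<forall>(V, \<psi>)\<in>atlas S'. open V & openin (dom S') (\<psi> ` V) &
    homeomorphic_map (top_of_set V) (subtopology (dom S') (\<psi> ` V)) \<psi>"
  proof (intro ballI, unfold split_paired_all split_conv)
   fix V \<psi> assume "(V, \<psi>) \<in> atlas S'"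
   then obtain \<phi> where c: "(V, \<phi>) \<in> atlas S" "\<psi> = \<beta>' \<circ> \<phi>" by (rule atlasE)
   have o: "openin (dom S) (\<phi> ` V)" and h: "homeomorphic_map (top_of_set V) (subtopology (dom S) (\<phi> ` V)) \<phi>"
    using 2[OF c(1)] by simp_all
   have "openin (dom S') (\<beta>' ` \<phi> ` V)"
    using homeomorphic_imp_open_map[OF homeo_inv] o unfolding open_map_def by blast
   moreover have "homeomorphic_map (subtopology (dom S) (\<phi> ` V)) (subtopology (dom S') (\<beta>' ` \<phi> ` V)) \<beta>'"
   proof (rule homeomorphic_map_subtopologies_alt[OF homeo_inv])
    fix x assume x: "x \<in> topspace (dom S)"
    show "(\<beta>' x \<in> \<beta>' ` \<phi> ` V) = (x \<in> \<phi> ` V)"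
     using inj_onD[OF inv_beta_inj _ x sub[OF c(1)]] by auto
   qed
   ultimately show "open V & openin (dom S') (\<psi> ` V) &
    homeomorphic_map (top_of_set V) (subtopology (dom S') (\<psi> ` V)) \<psi>"
    using 2[OF c(1)] homeomorphic_map_compose[OF h] by (simp add: c(2) image_comp)
  qed
  show "(\<Union>(V, \<phi>)\<in>atlas S'. \<phi> ` V) = topspace (dom S')"
  proof -
   have "x \<in> (\<Union>(V, \<phi>)\<in>atlas S'. \<phi> ` V)" for x
   proof -
    obtain V \<phi> u where c: "(V, \<phi>) \<in> atlas S" "u \<in> V" "\<beta> x = \<phi> u" using 3 beta_in[of x] by blast
    have "(V, \<beta>' \<circ> \<phi>) \<in> atlas S'" using c(1) by (force simp: transport_def)
    moreover have "x = (\<beta>' \<circ> \<phi>) u" using c(3) by (simp flip: c(3))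
    ultimately show ?thesis using c(2) by blast
   qed
   then show ?thesis by auto
  qed
  show "\<forall>(V, \<phi>)\<in>atlas S'. \<forall>(W, \<psi>)\<in>atlas S'. smooth_on (inv_into W \<psi> \<circ> \<phi>) {u \<in> V. \<phi> u \<in> \<psi> ` W}"
  proof (intro ballI, unfold split_paired_all split_conv, intro ballI, unfold split_paired_all split_conv)
   fix V \<phi>' W \<psi>' assume "(V, \<phi>') \<in> atlas S'" "(W, \<psi>') \<in> atlas S'"
   then obtain \<phi> \<psi> where c: "(V, \<phi>) \<in> atlas S" "\<phi>' = \<beta>' \<circ> \<phi>" and d: "(W, \<psi>) \<in> atlas S" "\<psi>' = \<beta>' \<circ> \<psi>"
    using atlasE by metis
   have inj: "inj_on \<psi> W" using homeomorphic_imp_injective_map[of "top_of_set W" _ \<psi>] 2[OF d(1)] by auto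
   have inj': "inj_on \<psi>' W" unfolding d(2)
    by (rule comp_inj_on[OF inj inj_on_subset[OF inv_beta_inj]]) (use sub[OF d(1)] in auto)
   have mem: "\<phi>' u \<in> \<psi>' ` W \<longleftrightarrow> \<phi> u \<in> \<psi> ` W" if "u \<in> V" for u
    using inj_onD[OF inv_beta_inj _ sub[OF c(1) that] sub[OF d(1)]] by (auto simp: c d)
   have eq: "{u \<in> V. \<phi>' u \<in> \<psi>' ` W} = {u \<in> V. \<phi> u \<in> \<psi> ` W}" using mem by auto
   have sm: "smooth_on (inv_into W \<psi> \<circ> \<phi>) {u \<in> V. \<phi> u \<in> \<psi> ` W}" by (rule 4[OF c(1) d(1)])
   have op: "open {u \<in> V. \<phi> u \<in> \<psi> ` W}"
   proof -
    have "continuous_map (top_of_set V) (dom S) \<phi>"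
     using 2[OF c(1)] homeomorphic_imp_continuous_map continuous_map_in_subtopology by blast
    moreover have "openin (dom S) (\<psi> ` W)" using 2[OF d(1)] by simp
    ultimately have "openin (top_of_set V) {u \<in> topspace (top_of_set V). \<phi> u \<in> \<psi> ` W}"
     by (rule openin_continuous_map_preimage)
    then show ?thesis using 2[OF c(1)] openin_open_trans[of V] by simp
   qed
   show "smooth_on (inv_into W \<psi>' \<circ> \<phi>') {u \<in> V. \<phi>' u \<in> \<psi>' ` W}" unfolding eq
   proof (rule smooth_on_cong[OF op _ sm])
    fix u assume u: "u \<in> {u \<in> V. \<phi> u \<in> \<psi> ` W}"
    then obtain w where w: "w \<in> W" "\<phi> u = \<psi> w" by auto
    have "inv_into W \<psi> (\<phi> u) = w" using w inv_into_f_f[OF inj w(1)] by simp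
    moreover have "inv_into W \<psi>' (\<phi>' u) = w"
    proof -
     have "\<phi>' u = \<psi>' w" using w by (simp add: c d)
     then show ?thesis using inv_into_f_f[OF inj' w(1)] by simp
    qed
    ultimately show "(inv_into W \<psi> \<circ> \<phi>) u = (inv_into W \<psi>' \<circ> \<phi>') u" by simp
   qed
  qed
 qed
qed

lemma imm_chart:
 assumes "(V, \<phi>) \<in> atlas S" "smooth_2_manifold (dom S) (atlas S)" "u \<in> V"
 shows "\<beta> ((\<beta>' \<circ> \<phi>) u) = \<phi> u"
proof -
 have "(\<Union>(V, \<phi>)\<in>atlas S. \<phi> ` V) = topspace (dom S)"
  using assms(2) unfolding smooth_2_manifold_def by simp
 then have "\<phi> u \<in> topspace (dom S)" using assms by blast
 then show ?thesis by simp
qed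

lemma cmc_transport:
 assumes "smooth_2_manifold (dom S) (atlas S)" "connected_space (dom S)" "topspace (dom S) \<noteq> {}"
  "imm S ` topspace (dom S) \<subseteq> M2 \<e> \<times> UNIV" "continuous_map (dom S) euclidean NN"
  and conf: "\<And>V \<phi>. (V, \<phi>) \<in> atlas S ==> \<exists>F N lam. conformal_immersion \<e> H F N lam &
   (\<forall>u\<in>V. imm S (\<phi> u) = F u & NN (\<phi> u) = N u)"
 shows "cmc_surface \<e> H S'"
proof (rule cmc_surfaceI[where NN = "NN \<circ> \<beta>"])
 show "smooth_2_manifold (dom S') (atlas S')" by (rule manifold_transport[OF assms(1)])
 show "connected_space (dom S')"
  using assms(2) homeomorphic_connected_space homeo unfolding homeomorphic_space_def by blast
 show "imm S' ` topspace (dom S') \<subseteq> M2 \<e> \<times> UNIV" using assms(4) by (auto simp: image_subset_iff)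
 show "continuous_map (dom S') euclidean (NN \<circ> \<beta>)" by (rule continuous_map_compose[OF cont_beta assms(5)])
 fix V \<psi> assume "(V, \<psi>) \<in> atlas S'"
 then obtain \<phi> where c: "(V, \<phi>) \<in> atlas S" "\<psi> = \<beta>' \<circ> \<phi>" by (rule atlasE)
 from conf[OF c(1)] obtain F N lam where "conformal_immersion \<e> H F N lam"
  "\<forall>u\<in>V. imm S (\<phi> u) = F u & NN (\<phi> u) = N u" by (elim exE conjE)
 then have "conformal_immersion \<e> H F N lam & (\<forall>u\<in>V. imm S' (\<psi> u) = F u & (NN \<circ> \<beta>) (\<psi> u) = N u)"
  using imm_chart[OF c(1) assms(1)] by (simp add: c(2))
 then show "\<exists>F N lam. conformal_immersion \<e> H F N lam & (\<forall>u\<in>V. imm S' (\<psi> u) = F u & (NN \<circ> \<beta>) (\<psi> u) = N u)"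
  by (intro exI)
qed simp

lemma conformal_transport: "conformal_surface \<e> H S ==> cmc_surface \<e> H S'"
 unfolding conformal_surface_def
proof (elim conjE exE)
 fix NN
 assume a: "smooth_2_manifold (dom S) (atlas S)" "connected_space (dom S)" "topspace (dom S) \<noteq> {}"
  "imm S ` topspace (dom S) \<subseteq> M2 \<e> \<times> UNIV" "continuous_map (dom S) euclidean NN"
  and c: "\<forall>V \<phi>. (V, \<phi>) \<in> atlas S -->
    (\<exists>F N lam. conformal_immersion \<e> H F N lam & (\<forall>u\<in>V. imm S (\<phi> u) = F u & NN (\<phi> u) = N u))"
 show ?thesis by (rule cmc_transport[OF a c[rule_format]])
qed

lemma joined_transport: "joined \<e> S' x y L \<longleftrightarrow> joined \<e> S (\<beta> x) (\<beta> y) L"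
proof
 assume "joined \<e> S' x y L"
 then obtain \<gamma> where \<gamma>: "\<gamma> 0 = x" "\<gamma> 1 = y" "pathin (dom S') \<gamma>"
  "(imm S' \<circ> \<gamma>) piecewise_C1_differentiable_on {0..1}" "(speed \<e> (imm S' \<circ> \<gamma>) has_integral L) {0..1}"
  unfolding joined_def path_length_speed by blast
 have eq: "imm S' \<circ> \<gamma> = imm S \<circ> (\<beta> \<circ> \<gamma>)" by auto
 show "joined \<e> S (\<beta> x) (\<beta> y) L"
  unfolding joined_def path_length_speed
  by (rule exI[of _ "\<beta> \<circ> \<gamma>"])
   (use \<gamma> pathin_compose[OF \<gamma>(3) cont_beta] in \<open>simp add: eq\<close>)
next
 assume "joined \<e> S (\<beta> x) (\<beta> y) L"
 then obtain \<gamma> where \<gamma>: "\<gamma> 0 = \<beta> x" "\<gamma> 1 = \<beta> y" "pathin (dom S) \<gamma>"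
  "(imm S \<circ> \<gamma>) piecewise_C1_differentiable_on {0..1}" "(speed \<e> (imm S \<circ> \<gamma>) has_integral L) {0..1}"
  unfolding joined_def path_length_speed by blast
 \<comment> \<open>Outside \<open>{0..1}\<close> the path may leave the carrier, where
   \<open>\<beta>'\<close> has no meaning, so it is made constant there. Differentiability at 0 and
   1 may be lost; both join the exceptional set.\<close>
 define \<gamma>' where "\<gamma>' t = \<beta>' (if t \<in> {0..1} then \<gamma> t else \<beta> x)" for t
 have mem: "(if t \<in> {0..1} then \<gamma> t else \<beta> x) \<in> topspace (dom S)" for t
  using \<gamma>(3) unfolding pathin_def by (auto simp: continuous_map_def Pi_iff)
 have g: "\<beta> (\<gamma>' t) = (if t \<in> {0..1} then \<gamma> t else \<beta> x)" for t
  unfolding \<gamma>'_def using mem by (rule beta_inv)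
 have p: "pathin (dom S') \<gamma>'"
  unfolding pathin_def
 proof (rule continuous_map_eq)
  show "continuous_map (top_of_set {0..1}) (dom S') (\<beta>' \<circ> \<gamma>)"
   using \<gamma>(3) unfolding pathin_def by (rule continuous_map_compose[OF _ cont_inv])
 qed (simp add: \<gamma>'_def)
 have e: "(imm S' \<circ> \<gamma>') t = (imm S \<circ> \<gamma>) t" if "t \<in> {0..1}" for t using g[of t] that by simp
 have pc: "(imm S' \<circ> \<gamma>') piecewise_C1_differentiable_on {0..1}"
 proof -
  obtain K where K: "finite K" "(imm S \<circ> \<gamma>) C1_differentiable_on {0..1} - K" "continuous_on {0..1} (imm S \<circ> \<gamma>)"
   using \<gamma>(4) unfolding piecewise_C1_differentiable_on_def by blast
  obtain D where D: "\<forall>t\<in>{0..1} - K. (imm S \<circ> \<gamma> has_vector_derivative D t) (at t)" "continuous_on ({0..1} - K) D"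
   using K(2) unfolding C1_differentiable_on_def by blast
  have "(imm S' \<circ> \<gamma>' has_vector_derivative D t) (at t)" if t: "t \<in> {0..1} - (K \<union> {0, 1})" for t
  proof (rule has_vector_derivative_transform_within_open[where f = "imm S \<circ> \<gamma>" and S = "{0<..<1}"])
   show "(imm S \<circ> \<gamma> has_vector_derivative D t) (at t)" using D(1) t by simp
   show "(imm S \<circ> \<gamma>) s = (imm S' \<circ> \<gamma>') s" if "s \<in> {0<..<1}" for s using e[of s] that by simp
  qed (use t in auto)
  moreover have "continuous_on ({0..1} - (K \<union> {0, 1})) D" by (rule continuous_on_subset[OF D(2)]) auto
  ultimately have "(imm S' \<circ> \<gamma>') C1_differentiable_on ({0..1} - (K \<union> {0, 1}))"
   unfolding C1_differentiable_on_def by (intro exI[of _ D]) simp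
  moreover have "continuous_on {0..1} (imm S' \<circ> \<gamma>')"
   using K(3) continuous_on_cong[of "{0..1}" "{0..1}" "imm S' \<circ> \<gamma>'" "imm S \<circ> \<gamma>"] e by simp
  ultimately show ?thesis unfolding piecewise_C1_differentiable_on_def
   using K(1) by (intro conjI exI[of _ "K \<union> {0, 1}"]) simp_all
 qed
 have sp: "(speed \<e> (imm S' \<circ> \<gamma>') has_integral L) {0..1}"
 proof (rule has_integral_spike_finite[OF _ _ \<gamma>(5), of "{0, 1}"])
  fix t :: real assume t: "t \<in> {0..1} - {0, 1}"
  have "vector_derivative (imm S' \<circ> \<gamma>') (at t) = vector_derivative (imm S \<circ> \<gamma>) (at t)"
  proof (rule vector_derivative_cong_eq)
   have "\<forall>\<^sub>F s in nhds t. s \<in> {0<..<1}" using t by (intro eventually_nhds_in_open) auto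
   then show "\<forall>\<^sub>F s in nhds t. s \<in> UNIV --> (imm S' \<circ> \<gamma>') s = (imm S \<circ> \<gamma>) s"
    by (rule eventually_mono) (use e in simp)
  qed (use t in auto)
  then show "speed \<e> (imm S' \<circ> \<gamma>') t = speed \<e> (imm S \<circ> \<gamma>) t" by (simp add: speed_def)
 qed auto
 have "\<gamma>' 0 = x" "\<gamma>' 1 = y" using \<gamma>(1,2) by (simp_all add: \<gamma>'_def)
 then show "joined \<e> S' x y L"
  unfolding joined_def path_length_speed using p pc sp by (intro exI[of _ \<gamma>']) simp
qed

lemma seq_compactin_transport: "seq_compactin (dom S) K ==> seq_compactin (dom S') (\<beta> -` K)"
 unfolding seq_compactin_def
proof (intro allI impI)
 fix \<sigma> :: "nat => 'a"
 assume K: "\<forall>\<sigma>::nat => 'b. range \<sigma> \<subseteq> K -->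
   (\<exists>l r. strict_mono (r::nat=>nat) & limitin (dom S) (\<sigma> \<circ> r) l sequentially)"
  and "range \<sigma> \<subseteq> \<beta> -` K"
 then have sub: "range (\<beta> \<circ> \<sigma>) \<subseteq> K" by auto
 from K[rule_format, OF sub] obtain l r where
  r: "strict_mono (r::nat=>nat)" "limitin (dom S) (\<beta> \<circ> \<sigma> \<circ> r) l sequentially"
  by (elim exE conjE)
 from continuous_map_limit[OF cont_inv r(2)]
 have "limitin (dom S') (\<sigma> \<circ> r) (\<beta>' l) sequentially" by (simp add: o_def)
 with r(1) show "\<exists>l r. strict_mono (r::nat=>nat) & limitin (dom S') (\<sigma> \<circ> r) l sequentially"
  by (intro exI conjI)
qed

lemma complete_transport:
 assumes t: "tame \<e> S" and i: "immersed_surface \<e> S'"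
 shows "complete_surface \<e> S'"
proof (rule tame_complete)
 have eps: "\<e> \<in> {-1, 1}" using t by (simp add: tame_def)
 have sep: "\<forall>x y. x \<noteq> y --> (\<exists>e>0. \<forall>L. joined \<e> S x y L --> e \<le> L)"
  by (rule t[unfolded tame_def, THEN conjunct2, THEN conjunct2, THEN conjunct1])
 have ex: "\<exists>\<rho>>0. \<forall>x\<in>topspace (dom S). \<exists>K. (\<forall>y L. joined \<e> S x y L --> L < \<rho> --> y \<in> K) & seq_compactin (dom S) K"
  by (rule t[unfolded tame_def, THEN conjunct2, THEN conjunct2, THEN conjunct2])
 then obtain \<rho> where \<rho>: "\<rho> > 0" "\<forall>x\<in>topspace (dom S). \<exists>K. (\<forall>y L. joined \<e> S x y L --> L < \<rho> --> y \<in> K) & seq_compactin (dom S) K"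
  by (elim exE conjE)
 show "tame \<e> S'"
  unfolding tame_def
 proof (intro conjI eps i)
  show "\<forall>x y. x \<noteq> y --> (\<exists>e>0. \<forall>L. joined \<e> S' x y L --> e \<le> L)"
  proof (intro allI impI)
  fix x y :: 'a assume "x \<noteq> y"
  then have "\<beta> x \<noteq> \<beta> y" using inj_beta by (simp add: inj_eq)
  then show "\<exists>e>0. \<forall>L. joined \<e> S' x y L --> e \<le> L" using sep by (simp add: joined_transport)
  qed
  show "\<exists>\<rho>>0. \<forall>x\<in>topspace (dom S'). \<exists>K. (\<forall>y L. joined \<e> S' x y L --> L < \<rho> --> y \<in> K) & seq_compactin (dom S') K"
  proof (intro exI[of _ \<rho>] conjI \<rho>(1) ballI)
  fix x
  from bspec[OF \<rho>(2) beta_in[of x]] obtain K where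
   K: "(\<forall>y L. joined \<e> S (\<beta> x) y L --> L < \<rho> --> y \<in> K) & seq_compactin (dom S) K" by (rule exE)
  show "\<exists>K. (\<forall>y L. joined \<e> S' x y L --> L < \<rho> --> y \<in> K) & seq_compactin (dom S') K"
   using K seq_compactin_transport[of K] by (intro exI[of _ "\<beta> -` K"]) (simp add: joined_transport)
  qed
 qed
qed simp

lemma invariant_transport:
 assumes "invariant_under S g"
 shows "invariant_under S' g"
proof -
 obtain \<tau> where \<tau>: "homeomorphic_map (dom S) (dom S) \<tau>" "\<forall>x\<in>topspace (dom S). g (imm S x) = imm S (\<tau> x)"
  using assms unfolding invariant_under_def by (elim exE conjE)
 have "homeomorphic_map (dom S') (dom S') (\<beta>' \<circ> (\<tau> \<circ> \<beta>))"
  by (intro homeomorphic_map_compose[OF _ homeo_inv] homeomorphic_map_compose[OF homeo_beta \<tau>(1)])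
 moreover have "g (imm S' x) = imm S' ((\<beta>' \<circ> (\<tau> \<circ> \<beta>)) x)" for x
 proof -
  have "\<tau> (\<beta> x) \<in> topspace (dom S)"
   using homeomorphic_imp_surjective_map[OF \<tau>(1)] beta_in[of x] by blast
  then show ?thesis using \<tau>(2) by simp
 qed
 ultimately show ?thesis unfolding invariant_under_def by (intro exI[of _ "\<beta>' \<circ> (\<tau> \<circ> \<beta>)"]) simp
qed

lemma image_of_transport: "image_of S' = image_of S"
 by (simp add: image_of_def range_beta[symmetric] image_comp o_def)

lemma embedded_transport:
 assumes "embedded S"
 shows "embedded S'"
proof -
 have im: "imm S' ` topspace (dom S') = imm S ` topspace (dom S)"
  using image_of_transport by (simp add: image_of_def)
 have eq: "imm S' = imm S \<circ> \<beta>" by auto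
 show ?thesis
  using homeomorphic_map_compose[OF homeo_beta assms[unfolded embedded_def embedding_map_def]]
  unfolding embedded_def embedding_map_def im by (simp only: eq)
qed

lemma homeomorphic_space_transport: "dom S' homeomorphic_space dom S"
 using homeo unfolding homeomorphic_space_def by (intro exI)

lemma upper_half_graph_transport:
 assumes "upper_half_graph_over S \<Omega>"
 shows "upper_half_graph_over S' \<Omega>"
proof -
 have im: "\<beta> ` upper_half S' = upper_half S"
  unfolding upper_half_def by (auto simp: image_iff) (metis beta_inv)
 have "homeomorphic_map (subtopology (dom S') (upper_half S')) (subtopology (dom S) (\<beta> ` upper_half S')) \<beta>"
 proof (rule homeomorphic_map_subtopologies_alt[OF homeo_beta])
  fix x
  show "(\<beta> x \<in> \<beta> ` upper_half S') = (x \<in> upper_half S')" by (rule inj_image_mem_iff[OF inj_beta])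
 qed
 from homeomorphic_map_compose[OF this] assms
 show ?thesis by (simp add: upper_half_graph_over_def im o_def)
qed

lemma orthogonal_transport:
 assumes o: "orthogonal_to_slice \<e> S" and M: "smooth_2_manifold (dom S) (atlas S)"
 shows "orthogonal_to_slice \<e> S'"
 unfolding orthogonal_to_slice_def
proof (intro ballI, unfold split_paired_all split_conv, intro ballI impI allI)
 fix V \<psi> u \<eta> assume "(V, \<psi>) \<in> atlas S'" and u: "u \<in> V" "snd (imm S' (\<psi> u)) = 0"
  and \<eta>: "unit_normal \<e> (imm S' \<circ> \<psi>) u \<eta>"
 from this(1) obtain \<phi> where c: "(V, \<phi>) \<in> atlas S" "\<psi> = \<beta>' \<circ> \<phi>" by (rule atlasE)
 have V: "open V" using M c(1) unfolding smooth_2_manifold_def by blast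
 have eq: "(imm S' \<circ> \<psi>) v = (imm S \<circ> \<phi>) v" if "v \<in> V" for v
  using imm_chart[OF c(1) M that] by (simp add: c(2))
 have "frechet_derivative (imm S' \<circ> \<psi>) (at u) = frechet_derivative (imm S \<circ> \<phi>) (at u)"
 proof -
  have "(imm S' \<circ> \<psi> has_derivative f') (at u) \<longleftrightarrow> (imm S \<circ> \<phi> has_derivative f') (at u)" for f'
   using has_derivative_transform_within_open[OF _ V u(1), of "imm S' \<circ> \<psi>" f' UNIV "imm S \<circ> \<phi>"]
    has_derivative_transform_within_open[OF _ V u(1), of "imm S \<circ> \<phi>" f' UNIV "imm S' \<circ> \<psi>"] eq by auto
  then show ?thesis by (simp add: frechet_derivative_def)
 qed
 then have "unit_normal \<e> (imm S \<circ> \<phi>) u \<eta>" using \<eta> eq[OF u(1)] by (simp add: unit_normal_def)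
 moreover have "snd (imm S (\<phi> u)) = 0" using u eq[OF u(1)] by simp
 ultimately show "pform \<e> \<eta> (0, 1) = 0" using o c(1) u(1) unfolding orthogonal_to_slice_def by blast
qed

end

text \<open>Lower bound: on a connected set the distance from \<open>a\<close> takes all values up
  to \<open>dist a b\<close>. Upper bound: a point is determined by the members of a countable basis
  that contain it.\<close>

lemma real_eqpoll_connected:
 fixes D :: "'b::{metric_space, second_countable_topology} set"
 assumes D: "connected D" and ab: "a \<in> D" "b \<in> D" "a \<noteq> b"
 shows "D \<approx> (UNIV :: real set)"
proof (rule lepoll_antisym)
 have "connected (dist a ` D)" by (intro connected_continuous_image D continuous_intros)
 moreover have "0 \<in> dist a ` D" using ab(1) by (intro image_eqI[of _ _ a]) auto
 ultimately have "{0..dist a b} \<subseteq> dist a ` D"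
  using ab(2) by (intro connected_contains_Icc) auto
 then have "{0..dist a b} \<lesssim> D" by (rule subset_image_lepoll)
 moreover have "(UNIV::real set) \<approx> {0..dist a b}"
  using closed_interval_eqpoll_reals[of 0 "dist a b"] ab by (simp add: eqpoll_sym)
 ultimately show "(UNIV::real set) \<lesssim> D" using lepoll_trans1 by blast
 from ex_countable_basis obtain B :: "'b set set" where "countable B & topological_basis B" by (rule exE)
 then have B: "countable B" "topological_basis B" by simp_all
 have ne: "B \<noteq> {}" using topological_basisE[OF B(2) open_UNIV UNIV_I] by blast
 define f where "f x = {n. x \<in> from_nat_into B n}" for x
 have "inj f"
 proof (rule injI, rule ccontr)
  fix x y assume xy: "f x = f y" "x \<noteq> y"
  obtain W where W: "W \<in> B" "x \<in> W" "W \<subseteq> - {y}"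
   by (rule topological_basisE[OF B(2), of "- {y}" x]) (use xy in auto)
  obtain n where "W = from_nat_into B n" using from_nat_into_surj[OF B(1) W(1)] by metis
  then have "n \<in> f x" "n \<notin> f y" using W by (auto simp: f_def)
  then show False using xy by simp
 qed
 then have "(UNIV::'b set) \<lesssim> (UNIV::nat set set)" unfolding lepoll_def by blast
 then show "D \<lesssim> (UNIV::real set)"
  using nat_sets_eqpoll_reals subset_imp_lepoll[OF subset_UNIV, of D]
  by (meson lepoll_trans lepoll_trans2)
qed

lemma transport_bijection:
 fixes D :: "'b::{metric_space, second_countable_topology} set"
 assumes "connected D" "a \<in> D" "b \<in> D" "a \<noteq> b"
 obtains \<beta> :: "real^3 => 'b" where "bij_betw \<beta> UNIV D"
proof -
 have "(UNIV :: (real^3) set) \<approx> (UNIV :: real set)"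
  by (rule real_eqpoll_connected[of UNIV 0 "axis 1 1"]) (auto simp: axis_eq_0_iff)
 also have "(UNIV :: real set) \<approx> D" using real_eqpoll_connected[OF assms] by (rule eqpoll_sym)
 finally show thesis using that unfolding eqpoll_def by blast
qed

section \<open>Amplitude functions\<close>

text \<open>The flow of an autonomous equation on the line; for
  \<open>f s = sqrt (1 - m^2 * (sin s)^2)\<close> it is Jacobi's amplitude.\<close>

definition amp :: "(real => real) => real => real" where
 "amp f = (SOME \<phi>. \<phi> 0 = 0 & (\<forall>x. (\<phi> has_real_derivative f (\<phi> x)) (at x)))"

text \<open>Positivity makes the travel time a strictly increasing differentiable function of the
  position; the upper bound makes it onto, so that the flow exists for all times.\<close>

locale bounded_speed =
 fixes f :: "real => real" and a b :: real
 assumes cont: "continuous_on UNIV f" and bounds: "0 < a" "\<And>s. a \<le> f s" "\<And>s. f s \<le> b"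
begin

lemma f_pos: "f s > 0"
 using bounds(1) bounds(2)[of s] by simp

text \<open>Separation of variables: \<open>E s\<close> is the time at which the flow reaches
  \<open>s\<close>, so the flow is the inverse of \<open>E\<close>.\<close>

lemma clock:
 obtains E where "E 0 = 0" "\<And>s. (E has_real_derivative 1 / f s) (at s)"
proof -
 have "isCont (%s. 1 / f s) x" for x
  using cont f_pos[of x] by (intro continuous_intros) (auto simp: continuous_on_eq_continuous_at)
 then obtain E where "\<forall>x. (E has_vector_derivative 1 / f x) (at x)"
  using einterval_antiderivative[of "-\<infinity>" "\<infinity>" "%s. 1 / f s"] by auto
 then have "((%x. E x - E 0) has_real_derivative 1 / f s) (at s)" for s
  by (auto intro!: derivative_eq_intros simp: has_real_derivative_iff_has_vector_derivative)
 then show thesis using that[of "%x. E x - E 0"] by simp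
qed

lemma clock_props:
 assumes E: "E 0 = 0" "\<And>s. (E has_real_derivative 1 / f s) (at s)"
 shows "strict_mono E" "surj E"
proof -
 show m: "strict_mono E"
 proof (rule strict_monoI)
  fix x y :: real assume "x < y"
  then show "E x < E y"
  proof (rule DERIV_pos_imp_increasing)
   fix s show "\<exists>z. (E has_real_derivative z) (at s) & 0 < z"
    using E(2)[of s] f_pos[of s] by (intro exI[of _ "1 / f s"]) simp
  qed
 qed
 have cE: "continuous_on UNIV E" using E(2) by (meson DERIV_continuous_on has_field_derivative_at_within)
 have b0: "b > 0" using f_pos[of 0] bounds(3)[of 0] by simp
 have up: "y / b \<le> E y" if "y \<ge> 0" for y
 proof -
  have "E 0 - 0 / b \<le> E y - y / b"
  proof (rule DERIV_nonneg_imp_nondecreasing[OF that, of "%y. E y - y / b"])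
   fix x
   have "((%y. E y - y / b) has_real_derivative 1 / f x - 1 / b) (at x)"
    using b0 by (auto intro!: derivative_eq_intros E(2))
   moreover have "1 / f x - 1 / b \<ge> 0" using f_pos[of x] bounds(3)[of x] b0 by (simp add: frac_le)
   ultimately show "\<exists>z. ((%y. E y - y / b) has_real_derivative z) (at x) & 0 \<le> z" by blast
  qed
  then show ?thesis using E(1) by simp
 qed
 have lo: "E y \<le> y / b" if "y \<le> 0" for y
 proof -
  have "E y - y / b \<le> E 0 - 0 / b"
  proof (rule DERIV_nonneg_imp_nondecreasing[OF that, of "%y. E y - y / b"])
   fix x
   have "((%y. E y - y / b) has_real_derivative 1 / f x - 1 / b) (at x)"
    using b0 by (auto intro!: derivative_eq_intros E(2))
   moreover have "1 / f x - 1 / b \<ge> 0" using f_pos[of x] bounds(3)[of x] b0 by (simp add: frac_le)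
   ultimately show "\<exists>z. ((%y. E y - y / b) has_real_derivative z) (at x) & 0 \<le> z" by blast
  qed
  then show ?thesis using E(1) by simp
 qed
 show "surj E"
  unfolding surj_def
 proof
  fix x
  have 1: "x \<le> E (b * \<bar>x\<bar>)" using up[of "b * \<bar>x\<bar>"] b0 by simp
  have 2: "E (- (b * \<bar>x\<bar>)) \<le> x" using lo[of "- (b * \<bar>x\<bar>)"] b0 by simp
  have "- (b * \<bar>x\<bar>) \<le> b * \<bar>x\<bar>" using b0 by simp
  from IVT'[OF 2 1 this continuous_on_subset[OF cE]] show "\<exists>y. x = E y" by auto
 qed
qed

lemma flow_inverse:
 assumes E: "E 0 = 0" "\<And>s. (E has_real_derivative 1 / f s) (at s)"
  and \<phi>: "\<phi> 0 = 0" "\<And>x. (\<phi> has_real_derivative f (\<phi> x)) (at x)"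
 shows "E (\<phi> x) = x"
proof -
 have "((%x. E (\<phi> x) - x) has_real_derivative 0) (at x)" for x
  using DERIV_chain2[OF E(2) \<phi>(2), of x] f_pos[of "\<phi> x"]
  by (auto intro!: derivative_eq_intros)
 from DERIV_isconst_all[of "%x. E (\<phi> x) - x" x 0] this show ?thesis by (simp add: E(1) \<phi>(1))
qed

lemma amp: "amp f 0 = 0" "(amp f has_real_derivative f (amp f x)) (at x)"
proof -
 obtain E where E: "E 0 = 0" "\<And>s. (E has_real_derivative 1 / f s) (at s)" using clock by metis
 note p = clock_props[OF E]
 define \<phi> where "\<phi> = inv E"
 have i: "E (\<phi> x) = x" "\<phi> (E x) = x" for x
  using p by (simp_all add: \<phi>_def surj_f_inv_f strict_mono_imp_inj_on)
 have cE: "isCont E s" for s using E(2) DERIV_isCont by blast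
 have "(\<phi> has_real_derivative f (\<phi> x)) (at x)" for x
 proof -
  have "isCont \<phi> (E (\<phi> x))"
   by (rule isCont_inverse_function[where d = 1]) (use i cE in auto)
  then have "(\<phi> has_real_derivative inverse (1 / f (\<phi> x))) (at x)"
   using DERIV_inverse_function[of E "1 / f (\<phi> x)" \<phi> x "x - 1" "x + 1"] E(2) f_pos[of "\<phi> x"] i by simp
  then show ?thesis by simp
 qed
 moreover have "\<phi> 0 = 0" using i(2)[of 0] E(1) by simp
 ultimately have "\<exists>\<phi>. \<phi> 0 = 0 & (\<forall>x. (\<phi> has_real_derivative f (\<phi> x)) (at x))" by (intro exI[of _ \<phi>]) simp
 from someI_ex[OF this] show "amp f 0 = 0" "(amp f has_real_derivative f (amp f x)) (at x)"
  unfolding amp_def by simp_all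
qed

text \<open>Every solution is inverted by the same clock.\<close>

lemma amp_unique:
 assumes "\<phi> 0 = 0" "\<And>x. (\<phi> has_real_derivative f (\<phi> x)) (at x)"
 shows "\<phi> x = amp f x"
proof -
 obtain E where E: "E 0 = 0" "\<And>s. (E has_real_derivative 1 / f s) (at s)" using clock by metis
 have "E (\<phi> x) = E (amp f x)" using flow_inverse[OF E assms] flow_inverse[OF E amp] by simp
 then show ?thesis using clock_props(1)[OF E] by (simp add: strict_mono_eq)
qed

lemma amp_strict_mono: "strict_mono (amp f)"
proof (rule strict_monoI)
 fix x y :: real assume "x < y"
 then show "amp f x < amp f y"
 proof (rule DERIV_pos_imp_increasing)
  fix s show "\<exists>z. (amp f has_real_derivative z) (at s) & 0 < z"
   using amp(2)[of s] f_pos[of "amp f s"] by (intro exI[of _ "f (amp f s)"]) simp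
 qed
qed

lemma amp_surj: "surj (amp f)"
proof -
 obtain E where E: "E 0 = 0" "\<And>s. (E has_real_derivative 1 / f s) (at s)" using clock by metis
 have "amp f (E s) = s" for s
  using flow_inverse[OF E amp, of "E s"] clock_props(1)[OF E] by (simp add: strict_mono_eq)
 then show ?thesis by (rule surjI)
qed

lemma amp_odd:
 assumes "\<And>s. f (- s) = f s"
 shows "amp f (- x) = - amp f x"
proof -
 have "((%x. - amp f (- x)) has_real_derivative f (- amp f (- x))) (at x)" for x
  using DERIV_mirror[of "amp f" "f (amp f (-x))" x] amp(2)[of "-x"] assms[of "amp f (- x)"]
  by (auto intro!: derivative_eq_intros DERIV_chain2[OF amp(2)])
 from amp_unique[of "%x. - amp f (- x)", OF _ this, of x] show ?thesis by (simp add: amp(1))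
qed

text \<open>By uniqueness: a shift by \<open>X\<close> in time and by \<open>P\<close> in position
  turns the flow into a solution with the same initial value.\<close>

lemma amp_period:
 assumes "\<And>s. f (s + P) = f s" "amp f X = P"
 shows "amp f (x + X) = amp f x + P"
proof -
 have "((%x. amp f (x + X) - P) has_real_derivative f (amp f (x + X) - P)) (at x)" for x
  using assms(1)[of "amp f (x + X) - P"]
  by (auto intro!: derivative_eq_intros DERIV_chain2[OF amp(2)])
 from amp_unique[of "%x. amp f (x + X) - P", OF _ this, of x] show ?thesis by (simp add: assms(2))
qed

end

lemma antiderivative_real:
 fixes g :: "real => real"
 assumes "continuous_on UNIV g"
 obtains G where "G 0 = 0" "\<And>x. (G has_real_derivative g x) (at x)"
proof -
 have "isCont g x" for x using assms by (simp add: continuous_on_eq_continuous_at)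
 then obtain G where "\<forall>x. (G has_vector_derivative g x) (at x)"
  using einterval_antiderivative[of "-\<infinity>" "\<infinity>" g] by auto
 then have "((%x. G x - G 0) has_real_derivative g s) (at s)" for s
  by (auto intro!: derivative_eq_intros simp: has_real_derivative_iff_has_vector_derivative)
 then show thesis using that[of "%x. G x - G 0"] by simp
qed

section \<open>The explicit conformal immersions\<close>

text \<open>
 The identities behind the explicit surfaces. Here \<open>t, s, q, r\<close> are the values of the two profile
 functions and their derivatives, \<open>d\<close> and \<open>d1\<close> are the inverses of \<open>1 - \<e> t\<^sup>2 q\<^sup>2\<close> and
 \<open>1 - \<e> t\<^sup>2\<close>, and \<open>\<kappa> = 1 / c\<close>.
\<close>

locale profile_point =
 fixes \<e> m c \<kappa> \<eta> b t s q r d d1 :: real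
 assumes ee: "\<e> * \<e> = 1" and ck: "c * \<kappa> = 1" and eta2: "\<eta>^2 = 4 * (1 - \<e> * \<kappa>^2)"
  and eta: "\<eta> = b * (1 - \<e> * m)"
  and s2: "s^2 = (1 + \<e> * m)^2 * t^2 - c^2 * (m + t^2)^2"
  and r2: "r^2 = (1 - q^2) * (1 - m^2 * q^2)"
  and d: "d * (1 - \<e> * t^2 * q^2) = 1" and d1: "d1 * (1 - \<e> * t^2) = 1"
begin

text \<open>\<open>pA\<close>, \<open>pB\<close>, \<open>pw\<close> are the coordinates of the
  horizontal part in the moving frame formed by the point of the geodesic, its velocity and its
  normal. \<open>Xa\<close>, \<open>Xb\<close>, \<open>Xc\<close>, \<open>hx\<close> belong in the
  same way to the x-derivative of the immersion, with \<open>hx\<close> its height component, and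
  \<open>Ya\<close>, \<open>Yb\<close>, \<open>Yc\<close>, \<open>hy\<close> to the y-derivative;
  \<open>lam\<close> is the conformal factor.\<close>

definition "pA = 1 - \<e> * b * (1 + \<e> * m) * \<eta> * t^2 * (1 - q^2) * d * d1 / 2"
definition "pB = - (\<e> * b * \<kappa> * t * s * (1 - q^2) * d * d1)"
definition "pw = b * t * r * d"
definition "Xa = - (\<e> * \<eta> * b * t * s * (1 - q^2) * (1 + m * t^2 * q^2) * d^2 * d1)"
definition "Xb = b * d^2 * d1 * ((c * (m + t^2) * (1 + \<e> * t^2) - 2 * \<e> * (1 + \<e> * m) * \<kappa> * t^2) * (1 - q^2) * (1 + m * t^2 * q^2)
   + (1 - \<e> * m) * (1 - \<e> * t^2)^2 * c * (m + t^2) * q^2)"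
definition "Xc = b * s * r * d^2 * (1 + \<e> * t^2 * q^2)"
definition "hx = \<eta> * s * q * d"
definition "C0 = - (1 + m^2) + 2 * m^2 * q^2 + \<e> * t^2 * (2 - (1 + m^2) * q^2)"
definition "Ya = \<eta> * b * (1 + \<e> * m) * \<e> * t^2 * q * r * d^2"
definition "Yb = 2 * \<e> * b * \<kappa> * t * s * q * r * d^2"
definition "Yc = b * t * d^2 * q * C0"
definition "hy = \<eta> * t * r * d"
definition "lam = \<eta>^2 * t^2 * (1 + \<e> * m * q^2)^2 * d^2"

text \<open>The factor \<open>1 - \<e> * t^2\<close> on the right cancels one \<open>d1\<close> in
  \<open>on_M2\<close> after \<open>s^2\<close> and \<open>\<eta>^2\<close> have been
  eliminated.\<close>

lemma fac1: "(1 + \<e> * m)^2 * t^2 - \<e> * (m + t^2)^2 = (1 - \<e> * t^2) * (t^2 - \<e> * m^2)"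
 by algebra

text \<open>Expanding the squares leaves terms in \<open>s^2\<close> and \<open>\<eta>^2\<close>,
  whose combination \<open>f2\<close> is a multiple of \<open>1 - \<e> t^2\<close>. The bracket that
  remains collapses to \<open>- \<e> (1 - m^2 q^2) d\<close>, which together with
  \<open>1 - q^2\<close> is the factorization of \<open>r^2\<close>.\<close>

lemma on_M2: "pA^2 + \<e> * pB^2 + \<e> * pw^2 = 1"
proof -
 have k2: "c^2 * \<kappa>^2 = 1" using ck by (metis power_mult_distrib one_power2)
 define W where "W = 1 - q^2"
 have e2: "\<e>^2 = 1" using ee by (simp add: power2_eq_square)
 have a: "b^2 * (1 - m^2) = b * (1 + \<e> * m) * \<eta>"
  unfolding eta using ee by algebra
 have A: "pA = 1 - \<e> * b^2 * (1 - m^2) * t^2 * W * d * d1 / 2"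
 proof -
  have "\<e> * b * (1 + \<e> * m) * \<eta> = \<e> * b^2 * (1 - m^2)" using a by algebra
  then show ?thesis unfolding pA_def W_def by simp
 qed
 have q4: "\<eta>^2 * (1 + \<e> * m)^2 * b^2 = (b^2 * (1 - m^2))^2" unfolding a by algebra
 have f2: "\<eta>^2 * (1 + \<e> * m)^2 * t^2 / 4 + \<e> * \<kappa>^2 * s^2 = (1 - \<e> * t^2) * (t^2 - \<e> * m^2)"
  unfolding fac1[symmetric] eta2 s2 using k2 by algebra
 have "pA^2 + \<e> * pB^2 - 1 = - (\<e> * b^2 * (1 - m^2) * t^2 * W * d * d1) +
   b^2 * t^2 * W^2 * d^2 * d1^2 * (\<eta>^2 * (1 + \<e> * m)^2 * t^2 / 4 + \<e> * \<kappa>^2 * s^2)"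
 proof -
  have "pA^2 = 1 - \<e> * b^2 * (1 - m^2) * t^2 * W * d * d1 + (b^2 * (1 - m^2))^2 * t^4 * W^2 * d^2 * d1^2 / 4"
   unfolding A using e2 by (simp add: power2_eq_square) algebra
  moreover have "\<e> * pB^2 = \<e> * b^2 * \<kappa>^2 * t^2 * s^2 * W^2 * d^2 * d1^2"
   unfolding pB_def W_def using e2 by (simp add: power_mult_distrib)
  ultimately show ?thesis unfolding q4[symmetric] by algebra
 qed
 also have "\<dots> = b^2 * t^2 * W * d * (- (\<e> * (1 - m^2) * d1) + W * d * d1 * (t^2 - \<e> * m^2))"
  unfolding f2 using d1 by algebra
 also have "\<dots> = - (\<e> * pw^2)"
 proof -
  have "- (\<e> * (1 - m^2) * d1) + W * d * d1 * (t^2 - \<e> * m^2) = - (\<e> * (1 - m^2 * q^2) * d)"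
  proof -
   have "- (\<e> * (1 - m^2)) * (1 - \<e> * t^2 * q^2) + W * (t^2 - \<e> * m^2) = - (\<e> * (1 - m^2 * q^2) * (1 - \<e> * t^2))"
    unfolding W_def using ee by algebra
   then have "d * d1 * (- (\<e> * (1 - m^2)) * (1 - \<e> * t^2 * q^2) + W * (t^2 - \<e> * m^2)) =
     d * d1 * (- (\<e> * (1 - m^2 * q^2) * (1 - \<e> * t^2)))" by simp
   then show ?thesis using d d1 by algebra
  qed
  then show ?thesis unfolding pw_def power_mult_distrib r2 W_def by algebra
 qed
 finally show ?thesis by simp
qed

lemma k2: "c^2 * \<kappa>^2 = 1" using ck by (metis power_mult_distrib one_power2)

text \<open>The pattern of all three metric identities: eliminate \<open>s\<close>,
  \<open>\<eta>\<close> and \<open>r\<close> through their squares, collect equal powers of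
  \<open>d\<close> and \<open>d1\<close>, and leave a polynomial identity that uses only
  \<open>\<e> * \<e> = 1\<close>.\<close>

lemma met_YY: "\<e> * Ya^2 + Yb^2 + Yc^2 + hy^2 = lam"
proof -
 have f2: "\<eta>^2 * (1 + \<e> * m)^2 * t^2 * \<e> + 4 * \<kappa>^2 * s^2 = 4 * \<e> * (1 - \<e> * t^2) * (t^2 - \<e> * m^2)"
 proof -
  have "\<eta>^2 * (1 + \<e> * m)^2 * t^2 * \<e> + 4 * \<kappa>^2 * s^2 = 4 * \<e> * ((1 + \<e> * m)^2 * t^2 - \<e> * (m + t^2)^2)"
   unfolding eta2 s2 using k2 ee by algebra
  then show ?thesis unfolding fac1 by simp
 qed
 have g: "4 * \<e> * r^2 * (1 - \<e> * t^2) * (t^2 - \<e> * m^2) + C0^2 = (1 - m^2)^2 * (1 - \<e> * t^2 * q^2)^2"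
  unfolding r2 C0_def using ee by algebra
 have "\<e> * Ya^2 + Yb^2 = b^2 * t^2 * q^2 * r^2 * d^4 * (\<eta>^2 * (1 + \<e> * m)^2 * t^2 * \<e> + 4 * \<kappa>^2 * s^2)"
  unfolding Ya_def Yb_def using ee by algebra
 then have "\<e> * Ya^2 + Yb^2 + Yc^2 = b^2 * t^2 * q^2 * d^4 * ((1 - m^2)^2 * (1 - \<e> * t^2 * q^2)^2)"
  unfolding f2 g[symmetric] Yc_def by algebra
 also have "\<dots> = b^2 * t^2 * q^2 * d^2 * (1 - m^2)^2" using d by algebra
 finally show ?thesis
  unfolding lam_def hy_def power_mult_distrib r2 unfolding eta using ee by algebra
qed

lemma met_XY: "\<e> * Xa * Ya + Xb * Yb + Xc * Yc + hx * hy = 0"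
proof -
 define W V where "W = 1 - q^2" and "V = 1 + m * t^2 * q^2"
 have g: "2 * \<e> * (m - t^2) * W * V + 2 * \<e> * (1 - \<e> * m) * (1 - \<e> * t^2) * (m + t^2) * q^2
   + (1 + \<e> * t^2 * q^2) * C0 + (1 - \<e> * m)^2 * (1 - \<e> * t^2 * q^2)^2 = 0"
  unfolding W_def V_def C0_def using ee by algebra
 have 1: "\<e> * Xa * Ya = b^2 * s * t * q * r * d^4 * (- \<e> * \<eta>^2 * (1 + \<e> * m) * t^2 * W * V * d1)"
  unfolding Xa_def Ya_def W_def[symmetric] V_def[symmetric] using ee by algebra
 have 2: "Xb * Yb = b^2 * s * t * q * r * d^4 * (2 * \<e> * d1 * (((m + t^2) * (1 + \<e> * t^2) -
   2 * \<e> * (1 + \<e> * m) * \<kappa>^2 * t^2) * W * V + (1 - \<e> * m) * (1 - \<e> * t^2)^2 * (m + t^2) * q^2))"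
  unfolding Xb_def Yb_def W_def[symmetric] V_def[symmetric] using ck by algebra
 have 3: "Xc * Yc = b^2 * s * t * q * r * d^4 * ((1 + \<e> * t^2 * q^2) * C0)"
  unfolding Xc_def Yc_def by algebra
 have 4: "hx * hy = b^2 * s * t * q * r * d^4 * ((1 - \<e> * m)^2 * (1 - \<e> * t^2 * q^2)^2)"
  unfolding hx_def hy_def using d eta by algebra
 have 5: "- \<e> * \<eta>^2 * (1 + \<e> * m) * t^2 * W * V * d1 + 2 * \<e> * d1 * (((m + t^2) * (1 + \<e> * t^2) -
   2 * \<e> * (1 + \<e> * m) * \<kappa>^2 * t^2) * W * V + (1 - \<e> * m) * (1 - \<e> * t^2)^2 * (m + t^2) * q^2) =
   2 * \<e> * (m - t^2) * W * V + 2 * \<e> * (1 - \<e> * m) * (1 - \<e> * t^2) * (m + t^2) * q^2"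
  unfolding eta2 using d1 ee by algebra
 show ?thesis unfolding 1 2 3 4 using 5 g by algebra
qed

lemma met_XX: "\<e> * Xa^2 + Xb^2 + Xc^2 + hx^2 = lam"
proof -
 define W V D D1 P where "W = 1 - q^2" and "V = 1 + m * t^2 * q^2" and "D = 1 - \<e> * t^2 * q^2"
  and "D1 = 1 - \<e> * t^2" and "P = c^2 * (m + t^2)^2"
 define u where "u = 1 + \<e> * m"
 have w2: "\<e> * \<eta>^2 * t^2 * s^2 + (c * (m + t^2) * (1 + \<e> * t^2) - 2 * \<e> * u * \<kappa> * t^2)^2 = D1^2 * (P - 4 * \<e> * m * t^2)"
  unfolding eta2 s2 D1_def P_def u_def using ck ee by algebra
 have w1: "(c * (m + t^2) * (1 + \<e> * t^2) - 2 * \<e> * u * \<kappa> * t^2) * (c * (m + t^2)) =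
   P * (1 + \<e> * t^2) - 2 * \<e> * u * t^2 * (m + t^2)"
  unfolding P_def using ck by algebra
 have 1: "\<e> * Xa^2 + Xb^2 = b^2 * d^4 * d1^2 *
   ((\<e> * \<eta>^2 * t^2 * s^2 + (c * (m + t^2) * (1 + \<e> * t^2) - 2 * \<e> * u * \<kappa> * t^2)^2) * W^2 * V^2
   + 2 * W * V * (1 - \<e> * m) * D1^2 * q^2 * ((c * (m + t^2) * (1 + \<e> * t^2) - 2 * \<e> * u * \<kappa> * t^2) * (c * (m + t^2)))
   + (1 - \<e> * m)^2 * D1^4 * P * q^4)"
  unfolding Xa_def Xb_def W_def[symmetric] V_def[symmetric] D1_def[symmetric] u_def[symmetric] P_def
  using ee by algebra
 have 2: "\<e> * Xa^2 + Xb^2 = b^2 * d^4 *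
   ((P - 4 * \<e> * m * t^2) * W^2 * V^2 + 2 * W * V * (1 - \<e> * m) * q^2 * (P * (1 + \<e> * t^2) - 2 * \<e> * u * t^2 * (m + t^2))
   + (1 - \<e> * m)^2 * D1^2 * P * q^4)"
  unfolding 1 w2 w1 using d1[folded D1_def] by algebra
 have 3: "Xc^2 + hx^2 = b^2 * d^4 * ((u^2 * t^2 - P) * (W * (1 - m^2 * q^2) * (1 + \<e> * t^2 * q^2)^2 + (1 - \<e> * m)^2 * q^2 * D^2))"
  unfolding Xc_def hx_def power_mult_distrib r2 s2 W_def[symmetric] P_def[symmetric] u_def[symmetric]
  using d[folded D_def] eta by algebra
 have 4: "lam = b^2 * d^4 * ((1 - \<e> * m)^2 * t^2 * (1 + \<e> * m * q^2)^2 * D^2)"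
  unfolding lam_def using d[folded D_def] eta by algebra
 have 5: "(P - 4 * \<e> * m * t^2) * W^2 * V^2 + 2 * W * V * (1 - \<e> * m) * q^2 * (P * (1 + \<e> * t^2) - 2 * \<e> * u * t^2 * (m + t^2))
   + (1 - \<e> * m)^2 * D1^2 * P * q^4 + (u^2 * t^2 - P) * (W * (1 - m^2 * q^2) * (1 + \<e> * t^2 * q^2)^2 + (1 - \<e> * m)^2 * q^2 * D^2)
   = (1 - \<e> * m)^2 * t^2 * (1 + \<e> * m * q^2)^2 * D^2"
  unfolding W_def V_def D_def D1_def u_def using ee by algebra
 show ?thesis using 2 3 unfolding 4 5[symmetric] by algebra
qed

lemma normal_vertical: "lam - hx^2 - hy^2 = \<eta>^2 * q^2 * (c * (m + t^2))^2 * d^2"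
 unfolding lam_def hx_def hy_def power_mult_distrib s2 r2 using ee by algebra

text \<open>The left side is the x-derivative of \<open>pB\<close>. In the moving frame it equals
  \<open>Xb\<close> minus \<open>pA\<close> times the speed \<open>\<eta> c (m + t^2) d1\<close> of
  the frame along the geodesic. Terms with \<open>\<kappa>\<close> and terms with \<open>c\<close>
  are compared separately, in \<open>k\<close> and \<open>cc\<close>.\<close>

lemma B_deriv:
 "- \<e> * b * \<kappa> * (1 - q^2) * d * d1 * (s^2 + t * ((1 + \<e> * m)^2 * t - 2 * c^2 * (m + t^2) * t) + 2 * \<e> * t^2 * s^2 * (q^2 * d + d1))
  = Xb - pA * (\<eta> * c * (m + t^2) * d1)"
proof -
 define u p W where "u = 1 + \<e> * m" and "p = m + t^2" and "W = 1 - q^2"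
 have 1: "- \<e> * \<kappa> * (s^2 + t * ((1 + \<e> * m)^2 * t - 2 * c^2 * (m + t^2) * t) + 2 * \<e> * t^2 * s^2 * (q^2 * d + d1))
  = - 2 * \<e> * \<kappa> * u^2 * t^2 + \<e> * c * p^2 + 2 * \<e> * c * p * t^2 - 2 * t^2 * (\<kappa> * u^2 * t^2 - c * p^2) * (q^2 * d + d1)"
  unfolding s2 u_def p_def using ck ee by algebra
 have 2: "pA * (\<eta> * c * p * d1) = b * ((1 - \<e> * m) * c * p * d1 - 2 * \<e> * u * (c - \<e> * \<kappa>) * p * t^2 * W * d * d1^2)"
 proof -
  have "pA * (\<eta> * c * p * d1) = \<eta> * c * p * d1 - \<e> * b * u * \<eta>^2 * t^2 * W * d * d1^2 * c * p / 2"
   unfolding pA_def u_def W_def by algebra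
  also have "\<dots> = b * ((1 - \<e> * m) * c * p * d1 - 2 * \<e> * u * (c - \<e> * \<kappa>) * p * t^2 * W * d * d1^2)"
   unfolding eta2 unfolding eta using ck by algebra
  finally show ?thesis .
 qed
 have k: "d * d1 * (- 2 * \<e> * \<kappa> * u^2 * t^2 - 2 * t^2 * \<kappa> * u^2 * t^2 * (q^2 * d + d1)) + 2 * u * \<kappa> * p * t^2 * d * d1^2
   = d^2 * d1 * (- 2 * \<e> * u * \<kappa> * t^2 * (1 + m * t^2 * q^2))"
 proof -
  have "- \<e> * u - u * t^2 * (q^2 * d + d1) + p * d1 = - \<e> * (1 + m * t^2 * q^2) * d"
   unfolding u_def p_def using d d1 ee by algebra
  then show ?thesis by algebra
 qed
 have cc: "W * d * d1 * (p^2 * \<e> + 2 * \<e> * p * t^2 + 2 * t^2 * p^2 * (q^2 * d + d1)) + (1 - \<e> * m) * p * d1 - 2 * \<e> * u * p * t^2 * W * d * d1^2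
   = d^2 * d1 * (p * (1 + \<e> * t^2) * W * (1 + m * t^2 * q^2) + (1 - \<e> * m) * (1 - \<e> * t^2)^2 * p * q^2)"
 proof -
  have "W * (p * \<e> + 2 * \<e> * t^2) * d + 2 * t^2 * p * W * q^2 * d^2 + (1 - \<e> * m) + (2 * t^2 * p - 2 * \<e> * u * t^2) * W * d * d1
   = d^2 * ((1 + \<e> * t^2) * W * (1 + m * t^2 * q^2) + (1 - \<e> * m) * (1 - \<e> * t^2)^2 * q^2)"
  proof -
   have "(2 * t^2 * p - 2 * \<e> * u * t^2) * d1 = - 2 * \<e> * t^2"
    unfolding u_def p_def using d1 ee by algebra
   then have "W * (p * \<e> + 2 * \<e> * t^2) * d + 2 * t^2 * p * W * q^2 * d^2 + (1 - \<e> * m) + (2 * t^2 * p - 2 * \<e> * u * t^2) * W * d * d1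
    = W * p * \<e> * d + 2 * t^2 * p * W * q^2 * d^2 + (1 - \<e> * m)" by algebra
   also have "\<dots> = d^2 * (W * p * \<e> * (1 - \<e> * t^2 * q^2) + 2 * t^2 * p * W * q^2 + (1 - \<e> * m) * (1 - \<e> * t^2 * q^2)^2)"
    using d by algebra
   also have "\<dots> = d^2 * ((1 + \<e> * t^2) * W * (1 + m * t^2 * q^2) + (1 - \<e> * m) * (1 - \<e> * t^2)^2 * q^2)"
   proof -
    have "W * p * \<e> * (1 - \<e> * t^2 * q^2) + 2 * t^2 * p * W * q^2 + (1 - \<e> * m) * (1 - \<e> * t^2 * q^2)^2 =
     (1 + \<e> * t^2) * W * (1 + m * t^2 * q^2) + (1 - \<e> * m) * (1 - \<e> * t^2)^2 * q^2"
     unfolding W_def p_def using ee by algebra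
    then show ?thesis by simp
   qed
   finally show ?thesis .
  qed
  then show ?thesis by algebra
 qed
 have "- \<e> * b * \<kappa> * (1 - q^2) * d * d1 * (s^2 + t * ((1 + \<e> * m)^2 * t - 2 * c^2 * (m + t^2) * t) + 2 * \<e> * t^2 * s^2 * (q^2 * d + d1))
   = b * W * d * d1 * (- 2 * \<e> * \<kappa> * u^2 * t^2 + \<e> * c * p^2 + 2 * \<e> * c * p * t^2 - 2 * t^2 * (\<kappa> * u^2 * t^2 - c * p^2) * (q^2 * d + d1))"
  unfolding 1[symmetric] W_def by algebra
 also have "\<dots> = Xb - pA * (\<eta> * c * p * d1)"
  unfolding 2 Xb_def W_def[symmetric] p_def[symmetric] u_def[symmetric] using k cc ee by algebra
 finally show ?thesis unfolding p_def .
qed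

end

section \<open>The parameters and the profile functions\<close>

locale delaunay =
 fixes \<e> H \<tau> :: real
 assumes eps: "\<e> \<in> {-1, 1}" and H: "H > 0" and disc: "4 * H^2 + \<e> > 0"
  and tau: "1 / (sqrt (4 * H^2 + \<e>) + 2 * H) \<le> \<tau>" "\<tau> < 1 / sqrt (4 * H^2 + \<e>)"
begin

definition "c = sqrt (4 * H^2 + \<e>)"
text \<open>Chosen so that \<open>c (\<tau> + \<sigma>) = 1 + \<e> \<tau> \<sigma>\<close>, the
  relation that turns the equation of the profile into
  \<open>t'^2 = c^2 (\<tau>^2 - t^2) (t^2 - \<sigma>^2)\<close>.\<close>

definition "\<sigma> = (1 - c * \<tau>) / (c - \<e> * \<tau>)"
definition "m = \<tau> * \<sigma>"
definition "\<eta> = 4 * H / c"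
definition "b = \<eta> / (1 - \<e> * m)"

lemma ee: "\<e> * \<e> = 1" using eps by auto

lemma c_pos: "c > 0" and c2: "c^2 = 4 * H^2 + \<e>"
 using disc by (simp_all add: c_def)

lemma tau_pos: "\<tau> > 0" and tau_lt: "c * \<tau> < 1" and tau_ge: "1 \<le> \<tau> * (c + 2 * H)"
proof -
 have p: "c + 2 * H > 0" using c_pos H by simp
 have t: "1 / (c + 2 * H) \<le> \<tau>" "\<tau> < 1 / c" using tau by (simp_all add: c_def)
 show "\<tau> > 0" using t(1) p by (meson divide_pos_pos less_le_trans zero_less_one)
 show "c * \<tau> < 1" using t(2) c_pos by (simp add: field_simps)
 show "1 \<le> \<tau> * (c + 2 * H)" using t(1) p by (simp add: divide_le_eq)
qed

lemma tau_lt1: "\<e> = 1 ==> \<tau> < 1" and c_gt1: "\<e> = 1 ==> c > 1"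
proof -
 assume e: "\<e> = 1"
 have "1^2 < c^2" using c2 e H by simp
 then show c: "c > 1" by (rule power2_less_imp_less) (use c_pos in simp)
 have "\<tau> * 1 < \<tau> * c" using tau_pos c by simp
 then show "\<tau> < 1" using tau_lt by (simp add: mult.commute)
qed

lemma den_pos: "c - \<e> * \<tau> > 0"
proof (cases "\<e> = 1")
 case True
 then show ?thesis using tau_lt1[OF True] c_gt1[OF True] by simp
next
 case False
 then show ?thesis using eps c_pos tau_pos by simp
qed

lemma sigma_pos: "\<sigma> > 0"
 using den_pos tau_lt by (simp add: \<sigma>_def)

lemma sigma_eq: "\<sigma> * (c - \<e> * \<tau>) = 1 - c * \<tau>"
 using den_pos by (simp add: \<sigma>_def)

lemma sum_eq: "c * (\<tau> + \<sigma>) = 1 + \<e> * m"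
 using sigma_eq unfolding m_def by algebra

text \<open>After multiplication by \<open>c - \<e> \<tau>\<close> the claim is
  \<open>\<e> \<tau>^2 - 2 c \<tau> + 1 \<le> 0\<close>, whose roots are the reciprocals of
  \<open>c + 2H\<close> and \<open>c - 2H\<close> because \<open>c^2 - 4 H^2 = \<e>\<close>.\<close>

lemma sigma_le: "\<sigma> \<le> \<tau>"
proof -
 have key: "\<e> * \<tau>^2 - 2 * c * \<tau> + 1 \<le> 0"
 proof (cases "\<e> = 1")
  case True
  have f: "\<e> * \<tau>^2 - 2 * c * \<tau> + 1 = (\<tau> * (c + 2 * H) - 1) * (\<tau> * (c - 2 * H) - 1)"
   using True c2 by algebra
  have "\<tau> * (c - 2 * H) \<le> 1" using tau_lt tau_pos H by (smt (verit) mult.commute mult_left_mono)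
  then show ?thesis unfolding f using tau_ge by (simp add: mult_nonneg_nonpos)
 next
  case False
  then have e: "\<e> = -1" using eps by auto
  have f: "\<e> * \<tau>^2 - 2 * c * \<tau> + 1 = (\<tau> * (c + 2 * H) - 1) * (\<tau> * (c - 2 * H) - 1)"
   using e c2 by algebra
  have "c < 2 * H"
   by (rule power_less_imp_less_base[where n = 2]) (use c2 e H in auto)
  then have "\<tau> * (c - 2 * H) \<le> 1" using tau_pos by (smt (verit) mult_pos_neg)
  then show ?thesis unfolding f using tau_ge by (simp add: mult_nonneg_nonpos)
 qed
 have "\<sigma> * (c - \<e> * \<tau>) \<le> \<tau> * (c - \<e> * \<tau>)"
  unfolding sigma_eq using key by (simp add: algebra_simps power2_eq_square)
 then show ?thesis using den_pos by simp
qed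

lemma m_pos: "m > 0" using tau_pos sigma_pos by (simp add: m_def)

lemma m_lt1: "m < 1"
proof -
 have "m * (c - \<e> * \<tau>) = \<tau> * (1 - c * \<tau>)" using sigma_eq by (simp add: m_def mult.assoc)
 also have "\<dots> < c - \<e> * \<tau>"
 proof (cases "\<e> = 1")
  case True
  have "\<tau> * (1 - c * \<tau>) < 1 * (1 - c * \<tau>)"
   using tau_lt tau_lt1[OF True] by (intro mult_strict_right_mono) auto
  also have "1 - c * \<tau> < c - \<tau>"
  proof -
   have "(c - 1) * (1 + \<tau>) > 0" using c_gt1[OF True] tau_pos by simp
   then show ?thesis by (simp add: algebra_simps)
  qed
  finally show ?thesis using True by simp
 next
  case False
  then have e: "\<e> = -1" using eps by auto
  have "\<tau> * (1 - c * \<tau>) \<le> \<tau> * 1" using tau_pos c_pos by (intro mult_left_mono) simp_all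
  then show ?thesis using e c_pos by simp
 qed
 finally have "m * (c - \<e> * \<tau>) < 1 * (c - \<e> * \<tau>)" by simp
 then show ?thesis using den_pos by (simp only: mult_less_cancel_right_pos)
qed

lemma em_pos: "1 - \<e> * m > 0" "1 + \<e> * m > 0"
 using eps m_lt1 m_pos by auto

lemma eta_pos: "\<eta> > 0" and b_pos: "b > 0"
 using H c_pos em_pos by (simp_all add: \<eta>_def b_def)

lemma eta_b: "\<eta> = b * (1 - \<e> * m)" using em_pos by (simp add: b_def)

lemma eta2: "\<eta>^2 = 4 * (1 - \<e> * (1/c)^2)"
proof -
 have "c^2 * \<eta>^2 = 16 * H^2" using c_pos by (simp add: \<eta>_def power_divide)
 also have "\<dots> = 4 * (c^2 - \<e>)" using c2 by simp
 finally show ?thesis using c_pos by (simp add: field_simps)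
qed

text \<open>The profile \<open>t\<close> oscillates between \<open>\<sigma>\<close> and \<open>\<tau>\<close>; the functions \<open>sn\<close>, \<open>cn\<close>, \<open>dn\<close> are Jacobi's, with modulus \<open>m\<close>.\<close>

definition "rad s = sqrt (\<tau>^2 * (cos s)^2 + \<sigma>^2 * (sin s)^2)"
definition "phi = amp (%s. c * rad s)"
definition "tt x = rad (phi x)"
definition "ts x = - (c * (\<tau>^2 - \<sigma>^2) * sin (phi x) * cos (phi x))"
definition "delta s = sqrt (1 - m^2 * (sin s)^2)"
definition "psi = amp delta"
definition "sn y = sin (psi y)"
definition "cn y = cos (psi y)"
definition "dn y = delta (psi y)"
text \<open>The parameter, along the fixed geodesic, of the frame in which the surface is written at
  \<open>x\<close>.\<close>

definition "II = (SOME G. G 0 = 0 & (\<forall>x. (G has_real_derivative \<eta> * c * (m + (tt x)^2) / (1 - \<e> * (tt x)^2)) (at x)))"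

lemma rad2: "(rad s)^2 = \<tau>^2 * (cos s)^2 + \<sigma>^2 * (sin s)^2"
 by (simp add: rad_def)

lemma rad_bounds: "\<sigma> \<le> rad s" "rad s \<le> \<tau>"
proof -
 have s2: "\<sigma>^2 \<le> \<tau>^2" using sigma_le sigma_pos by (simp add: power_mono)
 have a: "\<sigma>^2 * (cos s)^2 \<le> \<tau>^2 * (cos s)^2" "\<sigma>^2 * (sin s)^2 \<le> \<tau>^2 * (sin s)^2"
  using s2 by (simp_all add: mult_right_mono)
 have b: "\<sigma>^2 * (cos s)^2 + \<sigma>^2 * (sin s)^2 = \<sigma>^2" "\<tau>^2 * (cos s)^2 + \<tau>^2 * (sin s)^2 = \<tau>^2"
  by (simp_all flip: distrib_left)
 have "\<sigma>^2 \<le> (rad s)^2" "(rad s)^2 \<le> \<tau>^2" unfolding rad2 using a b by linarith+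
 moreover have "rad s \<ge> 0" by (simp add: rad_def)
 ultimately show "\<sigma> \<le> rad s" "rad s \<le> \<tau>"
  using sigma_pos tau_pos by (auto intro: power2_le_imp_le)
qed

lemma rad_pos: "rad s > 0" using rad_bounds(1)[of s] sigma_pos by simp

lemma delta2: "(delta s)^2 = 1 - m^2 * (sin s)^2" and delta_bounds: "sqrt (1 - m^2) \<le> delta s" "delta s \<le> 1"
proof -
 have m2: "m^2 < 1" using m_lt1 m_pos by (simp add: power_less_one_iff)
 have "m^2 * (sin s)^2 \<le> m^2 * 1" by (intro mult_left_mono) (simp_all add: abs_square_le_1)
 then show "(delta s)^2 = 1 - m^2 * (sin s)^2" "sqrt (1 - m^2) \<le> delta s" "delta s \<le> 1"
  using m2 by (simp_all add: delta_def)
qed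

lemma delta_pos: "delta s > 0"
proof -
 have "m^2 < 1" using m_lt1 m_pos by (simp add: power_less_one_iff)
 then have "sqrt (1 - m^2) > 0" by simp
 then show ?thesis using delta_bounds(1)[of s] by (rule less_le_trans)
qed

sublocale ph: bounded_speed "%s. c * rad s" "c * \<sigma>" "c * \<tau>"
proof
 show "continuous_on UNIV (%s. c * rad s)" unfolding rad_def by (intro continuous_intros)
 show "0 < c * \<sigma>" using c_pos sigma_pos by simp
 show "c * \<sigma> \<le> c * rad s" "c * rad s \<le> c * \<tau>" for s
  using c_pos rad_bounds[of s] by simp_all
qed

sublocale ps: bounded_speed delta "sqrt (1 - m^2)" 1
proof
 show "continuous_on UNIV delta" unfolding delta_def by (intro continuous_intros)
 show "0 < sqrt (1 - m^2)" using m_lt1 m_pos by (simp add: power_less_one_iff)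
 show "sqrt (1 - m^2) \<le> delta s" "delta s \<le> 1" for s by (rule delta_bounds)+
qed

lemma phi_deriv: "(phi has_real_derivative c * tt x) (at x)"
 using ph.amp(2) by (simp add: phi_def tt_def)

lemma psi_deriv: "(psi has_real_derivative dn y) (at y)"
 using ps.amp(2) by (simp add: psi_def dn_def)

lemma tt_pos: "tt x > 0" and tt_bounds: "\<sigma> \<le> tt x" "tt x \<le> \<tau>"
 using rad_pos rad_bounds by (simp_all add: tt_def)

lemma dn_pos: "dn y > 0" by (simp add: dn_def delta_pos)

lemma dn2: "(dn y)^2 = 1 - m^2 * (sn y)^2" by (simp add: dn_def sn_def delta2)

lemma cn2: "(cn y)^2 = 1 - (sn y)^2" by (simp add: cn_def sn_def cos_squared_eq)

lemma sn_deriv: "(sn has_real_derivative cn y * dn y) (at y)"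
 unfolding sn_def[abs_def] cn_def by (auto intro!: derivative_eq_intros psi_deriv)

lemma cn_deriv: "(cn has_real_derivative - (sn y * dn y)) (at y)"
 unfolding cn_def[abs_def] sn_def by (auto intro!: derivative_eq_intros psi_deriv)

lemma dn_deriv: "(dn has_real_derivative - (m^2 * sn y * cn y)) (at y)"
proof -
 have q: "sqrt (1 - m^2 * (sn y)^2) = dn y" by (simp add: dn_def delta_def sn_def)
 have "((%y. 1 - m^2 * (sn y)^2) has_real_derivative - (m^2 * (2 * sn y * (cn y * dn y)))) (at y)"
  by (auto intro!: derivative_eq_intros sn_deriv)
 moreover have "0 < 1 - m^2 * (sn y)^2" unfolding dn2[symmetric] using dn_pos[of y] by simp
 ultimately have "((%y. sqrt (1 - m^2 * (sn y)^2)) has_real_derivative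
   inverse (dn y) / 2 * - (m^2 * (2 * sn y * (cn y * dn y)))) (at y)"
  unfolding q[symmetric] by (intro DERIV_chain2[OF DERIV_real_sqrt])
 then have "((%y. sqrt (1 - m^2 * (sn y)^2)) has_real_derivative - (m^2 * sn y * cn y)) (at y)"
  by (rule DERIV_cong) (use dn_pos[of y] in \<open>simp add: field_simps\<close>)
 moreover have "dn = (%y. sqrt (1 - m^2 * (sn y)^2))" by (simp add: fun_eq_iff dn_def delta_def sn_def)
 ultimately show ?thesis by simp
qed

lemma r_deriv: "((%y. cn y * dn y) has_real_derivative - (1 + m^2) * sn y + 2 * m^2 * (sn y)^3) (at y)"
proof -
 have eq: "- (sn y * dn y) * dn y + - (m^2 * sn y * cn y) * cn y = - (1 + m^2) * sn y + 2 * m^2 * (sn y)^3"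
  using dn2[of y] cn2[of y] by algebra
 show ?thesis by (rule DERIV_cong[OF DERIV_mult[OF cn_deriv dn_deriv] eq])
qed

lemma tt2: "(tt x)^2 = \<tau>^2 * (cos (phi x))^2 + \<sigma>^2 * (sin (phi x))^2"
 by (simp add: tt_def rad2)

lemma tt_deriv: "(tt has_real_derivative ts x) (at x)"
proof -
 have "((%x. sqrt (\<tau>^2 * (cos (phi x))^2 + \<sigma>^2 * (sin (phi x))^2)) has_real_derivative ts x) (at x)"
  using tt_pos[of x] unfolding ts_def
  by (auto intro!: derivative_eq_intros phi_deriv simp: tt_def rad_def divide_simps)
    (simp add: algebra_simps power2_eq_square)
 moreover have "tt = (%x. sqrt (\<tau>^2 * (cos (phi x))^2 + \<sigma>^2 * (sin (phi x))^2))"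
  by (simp add: fun_eq_iff tt_def rad_def)
 ultimately show ?thesis by simp
qed

text \<open>The amplitude form gives \<open>c^2 (\<tau>^2 - t^2) (t^2 - \<sigma>^2)\<close>, which
  \<open>sum_eq\<close> rewrites. In classical terms \<open>t\<close> is \<open>\<tau>\<close> times
  Jacobi's dn at \<open>c \<tau> x\<close>, of modulus
  \<open>sqrt (1 - \<sigma>^2 / \<tau>^2)\<close>; it is constant if
  \<open>\<sigma> = \<tau>\<close>.\<close>

lemma ts2: "(ts x)^2 = (1 + \<e> * m)^2 * (tt x)^2 - c^2 * (m + (tt x)^2)^2"
proof -
 have "(ts x)^2 = c^2 * (\<tau>^2 - \<sigma>^2)^2 * (sin (phi x))^2 * (cos (phi x))^2"
  by (simp add: ts_def power_mult_distrib)
 also have "\<dots> = c^2 * (\<tau>^2 - (tt x)^2) * ((tt x)^2 - \<sigma>^2)"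
  unfolding tt2 using sin_squared_eq[of "phi x"] by algebra
 also have "\<dots> = (1 + \<e> * m)^2 * (tt x)^2 - c^2 * (m + (tt x)^2)^2"
  unfolding sum_eq[symmetric] unfolding m_def by algebra
 finally show ?thesis .
qed

lemma ts_deriv: "(ts has_real_derivative (1 + \<e> * m)^2 * tt x - 2 * c^2 * (m + (tt x)^2) * tt x) (at x)"
proof -
 have k: "(\<tau>^2 - \<sigma>^2) * ((cos (phi x))^2 - (sin (phi x))^2) = 2 * (tt x)^2 - \<tau>^2 - \<sigma>^2"
  using tt2[of x] sin_squared_eq[of "phi x"] by algebra
 have "- (c * (\<tau>^2 - \<sigma>^2) * (cos (phi x) * (c * tt x)) * cos (phi x) + - (sin (phi x) * (c * tt x)) * (c * (\<tau>^2 - \<sigma>^2) * sin (phi x)))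
  = - (c^2 * ((\<tau>^2 - \<sigma>^2) * ((cos (phi x))^2 - (sin (phi x))^2)) * tt x)"
  by algebra
 also have "\<dots> = (1 + \<e> * m)^2 * tt x - 2 * c^2 * (m + (tt x)^2) * tt x"
  unfolding k sum_eq[symmetric] unfolding m_def by algebra
 finally have eq: "- (c * (\<tau>^2 - \<sigma>^2) * (cos (phi x) * (c * tt x)) * cos (phi x) + - (sin (phi x) * (c * tt x)) * (c * (\<tau>^2 - \<sigma>^2) * sin (phi x)))
  = (1 + \<e> * m)^2 * tt x - 2 * c^2 * (m + (tt x)^2) * tt x" .
 show ?thesis unfolding ts_def[abs_def] eq[symmetric]
  by (auto intro!: derivative_eq_intros phi_deriv simp: algebra_simps)
qed

lemma D1_pos: "1 - \<e> * (tt x)^2 > 0"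
proof (cases "\<e> = 1")
 case True
 have "tt x < 1" using tt_bounds(2)[of x] tau_lt1[OF True] by simp
 then show ?thesis using True tt_pos[of x] by (simp add: power_less_one_iff)
next
 case False
 then have "\<e> = -1" using eps by auto
 then show ?thesis by (simp add: add_pos_nonneg)
qed

lemma sn_le: "(sn y)^2 \<le> 1" by (simp add: sn_def abs_square_le_1)

lemma D_pos: "1 - \<e> * (tt x)^2 * (sn y)^2 > 0"
proof (cases "\<e> = 1")
 case True
 have "(tt x)^2 * (sn y)^2 \<le> (tt x)^2 * 1" using sn_le by (intro mult_left_mono) auto
 then show ?thesis using True D1_pos[of x] by simp
next
 case False
 then have "\<e> = -1" using eps by auto
 then show ?thesis by (simp add: add_pos_nonneg)
qed

lemma E_pos: "1 + \<e> * m * (sn y)^2 > 0"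
proof -
 have "m * (sn y)^2 \<le> m * 1" using sn_le m_pos by (intro mult_left_mono) auto
 moreover have "m * (sn y)^2 \<ge> 0" using m_pos by simp
 ultimately show ?thesis using eps m_lt1 by auto
qed

lemma II: "II 0 = 0" "(II has_real_derivative \<eta> * c * (m + (tt x)^2) / (1 - \<e> * (tt x)^2)) (at x)"
proof -
 have ct: "continuous_on UNIV tt" using tt_deriv by (meson DERIV_continuous_on has_field_derivative_at_within)
 have "1 - \<e> * (tt x)^2 \<noteq> 0" for x using D1_pos[of x] by simp
 then have "continuous_on UNIV (%x. \<eta> * c * (m + (tt x)^2) / (1 - \<e> * (tt x)^2))"
  by (intro continuous_intros ct) simp
 from antiderivative_real[OF this]
 have "\<exists>G. G 0 = 0 & (\<forall>x. (G has_real_derivative \<eta> * c * (m + (tt x)^2) / (1 - \<e> * (tt x)^2)) (at x))" by metis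
 from someI_ex[OF this]
 show "II 0 = 0" "(II has_real_derivative \<eta> * c * (m + (tt x)^2) / (1 - \<e> * (tt x)^2)) (at x)"
  unfolding II_def by simp_all
qed

end

section \<open>Circular and hyperbolic functions in one notation, and the moving frame\<close>

lemma gsin_deriv: "\<e> \<in> {-1, 1} ==> (gsin \<e> has_real_derivative gcos \<e> x) (at x)"
 and gcos_deriv: "\<e> \<in> {-1, 1} ==> (gcos \<e> has_real_derivative - (\<e> * gsin \<e> x)) (at x)"
proof -
 assume "\<e> \<in> {-1, 1}"
 then have "\<e> = -1 \<or> \<e> = 1" by auto
 then show "(gsin \<e> has_real_derivative gcos \<e> x) (at x)" "(gcos \<e> has_real_derivative - (\<e> * gsin \<e> x)) (at x)"
  by (auto simp: gsin_def[abs_def] gcos_def[abs_def] intro!: derivative_eq_intros)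
qed

lemma gcos_gsin: "\<e> \<in> {-1, 1} ==> (gcos \<e> x)^2 + \<e> * (gsin \<e> x)^2 = 1"
 by (auto simp: gsin_def gcos_def cosh_square_eq)

lemma gcos_0 [simp]: "gcos \<e> 0 = 1" and gsin_0 [simp]: "gsin \<e> 0 = 0"
 and gcos_minus [simp]: "gcos \<e> (- x) = gcos \<e> x" and gsin_minus [simp]: "gsin \<e> (- x) = - gsin \<e> x"
 by (simp_all add: gcos_def gsin_def)

lemma gcos_add: "\<e> \<in> {-1, 1} ==> gcos \<e> (x + y) = gcos \<e> x * gcos \<e> y - \<e> * gsin \<e> x * gsin \<e> y"
 and gsin_add: "\<e> \<in> {-1, 1} ==> gsin \<e> (x + y) = gsin \<e> x * gcos \<e> y + gcos \<e> x * gsin \<e> y"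
 by (auto simp: gcos_def gsin_def cos_add sin_add cosh_add sinh_add)

lemma smooth_on_gsin: "smooth_on (gsin \<e>) UNIV" and smooth_on_gcos: "smooth_on (gcos \<e>) UNIV"
 using smooth_on_sin_cos smooth_on_sinh_cosh
 by (cases "\<e> = 1"; simp add: gsin_def[abs_def] gcos_def[abs_def])+

text \<open>
 Coordinates with respect to the moving frame given by the point with parameter \<open>\<theta>\<close> of a fixed
 geodesic, its velocity and the constant normal vector.
\<close>

definition vE :: "real => real => real => real => real => real^3" where
 "vE \<e> \<theta> a b w = (a * gsin \<e> \<theta> + b * gcos \<e> \<theta>) *\<^sub>R axis 1 1 + w *\<^sub>R axis 2 1 +
   (a * gcos \<e> \<theta> - \<e> * b * gsin \<e> \<theta>) *\<^sub>R axis 3 1"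

lemma vE_nth [simp]: "vE \<e> \<theta> a b w $ 1 = a * gsin \<e> \<theta> + b * gcos \<e> \<theta>" "vE \<e> \<theta> a b w $ 2 = w"
 "vE \<e> \<theta> a b w $ 3 = a * gcos \<e> \<theta> - \<e> * b * gsin \<e> \<theta>"
 by (simp_all add: vE_def axis_def)

lemma vE_scaleR: "k *\<^sub>R vE \<e> \<theta> a b w = vE \<e> \<theta> (k * a) (k * b) (k * w)"
 and vE_add: "vE \<e> \<theta> a b w + vE \<e> \<theta> a' b' w' = vE \<e> \<theta> (a + a') (b + b') (w + w')"
 and vE_diff: "vE \<e> \<theta> a b w - vE \<e> \<theta> a' b' w' = vE \<e> \<theta> (a - a') (b - b') (w - w')"
 and vE_zero: "vE \<e> \<theta> 0 0 0 = 0"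
 by (simp_all add: vec_eq_iff forall_3 algebra_simps)

lemma mform_vE:
 assumes "\<e> \<in> {-1, 1}"
 shows "mform \<e> (vE \<e> \<theta> a b w) (vE \<e> \<theta> a' b' w') = \<e> * a * a' + b * b' + w * w'"
proof -
 have ee: "\<e> * \<e> = 1" using assms by auto
 show ?thesis unfolding mform_def vE_nth using gcos_gsin[OF assms, of \<theta>] ee by algebra
qed

text \<open>The frame turns with \<open>\<theta>\<close>: the derivative of its first vector is
  \<open>\<theta>'\<close> times the second, that of the second is \<open>- \<e> \<theta>'\<close>
  times the first.\<close>

lemma vE_has_derivative:
 assumes e: "\<e> \<in> {-1, 1}" and \<theta>: "(\<theta> has_derivative \<theta>') (at u)" and a: "(a has_derivative a') (at u)"
  and b: "(b has_derivative b') (at u)" and w: "(w has_derivative w') (at u)"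
 shows "((%u. vE \<e> (\<theta> u) (a u) (b u) (w u)) has_derivative
  (%v. vE \<e> (\<theta> u) (a' v - \<e> * b u * \<theta>' v) (b' v + a u * \<theta>' v) (w' v))) (at u)"
proof -
 note s = DERIV_compose_FDERIV[OF gsin_deriv[OF e] \<theta>] and c = DERIV_compose_FDERIV[OF gcos_deriv[OF e] \<theta>]
 have "((%u. (a u * gsin \<e> (\<theta> u) + b u * gcos \<e> (\<theta> u)) *\<^sub>R (axis 1 1 :: real^3) + w u *\<^sub>R axis 2 1 +
   (a u * gcos \<e> (\<theta> u) - \<e> * b u * gsin \<e> (\<theta> u)) *\<^sub>R axis 3 1) has_derivative
   (%v. ((a u * (\<theta>' v * gcos \<e> (\<theta> u)) + a' v * gsin \<e> (\<theta> u)) + (b u * (\<theta>' v * - (\<e> * gsin \<e> (\<theta> u))) + b' v * gcos \<e> (\<theta> u))) *\<^sub>R axis 1 1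
    + w' v *\<^sub>R axis 2 1 +
    ((a u * (\<theta>' v * - (\<e> * gsin \<e> (\<theta> u))) + a' v * gcos \<e> (\<theta> u)) - (\<e> * b u * (\<theta>' v * gcos \<e> (\<theta> u)) + \<e> * b' v * gsin \<e> (\<theta> u))) *\<^sub>R axis 3 1)) (at u)"
  by (intro has_derivative_add has_derivative_diff has_derivative_scaleR_left has_derivative_mult
    has_derivative_mult_right s c a b w)
 then have "((%u. vE \<e> (\<theta> u) (a u) (b u) (w u)) has_derivative
   (%v. ((a u * (\<theta>' v * gcos \<e> (\<theta> u)) + a' v * gsin \<e> (\<theta> u)) + (b u * (\<theta>' v * - (\<e> * gsin \<e> (\<theta> u))) + b' v * gcos \<e> (\<theta> u))) *\<^sub>R axis 1 1
    + w' v *\<^sub>R axis 2 1 +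
    ((a u * (\<theta>' v * - (\<e> * gsin \<e> (\<theta> u))) + a' v * gcos \<e> (\<theta> u)) - (\<e> * b u * (\<theta>' v * gcos \<e> (\<theta> u)) + \<e> * b' v * gsin \<e> (\<theta> u))) *\<^sub>R axis 3 1)) (at u)"
  unfolding vE_def .
 moreover have "(%v. ((a u * (\<theta>' v * gcos \<e> (\<theta> u)) + a' v * gsin \<e> (\<theta> u)) + (b u * (\<theta>' v * - (\<e> * gsin \<e> (\<theta> u))) + b' v * gcos \<e> (\<theta> u))) *\<^sub>R (axis 1 1 :: real^3)
    + w' v *\<^sub>R axis 2 1 +
    ((a u * (\<theta>' v * - (\<e> * gsin \<e> (\<theta> u))) + a' v * gcos \<e> (\<theta> u)) - (\<e> * b u * (\<theta>' v * gcos \<e> (\<theta> u)) + \<e> * b' v * gsin \<e> (\<theta> u))) *\<^sub>R axis 3 1) =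
   (%v. vE \<e> (\<theta> u) (a' v - \<e> * b u * \<theta>' v) (b' v + a u * \<theta>' v) (w' v))"
  by (rule ext) (simp add: vec_eq_iff forall_3 axis_def algebra_simps)
 ultimately show ?thesis by simp
qed

lemma smooth_on_vE:
 assumes "open U" "smooth_on \<theta> U" "smooth_on a U" "smooth_on b U" "smooth_on w U"
 shows "smooth_on (%u. vE \<e> (\<theta> u) (a u) (b u) (w u)) U"
proof -
 have "smooth_on (%u. gsin \<e> (\<theta> u)) U" "smooth_on (%u. gcos \<e> (\<theta> u)) U"
  using smooth_on_compose_real[OF smooth_on_gsin assms(1) open_UNIV _ assms(2)]
   smooth_on_compose_real[OF smooth_on_gcos assms(1) open_UNIV _ assms(2)] by simp_all
 then show ?thesis unfolding vE_def
  by (intro smooth_on_add smooth_on_diff smooth_on_scaleR smooth_on_mult smooth_on_const assms)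
qed

lemma smooth_on_Pair:
 fixes f :: "'a::euclidean_space => 'b::real_normed_vector"
 assumes U: "open U" and f: "smooth_on f U" and g: "smooth_on g U"
 shows "smooth_on (%u. (f u, g u :: real)) U"
proof -
 have "smooth_on (%u. (f u, 0::real)) U"
 proof -
  have "Ck_on k f U ==> Ck_on k (%u. (f u, 0::real)) U" for k
  proof (induction k arbitrary: f)
   case 0
   then show ?case by (auto intro!: continuous_intros)
  next
   case (Suc k)
   show ?case
   proof (rule Ck_on_SucI[OF U, where f' = "%u v. (frechet_derivative f (at u) v, 0::real)"])
    show "((%u. (f u, 0::real)) has_derivative (%v. (frechet_derivative f (at u) v, 0::real))) (at u)" if "u \<in> U" for u
     using Suc.prems that by (intro has_derivative_Pair has_derivative_const) (simp add: frechet_derivative_works)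
    show "Ck_on k (%u. (frechet_derivative f (at u) v, 0::real)) U" for v
     using Suc.IH[of "%u. frechet_derivative f (at u) v"] Suc.prems by simp
   qed
  qed
  then show ?thesis using f by (simp add: smooth_on_def)
 qed
 moreover have "smooth_on (%u. g u *\<^sub>R (0 :: 'b, 1 :: real)) U"
  by (intro smooth_on_scaleR U g smooth_on_const)
 ultimately have "smooth_on (%u. (f u, 0) + g u *\<^sub>R (0 :: 'b, 1 :: real)) U" by (rule smooth_on_add[OF U])
 then show ?thesis by simp
qed

text \<open>One name for the primitive of \<open>1 / (1 - \<e> z^2)\<close> that vanishes at
  0.\<close>

definition hinv :: "real => real => real" where
 "hinv \<e> z = (if \<e> = 1 then artanh z else arctan z)"

lemma hinv_deriv:
 assumes "\<e> \<in> {-1, 1}" "1 - \<e> * z^2 > 0"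
 shows "(hinv \<e> has_real_derivative 1 / (1 - \<e> * z^2)) (at z)"
proof (cases "\<e> = 1")
 case True
 then have "z^2 < 1" using assms by simp
 then have "\<bar>z\<bar> < 1" using abs_square_less_1 by blast
 then show ?thesis using True
  by (auto simp: hinv_def[abs_def] intro!: derivative_eq_intros)
next
 case False
 then have "\<e> = -1" using assms by auto
 then show ?thesis
  by (auto simp: hinv_def[abs_def] inverse_eq_divide intro!: derivative_eq_intros)
qed

lemma smooth_on_hinv: "\<e> \<in> {-1, 1} ==> smooth_on (hinv \<e>) {z. 1 - \<e> * z^2 > 0}"
proof (cases "\<e> = 1")
 case True
 have "{z. 1 - \<e> * z^2 > 0} = {-1<..<1::real}"
  using True by (auto simp: abs_square_less_1 abs_less_iff)
 then show ?thesis using smooth_on_artanh True by (simp add: hinv_def[abs_def])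
next
 case False
 then show ?thesis using smooth_on_subset[OF smooth_on_arctan] by (simp add: hinv_def[abs_def])
qed

text \<open>Keeps derivatives in the form \<open>v$1 * p + v$2 * q\<close>, so that nested products
  deliver both partial derivatives, ready for comparison by \<open>algebra\<close>.\<close>

lemma has_derivative_mult_coord:
 fixes f g :: "real^2 => real"
 assumes "(f has_derivative (%v. v$1 * p + v$2 * q)) (at u)" "(g has_derivative (%v. v$1 * p' + v$2 * q')) (at u)"
 shows "((%u. f u * g u) has_derivative (%v. v$1 * (p * g u + f u * p') + v$2 * (q * g u + f u * q'))) (at u)"
 by (rule has_derivative_eq_rhs[OF has_derivative_mult[OF assms]]) (simp add: fun_eq_iff algebra_simps)

lemma has_derivative_inverse_coord:
 fixes g :: "real^2 => real"
 assumes "(g has_derivative (%v. v$1 * p + v$2 * q)) (at u)" "g u \<noteq> 0"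
 shows "((%u. inverse (g u)) has_derivative (%v. v$1 * (- p * (inverse (g u))^2) + v$2 * (- q * (inverse (g u))^2))) (at u)"
 by (rule has_derivative_eq_rhs[OF DERIV_compose_FDERIV[OF DERIV_inverse[OF assms(2)] assms(1)]])
  (simp add: fun_eq_iff algebra_simps power2_eq_square)

lemma has_derivative_coord:
 "((f::real^2 => real) has_derivative (%v. v$1 * p)) (at u) ==> (f has_derivative (%v. v$1 * p + v$2 * 0)) (at u)"
 "((f::real^2 => real) has_derivative (%v. v$2 * p)) (at u) ==> (f has_derivative (%v. v$1 * 0 + v$2 * p)) (at u)"
 "((%u::real^2. k::real) has_derivative (%v. v$1 * 0 + v$2 * 0)) (at u)"
 by simp_all

section \<open>The coordinate functions of the immersion and their derivatives\<close>

context delaunay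
begin

definition "rr y = cn y * dn y"
definition "fd x y = 1 / (1 - \<e> * (tt x)^2 * (sn y)^2)"
definition "fd1 x = 1 / (1 - \<e> * (tt x)^2)"
definition "fA x y = profile_point.pA \<e> m \<eta> b (tt x) (sn y) (fd x y) (fd1 x)"
definition "fB x y = profile_point.pB \<e> (1/c) b (tt x) (ts x) (sn y) (fd x y) (fd1 x)"
definition "fw x y = profile_point.pw b (tt x) (rr y) (fd x y)"
definition "fh x y = \<eta> * hinv \<e> (tt x * sn y)"
definition "fXa x y = profile_point.Xa \<e> m \<eta> b (tt x) (ts x) (sn y) (fd x y) (fd1 x)"
definition "fXb x y = profile_point.Xb \<e> m c (1/c) b (tt x) (sn y) (fd x y) (fd1 x)"
definition "fXc x y = profile_point.Xc \<e> b (tt x) (ts x) (sn y) (rr y) (fd x y)"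
definition "fhx x y = profile_point.hx \<eta> (ts x) (sn y) (fd x y)"
definition "fYa x y = profile_point.Ya \<e> m \<eta> b (tt x) (sn y) (rr y) (fd x y)"
definition "fYb x y = profile_point.Yb \<e> (1/c) b (tt x) (ts x) (sn y) (rr y) (fd x y)"
definition "fYc x y = profile_point.Yc \<e> m b (tt x) (sn y) (fd x y)"
definition "fhy x y = profile_point.hy \<eta> (tt x) (rr y) (fd x y)"
definition "flam x y = profile_point.lam \<e> m \<eta> (tt x) (sn y) (fd x y)"

lemma pp: "profile_point \<e> m c (1/c) \<eta> b (tt x) (ts x) (sn y) (rr y) (fd x y) (fd1 x)"
proof
 show "c * (1 / c) = 1" using c_pos by simp
 show "(rr y)^2 = (1 - (sn y)^2) * (1 - m^2 * (sn y)^2)" by (simp add: rr_def power_mult_distrib cn2 dn2)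
 show "fd x y * (1 - \<e> * (tt x)^2 * (sn y)^2) = 1" using D_pos[of x y] by (simp add: fd_def)
 show "fd1 x * (1 - \<e> * (tt x)^2) = 1" using D1_pos[of x] by (simp add: fd1_def)
qed (rule ee eta2 eta_b ts2)+

lemmas f_defs = fA_def fB_def fw_def fXa_def fXb_def fXc_def fhx_def fYa_def fYb_def fYc_def fhy_def flam_def
lemmas p_defs = profile_point.pA_def[OF pp] profile_point.pB_def[OF pp] profile_point.pw_def[OF pp]
 profile_point.Xa_def[OF pp] profile_point.Xb_def[OF pp] profile_point.Xc_def[OF pp] profile_point.hx_def[OF pp]
 profile_point.C0_def[OF pp] profile_point.Ya_def[OF pp] profile_point.Yb_def[OF pp] profile_point.Yc_def[OF pp]
 profile_point.hy_def[OF pp] profile_point.lam_def[OF pp]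

lemma coord_deriv: "((%u::real^2. u$i) has_derivative (%v. v$i)) (at u)"
 by (rule bounded_linear_imp_has_derivative) (rule bounded_linear_vec_nth)

lemma D_tt: "((%u::real^2. tt (u$1)) has_derivative (%v. v$1 * ts (u$1))) (at u)"
 by (rule DERIV_compose_FDERIV[OF tt_deriv coord_deriv])

lemma D_ts: "((%u::real^2. ts (u$1)) has_derivative
   (%v. v$1 * ((1 + \<e> * m)^2 * tt (u$1) - 2 * c^2 * (m + (tt (u$1))^2) * tt (u$1)))) (at u)"
 by (rule DERIV_compose_FDERIV[OF ts_deriv coord_deriv])

lemma D_sn: "((%u::real^2. sn (u$2)) has_derivative (%v. v$2 * rr (u$2))) (at u)"
 unfolding rr_def by (rule DERIV_compose_FDERIV[OF sn_deriv coord_deriv])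

lemma D_rr: "((%u::real^2. rr (u$2)) has_derivative (%v. v$2 * (- (1 + m^2) * sn (u$2) + 2 * m^2 * (sn (u$2))^3))) (at u)"
 unfolding rr_def by (rule DERIV_compose_FDERIV[OF r_deriv coord_deriv])

lemma D_II: "((%u::real^2. II (u$1)) has_derivative (%v. v$1 * (\<eta> * c * (m + (tt (u$1))^2) * fd1 (u$1)))) (at u)"
 using DERIV_compose_FDERIV[OF II(2) coord_deriv, of 1 u] by (simp add: fd1_def)

lemma fd_inv: "fd x y * (1 - \<e> * (tt x)^2 * (sn y)^2) = 1" "fd1 x * (1 - \<e> * (tt x)^2) = 1"
 using D_pos[of x y] D1_pos[of x] by (simp_all add: fd_def fd1_def)

lemma fd_pos: "fd x y > 0" "fd1 x > 0"
 using D_pos[of x y] D1_pos[of x] by (simp_all add: fd_def fd1_def)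

lemma D_fd: "((%u::real^2. fd (u$1) (u$2)) has_derivative (%v. v$1 * (2 * \<e> * tt (u$1) * ts (u$1) * (sn (u$2))^2 * (fd (u$1) (u$2))^2)
  + v$2 * (2 * \<e> * (tt (u$1))^2 * sn (u$2) * rr (u$2) * (fd (u$1) (u$2))^2))) (at u)"
 and D_fd1: "((%u::real^2. fd1 (u$1)) has_derivative (%v. v$1 * (2 * \<e> * tt (u$1) * ts (u$1) * (fd1 (u$1))^2))) (at u)"
proof -
 have n: "1 - \<e> * (tt (u$1))^2 * (sn (u$2))^2 \<noteq> 0" "1 - \<e> * (tt (u$1))^2 \<noteq> 0"
  using D_pos[of "u$1" "u$2"] D1_pos[of "u$1"] by simp_all
 have e: "fd x y = inverse (1 - \<e> * (tt x)^2 * (sn y)^2)" "fd1 x = inverse (1 - \<e> * (tt x)^2)" for x y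
  by (simp_all add: fd_def fd1_def inverse_eq_divide)
 have g: "((%u::real^2. 1 - \<e> * (tt (u$1))^2 * (sn (u$2))^2) has_derivative
   (%v. v$1 * (- (2 * \<e> * tt (u$1) * ts (u$1) * (sn (u$2))^2)) + v$2 * (- (2 * \<e> * (tt (u$1))^2 * sn (u$2) * rr (u$2))))) (at u)"
  by (rule derivative_eq_intros D_tt D_sn refl)+ (simp add: fun_eq_iff algebra_simps power2_eq_square)
 show "((%u::real^2. fd (u$1) (u$2)) has_derivative (%v. v$1 * (2 * \<e> * tt (u$1) * ts (u$1) * (sn (u$2))^2 * (fd (u$1) (u$2))^2)
  + v$2 * (2 * \<e> * (tt (u$1))^2 * sn (u$2) * rr (u$2) * (fd (u$1) (u$2))^2))) (at u)"
  unfolding e by (rule has_derivative_eq_rhs[OF has_derivative_inverse_coord[OF g n(1)]]) simp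
 have g: "((%u::real^2. 1 - \<e> * (tt (u$1))^2) has_derivative (%v. v$1 * (- (2 * \<e> * tt (u$1) * ts (u$1))) + v$2 * 0)) (at u)"
  by (rule derivative_eq_intros D_tt refl)+ (simp add: fun_eq_iff algebra_simps power2_eq_square)
 show "((%u::real^2. fd1 (u$1)) has_derivative (%v. v$1 * (2 * \<e> * tt (u$1) * ts (u$1) * (fd1 (u$1))^2))) (at u)"
  unfolding e by (rule has_derivative_eq_rhs[OF has_derivative_inverse_coord[OF g n(2)]]) simp
qed

lemma D_fw: "((%u::real^2. fw (u$1) (u$2)) has_derivative (%v. v$1 * fXc (u$1) (u$2) + v$2 * fYc (u$1) (u$2))) (at u)"
proof -
 note D = has_derivative_mult_coord[OF has_derivative_mult_coord[OF has_derivative_mult_coord[OF has_derivative_coord(3)[of b] has_derivative_coord(1)[OF D_tt]] has_derivative_coord(2)[OF D_rr]] D_fd]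
 have r: "(rr (u$2))^2 = (1 - (sn (u$2))^2) * (1 - m^2 * (sn (u$2))^2)"
  by (rule profile_point.r2[OF pp])
 show ?thesis
  unfolding f_defs p_defs
  by (rule has_derivative_eq_rhs[OF D])
   (rule ext, rule arg_cong2[where f = "(+)"]; rule arg_cong2[where f = "(*)", OF refl];
    use fd_inv(1)[of "u$1" "u$2"] r ee in algebra)
qed

lemma D_fh: "((%u::real^2. fh (u$1) (u$2)) has_derivative (%v. v$1 * fhx (u$1) (u$2) + v$2 * fhy (u$1) (u$2))) (at u)"
proof -
 have n: "1 - \<e> * (tt (u$1) * sn (u$2))^2 > 0"
  using D_pos[of "u$1" "u$2"] by (simp add: power_mult_distrib mult.assoc)
 note D = has_derivative_mult_coord[OF has_derivative_coord(1)[OF D_tt] has_derivative_coord(2)[OF D_sn]]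
 note D' = has_derivative_mult_right[OF DERIV_compose_FDERIV[OF hinv_deriv[OF eps n] D], of \<eta>]
 show ?thesis
  unfolding f_defs p_defs fh_def
  by (rule has_derivative_eq_rhs[OF D'])
   (simp add: fun_eq_iff fd_def power_mult_distrib mult.assoc add_divide_distrib field_simps)
qed

text \<open>The term with \<open>fB\<close> compensates the turning of the frame: it cancels against
  the one in \<open>vE_has_derivative\<close> and leaves \<open>fXa\<close>.\<close>

lemma D_fA: "((%u::real^2. fA (u$1) (u$2)) has_derivative
  (%v. v$1 * (fXa (u$1) (u$2) + \<e> * fB (u$1) (u$2) * (\<eta> * c * (m + (tt (u$1))^2) * fd1 (u$1))) + v$2 * fYa (u$1) (u$2))) (at u)"
proof -
 define k where "k = - \<e> * b * (1 + \<e> * m) * \<eta> / 2"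
 have eq: "fA x y = 1 + k * (tt x * (tt x * ((1 + - 1 * (sn y * sn y)) * (fd x y * fd1 x))))" for x y
  unfolding f_defs p_defs k_def by algebra
 have sq: "((%u::real^2. 1 + - 1 * (sn (u$2) * sn (u$2))) has_derivative (%v. v$1 * 0 + v$2 * (- 2 * sn (u$2) * rr (u$2)))) (at u)"
  by (rule has_derivative_eq_rhs[OF has_derivative_add[OF has_derivative_const has_derivative_mult_coord[OF has_derivative_coord(3) has_derivative_mult_coord[OF has_derivative_coord(2)[OF D_sn] has_derivative_coord(2)[OF D_sn]]]]])
   (simp add: fun_eq_iff algebra_simps)
 note D = has_derivative_mult_coord[OF has_derivative_coord(3)[of k] has_derivative_mult_coord[OF has_derivative_coord(1)[OF D_tt] has_derivative_mult_coord[OF has_derivative_coord(1)[OF D_tt]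
  has_derivative_mult_coord[OF sq has_derivative_mult_coord[OF D_fd has_derivative_coord(1)[OF D_fd1]]]]]]
 note D' = has_derivative_add[OF has_derivative_const[of 1] D]
 have ck: "c * (1/c) = 1" using c_pos by simp
 show ?thesis
  unfolding eq
  by (rule has_derivative_eq_rhs[OF D'], rule ext, simp only: add_0_left,
    rule arg_cong2[where f = "(+)"]; rule arg_cong2[where f = "(*)", OF refl];
    unfold f_defs p_defs k_def; use fd_inv(1)[of "u$1" "u$2"] fd_inv(2)[of "u$1"] ck ee in algebra)
qed

lemma D_fB: "((%u::real^2. fB (u$1) (u$2)) has_derivative
  (%v. v$1 * (fXb (u$1) (u$2) - fA (u$1) (u$2) * (\<eta> * c * (m + (tt (u$1))^2) * fd1 (u$1))) + v$2 * fYb (u$1) (u$2))) (at u)"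
proof -
 define \<kappa> where "\<kappa> = 1 / c"
 define k where "k = - \<e> * b * \<kappa>"
 have eq: "fB x y = k * (tt x * (ts x * ((1 + - 1 * (sn y * sn y)) * (fd x y * fd1 x))))" for x y
  unfolding f_defs p_defs k_def \<kappa>_def by algebra
 have sq: "((%u::real^2. 1 + - 1 * (sn (u$2) * sn (u$2))) has_derivative (%v. v$1 * 0 + v$2 * (- 2 * sn (u$2) * rr (u$2)))) (at u)"
  by (rule has_derivative_eq_rhs[OF has_derivative_add[OF has_derivative_const has_derivative_mult_coord[OF has_derivative_coord(3) has_derivative_mult_coord[OF has_derivative_coord(2)[OF D_sn] has_derivative_coord(2)[OF D_sn]]]]])
   (simp add: fun_eq_iff algebra_simps)
 note D = has_derivative_mult_coord[OF has_derivative_coord(3)[of k] has_derivative_mult_coord[OF has_derivative_coord(1)[OF D_tt] has_derivative_mult_coord[OF has_derivative_coord(1)[OF D_ts]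
  has_derivative_mult_coord[OF sq has_derivative_mult_coord[OF D_fd has_derivative_coord(1)[OF D_fd1]]]]]]
 have ck: "c * \<kappa> = 1" using c_pos by (simp add: \<kappa>_def)
 have e2: "\<eta>^2 = 4 * (1 - \<e> * \<kappa>^2)" using eta2 by (simp add: \<kappa>_def)
 show ?thesis
  unfolding eq
 proof (rule has_derivative_eq_rhs[OF D], rule ext, rule arg_cong2[where f = "(+)"], goal_cases)
  case (1 v)
  note B = profile_point.B_deriv[OF pp[of "u$1" "u$2"], folded fXb_def fA_def, folded \<kappa>_def]
  show ?case unfolding B[symmetric] k_def by (rule arg_cong2[where f = "(*)", OF refl]) algebra
 next
  case (2 v)
  show ?case
   by (rule arg_cong2[where f = "(*)", OF refl], unfold f_defs p_defs k_def, unfold \<kappa>_def[symmetric])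
    (use fd_inv(1)[of "u$1" "u$2"] fd_inv(2)[of "u$1"] ck ee in algebra)
 qed
qed

definition FF :: "real^2 => ambient" where
 "FF u = (vE \<e> (II (u$1)) (fA (u$1) (u$2)) (fB (u$1) (u$2)) (fw (u$1) (u$2)), fh (u$1) (u$2))"
definition XX :: "real^2 => ambient" where
 "XX u = (vE \<e> (II (u$1)) (fXa (u$1) (u$2)) (fXb (u$1) (u$2)) (fXc (u$1) (u$2)), fhx (u$1) (u$2))"
definition YY :: "real^2 => ambient" where
 "YY u = (vE \<e> (II (u$1)) (fYa (u$1) (u$2)) (fYb (u$1) (u$2)) (fYc (u$1) (u$2)), fhy (u$1) (u$2))"

lemma FF_deriv: "(FF has_derivative (%v. v$1 *\<^sub>R XX u + v$2 *\<^sub>R YY u)) (at u)"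
 unfolding FF_def[abs_def]
 by (rule has_derivative_eq_rhs[OF has_derivative_Pair[OF vE_has_derivative[OF eps D_II D_fA D_fB D_fw] D_fh]])
  (simp add: fun_eq_iff XX_def YY_def vE_scaleR vE_add, simp add: algebra_simps)

lemmas FF_partials = partials_eqI[OF FF_deriv]

lemma coord_smooth: "smooth_on (%u::real^2. u$i) UNIV"
 by (rule smooth_on_linear[OF open_UNIV bounded_linear_vec_nth])

end

lemma Ck_on_mult:
 fixes f g :: "'a::euclidean_space => real"
 shows "open U ==> Ck_on k f U ==> Ck_on k g U ==> Ck_on k (%u. f u * g u) U"
 by (rule bounded_bilinear.Ck_on[OF bounded_bilinear_mult])

context delaunay
begin

lemma smooth_tt: "smooth_on tt UNIV" and smooth_ts: "smooth_on ts UNIV"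
proof -
 have "smooth_on ((%b::bool. if b then tt else ts) i) UNIV" for i
 proof (rule smooth_on_ode[where f' = "%b. if b then ts else (%x. (1 + \<e> * m)^2 * tt x + (- 2 * c^2) * ((m + tt x * tt x) * tt x))"])
  fix k and i :: bool
  assume *: "\<And>j. Ck_on k ((%b. if b then tt else ts) j) UNIV"
  have t: "Ck_on k tt UNIV" "Ck_on k ts UNIV" using *[of True] *[of False] by simp_all
  have "Ck_on k (%x. (1 + \<e> * m)^2 * tt x + (- 2 * c^2) * ((m + tt x * tt x) * tt x)) UNIV"
   by (intro Ck_on_add Ck_on_mult Ck_on_const open_UNIV t)
  then show "Ck_on k (if i then ts else (%x. (1 + \<e> * m)^2 * tt x + (- 2 * c^2) * ((m + tt x * tt x) * tt x))) UNIV"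
   using t by simp
 qed (auto intro: tt_deriv DERIV_cong[OF ts_deriv] simp: power2_eq_square)
 from this[of True] this[of False] show "smooth_on tt UNIV" "smooth_on ts UNIV" by simp_all
qed

lemma smooth_sn: "smooth_on sn UNIV" and smooth_cn: "smooth_on cn UNIV" and smooth_dn: "smooth_on dn UNIV"
proof -
 have "smooth_on ((%i::nat. if i = 0 then sn else if i = 1 then cn else dn) i) UNIV" for i
 proof (rule smooth_on_ode[where f = "%i::nat. if i = 0 then sn else if i = 1 then cn else dn" and
   f' = "%i::nat. if i = 0 then (%y. cn y * dn y) else if i = 1 then (%y. - 1 * (sn y * dn y))
   else (%y. - (m^2) * (sn y * cn y))"])
  fix k and i :: nat
  assume *: "\<And>j. Ck_on k ((%i::nat. if i = 0 then sn else if i = 1 then cn else dn) j) UNIV"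
  have t: "Ck_on k sn UNIV" "Ck_on k cn UNIV" "Ck_on k dn UNIV" using *[of 0] *[of 1] *[of 2] by simp_all
  have "Ck_on k (%y. cn y * dn y) UNIV" "Ck_on k (%y. - 1 * (sn y * dn y)) UNIV" "Ck_on k (%y. - (m^2) * (sn y * cn y)) UNIV"
   by (intro Ck_on_mult Ck_on_const open_UNIV t)+
  then show "Ck_on k (if i = 0 then (%y. cn y * dn y) else if i = 1 then (%y. - 1 * (sn y * dn y))
   else (%y. - (m^2) * (sn y * cn y))) UNIV"
   by simp
 qed (auto intro: sn_deriv DERIV_cong[OF cn_deriv] DERIV_cong[OF dn_deriv])
 from this[of 0] this[of 1] this[of 2] show "smooth_on sn UNIV" "smooth_on cn UNIV" "smooth_on dn UNIV" by simp_all
qed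

lemmas smooth_rr = smooth_on_mult[OF open_UNIV smooth_cn smooth_dn, folded rr_def]

lemma smooth_coord:
 assumes "smooth_on (f :: real => real) UNIV"
 shows "smooth_on (%u::real^2. f (u$i)) UNIV"
 by (rule smooth_on_compose_real[OF assms open_UNIV open_UNIV _ coord_smooth]) simp

lemmas smooth_coords = smooth_coord[OF smooth_tt] smooth_coord[OF smooth_ts] smooth_coord[OF smooth_sn] smooth_coord[OF smooth_rr]

lemma smooth_fd: "smooth_on (%u::real^2. fd (u$1) (u$2)) UNIV" and smooth_fd1: "smooth_on (%u::real^2. fd1 (u$1)) UNIV"
proof -
 have n: "1 - \<e> * (tt x)^2 * (sn y)^2 \<noteq> 0" "1 - \<e> * (tt x)^2 \<noteq> 0" for x y
  using D_pos[of x y] D1_pos[of x] by simp_all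
 show "smooth_on (%u::real^2. fd (u$1) (u$2)) UNIV" "smooth_on (%u::real^2. fd1 (u$1)) UNIV"
  unfolding fd_def fd1_def by (intro smooth_intros smooth_coords open_UNIV n)+
qed

lemma smooth_II: "smooth_on II UNIV"
proof -
 have n: "1 - \<e> * (tt x)^2 \<noteq> 0" for x using D1_pos[of x] by simp
 have "smooth_on (%x. \<eta> * c * (m + (tt x)^2) / (1 - \<e> * (tt x)^2)) UNIV"
  by (intro smooth_intros smooth_tt open_UNIV n)
 from smooth_on_real_deriv[OF open_UNIV _ this] show ?thesis
  using II(2) by (simp add: has_real_derivative_iff_has_vector_derivative)
qed

lemma smooth_FF: "smooth_on FF UNIV"
 unfolding FF_def[abs_def]
proof (intro smooth_on_Pair smooth_on_vE open_UNIV smooth_coord[OF smooth_II])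
 show "smooth_on (%u::real^2. fA (u$1) (u$2)) UNIV" "smooth_on (%u::real^2. fB (u$1) (u$2)) UNIV"
  "smooth_on (%u::real^2. fw (u$1) (u$2)) UNIV"
  unfolding f_defs p_defs by (intro smooth_intros smooth_coords smooth_fd smooth_fd1 open_UNIV; simp)+
 have "1 - \<e> * (tt x * sn y)^2 > 0" for x y
  using D_pos[of x y] by (simp add: power_mult_distrib mult.assoc)
 then have "smooth_on (%u::real^2. hinv \<e> (tt (u$1) * sn (u$2))) UNIV"
  by (intro smooth_on_compose_real[OF smooth_on_hinv[OF eps]] smooth_on_mult smooth_coords open_UNIV)
   (auto intro!: open_Collect_less continuous_intros)
 then show "smooth_on (%u::real^2. fh (u$1) (u$2)) UNIV"
  unfolding fh_def by (intro smooth_intros open_UNIV)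
qed

text \<open>\<open>fnu\<close> is the vertical component of the normal. The horizontal coordinates
  are those of \<open>- (hx X + hy Y) / (lam fnu)\<close>, where numerator and denominator both
  contain the factor \<open>sn y\<close>; the definitions give the quotient after cancelling it, so
  the normal is smooth also where \<open>sn y = 0\<close>.\<close>

definition "fnu x y = - (c * sn y * (m + (tt x)^2) / (tt x * (1 + \<e> * m * (sn y)^2)))"
definition "fn x y = 1 / (\<eta> * tt x * (1 + \<e> * m * (sn y)^2) * c * (m + (tt x)^2) * fd x y)"
definition "fNa x y = fn x y * (ts x * fXa x y + tt x * rr y * (\<eta> * b * (1 + \<e> * m) * \<e> * (tt x)^2 * rr y * (fd x y)^2))"
definition "fNb x y = fn x y * (ts x * fXb x y + tt x * rr y * (2 * \<e> * b * (1 / c) * tt x * ts x * rr y * (fd x y)^2))"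
definition "fNc x y = fn x y * (ts x * fXc x y + tt x * rr y * (b * tt x * (fd x y)^2 *
 (- (1 + m^2) + 2 * m^2 * (sn y)^2 + \<e> * (tt x)^2 * (2 - (1 + m^2) * (sn y)^2))))"
definition NN :: "real^2 => ambient" where
 "NN u = (vE \<e> (II (u$1)) (fNa (u$1) (u$2)) (fNb (u$1) (u$2)) (fNc (u$1) (u$2)), fnu (u$1) (u$2))"

lemma pt_pos: "m + (tt x)^2 > 0" using m_pos by (simp add: add_pos_nonneg)

lemma n_nonzero: "\<eta> * tt x * (1 + \<e> * m * (sn y)^2) * c * (m + (tt x)^2) * fd x y > 0"
 using eta_pos tt_pos[of x] E_pos[of y] c_pos pt_pos[of x] fd_pos(1)[of x y] by simp

lemma smooth_NN: "smooth_on NN UNIV"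
 unfolding NN_def[abs_def]
proof (intro smooth_on_Pair smooth_on_vE open_UNIV smooth_coord[OF smooth_II])
 have n: "\<eta> * tt x * (1 + \<e> * m * (sn y)^2) * c * (m + (tt x)^2) * fd x y \<noteq> 0" "tt x * (1 + \<e> * m * (sn y)^2) \<noteq> 0" for x y
  using n_nonzero[of x y] tt_pos[of x] E_pos[of y] by auto
 have f: "smooth_on (%u::real^2. fn (u$1) (u$2)) UNIV"
  unfolding fn_def by (intro smooth_intros smooth_coords smooth_fd open_UNIV n)
 show "smooth_on (%u::real^2. fnu (u$1) (u$2)) UNIV"
  unfolding fnu_def by (intro smooth_intros smooth_coords smooth_fd open_UNIV n)
 show "smooth_on (%u::real^2. fNa (u$1) (u$2)) UNIV" "smooth_on (%u::real^2. fNb (u$1) (u$2)) UNIV"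
  "smooth_on (%u::real^2. fNc (u$1) (u$2)) UNIV"
  unfolding fNa_def fNb_def fNc_def f_defs p_defs
  by (intro smooth_intros smooth_coords smooth_fd smooth_fd1 f open_UNIV; simp)+
qed

lemma lam_pos: "flam x y > 0"
 unfolding f_defs p_defs using eta_pos tt_pos[of x] E_pos[of y] fd_pos(1)[of x y] by simp

lemma fnu_eq: "fnu x y * (tt x * (1 + \<e> * m * (sn y)^2)) = - (c * sn y * (m + (tt x)^2))"
 unfolding fnu_def using tt_pos[of x] E_pos[of y] by simp

lemma fn_eq: "fn x y * (\<eta> * tt x * (1 + \<e> * m * (sn y)^2) * c * (m + (tt x)^2) * fd x y) = 1"
 unfolding fn_def using n_nonzero[of x y] by (metis less_irrefl nonzero_divide_eq_eq)

lemma lam_nu: "flam x y * fnu x y = - (\<eta>^2 * tt x * (1 + \<e> * m * (sn y)^2) * (fd x y)^2 * c * sn y * (m + (tt x)^2))"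
 unfolding f_defs p_defs using fnu_eq[of x y] by algebra

lemma lam_nu_n: "flam x y * fnu x y * fn x y = - (\<eta> * sn y * fd x y)"
 unfolding lam_nu using fn_eq[of x y] by algebra

lemma normal_components:
 "flam x y * fnu x y * fNa x y = - fhx x y * fXa x y - fhy x y * fYa x y"
 "flam x y * fnu x y * fNb x y = - fhx x y * fXb x y - fhy x y * fYb x y"
 "flam x y * fnu x y * fNc x y = - fhx x y * fXc x y - fhy x y * fYc x y"
 unfolding fNa_def fNb_def fNc_def mult.assoc[symmetric] lam_nu_n
 unfolding fYa_def fYb_def fYc_def fhx_def fhy_def p_defs by algebra+

lemma normal_height: "flam x y * fnu x y * fnu x y = flam x y - (fhx x y)^2 - (fhy x y)^2"
proof -
 have "flam x y * fnu x y * fnu x y = \<eta>^2 * (sn y)^2 * (c * (m + (tt x)^2))^2 * (fd x y)^2"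
  unfolding lam_nu using fnu_eq[of x y] by algebra
 also have "\<dots> = flam x y - (fhx x y)^2 - (fhy x y)^2"
  unfolding flam_def fhx_def fhy_def by (rule profile_point.normal_vertical[OF pp, symmetric])
 finally show ?thesis .
qed

lemma conformal:
 "\<e> * (fXa x y)^2 + (fXb x y)^2 + (fXc x y)^2 + (fhx x y)^2 = flam x y"
 "\<e> * (fYa x y)^2 + (fYb x y)^2 + (fYc x y)^2 + (fhy x y)^2 = flam x y"
 "\<e> * fXa x y * fYa x y + fXb x y * fYb x y + fXc x y * fYc x y + fhx x y * fhy x y = 0"
 unfolding f_defs by (rule profile_point.met_XX[OF pp] profile_point.met_YY[OF pp] profile_point.met_XY[OF pp])+

lemma pform_vE: "pform \<e> (vE \<e> \<theta> a1 b1 w1, h1) (vE \<e> \<theta> a2 b2 w2, h2) = \<e> * a1 * a2 + b1 * b2 + w1 * w2 + h1 * h2"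
 by (simp add: pform_def mform_vE[OF eps])

lemma D_hx: "((%u::real^2. fhx (u$1) (u$2)) has_derivative (%v. v$1 * (\<eta> * sn (u$2) * fd (u$1) (u$2) *
   ((1 + \<e> * m)^2 * tt (u$1) - 2 * c^2 * (m + (tt (u$1))^2) * tt (u$1) + 2 * \<e> * tt (u$1) * (ts (u$1))^2 * (sn (u$2))^2 * fd (u$1) (u$2))) +
   v$2 * (\<eta> * ts (u$1) * rr (u$2) * fd (u$1) (u$2) * (1 + 2 * \<e> * (tt (u$1))^2 * (sn (u$2))^2 * fd (u$1) (u$2))))) (at u)"
proof -
 note D = has_derivative_mult_coord[OF has_derivative_mult_coord[OF has_derivative_mult_coord[OF has_derivative_coord(3)[of \<eta>]
   has_derivative_coord(1)[OF D_ts]] has_derivative_coord(2)[OF D_sn]] D_fd]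
 show ?thesis
  unfolding f_defs p_defs
  by (rule has_derivative_eq_rhs[OF D])
   (rule ext, rule arg_cong2[where f = "(+)"]; rule arg_cong2[where f = "(*)", OF refl]; algebra)
qed

lemma D_hy: "((%u::real^2. fhy (u$1) (u$2)) has_derivative (%v.
   v$1 * (\<eta> * ts (u$1) * rr (u$2) * fd (u$1) (u$2) * (1 + 2 * \<e> * (tt (u$1))^2 * (sn (u$2))^2 * fd (u$1) (u$2))) +
   v$2 * (\<eta> * tt (u$1) * fd (u$1) (u$2) * (- (1 + m^2) * sn (u$2) + 2 * m^2 * (sn (u$2))^3 +
   2 * \<e> * (tt (u$1))^2 * sn (u$2) * (rr (u$2))^2 * fd (u$1) (u$2))))) (at u)"
proof -
 note D = has_derivative_mult_coord[OF has_derivative_mult_coord[OF has_derivative_mult_coord[OF has_derivative_coord(3)[of \<eta>]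
   has_derivative_coord(1)[OF D_tt]] has_derivative_coord(2)[OF D_rr]] D_fd]
 show ?thesis
  unfolding f_defs p_defs
  by (rule has_derivative_eq_rhs[OF D])
   (rule ext, rule arg_cong2[where f = "(+)"]; rule arg_cong2[where f = "(*)", OF refl]; algebra)
qed

text \<open>The two summands on the left are the second derivatives of the height in x and in y. The
  right side is \<open>2 H lam\<close> times the vertical component of the normal, because
  \<open>2 H \<eta> c = 2 (c^2 - \<e>)\<close>.\<close>

lemma (in profile_point) height_laplace:
 "\<eta> * q * d * ((1 + \<e> * m)^2 * t - 2 * c^2 * (m + t^2) * t + 2 * \<e> * t * s^2 * q^2 * d) +
  \<eta> * t * d * (- (1 + m^2) * q + 2 * m^2 * q^3 + 2 * \<e> * t^2 * q * r^2 * d)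
  = - (2 * \<eta> * (c^2 - \<e>) * t * (1 + \<e> * m * q^2) * q * (m + t^2) * d^2)"
proof -
 have 1: "(1 + \<e> * m)^2 - (1 + m^2) + 2 * m^2 * q^2 - 2 * c^2 * (m + t^2) + 2 * \<e> * q^2 * s^2 * d + 2 * \<e> * t^2 * r^2 * d
  = d * (((1 + \<e> * m)^2 - (1 + m^2) + 2 * m^2 * q^2 - 2 * c^2 * (m + t^2)) * (1 - \<e> * t^2 * q^2) + 2 * \<e> * q^2 * s^2 + 2 * \<e> * t^2 * r^2)"
  using d by algebra
 have 2: "((1 + \<e> * m)^2 - (1 + m^2) + 2 * m^2 * q^2 - 2 * c^2 * (m + t^2)) * (1 - \<e> * t^2 * q^2) + 2 * \<e> * q^2 * s^2 + 2 * \<e> * t^2 * r^2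
  = - 2 * (c^2 - \<e>) * (1 + \<e> * m * q^2) * (m + t^2)"
  unfolding s2 r2 using ee by algebra
 show ?thesis using 1 unfolding 2 by algebra
qed

lemma laplace: "snd (dx (dx FF) u) + snd (dy (dy FF) u) = 2 * H * flam (u$1) (u$2) * snd (NN u)"
proof -
 have XX: "dx FF = XX" and YY: "dy FF = YY" using FF_partials by auto
 have s: "smooth_on XX UNIV" "smooth_on YY UNIV"
  using smooth_on_frechet[OF smooth_FF] unfolding XX[symmetric] YY[symmetric] by auto
 have snd_d: "snd (frechet_derivative G (at u) v) = G' v"
  if "smooth_on G UNIV" "((%u. snd (G u)) has_derivative G') (at u)" for G :: "real^2 => ambient" and G' v
 proof -
  have "(G has_derivative frechet_derivative G (at u)) (at u)"
   using smooth_on_differentiable[OF that(1)] by (simp add: frechet_derivative_works)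
  from has_derivative_snd[OF this] that(2) have "(%v. snd (frechet_derivative G (at u) v)) = G'"
   by (rule has_derivative_unique)
  then show ?thesis by metis
 qed
 have "snd (dx XX u) = \<eta> * sn (u$2) * fd (u$1) (u$2) *
   ((1 + \<e> * m)^2 * tt (u$1) - 2 * c^2 * (m + (tt (u$1))^2) * tt (u$1) + 2 * \<e> * tt (u$1) * (ts (u$1))^2 * (sn (u$2))^2 * fd (u$1) (u$2))"
  by (subst snd_d[OF s(1)]) (simp add: XX_def, rule D_hx, simp add: axis_def)
 moreover have "snd (dy YY u) = \<eta> * tt (u$1) * fd (u$1) (u$2) * (- (1 + m^2) * sn (u$2) + 2 * m^2 * (sn (u$2))^3 +
   2 * \<e> * (tt (u$1))^2 * sn (u$2) * (rr (u$2))^2 * fd (u$1) (u$2))"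
  by (subst snd_d[OF s(2)]) (simp add: YY_def, rule D_hy, simp add: axis_def)
 moreover have "2 * H * flam (u$1) (u$2) * snd (NN u) = - (2 * \<eta> * (c^2 - \<e>) * tt (u$1) * (1 + \<e> * m * (sn (u$2))^2) * sn (u$2) * (m + (tt (u$1))^2) * (fd (u$1) (u$2))^2)"
 proof -
  have "2 * H * flam (u$1) (u$2) * snd (NN u) = 2 * H * (flam (u$1) (u$2) * fnu (u$1) (u$2))" by (simp add: NN_def)
  moreover have "2 * H * \<eta> * c = 2 * (c^2 - \<e>)" unfolding \<eta>_def c2 using c_pos by (simp add: power2_eq_square)
  ultimately show ?thesis unfolding lam_nu by algebra
 qed
 ultimately show ?thesis unfolding XX YY
  using profile_point.height_laplace[OF pp[of "u$1" "u$2"]] by simp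
qed

text \<open>If \<open>sn\<close> vanished on an interval, so would its derivative
  \<open>cn dn\<close> and hence \<open>cn\<close>, against \<open>cn^2 + sn^2 = 1\<close>.\<close>

lemma sn_dense: "closure {u::real^2. sn (u$2) \<noteq> 0} = UNIV"
proof (rule ccontr)
 assume "closure {u::real^2. sn (u$2) \<noteq> 0} \<noteq> UNIV"
 then obtain u :: "real^2" where "u \<notin> closure {u. sn (u$2) \<noteq> 0}" by blast
 then obtain e where e: "e > 0" "\<And>v. dist v u < e ==> sn (v$2) = 0"
  unfolding closure_approachable by blast
 have z: "sn y = 0" if "\<bar>y - u$2\<bar> < e" for y
 proof -
  have "dist (u + (y - u$2) *\<^sub>R axis 2 1) u < e" using that by (simp add: dist_norm norm_axis_1)
  from e(2)[OF this] show ?thesis by (simp add: axis_def)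
 qed
 have "((%_. 0) has_real_derivative cn (u$2) * dn (u$2)) (at (u$2))"
  by (rule has_field_derivative_transform_within[OF sn_deriv e(1)]) (use z in \<open>auto simp: dist_real_def\<close>)
 then have "cn (u$2) * dn (u$2) = 0" using DERIV_unique DERIV_const by blast
 then have "cn (u$2) = 0" using dn_pos[of "u$2"] by simp
 then show False using cn2[of "u$2"] z[of "u$2"] e(1) by simp
qed

lemma ABw: "(fA x y)^2 + \<e> * (fB x y)^2 + \<e> * (fw x y)^2 = 1"
 unfolding f_defs by (rule profile_point.on_M2[OF pp])

text \<open>\<open>A\<close> is 1 plus a nonnegative term, and
  \<open>A^2 - B^2 = 1 + w^2\<close>.\<close>

lemma A_gt: "\<e> = -1 ==> \<bar>fB x y\<bar> < fA x y"
proof -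
 assume e: "\<e> = -1"
 have em: "- (\<e> * z) = z" for z using e by simp
 have "0 \<le> b * (1 + \<e> * m) * \<eta> * (tt x)^2 * (1 - (sn y)^2) * fd x y * fd1 x / 2"
  using b_pos em_pos eta_pos sn_le[of y] fd_pos(1)[of x y] fd_pos(2)[of x] by simp
 moreover have "fA x y = 1 + - (\<e> * (b * (1 + \<e> * m) * \<eta> * (tt x)^2 * (1 - (sn y)^2) * fd x y * fd1 x / 2))"
  unfolding f_defs p_defs by algebra
 ultimately have "fA x y > 0" unfolding em by simp
 moreover have "\<bar>fB x y\<bar>^2 < (fA x y)^2"
  using ABw[of x y] em[of "(fB x y)^2"] em[of "(fw x y)^2"] zero_le_power2[of "fw x y"] by (simp only: power2_abs)
 ultimately show ?thesis by (rule power2_less_imp_less[rotated, OF less_imp_le])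
qed

text \<open>Serves twice: it places the image on the upper sheet, and it makes the immersion proper
  in \<open>x\<close>.\<close>

lemma FF3_ge:
 assumes e: "\<e> = -1"
 shows "(fA (u$1) (u$2) - \<bar>fB (u$1) (u$2)\<bar>) * cosh (II (u$1)) \<le> fst (FF u) $ 3"
proof -
 have s: "\<bar>sinh z\<bar> \<le> cosh z" for z :: real
  by (rule power2_le_imp_le) (simp_all add: cosh_square_eq)
 have "- (fB (u$1) (u$2) * sinh (II (u$1))) \<le> \<bar>fB (u$1) (u$2)\<bar> * \<bar>sinh (II (u$1))\<bar>"
  by (metis abs_ge_minus_self abs_mult)
 also have "\<dots> \<le> \<bar>fB (u$1) (u$2)\<bar> * cosh (II (u$1))" by (intro mult_left_mono s) simp
 finally have *: "- (fB (u$1) (u$2) * sinh (II (u$1))) \<le> \<bar>fB (u$1) (u$2)\<bar> * cosh (II (u$1))" .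
 have em: "- (\<e> * z) = z" for z using e by simp
 have "gcos \<e> z = cosh z" "gsin \<e> z = sinh z" for z using e by (simp_all add: gcos_def gsin_def)
 then have "fst (FF u) $ 3 = fA (u$1) (u$2) * cosh (II (u$1)) + - (\<e> * (fB (u$1) (u$2) * sinh (II (u$1))))"
  by (simp add: FF_def)
 then show ?thesis using * unfolding em by (simp add: algebra_simps)
qed

lemma FF_in_M2: "fst (FF u) \<in> M2 \<e>"
proof -
 have "mform \<e> (fst (FF u)) (fst (FF u)) = \<e>"
  unfolding FF_def fst_conv mform_vE[OF eps] using ABw[of "u$1" "u$2"] ee by algebra
 moreover have "fst (FF u) $ 3 > 0" if "\<e> = -1"
 proof -
  have "0 < (fA (u$1) (u$2) - \<bar>fB (u$1) (u$2)\<bar>) * cosh (II (u$1))" using A_gt[OF that] by simp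
  then show ?thesis using FF3_ge[OF that, of u] by linarith
 qed
 ultimately show ?thesis by (simp add: M2_def)
qed

lemma conformal_FF: "conformal_immersion \<e> H FF NN (%u. flam (u$1) (u$2))"
proof
 fix u
 show "pform \<e> (dx FF u) (dx FF u) = flam (u$1) (u$2)" "pform \<e> (dy FF u) (dy FF u) = flam (u$1) (u$2)"
  "pform \<e> (dx FF u) (dy FF u) = 0"
  using conformal[of "u$1" "u$2"] by (simp_all add: FF_partials XX_def YY_def pform_vE power2_eq_square algebra_simps)
 show "(flam (u$1) (u$2) * snd (NN u)) *\<^sub>R NN u =
   flam (u$1) (u$2) *\<^sub>R (0, 1) - snd (dx FF u) *\<^sub>R dx FF u - snd (dy FF u) *\<^sub>R dy FF u"
  using normal_components[of "u$1" "u$2"] normal_height[of "u$1" "u$2"]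
  by (simp add: FF_partials XX_def YY_def NN_def vE_scaleR vE_diff vE_zero[of \<e> "II (u$1)", symmetric] del: vE_zero)
   (simp add: power2_eq_square)
 have "fnu x y = 0 \<longleftrightarrow> sn y = 0" for x y
  unfolding fnu_def using tt_pos[of x] E_pos[of y] c_pos pt_pos[of x] by auto
 then show "closure {u. snd (NN u) \<noteq> 0} = UNIV" using sn_dense by (simp add: NN_def)
qed (rule eps smooth_FF smooth_NN FF_in_M2 lam_pos laplace)+

end

section \<open>Symmetries\<close>

lemma vE_cong_sym:
 shows vE_mirror: "vE \<e> (- \<theta>) a (- b) w = vE \<e> \<theta> a b w - (2 * vE \<e> \<theta> a b w $ 1) *\<^sub>R axis 1 1"
  and vE_reflect: "vE \<e> \<theta> a b (- w) = reflection \<e> (axis 2 1) (vE \<e> \<theta> a b w)"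
  and vE_norm: "\<e> = 1 ==> norm (vE \<e> \<theta> a b w) = sqrt (a^2 + b^2 + w^2)"
proof -
 show "vE \<e> (- \<theta>) a (- b) w = vE \<e> \<theta> a b w - (2 * vE \<e> \<theta> a b w $ 1) *\<^sub>R axis 1 1"
  by (simp add: vec_eq_iff forall_3 axis_def)
 show "vE \<e> \<theta> a b (- w) = reflection \<e> (axis 2 1) (vE \<e> \<theta> a b w)"
  by (simp add: vec_eq_iff forall_3 axis_def reflection_def mform_def)
 assume e: "\<e> = 1"
 have "(a * sin \<theta> + b * cos \<theta>)^2 + w^2 + (a * cos \<theta> - b * sin \<theta>)^2 = a^2 + b^2 + w^2"
  using sin_cos_squared_add[of \<theta>] by algebra
 then show "norm (vE \<e> \<theta> a b w) = sqrt (a^2 + b^2 + w^2)"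
  using e by (simp add: norm_vec_def L2_set_def sum_3 gcos_def gsin_def)
qed

lemma frame_axes:
 assumes "\<e> \<in> {-1, 1}"
 shows "frame \<e> (axis 3 1) (axis 1 1) (axis 2 1)"
 using assms by (auto simp: frame_def mform_def M2_def axis_def)

lemma frame_axes_1: "frame 1 (axis 2 1) (axis 1 1) (axis 3 1)"
 by (auto simp: frame_def mform_def M2_def axis_def)

lemma along_vE:
 assumes e: "\<e> \<in> {-1, 1}"
 shows "along \<e> (axis 3 1) (axis 1 1) (axis 2 1) t (vE \<e> \<theta> a b w) = vE \<e> (\<theta> + t) a b w"
proof -
 have ee: "\<e> * (\<e> * z) = z" for z using e by auto
 have m: "mform \<e> (vE \<e> \<theta> a b w) (axis 3 1) = \<e> * (a * gcos \<e> \<theta> - \<e> * b * gsin \<e> \<theta>)"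
  "mform \<e> (vE \<e> \<theta> a b w) (axis 1 1) = a * gsin \<e> \<theta> + b * gcos \<e> \<theta>"
  "mform \<e> (vE \<e> \<theta> a b w) (axis 2 1) = w"
  by (simp_all add: mform_def axis_def)
 show ?thesis
  unfolding along_def m
  by (simp add: vec_eq_iff forall_3 axis_def gcos_add[OF e] gsin_add[OF e] ee algebra_simps)
qed

lemma along_nontrivial_hyp:
 assumes "t \<noteq> 0"
 shows "acts_nontrivially (-1) (along (-1) (axis 3 1) (axis 1 1) (axis 2 1) t)"
 unfolding acts_nontrivially_def
proof (rule bexI[of _ "axis 3 1"])
 have "along (-1) (axis 3 1) (axis 1 1) (axis 2 1) t (axis 3 1) $ 1 = sinh t"
  by (simp add: along_def mform_def axis_def gsin_def)
 then show "along (-1) (axis 3 1) (axis 1 1) (axis 2 1) t (axis 3 1) \<noteq> axis 3 1"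
  using assms by (auto simp: axis_def)
qed (simp add: M2_def mform_def axis_def)

text \<open>The geodesic meant here is the equator orthogonal to the third axis, so the translation
  by \<open>k \<pi>\<close> is a power of the half turn about \<open>axis 3 1\<close>, a point of
  the geodesic along which the surface is built.\<close>

lemma along_1_int:
 fixes k :: int
 shows "along 1 (axis 2 1) (axis 1 1) (axis 3 1) (of_int k * pi) x =
  (if even k then x else vector [- (x$1), - (x$2), x$3])"
proof (cases "even k")
 case True
 then obtain j where "k = 2 * j" by (rule evenE)
 then have k: "of_int k * pi = of_int j * (2 * pi)" by simp
 have "cos (of_int k * pi) = 1" "sin (of_int k * pi) = 0"
  unfolding k using cos_int_2pin[of j] sin_int_2pin[of j] by (simp_all add: mult.commute)
 then show ?thesis using True
  by (simp add: along_def gcos_def gsin_def vec_eq_iff forall_3 axis_def mform_def)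
next
 case False
 then obtain j where "k = 2 * j + 1" by (rule oddE)
 then have k: "of_int k * pi = of_int j * (2 * pi) + pi" by (simp add: algebra_simps)
 have "cos (of_int k * pi) = -1" "sin (of_int k * pi) = 0"
  unfolding k using cos_int_2pin[of j] sin_int_2pin[of j] by (simp_all add: mult.commute)
 then show ?thesis using False
  by (simp add: along_def gcos_def gsin_def vec_eq_iff forall_3 axis_def mform_def)
qed

lemma along_nontrivial_sph: "acts_nontrivially 1 (along 1 (axis 2 1) (axis 1 1) (axis 3 1) pi)"
 unfolding acts_nontrivially_def
proof (rule bexI[of _ "axis 2 1"])
 have "along 1 (axis 2 1) (axis 1 1) (axis 3 1) pi (axis 2 1) $ 2 = -1"
  by (simp add: along_def mform_def axis_def gcos_def gsin_def)
 then show "along 1 (axis 2 1) (axis 1 1) (axis 3 1) pi (axis 2 1) \<noteq> axis 2 1"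
  by (auto simp: axis_def)
qed (simp add: M2_def mform_def axis_def)

lemma int_periods:
 fixes f :: "real => real"
 assumes "\<And>x. f (x + P) = f x + d"
 shows "f (x + of_int k * P) = f x + of_int k * d"
proof (induction k rule: int_induct[where k = 0])
 case (step1 i)
 have e: "x + of_int (i + 1) * P = (x + of_int i * P) + P" by (simp add: algebra_simps)
 show ?case unfolding e assms step1 by (simp add: algebra_simps)
next
 case (step2 i)
 have e: "x + of_int (i - 1) * P + P = x + of_int i * P" by (simp add: algebra_simps)
 show ?case using assms[of "x + of_int (i - 1) * P"] unfolding e step2 by (simp add: algebra_simps)
qed simp

context delaunay
begin

section \<open>Parities and periods of the profile functions\<close>

lemma f_eqs:
 "fA x y = 1 - \<e> * b * (1 + \<e> * m) * \<eta> * (tt x)^2 * (1 - (sn y)^2) * fd x y * fd1 x / 2"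
 "fB x y = - (\<e> * b * (1/c) * tt x * ts x * (1 - (sn y)^2) * fd x y * fd1 x)"
 "fw x y = b * tt x * rr y * fd x y"
 unfolding f_defs p_defs by (rule refl)+

lemma phi_minus: "phi (- x) = - phi x" and psi_minus: "psi (- y) = - psi y"
 unfolding phi_def psi_def
 by (rule ph.amp_odd, simp add: rad_def) (rule ps.amp_odd, simp add: delta_def)

text \<open>\<open>rad\<close> depends on the squares of sine and cosine, so an increase of
  \<open>phi\<close> by \<open>pi\<close> is a full period of \<open>tt\<close>. In contrast
  \<open>sn\<close> changes sign when \<open>psi\<close> increases by \<open>pi\<close>, so its
  period is \<open>2 * Py\<close>.\<close>

definition "Px = (SOME x. phi x = pi)"
definition "Py = (SOME y. psi y = pi)"

lemma phi_Px: "phi Px = pi" and psi_Py: "psi Py = pi"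
proof -
 have "\<exists>x. phi x = pi" "\<exists>y. psi y = pi"
  using surjD[OF ph.amp_surj, of pi] surjD[OF ps.amp_surj, of pi] unfolding phi_def psi_def by metis+
 then show "phi Px = pi" "psi Py = pi" unfolding Px_def Py_def by (auto intro: someI_ex)
qed

lemma phi_mono: "strict_mono phi" and psi_mono: "strict_mono psi"
 and phi_0: "phi 0 = 0" and psi_0: "psi 0 = 0"
 unfolding phi_def psi_def by (rule ph.amp_strict_mono ps.amp_strict_mono ph.amp(1) ps.amp(1))+

lemma Px_pos: "Px > 0" and Py_pos: "Py > 0"
 using strict_mono_less[OF phi_mono, of 0 Px] strict_mono_less[OF psi_mono, of 0 Py]
 by (simp_all add: phi_Px psi_Py phi_0 psi_0)

lemma phi_period: "phi (x + Px) = phi x + pi" and psi_period: "psi (y + Py) = psi y + pi"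
proof -
 show "phi (x + Px) = phi x + pi"
  unfolding phi_def using phi_Px by (intro ph.amp_period) (simp_all add: rad_def phi_def)
 show "psi (y + Py) = psi y + pi"
  unfolding psi_def using psi_Py by (intro ps.amp_period) (simp_all add: delta_def psi_def)
qed

lemma tt_ts_sym: "tt (- x) = tt x" "ts (- x) = - ts x" "tt (x + Px) = tt x" "ts (x + Px) = ts x"
 unfolding tt_def ts_def phi_minus phi_period by (simp_all add: rad_def)

lemma sn_sym: "sn (- y) = - sn y" "rr (- y) = rr y" "sn (y + Py) = - sn y" "rr (y + Py) = - rr y"
 "sn (Py - y) = sn y" "rr (Py - y) = - rr y"
proof -
 show m: "sn (- y) = - sn y" "rr (- y) = rr y" for y
  unfolding rr_def sn_def cn_def dn_def psi_minus by (simp_all add: delta_def)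
 show p: "sn (y + Py) = - sn y" "rr (y + Py) = - rr y" for y
  unfolding rr_def sn_def cn_def dn_def psi_period by (simp_all add: delta_def)
 show "sn (Py - y) = sn y" "rr (Py - y) = - rr y"
  using p[of "- y"] m[of y] by (simp_all add: add.commute)
qed

lemma II_unique:
 assumes "G 0 = 0" "\<And>x. (G has_real_derivative \<eta> * c * (m + (tt x)^2) / (1 - \<e> * (tt x)^2)) (at x)"
 shows "G x = II x"
proof -
 have "((%x. G x - II x) has_real_derivative 0) (at x)" for x
  using DERIV_diff[OF assms(2) II(2), of x] by simp
 from DERIV_isconst_all[of "%x. G x - II x" x 0] this show ?thesis by (simp add: assms(1) II(1))
qed

lemma II_minus: "II (- x) = - II x"
proof -
 have "- II (- x) = II x"
 proof (rule II_unique[of "%x. - II (- x)"])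
  fix x
  have "((%x. II (- x)) has_real_derivative - (\<eta> * c * (m + (tt x)^2) / (1 - \<e> * (tt x)^2))) (at x)"
   using II(2)[of "- x"] unfolding DERIV_mirror tt_ts_sym by simp
  from DERIV_minus[OF this]
  show "((%x. - II (- x)) has_real_derivative \<eta> * c * (m + (tt x)^2) / (1 - \<e> * (tt x)^2)) (at x)" by simp
 qed (simp add: II(1))
 then show ?thesis by simp
qed

lemma II_period: "II (x + Px) = II x + II Px"
proof -
 have "II (x + Px) - II Px = II x"
 proof (rule II_unique[of "%x. II (x + Px) - II Px"])
  fix x
  have "((%x. II (x + Px)) has_real_derivative \<eta> * c * (m + (tt x)^2) / (1 - \<e> * (tt x)^2)) (at x)"
   using II(2)[of "x + Px"] unfolding DERIV_shift tt_ts_sym .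
  then show "((%x. II (x + Px) - II Px) has_real_derivative \<eta> * c * (m + (tt x)^2) / (1 - \<e> * (tt x)^2)) (at x)"
   by (auto intro!: derivative_eq_intros)
 qed simp
 then show ?thesis by simp
qed

lemma II_int: "II (x + of_int k * Px) = II x + of_int k * II Px"
 and tt_int: "tt (x + of_int k * Px) = tt x" and ts_int: "ts (x + of_int k * Px) = ts x"
 using int_periods[of II Px "II Px" x k] int_periods[of tt Px 0 x k] int_periods[of ts Px 0 x k]
 by (simp_all add: II_period tt_ts_sym)

lemma sn_int: "sn (y + of_int k * (2 * Py)) = sn y" and rr_int: "rr (y + of_int k * (2 * Py)) = rr y"
 and psi_int: "psi (y + of_int k * (2 * Py)) = psi y + of_int k * (2 * pi)"
proof -
 have s: "psi (y + 2 * Py) = psi y + 2 * pi" for y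
  using psi_period[of "y + Py"] psi_period[of y] by (simp add: algebra_simps)
 show p: "psi (y + of_int k * (2 * Py)) = psi y + of_int k * (2 * pi)"
  using int_periods[of psi "2 * Py" "2 * pi" y k] s by simp
 have "sin (psi y + of_int k * (2 * pi)) = sin (psi y)" "cos (psi y + of_int k * (2 * pi)) = cos (psi y)"
  using sin_int_2pin[of k] cos_int_2pin[of k] by (simp_all add: sin_add cos_add mult.commute)
 then show "sn (y + of_int k * (2 * Py)) = sn y" "rr (y + of_int k * (2 * Py)) = rr y"
  unfolding rr_def sn_def cn_def dn_def delta_def p by simp_all
qed

lemma II_mono: "strict_mono II"
proof (rule strict_monoI)
 fix x y :: real assume "x < y"
 then show "II x < II y"
 proof (rule DERIV_pos_imp_increasing)
  fix s show "\<exists>z. (II has_real_derivative z) (at s) & 0 < z"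
   using II(2)[of s] eta_pos c_pos pt_pos[of s] D1_pos[of s]
   by (intro exI[of _ "\<eta> * c * (m + (tt s)^2) / (1 - \<e> * (tt s)^2)"]) simp
 qed
qed

lemma f_cong:
 assumes "tt x' = tt x" "ts x' = ts x" "sn y' = sn y" "rr y' = rr y"
 shows "fd x' y' = fd x y" "fd1 x' = fd1 x" "fA x' y' = fA x y" "fB x' y' = fB x y" "fw x' y' = fw x y" "fh x' y' = fh x y"
  "fnu x' y' = fnu x y" "fNa x' y' = fNa x y" "fNb x' y' = fNb x y" "fNc x' y' = fNc x y"
proof -
 show d: "fd x' y' = fd x y" "fd1 x' = fd1 x" unfolding fd_def fd1_def assms by simp_all
 show "fA x' y' = fA x y" "fB x' y' = fB x y" "fw x' y' = fw x y" "fh x' y' = fh x y"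
  "fnu x' y' = fnu x y" "fNa x' y' = fNa x y" "fNb x' y' = fNb x y" "fNc x' y' = fNc x y"
  unfolding fA_def fB_def fw_def fh_def fnu_def fNa_def fNb_def fNc_def fn_def fXa_def fXb_def fXc_def assms d by simp_all
qed

lemma hinv_minus: "1 - \<e> * z^2 > 0 ==> hinv \<e> (- z) = - hinv \<e> z"
proof (cases "\<e> = 1")
 case True
 assume "1 - \<e> * z^2 > 0"
 then have "\<bar>z\<bar> < 1" using True abs_square_less_1[of z] by simp
 then show ?thesis using True by (simp add: hinv_def artanh_minus_real)
qed (simp add: hinv_def arctan_minus)

lemma f_minus_y: "fd x (- y) = fd x y" "fA x (- y) = fA x y" "fB x (- y) = fB x y" "fw x (- y) = fw x y" "fh x (- y) = - fh x y"
proof -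
 show "fd x (- y) = fd x y" unfolding fd_def sn_sym by simp
 have "1 - \<e> * (tt x * sn y)^2 > 0"
  using D_pos[of x y] by (simp add: power_mult_distrib mult.assoc)
 from hinv_minus[OF this] show "fh x (- y) = - fh x y" by (simp add: fh_def sn_sym)
 show "fA x (- y) = fA x y" "fB x (- y) = fB x y" "fw x (- y) = fw x y"
  unfolding f_eqs \<open>fd x (- y) = fd x y\<close> sn_sym by simp_all
qed

lemma f_reflect_y: "fd x (Py - y) = fd x y" "fA x (Py - y) = fA x y" "fB x (Py - y) = fB x y" "fw x (Py - y) = - fw x y" "fh x (Py - y) = fh x y"
proof -
 show "fd x (Py - y) = fd x y" unfolding fd_def sn_sym by simp
 then show "fA x (Py - y) = fA x y" "fB x (Py - y) = fB x y" "fw x (Py - y) = - fw x y" "fh x (Py - y) = fh x y"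
  unfolding f_eqs fh_def sn_sym by simp_all
qed

lemma f_minus_x: "fd (- x) y = fd x y" "fd1 (- x) = fd1 x" "fA (- x) y = fA x y" "fB (- x) y = - fB x y" "fw (- x) y = fw x y" "fh (- x) y = fh x y"
proof -
 show "fd (- x) y = fd x y" "fd1 (- x) = fd1 x" unfolding fd_def fd1_def tt_ts_sym by simp_all
 then show "fA (- x) y = fA x y" "fB (- x) y = - fB x y" "fw (- x) y = fw x y" "fh (- x) y = fh x y"
  unfolding f_eqs fh_def tt_ts_sym by simp_all
qed

section \<open>Symmetries of the immersion\<close>

lemma FF_flip: "FF (vector [u$1, - (u$2)]) = flip_height (FF u)"
 by (simp add: FF_def flip_height_def f_minus_y)

lemma FF_reflect: "FF (vector [u$1, Py - u$2]) = horizontal (reflection \<e> (axis 2 1)) (FF u)"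
 by (simp add: FF_def horizontal_def f_reflect_y vE_reflect)

lemma FF_translate: "FF (u + vector [of_int k * Px, 0]) = horizontal (along \<e> (axis 3 1) (axis 1 1) (axis 2 1) (of_int k * II Px)) (FF u)"
 using f_cong[of "u$1 + of_int k * Px" "u$1" "u$2" "u$2"]
 by (simp add: FF_def horizontal_def along_vE[OF eps] II_int tt_int ts_int)

text \<open>The composite of the symmetries \<open>x -> - x\<close> and \<open>y -> Py - y\<close>:
  a half turn about the point of the geodesic with parameter 0.\<close>

lemma FF_half_turn: "FF (vector [- (u$1), Py - u$2]) = (vector [- (fst (FF u) $ 1), - (fst (FF u) $ 2), fst (FF u) $ 3], snd (FF u))"
proof -
 have "fst (FF (vector [- (u$1), Py - u$2])) = vE \<e> (- II (u$1)) (fA (u$1) (u$2)) (- fB (u$1) (u$2)) (- fw (u$1) (u$2))"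
  by (simp add: FF_def II_minus f_minus_x f_reflect_y)
 also have "\<dots> = vector [- (fst (FF u) $ 1), - (fst (FF u) $ 2), fst (FF u) $ 3]"
  by (simp add: vec_eq_iff forall_3 FF_def)
 finally show ?thesis by (simp add: prod_eq_iff) (simp add: FF_def f_minus_x f_reflect_y)
qed

lemma FF_period_y: "FF (u + vector [0, of_int k * (2 * Py)]) = FF u" and NN_period_y: "NN (u + vector [0, of_int k * (2 * Py)]) = NN u"
 using f_cong[of "u$1" "u$1" "u$2 + of_int k * (2 * Py)" "u$2"]
 by (simp_all add: FF_def NN_def sn_int rr_int)

end

section \<open>Properness and coverings\<close>

text \<open>Convergent sequences in the image lift, modulo periods, to bounded sequences in the
  plane, which have limit points. For openness: if image points outside the image of
  \<open>V\<close> tended to \<open>p u\<close>, lifts would converge to some \<open>v\<close> with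
  \<open>p v = p u\<close>, and the period \<open>u - v\<close> would shift them into
  \<open>V\<close>.\<close>

lemma plane_covering_proper:
 fixes p :: "real^2 => 'b::euclidean_space"
 assumes c: "continuous_on UNIV p" and eq: "\<And>u v. p u = p v \<longleftrightarrow> v - u \<in> \<Lambda>"
  and proper: "\<And>R. \<exists>M. \<forall>u. norm (p u) \<le> R --> (\<exists>l\<in>\<Lambda>. norm (u + l) \<le> M)"
  and delta: "\<delta> > 0" "\<And>l. l \<in> \<Lambda> ==> norm l < 2 * \<delta> ==> l = 0"
 shows "plane_covering p \<Lambda> \<delta>" "closed (range p)"
proof -
 have lift: "\<exists>r v l. strict_mono (r::nat=>nat) & (\<forall>n. p (l n) = s n) & (l \<circ> r) \<longlonglongrightarrow> v & p v = z"
  if s: "\<And>n. s n \<in> range p" "s \<longlonglongrightarrow> z" for s z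
 proof -
  obtain R where R: "\<And>n. norm (s n) \<le> R"
   using convergent_imp_bounded[OF s(2)] by (auto simp: bounded_iff)
  obtain M where M: "\<And>u. norm (p u) \<le> R ==> \<exists>l\<in>\<Lambda>. norm (u + l) \<le> M" using proper[of R] by blast
  have "\<exists>v. p v = s n & v \<in> cball 0 M" for n
  proof -
   obtain u where u: "p u = s n" using s(1)[of n] by auto
   then obtain k where "k \<in> \<Lambda>" "norm (u + k) \<le> M" using M[of u] R[of n] by auto
   then show ?thesis using eq[of u "u + k"] u by (intro exI[of _ "u + k"]) simp
  qed
  then obtain l where l: "\<And>n. p (l n) = s n" "\<And>n. l n \<in> cball 0 M" by metis
  have "seq_compact (cball (0::real^2) M)" by (simp add: compact_eq_seq_compact_metric[symmetric])
  then obtain v r where r: "strict_mono (r::nat=>nat)" "(l \<circ> r) \<longlonglongrightarrow> v"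
   unfolding seq_compact_def using l(2) by metis
  have "isCont p v" using c by (simp add: continuous_on_eq_continuous_at)
  from isCont_tendsto_compose[OF this r(2)] have "(%n. p (l (r n))) \<longlonglongrightarrow> p v" by (simp add: o_def)
  moreover have "(%n. p (l (r n))) \<longlonglongrightarrow> z" using LIMSEQ_subseq_LIMSEQ[OF s(2) r(1)] l(1) by (simp add: o_def)
  ultimately have "p v = z" by (rule LIMSEQ_unique)
  then show ?thesis using r l(1) by (intro exI[of _ r] exI[of _ v] exI[of _ l]) simp
 qed
 show "closed (range p)"
  unfolding closed_sequential_limits
 proof (intro allI impI, elim conjE)
  fix s z assume "\<forall>n. s n \<in> range p" "s \<longlonglongrightarrow> z"
  then show "z \<in> range p" using lift[of s z] by blast
 qed
 show "plane_covering p \<Lambda> \<delta>"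
 proof
  fix V :: "(real^2) set" assume V: "open V"
  show "openin (top_of_set (range p)) (p ` V)"
  proof (rule ccontr)
   assume no: "\<not> openin (top_of_set (range p)) (p ` V)"
   obtain u where u: "u \<in> V" "\<And>e. e > 0 ==> \<exists>z\<in>range p. dist z (p u) < e & z \<notin> p ` V"
    using no unfolding openin_euclidean_subtopology_iff by blast
   have "\<exists>z. z \<in> range p & dist z (p u) < inverse (real (Suc n)) & z \<notin> p ` V" for n
    using u(2)[of "inverse (real (Suc n))"] by auto
   then obtain s where s: "\<And>n. s n \<in> range p" "\<And>n. dist (s n) (p u) < inverse (real (Suc n))" "\<And>n. s n \<notin> p ` V"
    by metis
   have "s \<longlonglongrightarrow> p u"
    by (rule metric_tendsto_imp_tendsto[OF LIMSEQ_inverse_real_of_nat])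
     (use s(2) in \<open>auto intro!: always_eventually less_imp_le simp: dist_real_def\<close>)
   from lift[OF s(1) this] obtain r v l where r: "strict_mono (r::nat=>nat)" "\<And>n. p (l n) = s n" "(l \<circ> r) \<longlonglongrightarrow> v" "p v = p u"
    by blast
   have "(%n. l (r n) + (u - v)) \<longlonglongrightarrow> v + (u - v)" using r(3) by (intro tendsto_intros) (simp add: o_def)
   then have "\<forall>\<^sub>F n in sequentially. l (r n) + (u - v) \<in> V" using V u(1) by (intro topological_tendstoD) auto
   then obtain n where n: "l (r n) + (u - v) \<in> V" by (auto simp: eventually_sequentially)
   have "u - v \<in> \<Lambda>" using r(4) eq by blast
   then have "p (l (r n)) = p (l (r n) + (u - v))" using eq by simp
   then show False using s(3)[of "r n"] r(2)[of "r n"] n by (metis imageI)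
  qed
 qed (rule c eq delta; assumption)+
qed

text \<open>Along paths shorter than 1 the ambient displacement is at most \<open>C x\<close> times
  the length. Injectivity then separates distinct points, and a ball of radius 1 lies over a bounded
  part of the ambient space.\<close>

lemma tame_proper:
 assumes S: "immersed_surface \<e> S" and eps: "\<e> \<in> {-1, 1}" and inj: "inj_on (imm S) (topspace (dom S))"
  and cpt: "\<And>R. seq_compactin (dom S) {y \<in> topspace (dom S). norm (imm S y) \<le> R}"
 shows "tame \<e> S"
 unfolding tame_def
proof (intro conjI allI impI)
 have M: "imm S ` topspace (dom S) \<subseteq> M2 \<e> \<times> UNIV" using S by (simp add: immersed_surface_def)
 define C where "C x = 2 * \<bar>fst (imm S x) $ 3\<bar> * exp 1 + 3" for x
 have C: "C x > 0" for x by (simp add: C_def add_nonneg_pos)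
 have le: "norm (imm S y - imm S x) \<le> C x * L" "0 \<le> L" if j: "joined \<e> S x y L" "L < 1" for x y L
 proof -
  obtain \<gamma> where \<gamma>: "\<gamma> 0 = x" "\<gamma> 1 = y" "path_length \<e> S \<gamma> L" using j(1) unfolding joined_def by (elim exE conjE)
  note b = path_extrinsic[OF M eps \<gamma>(3), of 1]
  show L: "0 \<le> L" using b(1) by simp
  have "2 * \<bar>fst (imm S x) $ 3\<bar> * exp L + 3 \<le> C x"
   unfolding C_def using j(2) by (intro add_right_mono mult_left_mono) auto
  then have "(2 * \<bar>fst (imm S x) $ 3\<bar> * exp L + 3) * L \<le> C x * L" using L by (rule mult_right_mono)
  then show "norm (imm S y - imm S x) \<le> C x * L" using b(2) \<gamma>(1,2) by simp
 qed
 show "\<exists>e>0. \<forall>L. joined \<e> S x y L --> e \<le> L" if "x \<noteq> y" for x y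
 proof (cases "x \<in> topspace (dom S) & y \<in> topspace (dom S)")
  case True
  then have "imm S y \<noteq> imm S x" using inj_on_eq_iff[OF inj, of y x] that by simp
  then have pos: "norm (imm S y - imm S x) / C x > 0" using C[of x] by simp
  show ?thesis
  proof (intro exI[of _ "min 1 (norm (imm S y - imm S x) / C x)"] conjI allI impI)
   fix L assume j: "joined \<e> S x y L"
   show "min 1 (norm (imm S y - imm S x) / C x) \<le> L"
   proof (cases "L < 1")
    case True
    from le(1)[OF j True] show ?thesis using C[of x] by (simp add: divide_le_eq mult.commute min.coboundedI2)
   qed simp
  qed (use pos in simp)
 next
  case False
  then show ?thesis using joined_topspace by (intro exI[of _ 1]) fastforce
 qed
 show "\<exists>\<rho>>0. \<forall>x\<in>topspace (dom S). \<exists>K. (\<forall>y L. joined \<e> S x y L --> L < \<rho> --> y \<in> K) & seq_compactin (dom S) K"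
 proof (intro exI[of _ 1] conjI ballI)
  fix x assume "x \<in> topspace (dom S)"
  show "\<exists>K. (\<forall>y L. joined \<e> S x y L --> L < 1 --> y \<in> K) & seq_compactin (dom S) K"
  proof (intro exI[of _ "{y \<in> topspace (dom S). norm (imm S y) \<le> norm (imm S x) + C x}"] conjI allI impI cpt)
   fix y L assume j: "joined \<e> S x y L" "L < 1"
   have "C x * L \<le> C x * 1" using j(2) C[of x] by (intro mult_left_mono) auto
   then have "norm (imm S y) \<le> norm (imm S x) + C x"
    using le(1)[OF j] norm_triangle_sub[of "imm S y" "imm S x"] by linarith
   then show "y \<in> {y \<in> topspace (dom S). norm (imm S y) \<le> norm (imm S x) + C x}"
    using joined_topspace[OF j(1)] by simp
  qed
 qed simp
qed (rule S eps)+

lemma seq_compactin_top_of_set: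
 fixes K :: "'b::metric_space set"
 assumes "compact K" "K \<subseteq> D"
 shows "seq_compactin (top_of_set D) K"
 unfolding seq_compactin_def
proof (intro allI impI)
 fix \<sigma> :: "nat => 'b" assume s: "range \<sigma> \<subseteq> K"
 have "seq_compact K" using assms by (simp add: compact_eq_seq_compact_metric)
 then obtain l r where "l \<in> K" "strict_mono (r::nat=>nat)" "(\<sigma> \<circ> r) \<longlonglongrightarrow> l"
  unfolding seq_compact_def using s by (metis range_subsetD)
 then show "\<exists>l r. strict_mono r & limitin (top_of_set D) (\<sigma> \<circ> r) l sequentially"
  using s assms(2) by (intro exI[of _ l] exI[of _ r])
   (auto simp: limitin_subtopology limitin_canonical_iff intro!: always_eventually)
qed

text \<open>A quantitative form of local injectivity: \<open>F\<close> minus its linearization at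
  \<open>u\<close> is Lipschitz with constant \<open>B / 2\<close> near \<open>u\<close>, while the
  linearization expands by at least \<open>B\<close>. Each of the two partial derivatives
  contributes \<open>B / 4\<close>.\<close>

lemma local_expansion:
 fixes F :: "real^2 => ambient"
 assumes F: "\<And>v. (F has_derivative (%z. z$1 *\<^sub>R X v + z$2 *\<^sub>R Y v)) (at v)"
  and c: "isCont X u" "isCont Y u" and inj: "inj (%z::real^2. z$1 *\<^sub>R X u + z$2 *\<^sub>R Y u)"
 shows "\<exists>\<rho>>0. \<exists>\<kappa>>0. \<forall>v\<in>ball u \<rho>. \<forall>w\<in>ball u \<rho>. \<kappa> * norm (v - w) \<le> norm (F v - F w)"
proof -
 let ?L = "%z::real^2. z$1 *\<^sub>R X u + z$2 *\<^sub>R Y u"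
 have lin: "linear ?L" using has_derivative_linear[OF F[of u]] .
 from linear_inj_bounded_below_pos[OF lin inj] obtain B where B: "B > 0" "\<And>z. B * norm z \<le> norm (?L z)" by metis
 obtain \<rho>1 where r1: "\<rho>1 > 0" "\<And>v. dist v u < \<rho>1 ==> dist (X v) (X u) < B / 4"
  using c(1) B(1) unfolding continuous_at_eps_delta by (metis zero_less_divide_iff zero_less_numeral)
 obtain \<rho>2 where r2: "\<rho>2 > 0" "\<And>v. dist v u < \<rho>2 ==> dist (Y v) (Y u) < B / 4"
  using c(2) B(1) unfolding continuous_at_eps_delta by (metis zero_less_divide_iff zero_less_numeral)
 define \<rho> where "\<rho> = min \<rho>1 \<rho>2"
 have G: "((%v. F v - ?L v) has_derivative (%z. (z$1 *\<^sub>R X v + z$2 *\<^sub>R Y v) - ?L z)) (at v)" for v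
  by (intro has_derivative_diff F linear_imp_has_derivative lin)
 have bd: "onorm (%z::real^2. (z$1 *\<^sub>R X v + z$2 *\<^sub>R Y v) - ?L z) \<le> B / 2" if "v \<in> ball u \<rho>" for v
 proof (rule onorm_bound)
  fix z :: "real^2"
  have "dist v u < \<rho>1" "dist v u < \<rho>2" using that by (simp_all add: \<rho>_def dist_commute)
  then have d: "norm (X v - X u) \<le> B / 4" "norm (Y v - Y u) \<le> B / 4"
   using r1(2) r2(2) by (simp_all add: dist_norm less_imp_le)
  have "(z$1 *\<^sub>R X v + z$2 *\<^sub>R Y v) - ?L z = z$1 *\<^sub>R (X v - X u) + z$2 *\<^sub>R (Y v - Y u)"
   by (simp add: algebra_simps)
  also have "norm \<dots> \<le> \<bar>z$1\<bar> * norm (X v - X u) + \<bar>z$2\<bar> * norm (Y v - Y u)"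
   by (rule order_trans[OF norm_triangle_ineq]) simp
  also have "\<dots> \<le> norm z * (B / 4) + norm z * (B / 4)"
   using d by (intro add_mono mult_mono component_le_norm_cart) auto
  finally show "norm ((z$1 *\<^sub>R X v + z$2 *\<^sub>R Y v) - ?L z) \<le> B / 2 * norm z" by simp
 qed (use B(1) in simp)
 have "B / 2 * norm (v - w) \<le> norm (F v - F w)" if "v \<in> ball u \<rho>" "w \<in> ball u \<rho>" for v w
 proof -
  have "norm ((F v - ?L v) - (F w - ?L w)) \<le> B / 2 * norm (v - w)"
   by (rule differentiable_bound[OF convex_ball[of u \<rho>] has_derivative_at_withinI[OF G] bd]) (use that in auto)
  moreover have "(F v - ?L v) - (F w - ?L w) = (F v - F w) - ?L (v - w)" by (simp add: algebra_simps)
  moreover have "norm z' \<le> norm z + norm (z - z')" for z z' :: ambient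
   using norm_triangle_ineq4[of z "z - z'"] by simp
  then have "norm (?L (v - w)) \<le> norm (F v - F w) + norm ((F v - F w) - ?L (v - w))" .
  ultimately show ?thesis using B(2)[of "v - w"] by simp
 qed
 moreover have "\<rho> > 0" using r1(1) r2(1) by (simp add: \<rho>_def)
 ultimately show ?thesis using B(1) by (intro exI[of _ \<rho>] conjI exI[of _ "B/2"]) auto
qed

text \<open>
 A path in the plane that starts at \<open>x\<close> cannot leave the ball of radius \<open>\<rho>\<close> about \<open>x\<close> before its
 length has reached \<open>\<kappa> \<rho>\<close>, up to a constant.
\<close>

lemma tame_plane:
 assumes S: "immersed_surface 1 S" and d: "dom S = (euclidean :: (real^2) topology)"
  and rho: "\<rho> > 0" "\<kappa> > 0" and ex: "\<And>v w. norm (v - w) \<le> \<rho> ==> \<kappa> * norm (v - w) \<le> norm (imm S v - imm S w)"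
 shows "tame 1 S"
 unfolding tame_def
proof (intro conjI allI impI)
 have M: "imm S ` topspace (dom S) \<subseteq> M2 1 \<times> UNIV" using S by (simp add: immersed_surface_def)
 define C :: real where "C = 2 * exp 1 + 3"
 have C: "C > 0" by (simp add: C_def add_pos_pos)
 define L0 where "L0 = min 1 (\<kappa> * \<rho> / (2 * C))"
 have L0: "L0 > 0" using rho C by (simp add: L0_def)
 have main: "\<kappa> * norm (y - x) \<le> C * L" "norm (y - x) \<le> \<rho>" if j: "joined 1 S x y L" "L < L0" for x y L
 proof -
  obtain \<gamma> where \<gamma>: "\<gamma> 0 = x" "\<gamma> 1 = y" "path_length 1 S \<gamma> L" using j(1) unfolding joined_def by (elim exE conjE)
  have L: "0 \<le> L" "L < 1" "L < \<kappa> * \<rho> / (2 * C)"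
   using path_extrinsic(1)[OF M _ \<gamma>(3), of 0] j(2) by (simp_all add: L0_def)
  have "C * L * 2 < \<kappa> * \<rho>" using L(3) C by (simp add: field_simps)
  then have cl: "C * L < \<kappa> * \<rho>" using mult_nonneg_nonneg[OF less_imp_le[OF C] L(1)] by linarith
  have F: "norm (imm S (\<gamma> s) - imm S x) \<le> C * L" if s: "s \<in> {0..1}" for s
  proof -
   have "imm S x \<in> M2 1 \<times> UNIV" using M d by (simp add: image_subset_iff)
   then have "fst (imm S x) \<in> M2 1" by (simp add: mem_Times_iff)
   then have "(fst (imm S x) $ 3)^2 \<le> 1"
    unfolding M2_def mform_def by simp (smt (verit) power2_eq_square zero_le_square)
   then have a: "\<bar>fst (imm S x) $ 3\<bar> \<le> 1" by (simp add: abs_square_le_1)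
   have "2 * \<bar>fst (imm S x) $ 3\<bar> * exp L + 3 \<le> 2 * 1 * exp 1 + 3"
    using a L(2) by (intro add_right_mono mult_mono) auto
   then have "(2 * \<bar>fst (imm S x) $ 3\<bar> * exp L + 3) * L \<le> C * L"
    unfolding C_def using L(1) by (intro mult_right_mono) simp_all
   then show ?thesis using path_extrinsic(2)[OF M _ \<gamma>(3) s] \<gamma>(1) by simp
  qed
  have cont: "continuous_on {0..1} (%s. norm (\<gamma> s - x))"
  proof -
   have "continuous_on {0..1} \<gamma>" using \<gamma>(3) unfolding path_length_def pathin_def d by simp
   then show ?thesis by (intro continuous_intros)
  qed
  have "norm (\<gamma> 1 - x) < \<rho>"
  proof (rule ccontr)
   assume "\<not> norm (\<gamma> 1 - x) < \<rho>"
   \<comment> \<open>A path leaving the ball crosses the sphere of radius \<open>\<rho>\<close>,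
     where the expansion estimate contradicts the bound on the ambient displacement.\<close>
   then have "\<exists>s\<ge>0. s \<le> 1 & norm (\<gamma> s - x) = \<rho>"
    using IVT'[of "%s. norm (\<gamma> s - x)" 0 \<rho> 1] cont \<gamma>(1) rho(1) by auto
   then obtain s where s: "s \<in> {0..1}" "norm (\<gamma> s - x) = \<rho>" by auto
   then show False using ex[of "\<gamma> s" x] F[OF s(1)] cl by simp
  qed
  then show "norm (y - x) \<le> \<rho>" using \<gamma>(2) by simp
  then show "\<kappa> * norm (y - x) \<le> C * L" using ex[of y x] F[of 1] \<gamma>(2) by simp
 qed
 show "\<exists>e>0. \<forall>L. joined 1 S x y L --> e \<le> L" if "x \<noteq> y" for x y
 proof (intro exI[of _ "min L0 (\<kappa> * norm (y - x) / C)"] conjI allI impI)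
  fix L assume j: "joined 1 S x y L"
  show "min L0 (\<kappa> * norm (y - x) / C) \<le> L"
  proof (cases "L < L0")
   case True
   from main(1)[OF j True] show ?thesis using C by (simp add: divide_le_eq mult.commute min.coboundedI2)
  qed simp
 qed (use that rho C L0 in simp)
 show "\<exists>\<rho>>0. \<forall>x\<in>topspace (dom S). \<exists>K. (\<forall>y L. joined 1 S x y L --> L < \<rho> --> y \<in> K) & seq_compactin (dom S) K"
 proof (intro exI[of _ L0] conjI ballI L0)
  fix x :: "real^2"
  have "seq_compactin (top_of_set UNIV) (cball x \<rho>)" by (intro seq_compactin_top_of_set) auto
  moreover have "y \<in> cball x \<rho>" if "joined 1 S x y L" "L < L0" for y L
   using main(2)[OF that] by (simp add: dist_norm norm_minus_commute)
  ultimately show "\<exists>K. (\<forall>y L. joined 1 S x y L --> L < L0 --> y \<in> K) & seq_compactin (dom S) K"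
   using d by (intro exI[of _ "cball x \<rho>"]) auto
 qed
qed (use S in auto)

lemma hinv_strict_mono:
 assumes e: "\<e> \<in> {-1, 1}" and z: "1 - \<e> * z^2 > 0" "1 - \<e> * z'^2 > 0" "z < z'"
 shows "hinv \<e> z < hinv \<e> z'"
proof (rule DERIV_pos_imp_increasing[OF z(3)])
 fix w assume w: "z \<le> w" "w \<le> z'"
 have "1 - \<e> * w^2 > 0"
 proof (cases "\<e> = 1")
  case True
  then have "\<bar>z\<bar> < 1" "\<bar>z'\<bar> < 1" using z abs_square_less_1[of z] abs_square_less_1[of z'] by simp_all
  then have "\<bar>w\<bar> < 1" using w by linarith
  then show ?thesis using True abs_square_less_1[of w] by simp
 next
  case False
  then have "\<e> = -1" using e by auto
  then show ?thesis by (simp add: add_pos_nonneg)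
 qed
 then show "\<exists>y. (hinv \<e> has_real_derivative y) (at w) & 0 < y"
  using hinv_deriv[OF e] by (intro exI[of _ "1 / (1 - \<e> * w^2)"]) simp
qed

lemma hinv_inj:
 assumes e: "\<e> \<in> {-1, 1}" and z: "1 - \<e> * z^2 > 0" "1 - \<e> * z'^2 > 0" "hinv \<e> z = hinv \<e> z'"
 shows "z = z'"
 using hinv_strict_mono[OF e z(1,2)] hinv_strict_mono[OF e z(2,1)] z(3) by (cases z z' rule: linorder_cases) auto

section \<open>Injectivity modulo periods and properness in the hyperbolic case\<close>

context delaunay
begin

lemma tq_bound: "1 - \<e> * (tt x * sn y)^2 > 0"
 using D_pos[of x y] by (simp add: power_mult_distrib mult.assoc)

text \<open>\<open>dn\<close> is positive and determined by \<open>sn\<close>, so \<open>rr\<close>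
  determines \<open>cn\<close>; sine and cosine fix \<open>psi\<close> modulo
  \<open>2 * pi\<close>.\<close>

lemma y_from_sn:
 assumes s: "sn y = sn y'" and r: "rr y = rr y'"
 shows "\<exists>j::int. y' = y + of_int j * (2 * Py)"
proof -
 have "dn y = dn y'"
 proof -
  have "(dn y)^2 = (dn y')^2" unfolding dn2 s ..
  then show ?thesis using dn_pos[of y] dn_pos[of y'] by (simp add: power2_eq_iff)
 qed
 then have "cn y = cn y'" using r dn_pos[of y] by (simp add: rr_def)
 then have "\<exists>n::int. psi y' = psi y + 2 * pi * n"
  using s sin_cos_eq_iff[of "psi y'" "psi y"] unfolding sn_def cn_def by metis
 then obtain n :: int where "psi y' = psi y + 2 * pi * n" ..
 then have "psi y' = psi (y + of_int n * (2 * Py))" unfolding psi_int by (simp add: mult.commute)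
 then show ?thesis using strict_mono_eq[OF psi_mono] by (intro exI[of _ n]) simp
qed

lemma tq_eq: "fh x y = fh x' y' ==> tt x * sn y = tt x' * sn y'"
 unfolding fh_def using hinv_inj[OF eps tq_bound tq_bound] eta_pos by simp

text \<open>Height and \<open>fw\<close> determine \<open>T = t q\<close> and
  \<open>W = t r\<close>, since \<open>fd\<close> depends on \<open>t q\<close> only. Eliminating
  \<open>q\<close> and \<open>r\<close> gives
  \<open>t^2 W^2 = t^4 - (1 + m^2) t^2 T^2 + m^2 T^4\<close>; a second root of this quadratic in
  \<open>t^2\<close> would force \<open>m^2 q^2 q'^2 = 1\<close>, against
  \<open>m < 1\<close>.\<close>

lemma profile_inj:
 assumes e: "\<e> = -1" and h: "fh x y = fh x' y'" and w: "fw x y = fw x' y'"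
 shows "sn y = sn y'" "rr y = rr y'"
proof -
 define t q r t' q' r' where d: "t = tt x" "q = sn y" "r = rr y" "t' = tt x'" "q' = sn y'" "r' = rr y'"
 have T: "t * q = t' * q'" using tq_eq[OF h] by (simp add: d)
 have t0: "t > 0" "t' > 0" using tt_pos by (simp_all add: d)
 have "fd x y = fd x' y'"
 proof -
  have "(tt x * sn y)^2 = (tt x' * sn y')^2" using tq_eq[OF h] by simp
  then show ?thesis unfolding fd_def by (simp add: power_mult_distrib mult.assoc)
 qed
 then have W: "t * r = t' * r'"
  using w b_pos fd_pos(1)[of x' y'] by (simp add: f_eqs d)
 have r: "r^2 = (1 - q^2) * (1 - m^2 * q^2)" "r'^2 = (1 - q'^2) * (1 - m^2 * q'^2)"
  using profile_point.r2[OF pp] by (simp_all add: d)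
 have "t = t'"
 proof (rule ccontr)
  assume "t \<noteq> t'"
  then have ne: "t^2 - t'^2 \<noteq> 0" using t0 by (simp add: power2_eq_iff)
  have 1: "t^2 * (t * r)^2 = t^4 - (1 + m^2) * t^2 * (t * q)^2 + m^2 * (t * q)^4"
   unfolding power_mult_distrib r by algebra
  have 2: "t'^2 * (t * r)^2 = t'^4 - (1 + m^2) * t'^2 * (t * q)^2 + m^2 * (t * q)^4"
   unfolding T W unfolding power_mult_distrib r by algebra
  have "(t^2 - t'^2) * (t^2 * t'^2 - m^2 * (t * q)^4) = 0" using 1 2 by algebra
  moreover have "t^2 * t'^2 - m^2 * (t * q)^4 = t^2 * t'^2 * (1 - m^2 * q^2 * q'^2)"
  proof -
   have "(t * q)^4 = (t * q)^2 * (t' * q')^2" unfolding T[symmetric] by algebra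
   then show ?thesis by algebra
  qed
  ultimately have "(t^2 - t'^2) * (t^2 * t'^2 * (1 - m^2 * q^2 * q'^2)) = 0" by (simp only:)
  then have "t^2 * t'^2 * (1 - m^2 * q^2 * q'^2) = 0" using ne by simp
  then have "m^2 * q^2 * q'^2 = 1" using t0 by simp
  moreover have "m^2 * q^2 * q'^2 \<le> m^2 * 1 * 1"
   using sn_le by (intro mult_mono) (auto simp: d)
  moreover have "m^2 < 1" using m_pos m_lt1 by (simp add: power_less_one_iff)
  ultimately show False by simp
 qed
 then show "sn y = sn y'" "rr y = rr y'" using T W t0 by (simp_all add: d)
qed

text \<open>
 The inequality behind the injectivity in the hyperbolic case: along the curves \<open>y = const\<close> the
 component of the velocity parallel to the axis never vanishes.
\<close>

lemma axial_speed:
 assumes e: "\<e> = -1"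
 shows "(fXc x y)^2 < (1 + (fw x y)^2) * (flam x y - (fhx x y)^2)"
proof -
 define t s q r d p where a: "t = tt x" "s = ts x" "q = sn y" "r = rr y" "d = fd x y" "p = c * (m + (tt x)^2)"
 have em: "\<e> * z = - z" for z using e by simp
 have E: "flam x y - (fhx x y)^2 = \<eta>^2 * t^2 * r^2 * d^2 + \<eta>^2 * q^2 * p^2 * d^2"
  using profile_point.normal_vertical[OF pp, of x y] unfolding flam_def fhx_def profile_point.hy_def[OF pp]
  by (simp add: a power_mult_distrib mult_ac)
 have d: "d * (1 + t^2 * q^2) = 1" "d > 0" using fd_inv(1)[of x y] fd_pos(1)[of x y] em by (simp_all add: a)
 have X: "(fXc x y)^2 = b^2 * s^2 * r^2 * d^2 * (d * (1 - t^2 * q^2))^2"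
  unfolding fXc_def profile_point.Xc_def[OF pp] em mult.assoc by (simp add: a power_mult_distrib)
 have "(d * (1 - t^2 * q^2))^2 \<le> 1"
 proof -
  have "0 \<le> d * (t^2 * q^2)" using d(2) by simp
  then have "d * (1 - t^2 * q^2) \<le> 1" "-1 \<le> d * (1 - t^2 * q^2)"
   using d by (simp_all only: distrib_left right_diff_distrib mult_1_right)
  then show ?thesis by (simp add: abs_square_le_1 abs_le_iff)
 qed
 then have 1: "(fXc x y)^2 \<le> b^2 * s^2 * r^2 * d^2" unfolding X by (simp add: mult_left_le)
 have s2: "s^2 = (1 - m)^2 * t^2 - p^2"
  using ts2[of x] em by (simp add: a power_mult_distrib)
 have eb: "\<eta> = b * (1 + m)" using eta_b em by simp
 have pp0: "p > 0" using c_pos pt_pos[of x] by (simp add: a)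
 have "b^2 * s^2 * r^2 * d^2 \<le> \<eta>^2 * s^2 * r^2 * d^2"
 proof -
  have "b * 1 \<le> \<eta>" unfolding eb using b_pos m_pos by (intro mult_left_mono) auto
  then have "b^2 \<le> \<eta>^2" using b_pos by (intro power_mono) auto
  then show ?thesis by (intro mult_right_mono) auto
 qed
 also have "\<dots> \<le> \<eta>^2 * (t^2 - p^2) * r^2 * d^2"
 proof -
  have "(1 - m)^2 \<le> 1" using m_pos m_lt1 by (simp add: power_le_one)
  then have "(1 - m)^2 * t^2 \<le> 1 * t^2" by (intro mult_right_mono) auto
  then show ?thesis unfolding s2 by (intro mult_right_mono mult_left_mono) auto
 qed
 also have "\<dots> = flam x y - (fhx x y)^2 - \<eta>^2 * d^2 * p^2 * (r^2 + q^2)"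
  unfolding E by algebra
 also have "\<dots> < flam x y - (fhx x y)^2"
 proof -
  have "r^2 + q^2 > 0"
  proof (cases "q = 0")
   case True
   then have "r^2 = 1" using profile_point.r2[OF pp[of x y]] by (simp add: a)
   then show ?thesis using True by simp
  qed (simp add: add_nonneg_pos)
  then show ?thesis using eta_pos d(2) pp0 by simp
 qed
 also have "\<dots> \<le> (1 + (fw x y)^2) * (flam x y - (fhx x y)^2)"
 proof -
  have "0 \<le> flam x y - (fhx x y)^2" unfolding E by simp
  then show ?thesis by (simp add: mult_right_mono algebra_simps)
 qed
 finally show ?thesis using 1 by simp
qed

text \<open>The third hypothesis says that the velocity \<open>x\<close> at the point
  \<open>p\<close> of the hyperboloid is orthogonal to the translation field
  \<open>(p3, 0, p1)\<close>. Its square is then determined by its second component, and for the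
  immersion \<open>axial_speed\<close> excludes the resulting value.\<close>

lemma axial_identity:
 fixes p1 p2 p3 x1 x2 x3 :: real
 assumes h: "p1^2 + p2^2 - p3^2 = -1" "p1 * x1 + p2 * x2 - p3 * x3 = 0" "x1 * p3 - p1 * x3 = 0"
  and E: "E = x1^2 + x2^2 - x3^2"
 shows "(1 + p2^2) * E = x2^2"
proof -
 have a: "x1 * p3 = p1 * x3" and b: "p1 * x1 - p3 * x3 = - (p2 * x2)" and c: "1 + p2^2 = p3^2 - p1^2" using h by simp_all
 have "(p3^2 - p1^2) * (x1^2 - x3^2) = (x1 * p3)^2 + (p1 * x3)^2 - (p3 * x3)^2 - (p1 * x1)^2" by algebra
 also have "\<dots> = 2 * (x1 * p3) * (p1 * x3) - (p3 * x3)^2 - (p1 * x1)^2" unfolding a by algebra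
 also have "\<dots> = - ((p1 * x1 - p3 * x3)^2)" by algebra
 finally have "(1 + p2^2) * (x1^2 - x3^2) = - (p2^2 * x2^2)" unfolding b c by (simp add: power_mult_distrib)
 then show ?thesis unfolding E by (simp add: algebra_simps)
qed

lemma FF_line: "((%x. FF (vector [x, y])) has_vector_derivative XX (vector [x, y])) (at x)"
proof -
 have *: "(vector [x, y] :: real^2) = x *\<^sub>R axis 1 1 + y *\<^sub>R axis 2 1" for x y
  by (simp add: vec_eq_iff forall_2 axis_def)
 have "((%x. vector [x, y] :: real^2) has_derivative (%h. h *\<^sub>R axis 1 1)) (at x)"
  unfolding * by (auto intro!: derivative_eq_intros)
 from has_derivative_compose[OF this FF_deriv] show ?thesis
  by (simp add: has_vector_derivative_def axis_def)
qed

text \<open>\<open>P1 / P3\<close> is the hyperbolic tangent of the position along the axis. Its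
  derivative in \<open>x\<close> never vanishes, so by Rolle's theorem no two points of a line
  \<open>y = const\<close> have the same image.\<close>

lemma x_inj:
 assumes e: "\<e> = -1" and F: "FF (vector [x, y]) = FF (vector [x', y])"
 shows "x = x'"
proof -
 define P X where "P x = fst (FF (vector [x, y]))" and "X x = fst (XX (vector [x, y]))" for x
 have D: "((%x. P x $ i) has_real_derivative X x $ i) (at x)" for i x
 proof -
  from has_derivative_fst[OF FF_line[unfolded has_vector_derivative_def]]
  have "(P has_vector_derivative X x) (at x)" by (simp add: has_vector_derivative_def P_def[abs_def] X_def)
  from bounded_linear.has_vector_derivative[OF bounded_linear_vec_nth this]
  show ?thesis by (simp add: has_real_derivative_iff_has_vector_derivative)
 qed
 interpret ci: conformal_immersion \<e> H FF NN "%u. flam (u$1) (u$2)" by (rule conformal_FF)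
 have P: "mform \<e> (P x) (P x) = \<e>" "P x $ 3 > 0" for x
  using ci.in_M2[of "vector [x, y]"] e by (auto simp: M2_def P_def)
 have PX: "mform \<e> (P x) (X x) = 0" for x
  using ci.tangent[of "vector [x, y]" "axis 1 1"] by (simp add: P_def X_def FF_partials)
 have nz: "X x $ 1 * P x $ 3 - P x $ 1 * X x $ 3 \<noteq> 0" for x
 proof
  assume z: "X x $ 1 * P x $ 3 - P x $ 1 * X x $ 3 = 0"
  have em: "\<e> * z = - z" for z using e by simp
  have c: "mform \<e> (X x) (X x) = flam x y - (fhx x y)^2"
   using ci.conf(1)[of "vector [x, y]"] by (simp add: FF_partials X_def pform_def XX_def power2_eq_square)
  have n: "P x $ 2 = fw x y" "X x $ 2 = fXc x y" by (simp_all add: P_def X_def FF_def XX_def)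
  have "(P x $ 1)^2 + (P x $ 2)^2 - (P x $ 3)^2 = -1" "P x $ 1 * X x $ 1 + P x $ 2 * X x $ 2 - P x $ 3 * X x $ 3 = 0"
   using P(1)[of x] PX[of x] unfolding mform_def em by (simp_all only: power2_eq_square e diff_conv_add_uminus)
  moreover have "flam x y - (fhx x y)^2 = (X x $ 1)^2 + (X x $ 2)^2 - (X x $ 3)^2"
   unfolding c[symmetric] mform_def em by (simp only: power2_eq_square diff_conv_add_uminus)
  ultimately have "(1 + (P x $ 2)^2) * (flam x y - (fhx x y)^2) = (X x $ 2)^2"
   by (intro axial_identity[OF _ _ z])
  then show False using axial_speed[OF e, of x y] by (simp add: n)
 qed
 have g: "((%x. P x $ 1 / P x $ 3) has_real_derivative (X x $ 1 * P x $ 3 - P x $ 1 * X x $ 3) / (P x $ 3 * P x $ 3)) (at x)" for x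
  using P(2)[of x] by (intro DERIV_divide D) auto
 have eq: "P x = P x'" using F by (simp add: P_def)
 have no: False if "u < v" "P u = P v" for u v
 proof -
  have "\<exists>z>u. z < v & ((%x. P x $ 1 / P x $ 3) has_real_derivative 0) (at z)"
  proof (rule Rolle[OF that(1)])
   show "continuous_on {u..v} (%x. P x $ 1 / P x $ 3)"
    by (intro continuous_at_imp_continuous_on ballI DERIV_isCont[OF g])
   show "(%x. P x $ 1 / P x $ 3) differentiable (at z)" for z by (rule differentiableI[OF g[unfolded has_field_derivative_def]])
  qed (use that in simp)
  then obtain z where "((%x. P x $ 1 / P x $ 3) has_real_derivative 0) (at z)" by blast
  from DERIV_unique[OF this g[of z]] nz[of z] P(2)[of z] show False by simp
 qed
 show ?thesis using no[of x x'] no[of x' x] eq by (cases x x' rule: linorder_cases) auto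
qed

definition "LY = {vector [0, of_int j * (2 * Py)] :: real^2 | j. True}"

lemma FF_eq_hyp:
 assumes e: "\<e> = -1"
 shows "FF u = FF v \<longleftrightarrow> v - u \<in> LY"
proof
 assume "v - u \<in> LY"
 then obtain j where "v - u = vector [0, of_int j * (2 * Py)]" by (auto simp: LY_def)
 then have "v = u + vector [0, of_int j * (2 * Py)]" by (simp add: algebra_simps)
 then show "FF u = FF v" by (simp add: FF_period_y)
next
 assume F: "FF u = FF v"
 have h: "fh (u$1) (u$2) = fh (v$1) (v$2)" using F by (simp add: FF_def)
 have "fst (FF u) $ 2 = fst (FF v) $ 2" using F by simp
 then have w: "fw (u$1) (u$2) = fw (v$1) (v$2)" by (simp add: FF_def)
 obtain j where j: "v$2 = u$2 + of_int j * (2 * Py)" using y_from_sn[OF profile_inj[OF e h w]] by blast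
 have "FF (vector [u$1, u$2]) = FF (vector [v$1, u$2])"
 proof -
  have 1: "vector [u$1, u$2] = u" and 2: "v = vector [v$1, u$2] + vector [0, of_int j * (2 * Py)]"
   using j by (simp_all add: vec_eq_iff forall_2)
  show ?thesis using F unfolding 1 by (subst (asm) 2) (simp add: FF_period_y)
 qed
 then have "u$1 = v$1" by (rule x_inj[OF e])
 then have "v - u = vector [0, of_int j * (2 * Py)]" using j by (simp add: vec_eq_iff forall_2)
 then show "v - u \<in> LY" by (auto simp: LY_def)
qed

lemma reduce_period:
 fixes P y :: real
 assumes "P > 0"
 shows "\<exists>j::int. \<bar>y + of_int j * P\<bar> \<le> P"
proof (intro exI[of _ "- \<lfloor>y / P\<rfloor>"])
 have "of_int \<lfloor>y / P\<rfloor> * P \<le> y / P * P" "y / P * P \<le> (of_int \<lfloor>y / P\<rfloor> + 1) * P"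
  using assms by (intro mult_right_mono; linarith)+
 then show "\<bar>y + of_int (- \<lfloor>y / P\<rfloor>) * P\<bar> \<le> P" using assms by (simp add: algebra_simps)
qed

lemma norm_vec2_le: "norm (v::real^2) \<le> \<bar>v$1\<bar> + \<bar>v$2\<bar>"
 using norm_le_l1_cart[of v] by (simp add: sum_2)

text \<open>For an upper bound \<open>K\<close> of \<open>A\<close> one has
  \<open>1 \<le> A^2 - B^2 = (A - |B|) (A + |B|) \<le> (A - |B|) 2 K\<close>.\<close>

lemma A_minus_B:
 assumes e: "\<e> = -1"
 shows "\<exists>K>0. \<forall>x y. K \<le> fA x y - \<bar>fB x y\<bar>"
proof -
 define K where "K = 1 + b * (1 - m) * \<eta> * \<tau>^2 / 2"
 have em: "- (\<e> * z) = z" "\<e> * z = - z" for z using e by simp_all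
 have up: "fA x y \<le> K" for x y
 proof -
  have d: "fd x y \<le> 1" "fd1 x \<le> 1"
   using D_pos[of x y] D1_pos[of x] unfolding fd_def fd1_def em mult.assoc by simp_all
  have t: "(tt x)^2 \<le> \<tau>^2" using tt_bounds(2)[of x] tt_pos[of x] by (intro power_mono) auto
  have c0: "0 \<le> b * (1 - m) * \<eta>" using b_pos m_lt1 eta_pos by simp
  have "b * (1 - m) * \<eta> * (tt x)^2 * (1 - (sn y)^2) * fd x y * fd1 x \<le> b * (1 - m) * \<eta> * \<tau>^2 * 1 * 1 * 1"
   using d t c0 sn_le[of y] fd_pos(1)[of x y] fd_pos(2)[of x] b_pos m_lt1 eta_pos
   by (intro mult_mono) (auto simp: less_imp_le)
  moreover have "fA x y = 1 + - (\<e> * (b * (1 + \<e> * m) * \<eta> * (tt x)^2 * (1 - (sn y)^2) * fd x y * fd1 x / 2))"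
   unfolding f_eqs by algebra
  then have "fA x y = 1 + b * (1 - m) * \<eta> * (tt x)^2 * (1 - (sn y)^2) * fd x y * fd1 x / 2"
   unfolding em(1) unfolding em(2) by simp
  ultimately show ?thesis unfolding K_def by simp
 qed
 have K: "K > 0" using up[of 0 0] A_gt[OF e, of 0 0] by linarith
 have "1 / (2 * K) \<le> fA x y - \<bar>fB x y\<bar>" for x y
 proof -
  have "1 + (fw x y)^2 = (fA x y - \<bar>fB x y\<bar>) * (fA x y + \<bar>fB x y\<bar>)"
   using ABw[of x y] unfolding em(2) by (simp add: algebra_simps power2_eq_square)
  then have "1 \<le> (fA x y - \<bar>fB x y\<bar>) * (fA x y + \<bar>fB x y\<bar>)" by (smt (verit) zero_le_power2)
  also have "\<dots> \<le> (fA x y - \<bar>fB x y\<bar>) * (2 * K)"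
   using A_gt[OF e, of x y] up[of x y] by (intro mult_left_mono) auto
  finally show ?thesis using K by (simp add: divide_le_eq)
 qed
 then show ?thesis using K by (intro exI[of _ "1 / (2 * K)"]) auto
qed

lemma II_lower:
 assumes e: "\<e> = -1"
 shows "\<exists>K>0. \<forall>x. K * \<bar>x\<bar> \<le> \<bar>II x\<bar>"
proof -
 define K where "K = \<eta> * c * m / (1 + \<tau>^2)"
 have K: "K > 0" using eta_pos c_pos m_pos by (simp add: K_def add_pos_nonneg)
 have em: "- (\<e> * z) = z" for z using e by simp
 have lo: "K * x \<le> II x" if "x \<ge> 0" for x
 proof -
  have "II 0 - K * 0 \<le> II x - K * x"
  proof (rule DERIV_nonneg_imp_nondecreasing[OF that, of "%x. II x - K * x"])
   fix z
   have "(tt z)^2 \<le> \<tau>^2" using tt_bounds(2)[of z] tt_pos[of z] by (intro power_mono) auto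
   then have "K \<le> \<eta> * c * (m + (tt z)^2) / (1 + (tt z)^2)"
    unfolding K_def using eta_pos c_pos m_pos by (intro frac_le mult_left_mono) (auto simp: add_pos_nonneg)
   also have "\<dots> = \<eta> * c * (m + (tt z)^2) / (1 - \<e> * (tt z)^2)"
    using em[of "(tt z)^2"] by (simp only: diff_conv_add_uminus)
   finally have "0 \<le> \<eta> * c * (m + (tt z)^2) / (1 - \<e> * (tt z)^2) - K" by simp
   moreover have "((%x. II x - K * x) has_real_derivative \<eta> * c * (m + (tt z)^2) / (1 - \<e> * (tt z)^2) - K) (at z)"
    by (rule DERIV_cong[OF DERIV_diff[OF II(2) DERIV_cmult[OF DERIV_ident]]]) simp
   ultimately show "\<exists>y. ((%x. II x - K * x) has_real_derivative y) (at z) & 0 \<le> y" by blast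
  qed
  then show ?thesis using II(1) by simp
 qed
 have "K * \<bar>x\<bar> \<le> \<bar>II x\<bar>" for x using lo[of x] lo[of "- x"] II_minus[of x] K by (cases "x \<ge> 0") auto
 then show ?thesis using K by blast
qed

lemma abs_le_cosh: "\<bar>z\<bar> \<le> cosh (z::real)"
proof -
 have "z \<le> cosh z" for z :: real
 proof (cases "z \<ge> 0")
  case True
  have "0 \<le> (z - 1)^2 + 1" by simp
  then have "2 * z \<le> 1 + z + z^2 / 2" by (simp add: power2_eq_square algebra_simps)
  from order_trans[OF this exp_lower_Taylor_quadratic[OF True]] have "2 * z + 0 \<le> exp z + exp (- z)"
   by (intro add_mono) simp_all
  then show ?thesis unfolding cosh_field_def by simp
 next
  case False
  then show ?thesis using cosh_real_pos[of z] by linarith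
 qed
 from this[of z] this[of "- z"] show ?thesis by (simp add: abs_le_iff)
qed

text \<open>A bounded image point has bounded \<open>x\<close>, because its third coordinate is at
  least a multiple of \<open>cosh (II x)\<close> and \<open>II\<close> grows linearly;
  \<open>y\<close> is reduced by its period. Nonzero elements of \<open>LY\<close> have length at
  least \<open>2 * Py\<close>, hence charts of radius \<open>Py\<close>.\<close>

lemma FF_covering_hyp:
 assumes e: "\<e> = -1"
 shows "plane_covering FF LY Py" "closed (range FF)"
proof -
 interpret ci: conformal_immersion \<e> H FF NN "%u. flam (u$1) (u$2)" by (rule conformal_FF)
 obtain K1 where K1: "K1 > 0" "\<And>x y. K1 \<le> fA x y - \<bar>fB x y\<bar>" using A_minus_B[OF e] by blast
 obtain K2 where K2: "K2 > 0" "\<And>x. K2 * \<bar>x\<bar> \<le> \<bar>II x\<bar>" using II_lower[OF e] by blast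
 have pr: "\<exists>l\<in>LY. norm (u + l) \<le> R / (K1 * K2) + 2 * Py" if u: "norm (FF u) \<le> R" for u R
 proof -
  have "fst (FF u) $ 3 \<le> norm (FF u)"
   using component_le_norm_cart[of "fst (FF u)" 3] norm_fst_le[of "fst (FF u)" "snd (FF u)"] by (simp only: prod.collapse)
  then have 1: "(fA (u$1) (u$2) - \<bar>fB (u$1) (u$2)\<bar>) * cosh (II (u$1)) \<le> R" using FF3_ge[OF e, of u] u by linarith
  have "K1 * (K2 * \<bar>u$1\<bar>) \<le> (fA (u$1) (u$2) - \<bar>fB (u$1) (u$2)\<bar>) * cosh (II (u$1))"
   using K1(1) K1(2)[of "u$1" "u$2"] K2(2)[of "u$1"] K2(1) abs_le_cosh[of "II (u$1)"] by (intro mult_mono) (auto intro: less_imp_le)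
  then have 2: "\<bar>u$1\<bar> \<le> R / (K1 * K2)" using 1 K1(1) K2(1) by (simp add: pos_le_divide_eq mult_ac)
  obtain j :: int where "\<bar>u$2 + of_int j * (2 * Py)\<bar> \<le> 2 * Py" using reduce_period[of "2 * Py" "u$2"] Py_pos by auto
  then have "norm (u + vector [0, of_int j * (2 * Py)]) \<le> R / (K1 * K2) + 2 * Py"
   using norm_vec2_le[of "u + vector [0, of_int j * (2 * Py)]"] 2 by simp
  then show ?thesis by (auto simp: LY_def)
 qed
 have dl: "l = 0" if "l \<in> LY" "norm l < 2 * Py" for l
 proof -
  obtain j where j: "l = vector [0, of_int j * (2 * Py)]" using \<open>l \<in> LY\<close> by (auto simp: LY_def)
  have "\<bar>l$2\<bar> < 2 * Py" using component_le_norm_cart[of l 2] that(2) by linarith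
  then have "\<bar>of_int j\<bar> * (2 * Py) < 1 * (2 * Py)" using j Py_pos by (simp add: abs_mult)
  then have "j = 0" using Py_pos by (simp only: mult_less_cancel_right_pos)
  then show ?thesis using j by (simp add: vec_eq_iff forall_2)
 qed
 have pr': "\<exists>M. \<forall>u. norm (FF u) \<le> R --> (\<exists>l\<in>LY. norm (u + l) \<le> M)" for R using pr by (intro exI allI impI)
 show "plane_covering FF LY Py" by (rule plane_covering_proper(1)[OF ci.cont_F FF_eq_hyp[OF e] pr' Py_pos dl])
 show "closed (range FF)" by (rule plane_covering_proper(2)[OF ci.cont_F FF_eq_hyp[OF e] pr' Py_pos dl])
qed

section \<open>The case of constant profile: the cylinder\<close>

definition "sgm = \<eta> * c * (m + \<tau>^2) / (1 - \<e> * \<tau>^2)"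

text \<open>The profile is squeezed between \<open>\<sigma>\<close> and \<open>\<tau>\<close>, so
  \<open>II\<close> is linear with slope \<open>sgm\<close>. The relation
  \<open>1 - \<e> m = \<tau> \<eta> c\<close> is the root of an identity between squares of positive
  numbers.\<close>

lemma cyl_facts:
 assumes s: "\<sigma> = \<tau>"
 shows "tt x = \<tau>" "ts x = 0" "m = \<tau>^2" "b * \<tau> = 1 / c" "1 - \<e> * m = \<tau> * \<eta> * c" "II x = sgm * x" "sgm > 0"
  "\<tau> * (c + 2 * H) = 1"
proof -
 show t: "tt x = \<tau>" for x using tt_bounds[of x] s by simp
 show "ts x = 0" unfolding ts_def s by simp
 show m: "m = \<tau>^2" unfolding m_def s by (simp add: power2_eq_square)
 have u: "1 + \<e> * m = 2 * c * \<tau>" using sum_eq s by simp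
 have ec: "\<eta> * c = 4 * H" using c_pos by (simp add: \<eta>_def)
 have "(1 - \<e> * m)^2 = (\<tau> * \<eta> * c)^2"
 proof -
  have "(1 - \<e> * m)^2 = (1 + \<e> * m)^2 - 4 * \<e> * m" by algebra
  also have "\<dots> = 4 * \<tau>^2 * (c^2 - \<e>)" unfolding u unfolding m by algebra
  also have "\<dots> = (\<tau> * (\<eta> * c))^2" unfolding ec c2 by algebra
  finally show ?thesis by (simp add: mult.assoc)
 qed
 then show k: "1 - \<e> * m = \<tau> * \<eta> * c"
  using em_pos(1) tau_pos eta_pos c_pos by (simp add: power2_eq_iff_nonneg less_imp_le)
 show "b * \<tau> = 1 / c" unfolding b_def k using tau_pos eta_pos c_pos by simp
 have D1: "1 - \<e> * \<tau>^2 > 0" using D1_pos[of 0] t by simp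
 then show p: "sgm > 0" unfolding sgm_def using eta_pos c_pos m_pos by (simp add: add_pos_nonneg)
 show "II x = sgm * x"
  by (rule II_unique[symmetric]) (use D1 in \<open>auto intro!: derivative_eq_intros simp: t sgm_def\<close>)
 have "2 * c * \<tau> = 1 + \<e> * \<tau>^2" "\<tau> * (4 * H) = 1 - \<e> * \<tau>^2" using u k ec m by (simp_all add: mult.assoc)
 then show "\<tau> * (c + 2 * H) = 1" by (simp add: algebra_simps)
qed

text \<open>The first identity makes \<open>sqrt (1 - c^2 w^2)\<close> a function of
  \<open>sn y\<close> alone, up to sign; this is what allows the height to be written over the strip
  \<open>c^2 w^2 < 1\<close>.\<close>

lemma cyl_w:
 assumes s: "\<sigma> = \<tau>"
 shows "1 - c^2 * (fw x y)^2 = (sn y)^2 * (1 - \<e> * m)^2 * (fd x y)^2"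
  "fA x y = 1 - \<e> * (\<tau> / c) * (1 - (sn y)^2) * fd x y" "fB x y = 0" "fA x y > 0"
proof -
 note cf = cyl_facts[OF s]
 have w: "fw x y = 1 / c * (rr y * fd x y)" unfolding f_eqs cf(1) using cf(4) by (simp add: mult.assoc[symmetric])
 have r: "(rr y)^2 = (1 - (sn y)^2) * (1 - m^2 * (sn y)^2)" by (rule profile_point.r2[OF pp])
 have d: "fd x y * (1 - \<e> * m * (sn y)^2) = 1" using fd_inv(1)[of x y] unfolding cf(1) cf(3)[symmetric] .
 have "c^2 * (fw x y)^2 = (rr y)^2 * (fd x y)^2" unfolding w using c_pos by (simp add: power_mult_distrib power_divide)
 then show "1 - c^2 * (fw x y)^2 = (sn y)^2 * (1 - \<e> * m)^2 * (fd x y)^2"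
  unfolding r using d ee by algebra
 show "fB x y = 0" unfolding f_eqs cf(2) by simp
 have k: "b * \<eta> * \<tau>^2 * fd1 x = 1 / c^2"
 proof -
  have f1: "fd1 x * (\<tau> * \<eta> * c) = 1" using fd_inv(2)[of x] unfolding cf(1) cf(3)[symmetric] cf(5) .
  have "b * \<eta> * \<tau>^2 * fd1 x * c = (b * \<tau>) * (fd1 x * (\<tau> * \<eta> * c))" by algebra
  then show ?thesis unfolding f1 cf(4) using c_pos by (simp add: field_simps power2_eq_square)
 qed
 have u: "1 + \<e> * m = 2 * c * \<tau>" using sum_eq s by simp
 have "fA x y = 1 - \<e> * (1 + \<e> * m) * (b * \<eta> * \<tau>^2 * fd1 x) * (1 - (sn y)^2) * fd x y / 2"
  unfolding f_eqs cf(1) by algebra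
 also have "\<dots> = 1 - \<e> * (\<tau> / c) * (1 - (sn y)^2) * fd x y"
  unfolding k u using c_pos by (simp add: field_simps power2_eq_square)
 finally show A: "fA x y = 1 - \<e> * (\<tau> / c) * (1 - (sn y)^2) * fd x y" .
 show "fA x y > 0"
 proof (cases "\<e> = 1")
  case True
  have "m * (sn y)^2 \<le> 1 * (sn y)^2" using m_lt1 by (intro mult_right_mono) auto
  then have "1 - (sn y)^2 \<le> 1 - \<e> * m * (sn y)^2" using True by simp
  then have "(1 - (sn y)^2) * fd x y \<le> (1 - \<e> * m * (sn y)^2) * fd x y"
   using fd_pos(1)[of x y] by (intro mult_right_mono) auto
  then have 1: "(1 - (sn y)^2) * fd x y \<le> 1" using d by (simp add: mult.commute)
  have 2: "\<tau> / c < 1" using tau_lt1[OF True] c_gt1[OF True] c_pos by simp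
  have "(\<tau> / c) * ((1 - (sn y)^2) * fd x y) \<le> (\<tau> / c) * 1" using 1 tau_pos c_pos by (intro mult_left_mono) auto
  then show ?thesis unfolding A using 2 True by (simp add: mult.assoc)
 next
  case False
  then have "\<e> = -1" using eps by auto
  then show ?thesis using A_gt[of x y] by linarith
 qed
qed

lemma FF_cyl_along:
 assumes s: "\<sigma> = \<tau>"
 shows "FF (u + vector [t / sgm, 0]) = horizontal (along \<e> (axis 3 1) (axis 1 1) (axis 2 1) t) (FF u)"
proof -
 note cf = cyl_facts[OF s]
 have "II (u$1 + t / sgm) = II (u$1) + t" unfolding cf(6) using cf(7) by (simp add: algebra_simps)
 then show ?thesis
  using f_cong[of "u$1 + t / sgm" "u$1" "u$2" "u$2"]
  by (simp add: FF_def horizontal_def along_vE[OF eps] cf(1,2))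
qed

lemma FF_NN_cyl_period:
 assumes s: "\<sigma> = \<tau>" and e: "\<e> = 1"
 shows "FF (u + vector [of_int i * (2 * pi / sgm), 0]) = FF u" "NN (u + vector [of_int i * (2 * pi / sgm), 0]) = NN u"
proof -
 note cf = cyl_facts[OF s]
 have "II (u$1 + of_int i * (2 * pi / sgm)) = II (u$1) + of_int i * (2 * pi)" unfolding cf(6) using cf(7) by (simp add: algebra_simps)
 then have "gsin \<e> (II (u$1 + of_int i * (2 * pi / sgm))) = gsin \<e> (II (u$1))"
  "gcos \<e> (II (u$1 + of_int i * (2 * pi / sgm))) = gcos \<e> (II (u$1))"
  using sin_int_2pin[of i] cos_int_2pin[of i] e by (simp_all add: gsin_def gcos_def sin_add cos_add mult.commute)
 then have "vE \<e> (II (u$1 + of_int i * (2 * pi / sgm))) a b' w = vE \<e> (II (u$1)) a b' w" for a b' w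
  by (simp add: vE_def)
 then show "FF (u + vector [of_int i * (2 * pi / sgm), 0]) = FF u" "NN (u + vector [of_int i * (2 * pi / sgm), 0]) = NN u"
  using f_cong[of "u$1 + of_int i * (2 * pi / sgm)" "u$1" "u$2" "u$2"]
  by (simp_all add: FF_def NN_def cf(1,2))
qed

definition "LXY = {vector [of_int i * (2 * pi / sgm), of_int j * (2 * Py)] :: real^2 | i j. True}"

lemma cyl_y:
 assumes s: "\<sigma> = \<tau>" and F: "fh x y = fh x' y'" "fw x y = fw x' y'"
 shows "sn y = sn y'" "rr y = rr y'" "fA x y = fA x' y'"
proof -
 note cf = cyl_facts[OF s]
 show q: "sn y = sn y'" using tq_eq[OF F(1)] tau_pos unfolding cf(1) by simp
 have d: "fd x y = fd x' y'" unfolding fd_def cf(1) q ..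
 have d1: "fd1 x = fd1 x'" unfolding fd1_def cf(1) ..
 show "rr y = rr y'" using F(2) b_pos tau_pos fd_pos(1)[of x' y'] unfolding f_eqs cf(1) d by simp
 show "fA x y = fA x' y'" unfolding f_eqs cf(1) d d1 q ..
qed

lemma FF_eq_cyl:
 assumes s: "\<sigma> = \<tau>" and e: "\<e> = 1"
 shows "FF u = FF v \<longleftrightarrow> v - u \<in> LXY"
proof
 assume "v - u \<in> LXY"
 then obtain i j where "v - u = vector [of_int i * (2 * pi / sgm), of_int j * (2 * Py)]" by (auto simp: LXY_def)
 then have "v = u + vector [of_int i * (2 * pi / sgm), 0] + vector [0, of_int j * (2 * Py)]"
  by (auto simp: vec_eq_iff forall_2 algebra_simps)
 then show "FF u = FF v" by (simp only: FF_period_y FF_NN_cyl_period[OF s e])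
next
 note cf = cyl_facts[OF s]
 assume F: "FF u = FF v"
 have h: "fh (u$1) (u$2) = fh (v$1) (v$2)" using F by (simp add: FF_def)
 have "fst (FF u) $ 2 = fst (FF v) $ 2" using F by simp
 then have w: "fw (u$1) (u$2) = fw (v$1) (v$2)" by (simp add: FF_def)
 note y = cyl_y[OF s h w]
 obtain j where j: "v$2 = u$2 + of_int j * (2 * Py)" using y_from_sn[OF y(1,2)] by blast
 have "fst (FF u) $ 1 = fst (FF v) $ 1" "fst (FF u) $ 3 = fst (FF v) $ 3" using F by simp_all
 then have "gsin \<e> (II (v$1)) = gsin \<e> (II (u$1))" "gcos \<e> (II (v$1)) = gcos \<e> (II (u$1))"
  using y(3) cyl_w(4)[OF s, of "v$1" "v$2"] by (simp_all add: FF_def cyl_w(3)[OF s])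
 moreover have "gsin \<e> z = sin z" "gcos \<e> z = cos z" for z using e by (simp_all add: gsin_def gcos_def)
 ultimately have "sin (II (v$1)) = sin (II (u$1))" "cos (II (v$1)) = cos (II (u$1))" by simp_all
 then obtain i :: int where "II (v$1) = II (u$1) + 2 * pi * i" using sin_cos_eq_iff by blast
 then have "sgm * (v$1) = sgm * (u$1 + of_int i * (2 * pi / sgm))" unfolding cf(6) using cf(7) by (simp add: algebra_simps)
 then have "v$1 = u$1 + of_int i * (2 * pi / sgm)" using cf(7) by simp
 then have "v - u = vector [of_int i * (2 * pi / sgm), of_int j * (2 * Py)]" using j by (simp add: vec_eq_iff forall_2)
 then show "v - u \<in> LXY" by (auto simp: LXY_def)
qed

lemma int_small:
 fixes P :: real
 assumes "\<bar>of_int j * P\<bar> < P"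
 shows "j = 0"
proof -
 have "P > 0" using assms by linarith
 then have "\<bar>of_int j\<bar> * P < 1 * P" using assms by (simp add: abs_mult)
 then show ?thesis using \<open>P > 0\<close> by (simp only: mult_less_cancel_right_pos)
qed

lemma FF_covering_cyl:
 assumes s: "\<sigma> = \<tau>" and e: "\<e> = 1"
 shows "plane_covering FF LXY (min (pi / sgm) Py)" "closed (range FF)"
proof -
 note cf = cyl_facts[OF s]
 interpret ci: conformal_immersion \<e> H FF NN "%u. flam (u$1) (u$2)" by (rule conformal_FF)
 have P: "2 * pi / sgm > 0" using cf(7) by simp
 have pr: "\<exists>M. \<forall>u. norm (FF u) \<le> R --> (\<exists>l\<in>LXY. norm (u + l) \<le> M)" for R
 proof (intro exI allI impI)
  fix u :: "real^2"
  obtain i j :: int where "\<bar>u$1 + of_int i * (2 * pi / sgm)\<bar> \<le> 2 * pi / sgm" "\<bar>u$2 + of_int j * (2 * Py)\<bar> \<le> 2 * Py"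
   using reduce_period[OF P, of "u$1"] reduce_period[of "2 * Py" "u$2"] Py_pos by auto
  then have "norm (u + vector [of_int i * (2 * pi / sgm), of_int j * (2 * Py)]) \<le> 2 * pi / sgm + 2 * Py"
   using norm_vec2_le[of "u + vector [of_int i * (2 * pi / sgm), of_int j * (2 * Py)]"] by simp
  then show "\<exists>l\<in>LXY. norm (u + l) \<le> 2 * pi / sgm + 2 * Py" by (auto simp: LXY_def)
 qed
 have dl: "l = 0" if "l \<in> LXY" "norm l < 2 * min (pi / sgm) Py" for l
 proof -
  obtain i j where l: "l = vector [of_int i * (2 * pi / sgm), of_int j * (2 * Py)]" using \<open>l \<in> LXY\<close> by (auto simp: LXY_def)
  have "2 * min (pi / sgm) Py \<le> 2 * pi / sgm" "2 * min (pi / sgm) Py \<le> 2 * Py" by auto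
  then have "\<bar>l$1\<bar> < 2 * pi / sgm" "\<bar>l$2\<bar> < 2 * Py"
   using component_le_norm_cart[of l 1] component_le_norm_cart[of l 2] that(2) by linarith+
  then have "i = 0" "j = 0" using l by (auto intro: int_small[of i "2 * pi / sgm"] int_small[of j "2 * Py"])
  then show ?thesis using l by (simp add: vec_eq_iff forall_2)
 qed
 have d0: "min (pi / sgm) Py > 0" using cf(7) Py_pos by simp
 show "plane_covering FF LXY (min (pi / sgm) Py)" by (rule plane_covering_proper(1)[OF ci.cont_F FF_eq_cyl[OF s e] pr d0 dl])
 show "closed (range FF)" by (rule plane_covering_proper(2)[OF ci.cont_F FF_eq_cyl[OF s e] pr d0 dl])
qed

section \<open>Uniform local injectivity in the spherical case\<close>

lemma along_axes: "along 1 (axis 3 1) (axis 1 1) (axis 2 1) t x =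
  vector [x$1 * cos t + x$3 * sin t, x$2, x$3 * cos t - x$1 * sin t]"
 by (simp add: along_def mform_def axis_def gcos_def gsin_def vec_eq_iff forall_3)

lemma along_isometry: "norm (along 1 (axis 3 1) (axis 1 1) (axis 2 1) t x - along 1 (axis 3 1) (axis 1 1) (axis 2 1) t y) = norm (x - y)"
proof -
 have "(x$1 * cos t + x$3 * sin t - (y$1 * cos t + y$3 * sin t))^2 + (x$2 - y$2)^2 +
  (x$3 * cos t - x$1 * sin t - (y$3 * cos t - y$1 * sin t))^2 = (x$1 - y$1)^2 + (x$2 - y$2)^2 + (x$3 - y$3)^2"
  using sin_cos_squared_add[of t] by algebra
 then show ?thesis by (simp add: along_axes norm_vec_def L2_set_def sum_3)
qed

lemma FF_shift_dist:
 assumes e: "\<e> = 1"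
 shows "norm (FF (u + vector [of_int i * Px, of_int j * (2 * Py)]) - FF (v + vector [of_int i * Px, of_int j * (2 * Py)])) = norm (FF u - FF v)"
proof -
 have "FF (u + vector [of_int i * Px, of_int j * (2 * Py)]) = horizontal (along 1 (axis 3 1) (axis 1 1) (axis 2 1) (of_int i * II Px)) (FF u)" for u
 proof -
  have "u + vector [of_int i * Px, of_int j * (2 * Py)] = u + vector [of_int i * Px, 0] + vector [0, of_int j * (2 * Py)]"
   by (simp add: vec_eq_iff forall_2)
  then show ?thesis by (simp only: FF_period_y FF_translate) (simp only: e)
 qed
 then show ?thesis by (simp add: horizontal_def norm_prod_def along_isometry)
qed

text \<open>By contradiction: violating pairs can be moved by periods into a bounded set, since the
  corresponding symmetries preserve Euclidean distances; near a limit point they contradict the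
  local expansion.\<close>

lemma FF_expansion:
 assumes e: "\<e> = 1"
 shows "\<exists>\<rho>>0. \<exists>\<kappa>>0. \<forall>v w. norm (v - w) \<le> \<rho> --> \<kappa> * norm (v - w) \<le> norm (FF v - FF w)"
proof (rule ccontr)
 assume no: "\<not> ?thesis"
 interpret ci: conformal_immersion \<e> H FF NN "%u. flam (u$1) (u$2)" by (rule conformal_FF)
 have "\<exists>v w. norm (v - w) \<le> inverse (real (Suc n)) & norm (FF v - FF w) < inverse (real (Suc n)) * norm (v - w) & norm v \<le> Px + 2 * Py" for n
 proof -
  have "inverse (real (Suc n)) > 0" by simp
  then obtain v w where vw: "norm (v - w) \<le> inverse (real (Suc n))" "norm (FF v - FF w) < inverse (real (Suc n)) * norm (v - w)"
   using no by (meson not_le)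
  obtain i j :: int where ij: "\<bar>v$1 + of_int i * Px\<bar> \<le> Px" "\<bar>v$2 + of_int j * (2 * Py)\<bar> \<le> 2 * Py"
   using reduce_period[OF Px_pos, of "v$1"] reduce_period[of "2 * Py" "v$2"] Py_pos by auto
  define g where "g = (vector [of_int i * Px, of_int j * (2 * Py)] :: real^2)"
  have "norm (v + g) \<le> Px + 2 * Py" using ij norm_vec2_le[of "v + g"] by (simp add: g_def)
  moreover have "norm (FF (v + g) - FF (w + g)) = norm (FF v - FF w)" unfolding g_def by (rule FF_shift_dist[OF e])
  moreover have "(v + g) - (w + g) = v - w" by simp
  ultimately show ?thesis using vw by (intro exI[of _ "v + g"] exI[of _ "w + g"]) simp
 qed
 then obtain v w where vw: "\<And>n. norm (v n - w n) \<le> inverse (real (Suc n))"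
  "\<And>n. norm (FF (v n) - FF (w n)) < inverse (real (Suc n)) * norm (v n - w n)" "\<And>n. norm (v n) \<le> Px + 2 * Py" by metis
 have "seq_compact (cball (0::real^2) (Px + 2 * Py))" by (simp add: compact_eq_seq_compact_metric[symmetric])
 moreover have "\<forall>n. v n \<in> cball 0 (Px + 2 * Py)" using vw(3) by simp
 ultimately obtain u r where r: "strict_mono (r::nat=>nat)" "(v \<circ> r) \<longlonglongrightarrow> u"
  unfolding seq_compact_def by metis
 have XY: "dx FF = XX" "dy FF = YY" using FF_partials by auto
 have "isCont XX u" "isCont YY u"
  using ci.cont_X ci.cont_Y unfolding XY by (simp_all add: continuous_on_eq_continuous_at)
 moreover have "inj (%z::real^2. z$1 *\<^sub>R XX u + z$2 *\<^sub>R YY u)"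
  using ci.immersion[of u] unfolding frechet_derivative_at[OF FF_deriv, symmetric] .
 ultimately obtain \<rho> \<kappa> where k: "\<rho> > 0" "\<kappa> > 0" "\<And>v w. v \<in> ball u \<rho> ==> w \<in> ball u \<rho> ==> \<kappa> * norm (v - w) \<le> norm (FF v - FF w)"
  using local_expansion[OF FF_deriv, of u] by blast
 have z: "(%n. inverse (real (Suc (r n)))) \<longlonglongrightarrow> 0"
  using LIMSEQ_subseq_LIMSEQ[OF LIMSEQ_inverse_real_of_nat r(1)] by (simp add: o_def)
 have "\<forall>\<^sub>F n in sequentially. v (r n) \<in> ball u (\<rho> / 2)"
  using r(2) k(1) by (intro topological_tendstoD[of "%n. v (r n)"]) (auto simp: o_def)
 moreover have "\<forall>\<^sub>F n in sequentially. inverse (real (Suc (r n))) < min (\<rho> / 2) \<kappa>"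
  by (rule order_tendstoD(2)[OF z]) (use k in simp)
 ultimately have "\<forall>\<^sub>F n in sequentially. v (r n) \<in> ball u (\<rho> / 2) & inverse (real (Suc (r n))) < min (\<rho> / 2) \<kappa>"
  by (rule eventually_conj)
 then obtain n where n: "v (r n) \<in> ball u (\<rho> / 2)" "inverse (real (Suc (r n))) < min (\<rho> / 2) \<kappa>"
  by (auto simp: eventually_sequentially)
 have "dist (v (r n)) (w (r n)) < \<rho> / 2" using vw(1)[of "r n"] n(2) by (simp add: dist_norm)
 then have "dist u (w (r n)) < \<rho>" using n(1) dist_triangle[of u "w (r n)" "v (r n)"] by simp
 then have "\<kappa> * norm (v (r n) - w (r n)) \<le> norm (FF (v (r n)) - FF (w (r n)))" using k(1) n(1) by (intro k(3)) auto
 also have "\<dots> < inverse (real (Suc (r n))) * norm (v (r n) - w (r n))" by (rule vw(2))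
 also have "\<dots> \<le> \<kappa> * norm (v (r n) - w (r n))" using n(2) by (intro mult_right_mono) auto
 finally show False by simp
qed

text \<open>A symmetry is witnessed by a homeomorphism \<open>f\<close> of the plane. The ambient
  map \<open>g'\<close> for the inverse is recorded so that \<open>f\<close> preserves the fibres of
  \<open>FF\<close> in both directions.\<close>

definition covers :: "(ambient => ambient) => bool" where
 "covers g \<longleftrightarrow> (\<exists>f f' g'. continuous_on UNIV f & continuous_on UNIV f' & (\<forall>u. f (f' u) = u) & (\<forall>u. f' (f u) = u) &
   (\<forall>u. g (FF u) = FF (f u)) & (\<forall>u. g' (FF u) = FF (f' u)))"

lemma coversI:
 assumes "continuous_on UNIV f" "continuous_on UNIV f'" "\<And>u. f (f' u) = u" "\<And>u. f' (f u) = u"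
  "\<And>u. g (FF u) = FF (f u)" "\<And>u. g' (FF u) = FF (f' u)"
 shows "covers g"
 unfolding covers_def using assms by (intro exI[of _ f] exI[of _ f'] exI[of _ g']) simp

lemma vector2_eq: "(vector [x, y] :: real^2) = x *\<^sub>R axis 1 1 + y *\<^sub>R axis 2 1"
 by (simp add: vec_eq_iff forall_2 axis_def)

lemma cont_vec2:
 assumes "continuous_on UNIV (f :: real^2 => real)" "continuous_on UNIV g"
 shows "continuous_on UNIV (%u. vector [f u, g u] :: real^2)"
 unfolding vector2_eq by (intro continuous_intros assms)

lemma covers_flip: "covers flip_height"
 by (rule coversI[of "%u. vector [u$1, - (u$2)]" "%u. vector [u$1, - (u$2)]" _ flip_height])
  (auto intro!: cont_vec2 continuous_intros simp: vec_eq_iff forall_2 FF_flip)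

lemma covers_reflect: "covers (horizontal (reflection \<e> (axis 2 1)))"
 by (rule coversI[of "%u. vector [u$1, Py - u$2]" "%u. vector [u$1, Py - u$2]" _ "horizontal (reflection \<e> (axis 2 1))"])
  (auto intro!: cont_vec2 continuous_intros simp: vec_eq_iff forall_2 FF_reflect)

lemma covers_translate: "covers (horizontal (along \<e> (axis 3 1) (axis 1 1) (axis 2 1) (of_int k * II Px)))"
 by (rule coversI[of "%u. u + vector [of_int k * Px, 0]" "%u. u + vector [of_int (- k) * Px, 0]" _
    "horizontal (along \<e> (axis 3 1) (axis 1 1) (axis 2 1) (of_int (- k) * II Px))"])
  (intro continuous_intros FF_translate[symmetric] | simp add: vec_eq_iff forall_2)+

lemma covers_half_turn:
 assumes e: "\<e> = 1"
 shows "covers (horizontal (along 1 (axis 2 1) (axis 1 1) (axis 3 1) (of_int k * pi)))"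
proof (cases "even k")
 case True
 then show ?thesis
  by (intro coversI[of "%u. u" "%u. u" _ "%a. a"]) (auto simp: horizontal_def along_1_int)
next
 case False
 have *: "horizontal (along 1 (axis 2 1) (axis 1 1) (axis 3 1) (of_int k * pi)) a = (vector [- (fst a $ 1), - (fst a $ 2), fst a $ 3], snd a)" for a
  using False by (simp add: horizontal_def along_1_int)
 show ?thesis
  by (rule coversI[of "%u. vector [- (u$1), Py - u$2]" "%u. vector [- (u$1), Py - u$2]" _
     "horizontal (along 1 (axis 2 1) (axis 1 1) (axis 3 1) (of_int k * pi))"])
   (auto intro!: cont_vec2 continuous_intros simp: vec_eq_iff forall_2 * FF_half_turn)
qed

lemma covers_cyl:
 assumes s: "\<sigma> = \<tau>"
 shows "covers (horizontal (along \<e> (axis 3 1) (axis 1 1) (axis 2 1) t))"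
 by (rule coversI[of "%u. u + vector [t / sgm, 0]" "%u. u + vector [(- t) / sgm, 0]" _
    "horizontal (along \<e> (axis 3 1) (axis 1 1) (axis 2 1) (- t))"])
  (intro continuous_intros FF_cyl_along[OF s, symmetric] | simp add: vec_eq_iff forall_2)+

section \<open>Maximum height and realization on the type \<open>real^3\<close>\<close>

lemma top_point: obtains y where "psi y = pi / 2" "sn y = 1" "rr y = 0"
proof -
 obtain y where y: "psi y = pi / 2" using surjD[OF ps.amp_surj, of "pi/2"] unfolding psi_def by metis
 have "sn y = 1" "rr y = 0" unfolding sn_def rr_def cn_def y by simp_all
 with y show thesis by (rule that)
qed

lemma tt_0: "tt 0 = \<tau>"
 unfolding tt_def phi_0 rad_def using tau_pos by simp

lemma fh_le: "fh x y \<le> \<eta> * hinv \<e> \<tau>"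
proof -
 have 1: "1 - \<e> * \<tau>^2 > 0" using D1_pos[of 0] tt_0 by simp
 have "tt x * sn y \<le> \<tau> * 1"
 proof -
  have "sn y \<le> 1" by (simp add: sn_def)
  then have "tt x * sn y \<le> tt x * 1" using tt_pos[of x] by (intro mult_left_mono) auto
  then show ?thesis using tt_bounds(2)[of x] by simp
 qed
 then have "hinv \<e> (tt x * sn y) \<le> hinv \<e> \<tau>"
  using hinv_strict_mono[OF eps tq_bound 1, of x y] by (cases "tt x * sn y = \<tau>") auto
 then show ?thesis unfolding fh_def using eta_pos by (intro mult_left_mono) auto
qed

lemma max_height:
 assumes "image_of S = range FF"
 shows "is_max_height S (\<eta> * hinv \<e> \<tau>)"
 unfolding is_max_height_def assms
proof (intro conjI ballI)
 obtain y where "sn y = 1" by (rule top_point)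
 then have "snd (FF (vector [0, y])) = \<eta> * hinv \<e> \<tau>" by (simp add: FF_def fh_def tt_0)
 then show "\<eta> * hinv \<e> \<tau> \<in> snd ` range FF" by (metis imageI rangeI)
qed (auto simp: FF_def fh_le)

lemma hinv_pos: "0 < z ==> 1 - \<e> * z^2 > 0 ==> 0 < hinv \<e> z"
 using hinv_strict_mono[OF eps, of 0 z] by (simp add: hinv_def split: if_splits)

lemma two_points: "\<exists>u v. FF u \<noteq> FF v"
proof -
 obtain y where y: "sn y = 1" by (rule top_point)
 have "1 - \<e> * \<tau>^2 > 0" using D1_pos[of 0] tt_0 by simp
 then have p: "fh 0 y > 0" using y hinv_pos[OF tau_pos] eta_pos by (simp add: fh_def tt_0)
 have "snd (FF (vector [0, y])) = fh 0 y" "snd (FF (vector [0, - y])) = - fh 0 y"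
  by (simp_all add: FF_def f_minus_y)
 then have "FF (vector [0, y]) \<noteq> FF (vector [0, - y])" using p by (metis less_irrefl neg_less_0_iff_less order.strict_trans)
 then show ?thesis by blast
qed

text \<open>Two choices of \<open>p\<close> are in view: \<open>FF\<close> itself with the inclusion
  as immersion, so that points with equal image are identified, and the identity of the plane with
  \<open>FF\<close> as immersion. In either case symmetries of the plane descend.\<close>

lemma model:
 fixes p :: "real^2 => 'b::{metric_space, second_countable_topology}"
 assumes pc: "plane_covering p \<Lambda> \<delta>" and I: "\<And>u. I (p u) = FF u" and N: "\<And>u v. p u = p v ==> NN u = NN v"
  and tame: "cmc_surface \<e> H (psurf p I \<delta>) ==> tame \<e> (psurf p I \<delta>)"
  and p: "(\<forall>u v. p u = p v \<longleftrightarrow> FF u = FF v) \<or> inj p"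
 shows "\<exists>S :: (real^3) surface. cmc_surface \<e> H S & complete_surface \<e> S & image_of S = range FF &
  (\<forall>g. covers g --> invariant_under S g) & (embedded (psurf p I \<delta>) --> embedded S) &
  (\<forall>\<Omega>. upper_half_graph_over (psurf p I \<delta>) \<Omega> --> upper_half_graph_over S \<Omega>) &
  (orthogonal_to_slice \<e> (psurf p I \<delta>) --> orthogonal_to_slice \<e> S)"
proof -
 interpret plane_covering p \<Lambda> \<delta> by (rule pc)
 let ?S = "psurf p I \<delta>"
 have top: "topspace (dom ?S) = range p" by (simp add: psurf_def)
 obtain u v where "FF u \<noteq> FF v" using two_points by blast
 then have "p u \<noteq> p v" using I by metis
 then obtain \<beta> :: "real^3 => 'b" where "bij_betw \<beta> UNIV (range p)"
  by (rule transport_bijection[OF connected_continuous_image[OF cont_p connected_UNIV] rangeI rangeI])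
 then interpret st: surface_transport \<beta> ?S by unfold_locales (simp add: top)
 have cs: "conformal_surface \<e> H ?S" by (rule psurf_conformal[OF conformal_FF I N])
 have c: "cmc_surface \<e> H (transport \<beta> ?S)" by (rule st.conformal_transport[OF cs])
 have man: "smooth_2_manifold (dom ?S) (atlas ?S)" using cs by (simp add: conformal_surface_def)
 have "complete_surface \<e> (transport \<beta> ?S)"
 proof (rule st.complete_transport)
  show "tame \<e> ?S" by (rule tame[OF conformal_surface_cmc[OF cs]])
  show "immersed_surface \<e> (transport \<beta> ?S)" using c by (simp add: cmc_surface_def)
 qed
 moreover have "image_of ?S = range FF"
  unfolding image_of_def top using I by (simp add: psurf_def image_image)
 then have "image_of (transport \<beta> ?S) = range FF" by (simp only: st.image_of_transport)
 moreover have "invariant_under (transport \<beta> ?S) g" if "covers g" for g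
 proof (rule st.invariant_transport)
  from that obtain f f' g' where f: "continuous_on UNIV f" "continuous_on UNIV f'" "\<forall>u. f (f' u) = u" "\<forall>u. f' (f u) = u"
   "\<forall>u. g (FF u) = FF (f u)" "\<forall>u. g' (FF u) = FF (f' u)" unfolding covers_def by (elim exE conjE)
  have "p u = p v \<longleftrightarrow> p (f u) = p (f v)" for u v
   using p
  proof
   assume "\<forall>u v. p u = p v \<longleftrightarrow> FF u = FF v"
   then have "p u = p v \<longleftrightarrow> FF u = FF v" "p (f u) = p (f v) \<longleftrightarrow> FF (f u) = FF (f v)" by simp_all
   moreover have "FF u = FF v \<longleftrightarrow> FF (f u) = FF (f v)" using f(4,5,6) by metis
   ultimately show ?thesis by simp
  next
   assume "inj p"
   then have "p u = p v \<longleftrightarrow> u = v" "p (f u) = p (f v) \<longleftrightarrow> f u = f v" by (simp_all add: inj_eq)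
   moreover have "u = v \<longleftrightarrow> f u = f v" using f(4) by metis
   ultimately show ?thesis by simp
  qed
  then show "invariant_under ?S g"
   by (intro psurf_invariant[OF f(1,2) f(3)[rule_format] f(4)[rule_format]]) (use f(5) I in simp_all)
 qed
 ultimately show ?thesis
  using c st.embedded_transport st.upper_half_graph_transport st.orthogonal_transport[OF _ man]
  by (intro exI[of _ "transport \<beta> ?S"] conjI impI allI) simp_all
qed

text \<open>The immersion is the inclusion of a closed subset of the ambient space: an embedding,
  with compact bounded parts.\<close>

lemma model_FF:
 assumes pc: "plane_covering FF \<Lambda> \<delta>" and cl: "closed (range FF)" and N: "\<And>u v. FF u = FF v ==> NN u = NN v"
 shows "\<exists>S :: (real^3) surface. cmc_surface \<e> H S & complete_surface \<e> S & image_of S = range FF &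
  (\<forall>g. covers g --> invariant_under S g) & embedded S &
  (\<forall>\<Omega>. upper_half_graph_over (psurf FF id \<delta>) \<Omega> --> upper_half_graph_over S \<Omega>) &
  (orthogonal_to_slice \<e> (psurf FF id \<delta>) --> orthogonal_to_slice \<e> S)"
proof -
 have "embedded (psurf FF id \<delta>)"
  by (simp add: embedded_def embedding_map_def psurf_def)
 moreover have "tame \<e> (psurf FF id \<delta>)" if "cmc_surface \<e> H (psurf FF id \<delta>)"
 proof (rule tame_proper)
  show "immersed_surface \<e> (psurf FF id \<delta>)" using that by (simp add: cmc_surface_def)
  show "seq_compactin (dom (psurf FF id \<delta>)) {y \<in> topspace (dom (psurf FF id \<delta>)). norm (imm (psurf FF id \<delta>) y) \<le> R}" for R
  proof -
   have "compact (range FF \<inter> cball 0 R)" by (intro closed_Int_compact cl compact_cball)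
   moreover have "{y \<in> topspace (dom (psurf FF id \<delta>)). norm (imm (psurf FF id \<delta>) y) \<le> R} = range FF \<inter> cball 0 R"
    by (auto simp: psurf_def)
   ultimately show ?thesis using seq_compactin_top_of_set[of "range FF \<inter> cball 0 R" "range FF"] by (simp add: psurf_def)
  qed
 qed (use eps in \<open>auto simp: psurf_def\<close>)
 ultimately show ?thesis
  using model[OF pc, of id, OF _ N] by simp
qed

lemma model_hyp:
 assumes e: "\<e> = -1"
 shows "\<exists>S :: (real^3) surface. cmc_surface \<e> H S & complete_surface \<e> S & image_of S = range FF &
  (\<forall>g. covers g --> invariant_under S g) & embedded S &
  (\<forall>\<Omega>. upper_half_graph_over (psurf FF id Py) \<Omega> --> upper_half_graph_over S \<Omega>) &
  (orthogonal_to_slice \<e> (psurf FF id Py) --> orthogonal_to_slice \<e> S)"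
proof (rule model_FF[OF FF_covering_hyp[OF e]])
 fix u v assume "FF u = FF v"
 then have "v - u \<in> LY" by (simp only: FF_eq_hyp[OF e])
 then obtain j where "v - u = vector [0, of_int j * (2 * Py)]" by (auto simp: LY_def)
 then have "v = u + vector [0, of_int j * (2 * Py)]" by (simp add: algebra_simps)
 then show "NN u = NN v" by (simp only: NN_period_y)
qed

lemma model_cyl:
 assumes s: "\<sigma> = \<tau>" and e: "\<e> = 1"
 shows "\<exists>S :: (real^3) surface. cmc_surface \<e> H S & complete_surface \<e> S & image_of S = range FF &
  (\<forall>g. covers g --> invariant_under S g) & embedded S &
  (\<forall>\<Omega>. upper_half_graph_over (psurf FF id (min (pi / sgm) Py)) \<Omega> --> upper_half_graph_over S \<Omega>) &
  (orthogonal_to_slice \<e> (psurf FF id (min (pi / sgm) Py)) --> orthogonal_to_slice \<e> S)"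
proof (rule model_FF[OF FF_covering_cyl[OF s e]])
 fix u v assume "FF u = FF v"
 then have "v - u \<in> LXY" by (simp only: FF_eq_cyl[OF s e])
 then obtain i j where "v - u = vector [of_int i * (2 * pi / sgm), of_int j * (2 * Py)]" by (auto simp: LXY_def)
 then have "v = u + vector [of_int i * (2 * pi / sgm), 0] + vector [0, of_int j * (2 * Py)]"
  by (auto simp: vec_eq_iff forall_2 algebra_simps)
 then show "NN u = NN v" by (simp only: NN_period_y FF_NN_cyl_period(2)[OF s e])
qed

text \<open>The plane itself is the domain, and completeness comes from uniform expansion instead of
  properness.\<close>

lemma model_sph:
 assumes e: "\<e> = 1"
 shows "\<exists>S :: (real^3) surface. cmc_surface \<e> H S & complete_surface \<e> S & image_of S = range FF &
  (\<forall>g. covers g --> invariant_under S g)"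
proof -
 have pc: "plane_covering (id :: real^2 => real^2) {0} 1"
  by unfold_locales (auto simp: open_openin[symmetric])
 have "tame \<e> (psurf id FF 1)" if c: "cmc_surface \<e> H (psurf id FF 1)"
 proof -
  obtain \<rho> \<kappa> where k: "\<rho> > 0" "\<kappa> > 0" "\<And>v w. norm (v - w) \<le> \<rho> ==> \<kappa> * norm (v - w) \<le> norm (FF v - FF w)"
   using FF_expansion[OF e] by blast
  have "immersed_surface 1 (psurf id FF 1)" using c e by (simp add: cmc_surface_def)
  then have "tame 1 (psurf id FF 1)"
   by (rule tame_plane[OF _ _ k(1,2)]) (use k(3) in \<open>simp_all add: psurf_def\<close>)
  then show ?thesis using e by simp
 qed
 from model[OF pc, of FF, OF _ _ this] show ?thesis by auto
qed

end

section \<open>The horizontal cylinder\<close>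

lemma M2_identity:
 fixes a b d \<e> :: real
 assumes "a * a + b * b + \<e> * (d * d) = \<e>" "\<e> * \<e> = 1"
 shows "d^2 + \<e> * a^2 = 1 - \<e> * b^2"
proof -
 have "\<e> * (a * a + b * b) + (\<e> * \<e>) * (d * d) = \<e> * \<e>"
  using arg_cong[OF assms(1), of "%z. \<e> * z"] by (simp add: algebra_simps)
 then show ?thesis unfolding assms(2) by (simp add: power2_eq_square algebra_simps)
qed

lemma geodesic_identity:
 fixes a b d g h \<e> :: real
 assumes "a * a + b * b + \<e> * (d * d) = \<e>" "g^2 + \<e> * h^2 = 1" "\<e> * \<e> = 1"
 shows "(a * h + b * 0 + \<e> * (d * g))^2 = 1 - \<e> * b^2 - \<e> * (a * g - d * h)^2"
proof -
 have "(a * h + b * 0 + \<e> * (d * g))^2 + \<e> * (a * g - d * h)^2 = (d^2 + \<e> * a^2) * (g^2 + \<e> * h^2)"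
  using assms(3) by algebra
 then show ?thesis unfolding M2_identity[OF assms(1,3)] assms(2) by simp
qed

section \<open>The upper half of the cylinder as a graph\<close>

context delaunay
begin

lemma two_H_c: "(2 * H / c)^2 = 1 - \<e> * (1 / c^2)" "2 * H / c > 0"
proof -
 have "1 - \<e> * (1 / c^2) = (c^2 - \<e>) / c^2" using c_pos by (simp add: diff_divide_distrib)
 also have "c^2 - \<e> = (2 * H)^2" using c2 by simp
 finally show "(2 * H / c)^2 = 1 - \<e> * (1 / c^2)" by (simp add: power_divide)
qed (use c_pos H in simp)

text \<open>Inverts \<open>q -> q (1 - \<e> m) / (1 - \<e> m q^2)\<close> on the unit interval: the
  root of \<open>\<e> m s q^2 + (1 - \<e> m) q = s\<close>, rationalized so that there is no
  division by \<open>\<e> m s\<close>.\<close>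

definition "qof s = 2 * s / ((1 - \<e> * m) + sqrt ((1 - \<e> * m)^2 + 4 * (\<e> * m) * s^2))"

lemma qof_root:
 assumes q: "0 < q" "q \<le> 1" and s: "s * (1 - \<e> * m * q^2) = q * (1 - \<e> * m)"
 shows "qof s = q"
proof -
 have e: "\<e> * m * s * q^2 + (1 - \<e> * m) * q = s" using s by (simp add: algebra_simps)
 \<comment> \<open>The derivative of the quadratic at its root \<open>q\<close>; being positive, it
   is the square root of the discriminant.\<close>
 define z where "z = 2 * (\<e> * m) * s * q + (1 - \<e> * m)"
 have Dp: "1 - \<e> * m * q^2 > 0"
 proof -
  have "q^2 \<le> 1" using q by (simp add: power_le_one)
  then have "\<bar>\<e> * m * q^2\<bar> \<le> m" using eps m_pos by (auto simp: abs_mult mult_left_le)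
  then show ?thesis using m_lt1 by linarith
 qed
 have "z * (1 - \<e> * m * q^2) = (1 - \<e> * m) * (1 + \<e> * m * q^2)"
  unfolding z_def using s by algebra
 moreover have "1 + \<e> * m * q^2 > 0"
 proof -
  have "q^2 \<le> 1" using q by (simp add: power_le_one)
  then have "\<bar>\<e> * m * q^2\<bar> \<le> m" using eps m_pos by (auto simp: abs_mult mult_left_le)
  then show ?thesis using m_lt1 by linarith
 qed
 ultimately have "z * (1 - \<e> * m * q^2) > 0" using em_pos by simp
 then have z0: "z > 0" using Dp by (simp add: zero_less_mult_iff)
 have "(1 - \<e> * m)^2 + 4 * (\<e> * m) * s^2 = z^2"
 proof -
  have "z^2 = (1 - \<e> * m)^2 + 4 * (\<e> * m) * s * (\<e> * m * s * q^2 + (1 - \<e> * m) * q)"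
   unfolding z_def by algebra
  then show ?thesis unfolding e by (simp add: power2_eq_square)
 qed
 then have "sqrt ((1 - \<e> * m)^2 + 4 * (\<e> * m) * s^2) = z" using z0 by simp
 then have "qof s = 2 * s / ((1 - \<e> * m) + z)" by (simp add: qof_def)
 moreover have "q * ((1 - \<e> * m) + z) = 2 * s"
 proof -
  have "q * ((1 - \<e> * m) + z) = 2 * (\<e> * m * s * q^2 + (1 - \<e> * m) * q)" unfolding z_def by algebra
  then show ?thesis unfolding e .
 qed
 moreover have "(1 - \<e> * m) + z > 0" using em_pos z0 by simp
 ultimately show ?thesis by (metis less_irrefl nonzero_eq_divide_eq)
qed

lemma qof_pos:
 assumes s: "0 < s" "s \<le> 1"
 shows "0 < qof s" "qof s \<le> 1" "s * (1 - \<e> * m * (qof s)^2) = qof s * (1 - \<e> * m)"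
  "(1 - \<e> * m)^2 + 4 * (\<e> * m) * s^2 > 0" "(1 - \<e> * m) + sqrt ((1 - \<e> * m)^2 + 4 * (\<e> * m) * s^2) > 0"
proof -
 define R where "R = sqrt ((1 - \<e> * m)^2 + 4 * (\<e> * m) * s^2)"
 have s2: "s^2 \<le> 1" using s by (simp add: power_le_one)
 \<comment> \<open>The difference of the two sides is a product of nonnegative factors; the
   comparison yields \<open>qof s \<le> 1\<close>.\<close>
 have ge: "(1 - \<e> * m)^2 + 4 * (\<e> * m) * s^2 \<ge> (2 * s - (1 - \<e> * m))^2"
 proof -
  have "(1 - \<e> * m)^2 + 4 * (\<e> * m) * s^2 - (2 * s - (1 - \<e> * m))^2 = 4 * s * (1 - s) * (1 - \<e> * m)"
   by algebra
  moreover have "4 * s * (1 - s) * (1 - \<e> * m) \<ge> 0" using s em_pos by simp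
  ultimately show ?thesis by linarith
 qed
 show p: "(1 - \<e> * m)^2 + 4 * (\<e> * m) * s^2 > 0"
 proof (cases "\<e> = 1")
  case True
  then show ?thesis using em_pos m_pos by (simp add: add_pos_nonneg)
 next
  case False
  then have e: "\<e> = -1" using eps by auto
  have "m * s^2 \<le> m * 1" using s2 m_pos by (intro mult_left_mono) auto
  moreover have "(1 + m)^2 - 4 * m = (1 - m)^2" by (simp add: power2_eq_square algebra_simps)
  moreover have "(1 - m)^2 > 0" using m_lt1 by simp
  ultimately have "(1 + m)^2 - 4 * (m * s^2) > 0" by linarith
  moreover have em: "\<e> * z = - z" for z using e by simp
  ultimately show ?thesis unfolding em by (simp add: mult.assoc)
 qed
 then have R: "R > 0" "R^2 = (1 - \<e> * m)^2 + 4 * (\<e> * m) * s^2" by (simp_all add: R_def)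
 show d: "(1 - \<e> * m) + sqrt ((1 - \<e> * m)^2 + 4 * (\<e> * m) * s^2) > 0" using R(1) em_pos unfolding R_def by linarith
 have "2 * s - (1 - \<e> * m) \<le> R" using ge R(1) unfolding R(2)[symmetric] by (metis less_imp_le power2_le_imp_le)
 then show "qof s \<le> 1" using d unfolding qof_def R_def by simp
 show "0 < qof s" using d s unfolding qof_def by simp
 have q: "qof s * ((1 - \<e> * m) + R) = 2 * s" using d unfolding qof_def R_def by simp
 have "((1 - \<e> * m) + R) \<noteq> 0" using d R_def by simp
 moreover have "((1 - \<e> * m) + R)^2 * (s * (1 - \<e> * m * (qof s)^2) - qof s * (1 - \<e> * m)) = 0"
  using q R(2) by algebra
 ultimately show "s * (1 - \<e> * m * (qof s)^2) = qof s * (1 - \<e> * m)" by simp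
qed

text \<open>The height as a function of the second coordinate, whose modulus is the sine or
  hyperbolic sine of the distance to the geodesic.\<close>

definition "cyl_height w = \<eta> * hinv \<e> (\<tau> * qof (sqrt (1 - c^2 * w^2)))"

definition "strip = {x \<in> M2 \<e>. c^2 * (x$2)^2 < 1}"

lemma fh_sign: "fh x y > 0 \<longleftrightarrow> sn y > 0" "fh x y = 0 \<longleftrightarrow> sn y = 0"
proof -
 have h0: "hinv \<e> 0 = 0" by (simp add: hinv_def)
 have z0: "1 - \<e> * 0^2 > 0" by simp
 have "hinv \<e> (tt x * sn y) > 0 \<longleftrightarrow> tt x * sn y > 0" "hinv \<e> (tt x * sn y) = 0 \<longleftrightarrow> tt x * sn y = 0"
  using hinv_strict_mono[OF eps z0 tq_bound, of x y] hinv_strict_mono[OF eps tq_bound z0, of x y] h0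
  by (cases "tt x * sn y" "0::real" rule: linorder_cases; auto)+
 then show "fh x y > 0 \<longleftrightarrow> sn y > 0" "fh x y = 0 \<longleftrightarrow> sn y = 0"
  unfolding fh_def using eta_pos tt_pos[of x] by (simp_all add: zero_less_mult_iff)
qed

lemma cyl_fst_snd:
 assumes s: "\<sigma> = \<tau>" and h: "snd (FF u) > 0"
 shows "fst (FF u) \<in> strip" "cyl_height (fst (FF u) $ 2) = snd (FF u)"
proof -
 note cf = cyl_facts[OF s]
 have q: "sn (u$2) > 0" using h fh_sign(1) by (simp add: FF_def)
 have q1: "sn (u$2) \<le> 1" by (simp add: sn_def)
 define S where "S = sn (u$2) * (1 - \<e> * m) * fd (u$1) (u$2)"
 have S: "S > 0" using q em_pos fd_pos(1)[of "u$1" "u$2"] by (simp add: S_def)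
 have cw: "1 - c^2 * (fw (u$1) (u$2))^2 = S^2" unfolding cyl_w(1)[OF s] S_def by (simp add: power_mult_distrib)
 have w2: "fst (FF u) $ 2 = fw (u$1) (u$2)" by (simp add: FF_def)
 have "S^2 > 0" using S by simp
 then have "c^2 * (fw (u$1) (u$2))^2 < 1" using cw by linarith
 then show "fst (FF u) \<in> strip" unfolding strip_def using FF_in_M2[of u] by (simp add: w2)
 have sq: "sqrt (1 - c^2 * (fw (u$1) (u$2))^2) = S" unfolding cw using S by simp
 have "fd (u$1) (u$2) * (1 - \<e> * m * (sn (u$2))^2) = 1" using fd_inv(1)[of "u$1" "u$2"] unfolding cf(1) cf(3)[symmetric] .
 then have "S * (1 - \<e> * m * (sn (u$2))^2) = sn (u$2) * (1 - \<e> * m)" unfolding S_def by algebra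
 from qof_root[OF q q1 this] show "cyl_height (fst (FF u) $ 2) = snd (FF u)"
  unfolding cyl_height_def w2 sq by (simp add: FF_def fh_def cf(1))
qed

lemma sn_surj:
 assumes "0 < q" "q \<le> 1"
 shows "\<exists>y. sn y = q"
proof -
 obtain y where "psi y = arcsin q" using surjD[OF ps.amp_surj, of "arcsin q"] unfolding psi_def by metis
 then show ?thesis using assms by (intro exI[of _ y]) (simp add: sn_def)
qed

lemma polar_coordinates:
 assumes A: "A > 0" and x: "z^2 + \<e> * x^2 = A^2" "\<e> = -1 --> z > 0"
 shows "\<exists>\<theta>. x = A * gsin \<e> \<theta> & z = A * gcos \<e> \<theta>"
proof (cases "\<e> = 1")
 case True
 have "(z / A)^2 + (x / A)^2 = 1" using x A True by (simp add: power_divide add_divide_distrib[symmetric])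
 then obtain \<theta> where "z / A = cos \<theta>" "x / A = sin \<theta>" using sincos_total_2pi by metis
 then show ?thesis using A True by (intro exI[of _ \<theta>]) (simp add: gsin_def gcos_def field_simps)
next
 case False
 then have e: "\<e> = -1" using eps by auto
 define \<theta> where "\<theta> = arsinh (x / A)"
 have s: "sinh \<theta> = x / A" by (simp add: \<theta>_def)
 have "(A * cosh \<theta>)^2 = z^2" using x(1) A e
  by (simp add: power_mult_distrib cosh_square_eq s power_divide algebra_simps)
 then have "z = A * cosh \<theta>" using x(2) e A by (simp add: power2_eq_iff) (smt (verit) cosh_real_pos mult_pos_pos)
 then show ?thesis using s A e by (intro exI[of _ \<theta>]) (simp add: gsin_def gcos_def)
qed

text \<open>\<open>qof\<close> gives the value of \<open>sn\<close>; of the points \<open>y0\<close>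
  and \<open>Py - y0\<close>, which share it, one has the right sign of \<open>fw\<close>. The
  position along the geodesic is then read off in polar coordinates.\<close>

lemma cyl_lift:
 assumes s: "\<sigma> = \<tau>" and x: "x \<in> strip"
 shows "\<exists>u. FF u = (x, cyl_height (x$2)) & snd (FF u) > 0"
proof -
 note cf = cyl_facts[OF s]
 define w where "w = x$2"
 define S where "S = sqrt (1 - c^2 * w^2)"
 have cw: "c^2 * w^2 < 1" using x by (simp add: strip_def w_def)
 have S: "0 < S" "S \<le> 1" "S^2 = 1 - c^2 * w^2" using cw by (simp_all add: S_def)
 note q = qof_pos[OF S(1,2)]
 obtain y0 where y0: "sn y0 = qof S" using sn_surj[OF q(1,2)] by blast
 have d: "fd x' y0 * (1 - \<e> * m * (sn y0)^2) = 1" for x' using fd_inv(1)[of x' y0] unfolding cf(1) cf(3)[symmetric] .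
 have "fw 0 y0 ^ 2 = w^2"
 proof -
  have "sn y0 * (1 - \<e> * m) * fd 0 y0 = S"
   using d[of 0] q(3)[folded y0] by algebra
  then have "1 - c^2 * (fw 0 y0)^2 = S^2" using cyl_w(1)[OF s, of 0 y0] by (metis power_mult_distrib)
  then show ?thesis using S(3) c_pos by simp
 qed
 then have "fw 0 y0 = w \<or> fw 0 (Py - y0) = w" by (auto simp: power2_eq_iff f_reflect_y)
 moreover have "sn (Py - y0) = qof S" using y0 sn_sym(5) by simp
 ultimately obtain y where y: "sn y = qof S" "fw 0 y = w" using y0 by blast
 have t0: "tt x' = tt 0" "ts x' = ts 0" for x' using cf(1,2) by simp_all
 have fw: "fw x' y = w" and fA: "fA x' y = fA 0 y" for x' using f_cong(3,5)[of x' 0 y y] t0[of x'] y(2) by simp_all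
 have A: "fA 0 y > 0" by (rule cyl_w(4)[OF s])
 have M: "x \<in> M2 \<e>" using x by (simp add: strip_def)
 have "(x$3)^2 + \<e> * (x$1)^2 = (fA 0 y)^2"
 proof -
  have "x$1 * x$1 + x$2 * x$2 + \<e> * (x$3 * x$3) = \<e>" using M by (simp add: M2_def mform_def)
  moreover have "(fA 0 y)^2 + \<e> * w^2 = 1" using ABw[of 0 y] cyl_w(3)[OF s, of 0 y] y(2) by simp
  ultimately show ?thesis using M2_identity[OF _ ee, of "x$1" "x$2" "x$3"] unfolding w_def by simp
 qed
 then obtain \<theta> where \<theta>: "x$1 = fA 0 y * gsin \<e> \<theta>" "x$3 = fA 0 y * gcos \<e> \<theta>"
  using polar_coordinates[OF A, of "x$3" "x$1"] M by (auto simp: M2_def)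
 define u where "u = (vector [\<theta> / sgm, y] :: real^2)"
 have II: "II (u$1) = \<theta>" unfolding cf(6) u_def using cf(7) by simp
 have u: "u$1 = \<theta> / sgm" "u$2 = y" by (simp_all add: u_def)
 have "fst (FF u) = x"
  unfolding FF_def fst_conv II cyl_w(3)[OF s] u(2) fw fA[of "u$1"]
  by (simp add: vec_eq_iff forall_3 \<theta> w_def)
 moreover have "snd (FF u) = cyl_height (x$2)"
  by (simp add: FF_def fh_def cyl_height_def cf(1) u_def y(1) S_def[symmetric] w_def[symmetric])
 moreover have "snd (FF u) > 0" using fh_sign(1) y(1) q(1) by (simp add: FF_def u_def)
 ultimately show ?thesis by (intro exI[of _ u]) (simp add: prod_eq_iff)
qed

lemma cyl_height_continuous: "continuous_on strip (%x. cyl_height (x$2))"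
proof -
 have r: "0 < sqrt (1 - c^2 * (x$2)^2)" "sqrt (1 - c^2 * (x$2)^2) \<le> 1" if "x \<in> strip" for x
  using that by (simp_all add: strip_def)
 have nz: "\<forall>x\<in>strip. (1 - \<e> * m) + sqrt ((1 - \<e> * m)^2 + 4 * (\<e> * m) * (sqrt (1 - c^2 * (x$2)^2))^2) \<noteq> 0"
 proof
  fix x assume "x \<in> strip"
  from qof_pos(5)[OF r[OF this]]
  show "(1 - \<e> * m) + sqrt ((1 - \<e> * m)^2 + 4 * (\<e> * m) * (sqrt (1 - c^2 * (x$2)^2))^2) \<noteq> 0" by (rule less_imp_neq[symmetric])
 qed
 have w: "continuous_on strip (%x. x$2)" by (intro continuous_intros)
 have q: "continuous_on strip (%x. \<tau> * qof (sqrt (1 - c^2 * (x$2)^2)))"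
  unfolding qof_def
  by (intro continuous_on_mult continuous_on_const continuous_on_divide continuous_on_add continuous_on_diff
    continuous_on_real_sqrt continuous_on_power w nz)
 have hc: "continuous_on {z. 1 - \<e> * z^2 > 0} (hinv \<e>)" by (rule smooth_on_continuous[OF smooth_on_hinv[OF eps]])
 have im: "(%x. \<tau> * qof (sqrt (1 - c^2 * (x$2)^2))) ` strip \<subseteq> {z. 1 - \<e> * z^2 > 0}"
 proof (rule image_subsetI)
  fix x assume "x \<in> strip"
  note k = qof_pos(1,2)[OF r[OF this]]
  obtain y where "sn y = qof (sqrt (1 - c^2 * (x$2)^2))" using sn_surj[OF k] by blast
  then show "\<tau> * qof (sqrt (1 - c^2 * (x$2)^2)) \<in> {z. 1 - \<e> * z^2 > 0}" using tq_bound[of 0 y] tt_0 by simp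
 qed
 show ?thesis unfolding cyl_height_def
  by (intro continuous_on_mult continuous_on_const continuous_on_compose2[OF hc q im])
qed

lemma cyl_graph:
 assumes s: "\<sigma> = \<tau>"
 shows "upper_half_graph_over (psurf FF id \<delta>) strip"
proof -
 let ?U = "{z \<in> range FF. snd z > 0}"
 have U: "upper_half (psurf FF id \<delta>) = ?U" by (auto simp: upper_half_def psurf_def)
 have sub: "subtopology (dom (psurf FF id \<delta>)) ?U = top_of_set ?U"
  by (simp add: psurf_def subtopology_subtopology) (rule arg_cong[of _ _ top_of_set], auto)
 have "homeomorphic_maps (top_of_set ?U) (top_of_set strip) fst (%x. (x, cyl_height (x$2)))"
  unfolding homeomorphic_maps_def
 proof (intro conjI ballI)
  show "continuous_map (top_of_set ?U) (top_of_set strip) fst"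
   using cyl_fst_snd(1)[OF s] by (auto simp: continuous_map_in_subtopology intro!: continuous_intros)
  have "(x, cyl_height (x$2)) \<in> ?U" if "x \<in> strip" for x
   using cyl_lift[OF s that] by (metis (mono_tags, lifting) mem_Collect_eq rangeI)
  then show "continuous_map (top_of_set strip) (top_of_set ?U) (%x. (x, cyl_height (x$2)))"
   unfolding continuous_map_in_subtopology by (auto intro!: continuous_intros cyl_height_continuous)
  show "(fst z, cyl_height (fst z $ 2)) = z" if "z \<in> topspace (top_of_set ?U)" for z
  proof -
   have "z \<in> range FF" "snd z > 0" using that by simp_all
   then obtain u where "z = FF u" "snd (FF u) > 0" by blast
   then show ?thesis using cyl_fst_snd(2)[OF s, of u] by simp
  qed
 qed simp
 then have "homeomorphic_map (top_of_set ?U) (top_of_set strip) fst" by (rule homeomorphic_maps_imp_map)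
 then show ?thesis unfolding upper_half_graph_over_def U sub by (simp add: psurf_def)
qed

text \<open>Height 0 means \<open>sn = 0\<close>; there the y-derivative is vertical and nonzero, so
  every normal is horizontal.\<close>

lemma orthogonal_FF: "orthogonal_to_slice \<e> (psurf FF id \<delta>)"
 unfolding orthogonal_to_slice_def
proof (intro ballI, unfold split_paired_all split_conv, intro ballI impI allI)
 fix V \<phi> u n assume "(V, \<phi>) \<in> atlas (psurf FF id \<delta>)" and u: "u \<in> V" and h: "snd (imm (psurf FF id \<delta>) (\<phi> u)) = 0"
  and n: "unit_normal \<e> (imm (psurf FF id \<delta>) \<circ> \<phi>) u n"
 then have \<phi>: "\<phi> = FF" "imm (psurf FF id \<delta>) = id" by (auto simp: psurf_def)
 have "sn (u$2) = 0" using h fh_sign(2)[of "u$1" "u$2"] by (simp add: \<phi> FF_def)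
 then have Y: "YY u = (0, fhy (u$1) (u$2))"
  unfolding YY_def f_defs p_defs by (simp add: vE_zero)
 have "rr (u$2) \<noteq> 0" using profile_point.r2[OF pp[of "u$1" "u$2"]] \<open>sn (u$2) = 0\<close> by auto
 then have "fhy (u$1) (u$2) \<noteq> 0" unfolding f_defs p_defs using eta_pos tt_pos[of "u$1"] fd_pos(1)[of "u$1" "u$2"] by simp
 moreover have "pform \<e> (YY u) n = 0"
  using n[unfolded unit_normal_def \<phi> id_o, THEN conjunct2, THEN conjunct2, THEN spec, of "axis 2 1"]
  unfolding FF_partials(2) .
 ultimately show "pform \<e> n (0, 1) = 0" unfolding Y by (simp add: pform_def)
qed

section \<open>The strip as a tubular neighbourhood of the geodesic\<close>

lemma mform_geodesic:
 assumes x: "x \<in> M2 \<e>" and y: "y \<in> geodesic \<e> (axis 3 1) (axis 1 1)"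
 shows "(mform \<e> x y)^2 = 1 - \<e> * (x$2)^2 - \<e> * (x$1 * y$3 - x$3 * y$1)^2"
proof -
 obtain t where t: "y = gcos \<e> t *\<^sub>R axis 3 1 + gsin \<e> t *\<^sub>R axis 1 1" using y by (auto simp: geodesic_def)
 have y: "y$1 = gsin \<e> t" "y$2 = 0" "y$3 = gcos \<e> t" by (simp_all add: t axis_def)
 have "x$1 * x$1 + x$2 * x$2 + \<e> * (x$3 * x$3) = \<e>" using x by (simp add: M2_def mform_def)
 then show ?thesis unfolding mform_def y by (rule geodesic_identity[OF _ gcos_gsin[OF eps] ee])
qed

text \<open>The cosine of the radius of the tube is \<open>2 H / c\<close>, and a point is closest to its projection.\<close>

lemma mdistance_less_radius:
 assumes "x \<in> M2 \<e>" "y \<in> geodesic \<e> (axis 3 1) (axis 1 1)" "\<e> = -1 \<or> \<bar>mform \<e> x y\<bar> \<le> 1"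
  "\<e> = 1 \<or> 1 \<le> - mform \<e> x y"
 shows "mdistance \<e> x y < cylinder_radius \<e> H \<longleftrightarrow>
  (if \<e> = 1 then 2 * H / c < mform \<e> x y else - mform \<e> x y < 2 * H / c)"
proof (cases "\<e> = 1")
 case True
 have c1: "1 + (1 / (2 * H))^2 = (c / (2 * H))^2"
  using c2 H True by (simp add: power_divide field_simps power2_eq_square)
 have "cos (arctan (1 / (2 * H))) = 2 * H / c"
  unfolding cos_arctan c1 using c_pos H by simp
 moreover have "0 \<le> arctan (1 / (2 * H))" "arctan (1 / (2 * H)) \<le> pi"
  using H arctan_ubound[of "1 / (2 * H)"] by (simp_all add: less_imp_le) (smt (verit) pi_gt_zero pi_half_less_two)
 ultimately have r: "arctan (1 / (2 * H)) = arccos (2 * H / c)" "2 * H / c \<le> 1" "-1 \<le> 2 * H / c"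
  by (metis arccos_cos, metis cos_le_one, metis cos_ge_minus_one)
 have "arccos (mform \<e> x y) < arccos (2 * H / c) \<longleftrightarrow> 2 * H / c < mform \<e> x y"
  using assms(3) True r by (intro arccos_less_mono) auto
 then show ?thesis using True r(1) by (simp add: mdistance_def cylinder_radius_def)
next
 case False
 then have e: "\<e> = -1" using eps by auto
 have h1: "1 / (2 * H) < 1"
 proof -
  have "1^2 < (2 * H)^2" using disc e by (simp add: power_mult_distrib)
  then have "1 < 2 * H" by (rule power2_less_imp_less) (use H in simp)
  then show ?thesis by simp
 qed
 have "cosh (artanh (1 / (2 * H))) = 2 * H / c"
 proof (rule power2_eq_imp_eq)
  \<comment> \<open>\<open>X^2 = (1 + z) / (1 - z)\<close> turns the claim on \<open>cosh\<close>
    into algebra.\<close>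
  define z X where "z = 1 / (2 * H)" and "X = exp (artanh z)"
  have z: "0 < z" "z < 1" using H h1 by (simp_all add: z_def)
  have "X^2 = exp (2 * artanh z)" by (simp add: X_def exp_double)
  also have "\<dots> = (1 + z) / (1 - z)" using z by (simp add: artanh_def)
  finally have "X^2 * (1 - z) = 1 + z" using z by simp
  moreover have "(2 * X * cosh (artanh z))^2 = (X^2 + 1)^2"
   by (simp add: X_def cosh_field_def exp_minus algebra_simps power2_eq_square)
  ultimately have "4 * X^2 * ((cosh (artanh z))^2 * (1 - z^2)) = 4 * X^2" by algebra
  moreover have "X^2 \<noteq> 0" by (simp add: X_def)
  ultimately have "(cosh (artanh z))^2 * (1 - z^2) = 1" by simp
  moreover have z2: "1 - z^2 = c^2 / (2 * H)^2"
   using c2 H e by (simp add: z_def power_divide field_simps)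
  ultimately have k: "(cosh (artanh z))^2 * (c^2 / (2 * H)^2) = 1" by (simp only: z2)
  have "C = (2 * H / c)^2" if "C * (c^2 / (2 * H)^2) = 1" for C
   using that c_pos H by (simp add: power_divide field_simps)
  from this[OF k] show "(cosh (artanh (1 / (2 * H))))^2 = (2 * H / c)^2" unfolding z_def .
 qed (use H c_pos in auto)
 moreover have "0 \<le> artanh (1 / (2 * H))" using h1 H by (simp add: artanh_def field_simps)
 ultimately have r: "artanh (1 / (2 * H)) = arcosh (2 * H / c)" "1 \<le> 2 * H / c"
  by (metis arcosh_cosh_real, metis cosh_real_ge_1)
 have "arcosh (- mform \<e> x y) < arcosh (2 * H / c) \<longleftrightarrow> - mform \<e> x y < 2 * H / c"
  using assms(4) e r by (intro arcosh_less_iff_real) auto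
 then show ?thesis using e r(1) by (simp add: mdistance_def cylinder_radius_def)
qed

text \<open>Since \<open>1 - (2H/c)^2 = \<e> / c^2\<close>, being closer than the radius to a point
  \<open>y\<close> of the geodesic gives
  \<open>(x$2)^2 + (x$1 * y$3 - x$3 * y$1)^2 < 1 / c^2\<close>. Conversely, \<open>y\<close> is
  taken to be the projection of \<open>x\<close>, found in polar coordinates, for which the second
  square vanishes.\<close>

lemma tube_strip: "tube \<e> (geodesic \<e> (axis 3 1) (axis 1 1)) (cylinder_radius \<e> H) = strip"
proof (intro set_eqI iffI)
 note hc = two_H_c
 have em: "\<e> = 1 \<or> \<e> = -1" using eps by auto
 fix x assume "x \<in> tube \<e> (geodesic \<e> (axis 3 1) (axis 1 1)) (cylinder_radius \<e> H)"
 then obtain y where x: "x \<in> M2 \<e>" and y: "y \<in> geodesic \<e> (axis 3 1) (axis 1 1)" "mdistance \<e> x y < cylinder_radius \<e> H"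
  unfolding tube_def by blast
 note sq = mform_geodesic[OF x y(1)]
 have "(x$2)^2 < 1 / c^2"
  using em
 proof
  assume e: "\<e> = 1"
  have "(mform \<e> x y)^2 \<le> 1" unfolding sq unfolding e by simp
  then have "\<bar>mform \<e> x y\<bar> \<le> 1" by (simp add: abs_square_le_1)
  then have "2 * H / c < mform \<e> x y" using mdistance_less_radius[OF x y(1)] y(2) e by simp
  then have "(2 * H / c)^2 < (mform \<e> x y)^2" using hc(2) by (intro power_strict_mono) auto
  then have "(x$2)^2 + (x$1 * y$3 - x$3 * y$1)^2 < 1 / c^2" unfolding hc(1) sq unfolding e by simp
  then show ?thesis by (smt (verit) zero_le_power2)
 next
  assume e: "\<e> = -1"
  obtain t where t: "y = gcos \<e> t *\<^sub>R axis 3 1 + gsin \<e> t *\<^sub>R axis 1 1" using y(1) by (auto simp: geodesic_def)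
  have y13: "y$1 = sinh t" "y$3 = cosh t" using e by (simp_all add: t axis_def gcos_def gsin_def)
  have x0: "x$1 * x$1 + x$2 * x$2 - x$3 * x$3 = -1" "x$3 > 0" using x e by (auto simp: M2_def mform_def)
  then have "\<bar>x$1\<bar>^2 < (x$3)^2" by (simp add: power2_eq_square) (smt (verit) zero_le_square)
  then have x13: "\<bar>x$1\<bar> < x$3" by (rule power2_less_imp_less) (use x0 in simp)
  have s: "\<bar>sinh t\<bar> \<le> cosh t" by (rule power2_le_imp_le) (simp_all add: cosh_square_eq)
  have "x$1 * sinh t \<le> \<bar>x$1\<bar> * \<bar>sinh t\<bar>" by (metis abs_ge_self abs_mult)
  also have "\<dots> \<le> x$3 * cosh t" using x13 s by (intro mult_mono) auto
  finally have nn: "0 \<le> - mform \<e> x y"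
   unfolding mform_def y13 using t e by (simp add: axis_def)
  have "1 \<le> (- mform \<e> x y)^2" unfolding power2_minus sq unfolding e by simp
  then have "1 \<le> - mform \<e> x y" using nn by (metis power2_le_imp_le one_power2)
  then have "- mform \<e> x y < 2 * H / c" using mdistance_less_radius[OF x y(1)] y(2) e by simp
  then have "(- mform \<e> x y)^2 < (2 * H / c)^2" using nn by (intro power_strict_mono) auto
  then have "(x$2)^2 + (x$1 * y$3 - x$3 * y$1)^2 < 1 / c^2" unfolding power2_minus hc(1) sq unfolding e by simp
  then show ?thesis by (smt (verit) zero_le_power2)
 qed
 then show "x \<in> strip" unfolding strip_def using x c_pos by (simp add: field_simps)
next
 note hc = two_H_c
 have em: "\<e> = 1 \<or> \<e> = -1" using eps by auto
 fix x assume "x \<in> strip"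
 then have x: "x \<in> M2 \<e>" "(x$2)^2 < 1 / c^2" unfolding strip_def using c_pos by (simp_all add: field_simps)
 define A where "A = sqrt (1 - \<e> * (x$2)^2)"
 have pos: "1 - \<e> * (x$2)^2 > 0"
  using em
 proof
  assume e: "\<e> = 1"
  have "1 / c^2 \<le> 1" using c_gt1[OF e] by (simp add: power_le_one_iff)
  then show ?thesis using x(2) e by simp
 qed (simp add: add_pos_nonneg)
 then have A: "A > 0" "A^2 = 1 - \<e> * (x$2)^2" by (simp_all add: A_def)
 have "(x$3)^2 + \<e> * (x$1)^2 = A^2"
 proof -
  have "x$1 * x$1 + x$2 * x$2 + \<e> * (x$3 * x$3) = \<e>" using x(1) by (simp add: M2_def mform_def)
  then show ?thesis unfolding A(2) by (rule M2_identity[OF _ ee])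
 qed
 then obtain \<theta> where \<theta>: "x$1 = A * gsin \<e> \<theta>" "x$3 = A * gcos \<e> \<theta>"
  using polar_coordinates[OF A(1), of "x$3" "x$1"] x(1) by (auto simp: M2_def)
 define y where "y = gcos \<e> \<theta> *\<^sub>R (axis 3 1 :: real^3) + gsin \<e> \<theta> *\<^sub>R axis 1 1"
 have y: "y \<in> geodesic \<e> (axis 3 1) (axis 1 1)" by (auto simp: geodesic_def y_def)
 have yi: "y$1 = gsin \<e> \<theta>" "y$2 = 0" "y$3 = gcos \<e> \<theta>" by (simp_all add: y_def axis_def)
 have mf: "mform \<e> x y = \<e> * A"
  unfolding mform_def yi \<theta> using gcos_gsin[OF eps, of \<theta>] ee by algebra
 have "mdistance \<e> x y < cylinder_radius \<e> H"
  using em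
 proof
  assume e: "\<e> = 1"
  have "A \<le> 1" unfolding A_def e by simp
  moreover have "2 * H / c < A"
  proof (rule power2_less_imp_less)
   have o: "\<e> * z = z" for z using e by simp
   show "(2 * H / c)^2 < A^2" unfolding hc(1) A(2) o using x(2) by simp
  qed (use A in simp)
  ultimately show ?thesis using mdistance_less_radius[OF x(1) y] A(1) mf e by simp
 next
  assume e: "\<e> = -1"
  have "1 \<le> A" unfolding A_def e by simp
  moreover have "A < 2 * H / c"
  proof (rule power2_less_imp_less)
   have o: "\<e> * z = - z" for z using e by simp
   show "A^2 < (2 * H / c)^2" unfolding hc(1) A(2) o using x(2) by simp
  qed (use hc(2) in simp)
  ultimately show ?thesis using mdistance_less_radius[OF x(1) y] A(1) mf e by simp
 qed
 then show "x \<in> tube \<e> (geodesic \<e> (axis 3 1) (axis 1 1)) (cylinder_radius \<e> H)"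
  unfolding tube_def using x(1) y by blast
qed

lemma horizontal_cylinderI:
 fixes S :: "(real^3) surface"
 assumes s: "\<sigma> = \<tau>" and S: "cmc_surface \<e> H S" "complete_surface \<e> S" "\<And>g. covers g ==> invariant_under S g"
  "\<And>\<Omega>. upper_half_graph_over (psurf FF id \<delta>) \<Omega> ==> upper_half_graph_over S \<Omega>"
  "orthogonal_to_slice \<e> (psurf FF id \<delta>) ==> orthogonal_to_slice \<e> S"
 shows "is_horizontal_cylinder \<e> H S"
 unfolding is_horizontal_cylinder_def
proof (intro conjI exI allI)
 show "frame \<e> (axis 3 1) (axis 1 1) (axis 2 1)" by (rule frame_axes[OF eps])
 show "invariant_under S (horizontal (along \<e> (axis 3 1) (axis 1 1) (axis 2 1) t))" for t
  by (rule S(3)[OF covers_cyl[OF s]])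
 show "horizontally_symmetric S" unfolding horizontally_symmetric_def by (rule S(3)[OF covers_flip])
 show "invariant_under S (horizontal (reflection \<e> (axis 2 1)))" by (rule S(3)[OF covers_reflect])
 show "orthogonal_to_slice \<e> S" by (rule S(5)[OF orthogonal_FF])
 show "upper_half_graph_over S (tube \<e> (geodesic \<e> (axis 3 1) (axis 1 1)) (cylinder_radius \<e> H))"
  unfolding tube_strip by (rule S(4)[OF cyl_graph[OF s]])
qed (rule S(1,2))+

end

section \<open>Self-intersections\<close>

text \<open>
 A curve in the image of an embedded surface lifts continuously to a chart, hence its velocity is
 tangent to the surface; an image that contains three independent velocities at one point is
 therefore not the image of an embedded surface.
\<close>

lemma velocity_in_range:
 fixes G :: "real^2 => ambient" and \<gamma> :: "real => ambient"
 assumes G: "(G has_derivative L) (at u0)" and L: "inj L"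
  and \<gamma>: "(\<gamma> has_vector_derivative w) (at 0)"
  and v: "(v \<longlongrightarrow> u0) (at 0)" "\<forall>\<^sub>F s in at 0. \<gamma> s = G (v s)" "\<gamma> 0 = G u0"
 shows "w \<in> range L"
proof -
 have lin: "linear L" by (rule has_derivative_linear[OF G])
 from linear_inj_bounded_below_pos[OF lin L] obtain B where B: "B > 0" "\<And>z. B * norm z \<le> norm (L z)" by metis
 have "\<exists>y\<in>range L. dist y w < e" if e: "e > 0" for e
 proof -
  define k where "k = norm w + 1"
  have k: "k > 0" by (simp add: k_def add_nonneg_pos)
  \<comment> \<open>The bound \<open>B / 2\<close> is absorbed by the expansion of \<open>L\<close>
    and yields \<open>norm z \<le> 2 k |s| / B\<close>; the second entry of the minimum then keeps
    the linearization error of \<open>G\<close> below \<open>e |s| / 2\<close>.\<close>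
  define e1 e2 where "e1 = min (B/2) (e * B / (4 * k))" and "e2 = min (e/4) 1"
  have e12: "e1 > 0" "e2 > 0" using e B(1) k by (simp_all add: e1_def e2_def)
  obtain d1 where d1: "d1 > 0" "\<And>y. norm (y - u0) < d1 ==> norm (G y - G u0 - L (y - u0)) \<le> e1 * norm (y - u0)"
   using G[unfolded has_derivative_at_alt] e12(1) by blast
  obtain d2 where d2: "d2 > 0" "\<And>s. norm (s - 0) < d2 ==> norm (\<gamma> s - \<gamma> 0 - (s - 0) *\<^sub>R w) \<le> e2 * norm (s - 0)"
   using \<gamma>[unfolded has_vector_derivative_def has_derivative_at_alt] e12(2) by blast
  have "\<forall>\<^sub>F s in at 0. dist (v s) u0 < d1" using v(1) d1(1) by (rule tendstoD)
  moreover have "\<forall>\<^sub>F s in at (0::real). dist s 0 < d2 & s \<noteq> 0"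
   using d2(1) by (auto simp: eventually_at)
  ultimately have "\<forall>\<^sub>F s in at 0. dist (v s) u0 < d1 & (dist s 0 < d2 & s \<noteq> 0) & \<gamma> s = G (v s)"
   using v(2) by (simp add: eventually_conj_iff)
  then obtain s where s: "dist (v s) u0 < d1" "dist s 0 < d2" "s \<noteq> 0" "\<gamma> s = G (v s)"
   using eventually_happens[of _ "at (0::real)"] by auto
  define z where "z = v s - u0"
  have 1: "norm (\<gamma> s - \<gamma> 0 - L z) \<le> e1 * norm z" using d1(2)[of "v s"] s v(3) by (simp add: z_def dist_norm)
  have 2: "norm (\<gamma> s - \<gamma> 0 - s *\<^sub>R w) \<le> e2 * \<bar>s\<bar>" using d2(2)[of s] s(2) by (simp add: dist_norm)
  have "norm (\<gamma> s - \<gamma> 0) \<le> norm (s *\<^sub>R w) + norm (\<gamma> s - \<gamma> 0 - s *\<^sub>R w)" by (rule norm_triangle_sub)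
  also have "\<dots> \<le> \<bar>s\<bar> * norm w + 1 * \<bar>s\<bar>"
   using 2 mult_right_mono[of e2 1 "\<bar>s\<bar>"] by (simp add: e2_def)
  finally have 3: "norm (\<gamma> s - \<gamma> 0) \<le> k * \<bar>s\<bar>" by (simp add: k_def algebra_simps)
  have "B * norm z \<le> norm (L z)" by (rule B(2))
  also have "\<dots> \<le> norm (\<gamma> s - \<gamma> 0) + norm (\<gamma> s - \<gamma> 0 - L z)"
   using norm_triangle_ineq4[of "\<gamma> s - \<gamma> 0" "\<gamma> s - \<gamma> 0 - L z"] by simp
  also have "\<dots> \<le> k * \<bar>s\<bar> + B / 2 * norm z"
  proof (rule add_mono[OF 3])
   have "e1 * norm z \<le> B / 2 * norm z" by (rule mult_right_mono) (simp_all add: e1_def)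
   then show "norm (\<gamma> s - \<gamma> 0 - L z) \<le> B / 2 * norm z" using 1 by linarith
  qed
  finally have "norm z \<le> 2 * k * \<bar>s\<bar> / B" using B(1) by (simp add: field_simps)
  then have "e1 * norm z \<le> (e * B / (4 * k)) * (2 * k * \<bar>s\<bar> / B)"
   using e12(1) e B(1) k by (intro mult_mono) (auto simp: e1_def)
  also have "\<dots> = e / 2 * \<bar>s\<bar>" using B(1) k by (simp add: field_simps)
  finally have 4: "e1 * norm z \<le> e / 2 * \<bar>s\<bar>" .
  have "norm (L z - s *\<^sub>R w) \<le> norm (\<gamma> s - \<gamma> 0 - s *\<^sub>R w) + norm (\<gamma> s - \<gamma> 0 - L z)"
   using norm_triangle_ineq4[of "\<gamma> s - \<gamma> 0 - s *\<^sub>R w" "\<gamma> s - \<gamma> 0 - L z"] by simp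
  also have "\<dots> \<le> e / 4 * \<bar>s\<bar> + e / 2 * \<bar>s\<bar>"
  proof (rule add_mono)
   have "e2 * \<bar>s\<bar> \<le> e / 4 * \<bar>s\<bar>" by (rule mult_right_mono) (simp_all add: e2_def)
   then show "norm (\<gamma> s - \<gamma> 0 - s *\<^sub>R w) \<le> e / 4 * \<bar>s\<bar>" using 2 by linarith
  qed (use 1 4 in linarith)
  also have "\<dots> < e * \<bar>s\<bar>" using e s(3) by simp
  finally have 5: "norm (L z - s *\<^sub>R w) < e * \<bar>s\<bar>" .
  have "L ((1/s) *\<^sub>R z) - w = (1/s) *\<^sub>R (L z - s *\<^sub>R w)" using s(3) linear_scale[OF lin] by (simp add: scaleR_diff_right)
  then have "dist (L ((1/s) *\<^sub>R z)) w = norm (L z - s *\<^sub>R w) / \<bar>s\<bar>" by (simp add: dist_norm)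
  then have "dist (L ((1/s) *\<^sub>R z)) w < e" using 5 s(3) by (simp add: divide_less_eq)
  then show ?thesis by blast
 qed
 then have "w \<in> closure (range L)" unfolding closure_approachable by blast
 moreover have "closed (range L)" by (intro closed_subspace linear_subspace_image[OF lin] subspace_UNIV)
 ultimately show ?thesis by simp
qed

text \<open>The image of a chart is relatively open in the image of an embedded surface, so a curve
  in that image stays in it near parameter 0 and is lifted continuously by the inverse of the chart.
  \<open>R\<close> is the tangent plane at \<open>P\<close>.\<close>

lemma embedded_tangents:
 fixes T :: "'a surface"
 assumes T: "immersed_surface \<e> T" "embedded T" and P: "P \<in> image_of T"
 shows "\<exists>R. subspace R & dim R \<le> 2 & (\<forall>\<gamma> w. (\<gamma> has_vector_derivative w) (at 0) --> \<gamma> 0 = P -->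
  range \<gamma> \<subseteq> image_of T --> w \<in> R)"
proof -
 obtain x0 where x0: "x0 \<in> topspace (dom T)" "imm T x0 = P" using P by (auto simp: image_of_def)
 obtain V \<phi> u0 where c: "(V, \<phi>) \<in> atlas T" "u0 \<in> V" "\<phi> u0 = x0" using chart_cover[OF T(1) x0(1)] by metis
 note cf = chart_facts[OF T(1) c(1)]
 let ?G = "imm T \<circ> \<phi>" and ?L = "frechet_derivative (imm T \<circ> \<phi>) (at u0)"
 have imm: "smooth_on ?G V" "inj ?L"
  using T(1) c(1,2) unfolding immersed_surface_def by fast+
 have GL: "(?G has_derivative ?L) (at u0)"
  using smooth_on_differentiable[OF imm(1) c(2)] by (simp add: frechet_derivative_works)
 have hm: "homeomorphic_map (dom T) (top_of_set (image_of T)) (imm T)"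
  using T(2) by (simp add: embedded_def embedding_map_def image_of_def)
 have hc: "homeomorphic_map (top_of_set V) (subtopology (dom T) (\<phi> ` V)) \<phi>"
  using T(1) c(1) unfolding immersed_surface_def smooth_2_manifold_def by fast
 have hG: "homeomorphic_map (top_of_set V) (top_of_set (?G ` V)) ?G"
 proof -
  have sub: "\<phi> ` V \<subseteq> topspace (dom T)" using openin_subset[OF cf(2)] .
  have "homeomorphic_map (subtopology (dom T) (\<phi> ` V)) (subtopology (top_of_set (image_of T)) (imm T ` \<phi> ` V)) (imm T)"
  proof (rule homeomorphic_map_subtopologies_alt[OF hm])
   fix x assume "x \<in> topspace (dom T)"
   then show "(imm T x \<in> imm T ` \<phi> ` V) = (x \<in> \<phi> ` V)"
    using homeomorphic_imp_injective_map[OF hm] sub by (meson inj_on_image_mem_iff)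
  qed
  moreover have "subtopology (top_of_set (image_of T)) (imm T ` \<phi> ` V) = top_of_set (?G ` V)"
  proof -
   have "imm T ` \<phi> ` V \<subseteq> image_of T" unfolding image_of_def using sub by (rule image_mono)
   then show ?thesis by (simp add: subtopology_subtopology Int_absorb1 image_comp)
  qed
  ultimately show ?thesis using homeomorphic_map_compose[OF hc] by metis
 qed
 then obtain g where g: "homeomorphic_maps (top_of_set V) (top_of_set (?G ` V)) ?G g"
  using homeomorphic_map_maps by blast
 have gG: "g (?G u) = u" if "u \<in> V" for u using g that unfolding homeomorphic_maps_def by simp
 have gc: "continuous_on (?G ` V) g" using g unfolding homeomorphic_maps_def by (simp add: continuous_map_in_subtopology)
 have op: "openin (top_of_set (image_of T)) (?G ` V)"
  using homeomorphic_imp_open_map[OF hm] cf(2) unfolding open_map_def by (metis image_comp)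
 then obtain O' where O': "open O'" "?G ` V = image_of T \<inter> O'" by (auto simp: openin_open)
 have "w \<in> range ?L" if \<gamma>: "(\<gamma> has_vector_derivative w) (at 0)" "\<gamma> 0 = P" "range \<gamma> \<subseteq> image_of T" for \<gamma> w
 proof (rule velocity_in_range[OF GL imm(2) \<gamma>(1), of "g \<circ> \<gamma>"])
  have P: "P = ?G u0" using x0 c by simp
  have cont: "(\<gamma> \<longlongrightarrow> P) (at 0)" using has_vector_derivative_continuous[OF \<gamma>(1)] \<gamma>(2) by (simp add: continuous_within)
  have "P \<in> O'" using P O'(2) c(2) by blast
  then have "\<forall>\<^sub>F s in at 0. \<gamma> s \<in> O'" using cont O'(1) by (intro topological_tendstoD)
  then have ev: "\<forall>\<^sub>F s in at 0. \<gamma> s \<in> ?G ` V" by (rule eventually_mono) (use \<gamma>(3) O'(2) in auto)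
  then show "\<forall>\<^sub>F s in at 0. \<gamma> s = ?G ((g \<circ> \<gamma>) s)" by (rule eventually_mono) (use gG in force)
  have "((%s. g (\<gamma> s)) \<longlongrightarrow> g P) (at 0)"
   by (rule continuous_on_tendsto_compose[OF gc cont _ ev]) (use P c(2) in auto)
  then show "((g \<circ> \<gamma>) \<longlongrightarrow> u0) (at 0)" using gG[OF c(2)] P by (simp add: o_def)
  show "\<gamma> 0 = ?G u0" using \<gamma>(2) P by simp
 qed
 moreover have "subspace (range ?L)" "dim (range ?L) \<le> 2"
  using linear_subspace_image[OF has_derivative_linear[OF GL] subspace_UNIV] dim_image_le[OF has_derivative_linear[OF GL], of UNIV]
  by simp_all
 ultimately show ?thesis by (intro exI[of _ "range ?L"]) simp
qed

context delaunay
begin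

text \<open>At frame angles \<pi> and -\<pi>, and at \<open>sn y = 1\<close>, the points
  \<open>(x, y)\<close> and \<open>(-x, y)\<close> have the same image. Their x-velocities have
  equal horizontal and opposite vertical parts, the latter nonzero because
  \<open>ts x \<noteq> 0\<close>; their sum, their difference and the y-velocity are nonzero and
  orthogonal, too many for a tangent plane.\<close>

lemma not_embedded:
 fixes T :: "'a surface"
 assumes e: "\<e> = 1" and x: "II x = pi" "ts x \<noteq> 0" and T: "immersed_surface \<e> T" "image_of T = range FF"
 shows "\<not> embedded T"
proof
 assume emb: "embedded T"
 obtain y where y: "sn y = 1" "rr y = 0" by (rule top_point)
 define u1 u2 where "u1 = (vector [x, y] :: real^2)" and "u2 = (vector [- x, y] :: real^2)"
 have g: "gsin \<e> pi = 0" "gcos \<e> pi = -1" using e by (simp_all add: gsin_def gcos_def)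
 have P: "FF u1 = FF u2"
  using g by (simp add: FF_def u1_def u2_def II_minus x(1) f_minus_x vec_eq_iff forall_3) (simp add: f_eqs y)
 have "FF u1 \<in> image_of T" using T(2) by simp
 from embedded_tangents[OF T(1) emb this] obtain R where R: "subspace R" "dim R \<le> 2"
  "\<And>\<gamma> w. (\<gamma> has_vector_derivative w) (at 0) ==> \<gamma> 0 = FF u1 ==> range \<gamma> \<subseteq> image_of T ==> w \<in> R" by metis
 have line: "((%s. FF (u + s *\<^sub>R axis i 1)) has_vector_derivative (if i = 1 then XX u else YY u)) (at 0)"
  for u :: "real^2" and i
 proof -
  have "((%s. u + s *\<^sub>R axis i 1) has_derivative (%s. s *\<^sub>R axis i 1)) (at 0)" by (auto intro!: derivative_eq_intros)
  from has_derivative_compose[OF this, of FF "%v. v$1 *\<^sub>R XX u + v$2 *\<^sub>R YY u"] FF_deriv[of u]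
  have "((%s. FF (u + s *\<^sub>R axis i 1)) has_derivative (%s. (s *\<^sub>R axis i 1 :: real^2)$1 *\<^sub>R XX u + (s *\<^sub>R axis i 1 :: real^2)$2 *\<^sub>R YY u)) (at 0)"
   by simp
  moreover have "i = 1 \<or> i = 2" by (rule exhaust_2)
  ultimately show ?thesis unfolding has_vector_derivative_def by (auto simp: axis_def)
 qed
 have in_R: "XX u1 \<in> R" "XX u2 \<in> R" "YY u1 \<in> R"
  using R(3)[OF line[of u1 1]] R(3)[OF line[of u2 1]] R(3)[OF line[of u1 2]] P T(2) by auto
 define a h k where "a = fXb x y" and "h = fhx x y" and "k = fYc x y"
 have s0: "fd (- x) y = fd x y" "fd1 (- x) = fd1 x" by (rule f_minus_x)+
 have vals: "fXa x y = 0" "fXc x y = 0" "fYa x y = 0" "fYb x y = 0" "fhy x y = 0"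
  unfolding f_defs p_defs by (simp_all add: y)
 have vals': "fXa (- x) y = 0" "fXc (- x) y = 0" "fXb (- x) y = a" "fhx (- x) y = - h"
  unfolding a_def h_def f_defs p_defs unfolding s0 tt_ts_sym by (simp_all add: y)
 have X1: "XX u1 = (vector [- a, 0, 0], h)" and X2: "XX u2 = (vector [- a, 0, 0], - h)"
  and Y1: "YY u1 = (vector [0, k, 0], 0)"
  unfolding XX_def YY_def u1_def u2_def using g vals vals'
  by (simp_all add: vec_eq_iff forall_3 II_minus x(1) a_def h_def k_def)
 have d: "fd x y > 0" "fd1 x > 0" by (rule fd_pos)+
 have em: "1 - m > 0" "1 - (tt x)^2 > 0" using em_pos(1) D1_pos[of x] e by simp_all
 have "a = b * (fd x y)^2 * fd1 x * ((1 - \<e> * m) * (1 - \<e> * (tt x)^2)^2 * c * (m + (tt x)^2))"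
  unfolding a_def f_defs p_defs by (simp add: y)
 then have a0: "a \<noteq> 0" using b_pos d em_pos(1) D1_pos[of x] c_pos pt_pos[of x] by simp
 have h0: "h \<noteq> 0" unfolding h_def f_defs p_defs using eta_pos x(2) d by (simp add: y)
 have "k = b * tt x * (fd x y)^2 * (- ((1 - m^2) * (1 - (tt x)^2)))"
  unfolding k_def f_defs p_defs using y by (simp add: e) (simp add: algebra_simps)
 moreover have "1 - m^2 \<noteq> 0" using m_pos m_lt1 by (simp add: power2_eq_1_iff)
 ultimately have k0: "k \<noteq> 0" using b_pos tt_pos[of x] d em by simp
 define S where "S = {XX u1 + XX u2, XX u1 - XX u2, YY u1}"
 have S: "XX u1 + XX u2 = (vector [- 2 * a, 0, 0], 0)" "XX u1 - XX u2 = (0, 2 * h)"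
  by (simp_all add: X1 X2 vec_eq_iff forall_3)
 have "pairwise orthogonal S"
  unfolding S_def S Y1 by (auto simp: pairwise_def orthogonal_def inner_vec_def sum_3)
 moreover have "0 \<notin> S" using a0 h0 k0 unfolding S_def S Y1 by (auto simp: zero_prod_def vec_eq_iff forall_3)
 ultimately have "independent S" by (rule pairwise_orthogonal_independent)
 moreover have "S \<subseteq> R" unfolding S_def using in_R R(1) by (auto intro: subspace_add subspace_diff)
 ultimately have "card S \<le> dim R" using independent_card_le_dim by blast
 moreover have "card S = 3"
  unfolding S_def S Y1 using a0 h0 k0 by (auto simp: vec_eq_iff forall_3 card_insert_if)
 ultimately show False using R(2) by simp
qed

text \<open>The integrand of \<open>II\<close> in the variable \<open>s = phi x\<close>, where
  \<open>ds = c t dx\<close>; the interval of integration then stays fixed while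
  \<open>\<tau>\<close> varies.\<close>

definition "gg s = \<eta> * (m / rad s + rad s) / (1 - \<e> * (rad s)^2)"

lemma rad_D_pos: "1 - \<e> * (rad s)^2 > 0"
proof -
 obtain x where "phi x = s" using surjD[OF ph.amp_surj, of s] unfolding phi_def by metis
 then show ?thesis using D1_pos[of x] by (simp add: tt_def)
qed

lemma II_half: "(gg has_integral II (Px / 2)) {0..pi/2}"
proof -
 have r: "rad s \<noteq> 0" "1 - \<e> * (rad s)^2 \<noteq> 0" for s using rad_pos[of s] rad_D_pos[of s] by simp_all
 have "continuous_on UNIV rad" unfolding rad_def by (intro continuous_intros)
 then have cg: "continuous_on UNIV gg" unfolding gg_def using r by (intro continuous_intros) simp_all
 obtain G where G: "G 0 = 0" "\<And>s. (G has_real_derivative gg s) (at s)" using antiderivative_real[OF cg] by metis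
 have "G (phi x) = II x" for x
 proof (rule II_unique[of "%x. G (phi x)"])
  fix x
  have "gg (phi x) * (c * tt x) = \<eta> * c * (m + (tt x)^2) / (1 - \<e> * (tt x)^2)"
   unfolding gg_def tt_def using r[of "phi x"] by (simp add: field_simps power2_eq_square)
  then show "((%x. G (phi x)) has_real_derivative \<eta> * c * (m + (tt x)^2) / (1 - \<e> * (tt x)^2)) (at x)"
   using DERIV_chain2[OF G(2) phi_deriv, of x] by simp
 qed (simp add: phi_0 G(1))
 moreover have "phi (Px / 2) = pi / 2" using phi_period[of "- (Px / 2)"] phi_minus[of "Px / 2"] by simp
 ultimately have "G (pi / 2) = II (Px / 2)" by metis
 moreover have "(gg has_integral G (pi / 2) - G 0) {0..pi/2}"
  by (rule fundamental_theorem_of_calculus)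
   (auto intro: has_field_derivative_at_within[OF G(2)] simp: has_real_derivative_iff_has_vector_derivative[symmetric])
 ultimately show ?thesis by (simp add: G(1))
qed

text \<open>\<open>II Px\<close> is twice \<open>II (Px / 2)\<close>, so the value \<pi> is taken
  strictly between \<open>Px / 2\<close> and \<open>Px\<close>, where neither the sine nor the
  cosine of \<open>phi\<close> vanishes.\<close>

lemma crossing_point:
 assumes J: "pi / 2 < II (Px / 2)" "II (Px / 2) < pi" and nc: "\<sigma> \<noteq> \<tau>"
 shows "\<exists>x. II x = pi & ts x \<noteq> 0"
proof -
 have "II Px = 2 * II (Px / 2)" using II_period[of "- (Px / 2)"] II_minus[of "Px / 2"] by simp
 then have "II (Px / 2) \<le> pi" "pi \<le> II Px" using J by simp_all
 moreover have "continuous_on {Px/2..Px} II"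
  using II(2) by (intro continuous_at_imp_continuous_on ballI) (blast intro: DERIV_isCont)
 ultimately obtain x where x: "Px / 2 \<le> x" "x \<le> Px" "II x = pi"
  using IVT'[of II "Px/2" pi Px] Px_pos by auto
 have "x \<noteq> Px / 2" using x(3) J(2) by (metis less_irrefl)
 moreover have "x \<noteq> Px" using x(3) J(1) \<open>II Px = 2 * II (Px / 2)\<close> by auto
 ultimately have "Px / 2 < x" "x < Px" using x by simp_all
 then have "phi (Px / 2) < phi x" "phi x < phi Px" using strict_mono_less[OF phi_mono] by simp_all
 moreover have "phi (Px / 2) = pi / 2" using phi_period[of "- (Px / 2)"] phi_minus[of "Px / 2"] by simp
 ultimately have p: "pi / 2 < phi x" "phi x < pi" using phi_Px by simp_all
 then have "sin (phi x) > 0" by (intro sin_gt_zero) auto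
 moreover have "cos (phi x) < 0" using p cos_gt_zero_pi[of "pi - phi x"] by simp
 moreover have "\<tau>^2 \<noteq> \<sigma>^2" using nc sigma_pos tau_pos by (simp add: power2_eq_iff)
 ultimately have "ts x \<noteq> 0" unfolding ts_def using c_pos by simp
 then show ?thesis using x(3) by blast
qed

text \<open>\<open>m / rad s \<le> \<tau>\<close> because \<open>rad s \<ge> \<sigma>\<close>, and
  both \<open>\<tau>\<close> and \<open>rad s\<close> are at most \<open>1 / c\<close>; the bound is
  uniform in \<open>\<tau>\<close>.\<close>

lemma gg_bound:
 assumes e: "\<e> = 1"
 shows "norm (gg s) \<le> \<eta> * (2 / c) / (1 - 1 / c^2)"
proof -
 have t: "rad s \<le> 1 / c" "\<tau> \<le> 1 / c" using rad_bounds(2)[of s] tau_lt c_pos by (simp_all add: field_simps) (smt (verit) mult_left_mono mult.commute)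
 have "m / rad s \<le> \<tau>" unfolding m_def using rad_bounds(1)[of s] rad_pos[of s] tau_pos
  by (simp add: divide_le_eq mult_left_mono)
 then have n: "m / rad s + rad s \<le> 2 / c" using t by (simp add: field_simps)
 have "(rad s)^2 \<le> (1 / c)^2" using t(1) rad_pos[of s] by (intro power_mono) auto
 then have "1 - 1 / c^2 \<le> 1 - \<e> * (rad s)^2" using e by (simp add: power_divide)
 moreover have "1 < c^2" using c2 H e by simp
 then have "0 < 1 - 1 / c^2" using divide_less_eq_1_pos[of "c^2" 1] c_pos by simp
 moreover have "0 \<le> m / rad s + rad s" using m_pos rad_pos[of s] by (simp add: add_nonneg_nonneg less_imp_le)
 moreover have "\<eta> * (m / rad s + rad s) \<le> \<eta> * (2 / c)" using eta_pos by (intro mult_left_mono n) simp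
 moreover have "0 \<le> \<eta> * (2 / c)" using eta_pos c_pos by simp
 ultimately have "gg s \<le> \<eta> * (2 / c) / (1 - 1 / c^2)" "0 \<le> gg s"
  unfolding gg_def using eta_pos rad_D_pos[of s] by (blast intro: frac_le, blast intro: divide_nonneg_pos mult_nonneg_nonneg less_imp_le)
 then show ?thesis by simp
qed

end

text \<open>Dominated convergence: as \<open>\<tau>\<close> tends to \<open>1 / c\<close>,
  \<open>\<sigma>\<close> tends to 0 and \<open>rad s\<close> to \<open>cos s / c\<close>. The limit
  integrand has the primitive \<open>2 arctan (sin s / (2H))\<close>.\<close>

lemma half_period_limit:
 fixes H :: real and \<tau> :: "nat => real"
 assumes H: "H > 0" and d: "\<And>n. delaunay 1 H (\<tau> n)" and lim: "\<tau> \<longlonglongrightarrow> 1 / sqrt (4 * H^2 + 1)"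
 shows "(%n. delaunay.II 1 H (\<tau> n) (delaunay.Px 1 H (\<tau> n) / 2)) \<longlonglongrightarrow> 2 * arctan (1 / (2 * H))"
proof -
 define c where "c = sqrt (4 * H^2 + 1)"
 define \<eta> where "\<eta> = 4 * H / c"
 \<comment> \<open>The endpoint \<open>pi/2\<close> is left out: there \<open>rad\<close> equals
   \<open>\<sigma>\<close> and \<open>m / rad = \<tau>\<close> does not tend to 0.\<close>
 define S where "S = {0<..<pi/2}"
 define g where "g s = 4 * H * cos s / (4 * H^2 + (sin s)^2)" for s :: real
 define f where "f n s = delaunay.gg 1 H (\<tau> n) s" for n s
 have c: "c > 0" "c^2 = 4 * H^2 + 1" by (simp_all add: c_def add_nonneg_pos)
 have c1: "c > 1" by (rule power2_less_imp_less) (use c H in auto)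
 have cd: "delaunay.c 1 H = c" "delaunay.\<eta> 1 H = \<eta>"
  using delaunay.c_def[OF d] delaunay.\<eta>_def[OF d] by (simp_all add: c_def \<eta>_def)
 have F: "(f n has_integral delaunay.II 1 H (\<tau> n) (delaunay.Px 1 H (\<tau> n) / 2)) S" for n
  using delaunay.II_half[OF d, of n] unfolding S_def f_def has_integral_Icc_iff_Ioo .
 have lc: "\<tau> \<longlonglongrightarrow> 1 / c" using lim by (simp add: c_def)
 define \<sigma> where "\<sigma> n = (1 - c * \<tau> n) / (c - \<tau> n)" for n
 have "c - 1 / c > 0" using c1 c(1) by (simp add: field_simps power2_eq_square[symmetric])
 then have ls: "\<sigma> \<longlonglongrightarrow> 0"
  using tendsto_divide[OF tendsto_diff[OF tendsto_const[of 1] tendsto_mult[OF tendsto_const[of c] lc]] tendsto_diff[OF tendsto_const[of c] lc]] c(1)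
  unfolding \<sigma>_def[abs_def] by simp
 have conv: "(%n. f n s) \<longlonglongrightarrow> g s" if s: "s \<in> S" for s
 proof -
  define R where "R n = sqrt ((\<tau> n)^2 * (cos s)^2 + (\<sigma> n)^2 * (sin s)^2)" for n
  have fn: "f n s = \<eta> * (\<tau> n * \<sigma> n / R n + R n) / (1 - (R n)^2)" for n
   unfolding f_def delaunay.gg_def[OF d] delaunay.rad_def[OF d] delaunay.m_def[OF d] delaunay.\<sigma>_def[OF d] cd R_def \<sigma>_def by simp
  have cs: "cos s > 0" using s by (intro cos_gt_zero) (auto simp: S_def)
  have "R \<longlonglongrightarrow> sqrt ((1 / c)^2 * (cos s)^2 + 0^2 * (sin s)^2)"
   unfolding R_def[abs_def] by (intro tendsto_intros lc ls)
  then have R: "R \<longlonglongrightarrow> cos s / c" using cs c(1) by (simp add: real_sqrt_mult real_sqrt_divide power_divide)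
  have nz: "cos s / c \<noteq> 0" "1 - (cos s / c)^2 \<noteq> 0"
  proof -
   have "0 < 4 * H^2 + (sin s)^2" using H by (simp add: add_pos_nonneg)
   then have "(cos s)^2 < c^2" unfolding c(2) cos_squared_eq by linarith
   then show "1 - (cos s / c)^2 \<noteq> 0" using c(1) by (simp add: power_divide)
  qed (use cs c in simp)
  have "(%n. \<eta> * (\<tau> n * \<sigma> n / R n + R n) / (1 - (R n)^2)) \<longlonglongrightarrow> \<eta> * (1 / c * 0 / (cos s / c) + cos s / c) / (1 - (cos s / c)^2)"
   by (intro tendsto_intros lc ls R nz)
  also have "\<eta> * (1 / c * 0 / (cos s / c) + cos s / c) / (1 - (cos s / c)^2) = g s"
  proof -
   have "4 * H^2 + (sin s)^2 = c^2 - (cos s)^2" unfolding c(2) using sin_squared_eq[of s] by simp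
   moreover have "1 - (cos s / c)^2 = (c^2 - (cos s)^2) / c^2" using c(1) by (simp add: power_divide diff_divide_distrib)
   ultimately show ?thesis unfolding g_def \<eta>_def using c(1) by (simp add: power2_eq_square)
  qed
  finally show ?thesis unfolding fn .
 qed
 have bd: "norm (f n s) \<le> \<eta> * (2 / c) / (1 - 1 / c^2)" for n s
  using delaunay.gg_bound[OF d refl, of n s] unfolding f_def cd .
 have hi: "(%_. \<eta> * (2 / c) / (1 - 1 / c^2)) integrable_on S"
  using has_integral_const_real[of "\<eta> * (2 / c) / (1 - 1 / c^2)" 0 "pi/2"]
  unfolding S_def has_integral_Icc_iff_Ioo integrable_on_def by blast
 have G: "(g has_integral 2 * arctan (1 / (2 * H))) S"
 proof -
  have "(g has_integral 2 * arctan (sin (pi/2) / (2 * H)) - 2 * arctan (sin 0 / (2 * H))) {0..pi/2}"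
  proof (rule fundamental_theorem_of_calculus)
   fix s :: real
   have p: "4 * H^2 + (sin s)^2 > 0" using H by (simp add: add_pos_nonneg)
   have "((%s. 2 * arctan (sin s / (2 * H))) has_real_derivative 2 * (inverse (1 + (sin s / (2 * H))^2) * (cos s / (2 * H)))) (at s)"
    by (rule DERIV_cmult[OF DERIV_chain2[OF DERIV_arctan DERIV_cdivide[OF DERIV_sin]]])
   moreover have "2 * (inverse (1 + (sin s / (2 * H))^2) * (cos s / (2 * H))) = g s"
   proof -
    define X where "X = 4 * H^2 + (sin s)^2"
    have "1 + (sin s / (2 * H))^2 = X / (4 * H^2)" using H by (simp add: X_def power_divide field_simps)
    then show ?thesis unfolding g_def X_def[symmetric] using H p by (simp add: inverse_eq_divide power2_eq_square)
   qed
   ultimately show "((%s. 2 * arctan (sin s / (2 * H))) has_vector_derivative g s) (at s within {0..pi/2})"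
    by (simp add: has_real_derivative_iff_has_vector_derivative has_vector_derivative_at_within)
  qed simp
  then show ?thesis unfolding S_def has_integral_Icc_iff_Ioo by simp
 qed
 have "(%n. integral S (f n)) \<longlonglongrightarrow> integral S g"
  by (rule dominated_convergence(2)[where h = "%_. \<eta> * (2 / c) / (1 - 1 / c^2)"])
   (use F bd hi conv in \<open>auto simp: integrable_on_def\<close>)
 then show ?thesis using integral_unique[OF F] integral_unique[OF G] by simp
qed

text \<open>If there were no such threshold, parameters without a crossing would accumulate at
  \<open>t1\<close>. There the half-period angle tends to \<open>2 arctan (1 / (2H))\<close>, which
  lies strictly between \<pi>/2 and \<pi> because \<open>H < 1/2\<close>.\<close>

lemma crossing_near_sphere:
 fixes H :: real
 assumes H: "0 < H" "H < 1/2"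
 defines "t0 \<equiv> 1 / (sqrt (4 * H^2 + 1) + 2 * H)" and "t1 \<equiv> 1 / sqrt (4 * H^2 + 1)"
 shows "\<exists>\<tau>0. t0 < \<tau>0 & \<tau>0 < t1 & (\<forall>\<tau>. \<tau>0 \<le> \<tau> & \<tau> < t1 -->
  (\<exists>x. delaunay.II 1 H \<tau> x = pi & delaunay.ts 1 H \<tau> x \<noteq> 0))"
proof (rule ccontr)
 assume no: "\<not> ?thesis"
 have q: "0 < sqrt (4 * H^2 + 1)" by (simp add: add_nonneg_pos)
 have t: "t0 < t1"
  unfolding t0_def t1_def by (rule divide_strict_left_mono[OF _ _ mult_pos_pos[OF add_pos_pos[OF q] q]]) (use H in simp_all)
 have dl: "delaunay 1 H \<tau>" if "t0 \<le> \<tau>" "\<tau> < t1" for \<tau>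
 proof
  show "0 < 4 * H^2 + 1" by (simp add: add_nonneg_pos)
 qed (use that H in \<open>simp_all add: t0_def t1_def\<close>)
 have "\<forall>n. \<exists>\<tau>. t0 < \<tau> & t1 - inverse (real (Suc n)) < \<tau> & \<tau> < t1 &
   (\<nexists>x. delaunay.II 1 H \<tau> x = pi & delaunay.ts 1 H \<tau> x \<noteq> 0)"
 proof
  fix n
  define a where "a = (max t0 (t1 - inverse (real (Suc n))) + t1) / 2"
  have "max t0 (t1 - inverse (real (Suc n))) < t1" using t by simp
  then have a: "max t0 (t1 - inverse (real (Suc n))) < a" "a < t1" by (simp_all add: a_def)
  then have "t0 < a" by simp
  from no[unfolded not_ex, THEN spec, of a] \<open>t0 < a\<close> a(2)
  have "\<not> (\<forall>\<tau>. a \<le> \<tau> & \<tau> < t1 --> (\<exists>x. delaunay.II 1 H \<tau> x = pi & delaunay.ts 1 H \<tau> x \<noteq> 0))"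
   by (simp only: simp_thms)
  then obtain \<tau> where t: "a \<le> \<tau>" "\<tau> < t1" "\<nexists>x. delaunay.II 1 H \<tau> x = pi & delaunay.ts 1 H \<tau> x \<noteq> 0"
   unfolding not_all not_imp by (elim exE conjE)
  from t(1) a(1) have "t0 < \<tau>" "t1 - inverse (real (Suc n)) < \<tau>" by linarith+
  with t(2,3) show "\<exists>\<tau>. t0 < \<tau> & t1 - inverse (real (Suc n)) < \<tau> & \<tau> < t1 &
   (\<nexists>x. delaunay.II 1 H \<tau> x = pi & delaunay.ts 1 H \<tau> x \<noteq> 0)" by (intro exI[of _ \<tau>] conjI)
 qed
 from choice[OF this] obtain \<tau> where \<tau>': "\<forall>n. t0 < \<tau> n & t1 - inverse (real (Suc n)) < \<tau> n & \<tau> n < t1 &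
   (\<nexists>x. delaunay.II 1 H (\<tau> n) x = pi & delaunay.ts 1 H (\<tau> n) x \<noteq> 0)" by (rule exE)
 note \<tau> = \<tau>'[THEN spec, THEN conjunct1] \<tau>'[THEN spec, THEN conjunct2, THEN conjunct1]
  \<tau>'[THEN spec, THEN conjunct2, THEN conjunct2, THEN conjunct1] \<tau>'[THEN spec, THEN conjunct2, THEN conjunct2, THEN conjunct2]
 have d: "delaunay 1 H (\<tau> n)" for n using dl[of "\<tau> n"] \<tau>(1,3)[of n] by simp
 have lo: "(%n. t1 - inverse (real (Suc n))) \<longlonglongrightarrow> t1"
  using tendsto_diff[OF tendsto_const[of t1] LIMSEQ_inverse_real_of_nat] by (simp only: diff_zero)
 have ev: "\<forall>\<^sub>F n in sequentially. t1 - inverse (real (Suc n)) \<le> \<tau> n" "\<forall>\<^sub>F n in sequentially. \<tau> n \<le> t1"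
  by (rule always_eventually, rule allI, rule less_imp_le, rule \<tau>)+
 have "\<tau> \<longlonglongrightarrow> t1" by (rule tendsto_sandwich[OF ev lo tendsto_const])
 from half_period_limit[OF H(1) d this[unfolded t1_def]]
 have L: "(%n. delaunay.II 1 H (\<tau> n) (delaunay.Px 1 H (\<tau> n) / 2)) \<longlonglongrightarrow> 2 * arctan (1 / (2 * H))" .
 have "1 < 1 / (2 * H)" using H by (simp add: less_divide_eq)
 then have "pi / 4 < arctan (1 / (2 * H))" unfolding arctan_one[symmetric] arctan_less_iff .
 then have a: "pi / 2 < 2 * arctan (1 / (2 * H))" "2 * arctan (1 / (2 * H)) < pi"
  using arctan_ubound[of "1 / (2 * H)"] by linarith+
 have "\<forall>\<^sub>F n in sequentially. pi / 2 < delaunay.II 1 H (\<tau> n) (delaunay.Px 1 H (\<tau> n) / 2) &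
   delaunay.II 1 H (\<tau> n) (delaunay.Px 1 H (\<tau> n) / 2) < pi"
  by (intro eventually_conj order_tendstoD(1)[OF L a(1)] order_tendstoD(2)[OF L a(2)])
 from eventually_happens'[OF sequentially_bot this]
 obtain n where n: "pi / 2 < delaunay.II 1 H (\<tau> n) (delaunay.Px 1 H (\<tau> n) / 2)"
   "delaunay.II 1 H (\<tau> n) (delaunay.Px 1 H (\<tau> n) / 2) < pi" by (elim exE conjE)
 have "delaunay.\<sigma> 1 H (\<tau> n) \<noteq> \<tau> n"
 proof
  assume s: "delaunay.\<sigma> 1 H (\<tau> n) = \<tau> n"
  have "\<tau> n * (delaunay.c 1 H + 2 * H) = 1" by (rule delaunay.cyl_facts(8)[OF d s])
  then have "\<tau> n * (sqrt (4 * H^2 + 1) + 2 * H) = 1" unfolding delaunay.c_def[OF d] .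
  moreover have "sqrt (4 * H^2 + 1) + 2 * H \<noteq> 0" using H q by linarith
  ultimately have "\<tau> n = t0" unfolding t0_def by (intro eq_divide_imp)
  then show False using \<tau>(1)[of n] by simp
 qed
 from \<tau>(4)[of n] delaunay.crossing_point[OF d n this] show False by (rule notE)
qed

section \<open>The sphere\<close>

text \<open>
 The sphere, parametrized over the round sphere: in polar form \<open>X = (a, z)\<close> the horizontal part depends
 only on \<open>a\<close> and the height only on \<open>z\<close>. The sign \<open>s\<close> distinguishes the two stereographic charts.
\<close>

lemma snd_frechet:
 fixes G :: "real^2 => ambient"
 assumes "smooth_on G UNIV" "((%u. snd (G u)) has_derivative G') (at u)"
 shows "snd (frechet_derivative G (at u) v) = G' v"
proof -
 have "(G has_derivative frechet_derivative G (at u)) (at u)"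
  using smooth_on_differentiable[OF assms(1)] by (simp add: frechet_derivative_works)
 from has_derivative_unique[OF has_derivative_snd[OF this] assms(2)] show ?thesis by metis
qed

locale sphere_chart =
 fixes \<e> H s :: real
 assumes eps: "\<e> \<in> {-1, 1}" and H: "H > 0" and disc: "4 * H^2 + \<e> > 0" and s: "s * s = 1"
begin

definition "c = sqrt (4 * H^2 + \<e>)"
definition rho :: "real^2 => real" where "rho u = (u$1)^2 + (u$2)^2"
definition "w u = 1 + rho u"
text \<open>\<open>Q\<close> is the denominator of the horizontal coordinates, \<open>d\<close> its
  inverse and \<open>Qd\<close> its derivative with respect to \<open>rho\<close>;
  \<open>zeta\<close> is the third coordinate of the point of the round sphere.\<close>

definition "Q u = H^2 * (w u)^2 + \<e> * rho u"
definition "d u = inverse (Q u)"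
definition "Qd u = 2 * H^2 * w u + \<e>"
definition "zeta u = s * (1 - rho u) / w u"
definition "hh u = 4 * H / c * hinv \<e> (zeta u / c)"
definition F :: "real^2 => ambient" where
 "F u = (vector [2 * H * w u * u$1 * d u, 2 * H * w u * u$2 * d u, 2 * H^2 * (w u)^2 * d u - 1], hh u)"
definition X :: "real^2 => ambient" where
 "X u = (vector [2 * H * ((2 * (u$1)^2 + w u) * d u - w u * u$1 * (2 * u$1 * Qd u) * (d u)^2),
   2 * H * (2 * u$1 * u$2 * d u - w u * u$2 * (2 * u$1 * Qd u) * (d u)^2),
   2 * H^2 * (4 * w u * u$1 * d u - (w u)^2 * (2 * u$1 * Qd u) * (d u)^2)], - (4 * s * H * u$1 * d u))"
definition Y :: "real^2 => ambient" where
 "Y u = (vector [2 * H * (2 * u$1 * u$2 * d u - w u * u$1 * (2 * u$2 * Qd u) * (d u)^2),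
   2 * H * ((2 * (u$2)^2 + w u) * d u - w u * u$2 * (2 * u$2 * Qd u) * (d u)^2),
   2 * H^2 * (4 * w u * u$2 * d u - (w u)^2 * (2 * u$2 * Qd u) * (d u)^2)], - (4 * s * H * u$2 * d u))"
definition N :: "real^2 => ambient" where
 "N u = (vector [- (2 * u$1 * (H^2 * (w u)^2 - \<e> * rho u) * d u / w u), - (2 * u$2 * (H^2 * (w u)^2 - \<e> * rho u) * d u / w u),
   4 * \<e> * H * rho u * d u], - zeta u)"
definition "lam u = 4 * H^2 * (w u)^2 * (d u)^2"

lemma ee: "\<e> * \<e> = 1" using eps by auto

lemma c_pos: "c > 0" and c2: "c^2 = 4 * H^2 + \<e>" using disc by (simp_all add: c_def)

lemma rho_nonneg: "rho u \<ge> 0" and w_pos: "w u > 0" by (simp_all add: rho_def w_def add_pos_nonneg)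

lemma zeta_le: "(zeta u)^2 \<le> 1"
proof -
 have "(1 - rho u)^2 \<le> (w u)^2" using rho_nonneg[of u] by (simp add: w_def power2_eq_square algebra_simps)
 moreover have "s^2 = 1" using s by (simp add: power2_eq_square)
 ultimately show ?thesis using w_pos[of u] by (simp add: zeta_def power_mult_distrib power_divide)
qed

text \<open>Reduces positivity of \<open>Q\<close> to \<open>c^2 > \<e> zeta^2\<close>, the
  inequality that also keeps the height in the domain of \<open>hinv\<close>.\<close>

lemma Q_zeta: "4 * Q u = (w u)^2 * (c^2 - \<e> * (zeta u)^2)"
proof -
 have "(zeta u)^2 * (w u)^2 = (1 - rho u)^2"
  using w_pos[of u] s by (simp add: zeta_def power_mult_distrib power_divide power2_eq_square)
 then show ?thesis unfolding Q_def c2 w_def by algebra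
qed

lemma cz: "c^2 - \<e> * z^2 > 0" if "z^2 \<le> 1"
proof (cases "\<e> = 1")
 case True
 have "0 < 4 * H^2" using H by simp
 moreover have "\<e> * z^2 = z^2" using True by simp
 ultimately show ?thesis using that True unfolding c2 by linarith
next
 case False
 then have "\<e> = -1" using eps by auto
 then show ?thesis using disc zero_le_power2[of z] unfolding c2 by (simp add: add_pos_nonneg)
qed

lemma Q_pos: "Q u > 0" and dQ: "d u * Q u = 1" and d_pos: "d u > 0"
proof -
 have "0 < 4 * Q u" unfolding Q_zeta using w_pos[of u] cz[OF zeta_le[of u]] by simp
 then show "Q u > 0" by simp
 then show "d u * Q u = 1" "d u > 0" by (simp_all add: d_def)
qed

lemma hinv_arg: "1 - \<e> * (z / c)^2 > 0" if "z^2 \<le> 1"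
proof -
 have "1 - \<e> * (z / c)^2 = (c^2 - \<e> * z^2) / c^2" using c_pos by (simp add: power_divide diff_divide_distrib)
 then show ?thesis using cz[OF that] c_pos by simp
qed

lemma coord: "((%u::real^2. u$1) has_derivative (%v. v$1 * 1 + v$2 * 0)) (at u)"
 "((%u::real^2. u$2) has_derivative (%v. v$1 * 0 + v$2 * 1)) (at u)"
 using bounded_linear_imp_has_derivative[OF bounded_linear_vec_nth] by simp_all

lemma add_coord:
 fixes f g :: "real^2 => real"
 assumes "(f has_derivative (%v. v$1 * p + v$2 * q)) (at u)" "(g has_derivative (%v. v$1 * p' + v$2 * q')) (at u)"
 shows "((%u. f u + g u) has_derivative (%v. v$1 * (p + p') + v$2 * (q + q'))) (at u)"
 by (rule has_derivative_eq_rhs[OF has_derivative_add[OF assms]]) (simp add: fun_eq_iff algebra_simps)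

lemma coord_eq:
 fixes f :: "real^2 => real"
 assumes "(f has_derivative (%v. v$1 * p + v$2 * q)) (at u)" "p = p'" "q = q'"
 shows "(f has_derivative (%v. v$1 * p' + v$2 * q')) (at u)"
 using assms by simp

lemma D_rho: "(rho has_derivative (%v. v$1 * (2 * u$1) + v$2 * (2 * u$2))) (at u)"
 unfolding rho_def[abs_def] power2_eq_square
 by (rule coord_eq[OF add_coord[OF has_derivative_mult_coord[OF coord(1) coord(1)] has_derivative_mult_coord[OF coord(2) coord(2)]]]) simp_all

lemma D_w: "(w has_derivative (%v. v$1 * (2 * u$1) + v$2 * (2 * u$2))) (at u)"
 unfolding w_def[abs_def] by (rule coord_eq[OF add_coord[OF has_derivative_coord(3) D_rho]]) simp_all

lemma D_Q: "(Q has_derivative (%v. v$1 * (2 * u$1 * Qd u) + v$2 * (2 * u$2 * Qd u))) (at u)"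
 unfolding Q_def[abs_def] power2_eq_square
 by (rule coord_eq[OF add_coord[OF has_derivative_mult_coord[OF has_derivative_coord(3)[of "H * H"] has_derivative_mult_coord[OF D_w D_w]]
    has_derivative_mult_coord[OF has_derivative_coord(3)[of \<e>] D_rho]]]) (simp_all add: Qd_def power2_eq_square algebra_simps)

lemma D_d: "(d has_derivative (%v. v$1 * (- (2 * u$1 * Qd u) * (d u)^2) + v$2 * (- (2 * u$2 * Qd u) * (d u)^2))) (at u)"
 unfolding d_def[abs_def] by (rule has_derivative_inverse_coord[OF D_Q]) (use Q_pos[of u] in simp)

lemma D_zeta: "(zeta has_derivative (%v. v$1 * (- (4 * s * u$1 * (inverse (w u))^2)) + v$2 * (- (4 * s * u$2 * (inverse (w u))^2)))) (at u)"
proof -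
 have z: "zeta = (%u. s * ((1 + - 1 * rho u) * inverse (w u)))" by (simp add: fun_eq_iff zeta_def divide_inverse)
 have w: "w u \<noteq> 0" using w_pos[of u] by simp
 note D = has_derivative_mult_coord[OF has_derivative_coord(3)[of s] has_derivative_mult_coord[OF add_coord[OF has_derivative_coord(3)[of 1]
   has_derivative_mult_coord[OF has_derivative_coord(3)[of "-1"] D_rho]] has_derivative_inverse_coord[OF D_w w]]]
 define i where "i = inverse (w u)"
 have i: "i * (1 + rho u) = 1" unfolding i_def w_def[symmetric] using w by simp
 show ?thesis
  unfolding z by (rule coord_eq[OF D]; unfold i_def[symmetric]; use i in algebra)
qed

lemma D_hh: "(hh has_derivative (%v. v$1 * (- (4 * s * H * u$1 * d u)) + v$2 * (- (4 * s * H * u$2 * d u)))) (at u)"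
proof -
 define K i j where "K = 1 / (1 - \<e> * (zeta u * inverse c)^2)" and "i = inverse (w u)" and "j = inverse c"
 have h: "hh = (%u. (4 * H * inverse c) * hinv \<e> (zeta u * inverse c))" by (simp add: fun_eq_iff hh_def divide_inverse)
 have arg: "1 - \<e> * (zeta u * inverse c)^2 > 0" using hinv_arg[OF zeta_le[of u]] by (simp add: divide_inverse)
 have i: "i * w u = 1" "j * c = 1" using w_pos[of u] c_pos by (simp_all add: i_def j_def)
 have K: "K * (1 - \<e> * (zeta u * j)^2) = 1" using arg by (simp add: K_def j_def)
 have K': "4 * K = c^2 * (w u)^2 * d u"
  using K i(2) Q_zeta[of u] dQ[of u] by algebra
 have k: "4 * H * j * (- (4 * s * r * i^2) * j * K) = - (4 * s * H * r * d u)" for r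
  using K' i by algebra
 have D: "((%u. zeta u * inverse c) has_derivative (%v. v$1 * (- (4 * s * u$1 * i^2) * j) + v$2 * (- (4 * s * u$2 * i^2) * j))) (at u)"
  unfolding i_def j_def by (rule coord_eq[OF has_derivative_mult_coord[OF D_zeta has_derivative_coord(3)]]) simp_all
 have "(hh has_derivative (%v. 4 * H * inverse c * ((v$1 * (- (4 * s * u$1 * i^2) * j) + v$2 * (- (4 * s * u$2 * i^2) * j)) * K))) (at u)"
  unfolding h K_def by (rule has_derivative_mult_right[OF DERIV_compose_FDERIV[OF hinv_deriv[OF eps arg] D]])
 then show ?thesis
 proof (rule has_derivative_eq_rhs, intro ext)
  fix v :: "real^2"
  have "4 * H * inverse c * ((v$1 * (- (4 * s * u$1 * i^2) * j) + v$2 * (- (4 * s * u$2 * i^2) * j)) * K) =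
   v$1 * (4 * H * j * (- (4 * s * u$1 * i^2) * j * K)) + v$2 * (4 * H * j * (- (4 * s * u$2 * i^2) * j * K))"
   unfolding j_def[symmetric] by algebra
  then show "4 * H * inverse c * ((v$1 * (- (4 * s * u$1 * i^2) * j) + v$2 * (- (4 * s * u$2 * i^2) * j)) * K) =
   v$1 * (- (4 * s * H * u$1 * d u)) + v$2 * (- (4 * s * H * u$2 * d u))" unfolding k .
 qed
qed

lemma F_deriv: "(F has_derivative (%v. v$1 *\<^sub>R X u + v$2 *\<^sub>R Y u)) (at u)"
proof -
 have v3: "vector [p, q, r] = p *\<^sub>R axis 1 1 + q *\<^sub>R axis 2 1 + r *\<^sub>R (axis 3 1 :: real^3)" for p q r
  by (simp add: vec_eq_iff forall_3 axis_def)
 note H2 = has_derivative_coord(3)[of "2 * H"]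
 note 1 = has_derivative_mult_coord[OF has_derivative_mult_coord[OF has_derivative_mult_coord[OF H2 D_w] coord(1)] D_d, of u]
 note 2 = has_derivative_mult_coord[OF has_derivative_mult_coord[OF has_derivative_mult_coord[OF H2 D_w] coord(2)] D_d, of u]
 note 3 = add_coord[OF has_derivative_mult_coord[OF has_derivative_mult_coord[OF has_derivative_coord(3)[of "2 * H^2"]
   has_derivative_mult_coord[OF D_w D_w]] D_d] has_derivative_coord(3)[of "-1"], of u]
 have F: "F = (%u. ((2 * H * w u * u$1 * d u) *\<^sub>R axis 1 1 + (2 * H * w u * u$2 * d u) *\<^sub>R axis 2 1 +
   (2 * H^2 * (w u * w u) * d u + - 1) *\<^sub>R axis 3 1, hh u))"
  by (simp add: fun_eq_iff F_def v3 power2_eq_square)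
 show ?thesis unfolding F
  by (rule has_derivative_eq_rhs[OF has_derivative_Pair[OF has_derivative_add[OF has_derivative_add[OF has_derivative_scaleR_left[OF 1]
    has_derivative_scaleR_left[OF 2]] has_derivative_scaleR_left[OF 3]] D_hh]])
   (rule ext, simp add: X_def Y_def vec_eq_iff forall_3 axis_def, intro conjI; algebra)
qed

lemmas F_partials = partials_eqI[OF F_deriv]

lemma smooth_parts: "smooth_on rho UNIV" "smooth_on w UNIV" "smooth_on d UNIV" "smooth_on zeta UNIV" "smooth_on hh UNIV"
 "smooth_on (%u::real^2. u$i) UNIV"
proof -
 have q: "Q u \<noteq> 0" "w u \<noteq> 0" for u using Q_pos[of u] w_pos[of u] by simp_all
 show co: "smooth_on (%u::real^2. u$i) UNIV" for i
  by (rule smooth_on_linear[OF open_UNIV bounded_linear_vec_nth])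
 show r: "smooth_on rho UNIV" unfolding rho_def[abs_def] by (intro smooth_intros open_UNIV co)
 show w: "smooth_on w UNIV" unfolding w_def[abs_def] by (intro smooth_intros open_UNIV r)
 show "smooth_on d UNIV" unfolding d_def[abs_def] using q(1) unfolding Q_def[abs_def]
  by (intro smooth_on_inverse smooth_on_add smooth_on_mult smooth_on_power smooth_on_const open_UNIV r w)
 show z: "smooth_on zeta UNIV" unfolding zeta_def[abs_def] by (intro smooth_intros open_UNIV r w q)
 have "smooth_on (%u. hinv \<e> (zeta u / c)) UNIV"
  by (rule smooth_on_compose_real[OF smooth_on_hinv[OF eps] open_UNIV])
   (use hinv_arg[OF zeta_le] c_pos in \<open>auto intro!: open_Collect_less continuous_intros smooth_on_divide z smooth_on_const\<close>)
 then show "smooth_on hh UNIV" unfolding hh_def[abs_def] by (intro smooth_on_mult smooth_on_const open_UNIV)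
qed

lemma smooth_vector3:
 fixes f g h :: "real^2 => real"
 assumes "smooth_on f UNIV" "smooth_on g UNIV" "smooth_on h UNIV"
 shows "smooth_on (%u. vector [f u, g u, h u] :: real^3) UNIV"
proof -
 have v3: "vector [p, q, r] = p *\<^sub>R axis 1 1 + q *\<^sub>R axis 2 1 + r *\<^sub>R (axis 3 1 :: real^3)" for p q r
  by (simp add: vec_eq_iff forall_3 axis_def)
 show ?thesis unfolding v3 by (intro smooth_on_add smooth_on_scaleR smooth_on_const open_UNIV assms)
qed

text \<open>The height depends on \<open>rho\<close> only, so its gradient is radial and the
  tangential part of the vertical field is a multiple of \<open>x X + y Y\<close>; the fact
  \<open>r\<close> computes this radial derivative.\<close>

lemma conformal_sphere: "conformal_immersion \<e> H F N lam"
proof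
 show "smooth_on F UNIV" unfolding F_def[abs_def]
  by (intro smooth_on_Pair smooth_vector3 smooth_on_mult smooth_on_diff smooth_on_power smooth_on_const smooth_parts open_UNIV)
 have "w u \<noteq> 0" for u using w_pos[of u] by simp
 then show "smooth_on N UNIV" unfolding N_def[abs_def]
  by (intro smooth_on_Pair smooth_vector3 smooth_on_mult smooth_on_diff smooth_on_minus smooth_on_divide smooth_on_power smooth_on_const smooth_parts open_UNIV)
 fix u
 define x y W R D where v: "x = u$1" "y = u$2" "W = w u" "R = rho u" "D = d u"
 have R: "R = x^2 + y^2" and W: "W = 1 + R" and D: "D * (H^2 * W^2 + \<e> * R) = 1"
  using dQ[of u] by (simp_all add: v rho_def w_def Q_def)
 have W0: "W \<noteq> 0" using w_pos[of u] by (simp add: v)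
 note defs = X_def Y_def F_def lam_def Qd_def v[symmetric]
 show "lam u > 0" unfolding lam_def using H w_pos[of u] d_pos[of u] by simp
 show "fst (F u) \<in> M2 \<e>"
 proof -
  have "mform \<e> (fst (F u)) (fst (F u)) = \<e>"
   unfolding mform_def defs fst_conv vector_3 using D ee unfolding W R by algebra
  moreover have "fst (F u) $ 3 > 0" if "\<e> = -1"
  proof -
   have "fst (F u) $ 3 = (H^2 * W^2 - \<e> * R) * D" unfolding defs fst_conv vector_3 using D by algebra
   moreover have "H^2 * W^2 - \<e> * R > 0" using that H W0 rho_nonneg[of u] by (simp add: v add_pos_nonneg)
   ultimately show ?thesis using d_pos[of u] by (simp add: v)
  qed
  ultimately show ?thesis by (simp add: M2_def)
 qed
 show "pform \<e> (dx F u) (dx F u) = lam u" unfolding F_partials pform_def mform_def defs fst_conv snd_conv vector_3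
  using D ee s unfolding W R by algebra
 show "pform \<e> (dy F u) (dy F u) = lam u" unfolding F_partials pform_def mform_def defs fst_conv snd_conv vector_3
  using D ee s unfolding W R by algebra
 show "pform \<e> (dx F u) (dy F u) = 0" unfolding F_partials pform_def mform_def defs fst_conv snd_conv vector_3
  using D ee s unfolding W R by algebra
 show "(lam u * snd (N u)) *\<^sub>R N u = lam u *\<^sub>R (0, 1) - snd (dx F u) *\<^sub>R dx F u - snd (dy F u) *\<^sub>R dy F u"
 proof -
  define i where "i = inverse W"
  have i: "i * (1 + (x^2 + y^2)) = 1" unfolding i_def R[symmetric] W[symmetric] using W0 by simp
  have iW: "i * W = 1" using i R W by simp
  note a = vector_3[where 'a = real]
  have X1: "fst (X u) $ 1 = 2 * H * ((2 * x^2 + W) * D - W * x * (2 * x * Qd u) * D^2)"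
   "fst (X u) $ 2 = 2 * H * (2 * x * y * D - W * y * (2 * x * Qd u) * D^2)"
   "fst (X u) $ 3 = 2 * H^2 * (4 * W * x * D - W^2 * (2 * x * Qd u) * D^2)"
   "fst (Y u) $ 1 = 2 * H * (2 * x * y * D - W * x * (2 * y * Qd u) * D^2)"
   "fst (Y u) $ 2 = 2 * H * ((2 * y^2 + W) * D - W * y * (2 * y * Qd u) * D^2)"
   "fst (Y u) $ 3 = 2 * H^2 * (4 * W * y * D - W^2 * (2 * y * Qd u) * D^2)"
   "snd (X u) = - (4 * s * H * x * D)" "snd (Y u) = - (4 * s * H * y * D)"
   unfolding X_def Y_def v by simp_all
  have q: "Qd u = 2 * H^2 * W + \<e>" by (simp add: Qd_def v)
  have k: "(2 * R + W) * D - 2 * W * R * Qd u * D^2 = (1 - R) * (H^2 * W^2 - \<e> * R) * D^2"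
   "2 * H^2 * (4 * W * R * D - W^2 * (2 * R * Qd u) * D^2) = - (4 * \<e> * H^2 * W * R * (1 - R) * D^2)"
  proof -
   have "(2 * R + W) * (H^2 * W^2 + \<e> * R) - 2 * W * R * (2 * H^2 * W + \<e>) = (1 - R) * (H^2 * W^2 - \<e> * R)"
    unfolding W by algebra
   then show "(2 * R + W) * D - 2 * W * R * Qd u * D^2 = (1 - R) * (H^2 * W^2 - \<e> * R) * D^2"
    unfolding q using D by algebra
   have "4 * W * R * (H^2 * W^2 + \<e> * R) - W^2 * (2 * R * (2 * H^2 * W + \<e>)) = - (2 * \<e> * W * R * (1 - R))"
    unfolding W by algebra
   then show "2 * H^2 * (4 * W * R * D - W^2 * (2 * R * Qd u) * D^2) = - (4 * \<e> * H^2 * W * R * (1 - R) * D^2)"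
    unfolding q using D by algebra
  qed
  have r: "x * fst (X u) $ 1 + y * fst (Y u) $ 1 = 2 * H * x * ((1 - R) * (H^2 * W^2 - \<e> * R) * D^2)"
   "x * fst (X u) $ 2 + y * fst (Y u) $ 2 = 2 * H * y * ((1 - R) * (H^2 * W^2 - \<e> * R) * D^2)"
   "x * fst (X u) $ 3 + y * fst (Y u) $ 3 = - (4 * \<e> * H^2 * W * R * (1 - R) * D^2)"
   unfolding k[symmetric] X1 unfolding R by algebra+
  have Nn: "fst (N u) $ 1 = - (2 * x * (H^2 * W^2 - \<e> * R) * D * i)" "fst (N u) $ 2 = - (2 * y * (H^2 * W^2 - \<e> * R) * D * i)"
   "fst (N u) $ 3 = 4 * \<e> * H * R * D" "snd (N u) = - (s * (1 - R) * i)"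
   unfolding N_def v i_def by (simp_all add: zeta_def divide_inverse)
  have l: "lam u = 4 * H^2 * W^2 * D^2" by (simp add: lam_def v)
  have comp: "lam u * snd (N u) * fst (N u) $ 1 = 4 * s * H * D * (x * fst (X u) $ 1 + y * fst (Y u) $ 1)"
   "lam u * snd (N u) * fst (N u) $ 2 = 4 * s * H * D * (x * fst (X u) $ 2 + y * fst (Y u) $ 2)"
   "lam u * snd (N u) * fst (N u) $ 3 = 4 * s * H * D * (x * fst (X u) $ 3 + y * fst (Y u) $ 3)"
   unfolding r Nn l using iW by algebra+
  have vert: "lam u * snd (N u) * snd (N u) = lam u - snd (X u) * snd (X u) - snd (Y u) * snd (Y u)"
  proof -
   have "lam u * snd (N u) * snd (N u) = 4 * H^2 * (1 - R)^2 * D^2" unfolding Nn l using iW s by algebra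
   also have "(1 - R)^2 = W^2 - 4 * R" unfolding W by algebra
   finally show ?thesis unfolding X1 l R using s by algebra
  qed
  have g: "lam u * snd (N u) * p = - (snd (X u) * p1) - snd (Y u) * p2"
   if "lam u * snd (N u) * p = 4 * s * H * D * (x * p1 + y * p2)" for p p1 p2
   unfolding that X1 by algebra
  show ?thesis
   unfolding F_partials prod_eq_iff vec_eq_iff forall_3
   using g[OF comp(1)] g[OF comp(2)] g[OF comp(3)] vert by simp
 qed
 have XY: "dx F = X" "dy F = Y" using F_partials by auto
 have sm: "smooth_on X UNIV" "smooth_on Y UNIV" using smooth_on_frechet[OF \<open>smooth_on F UNIV\<close>] unfolding XY[symmetric] by auto
 note m = has_derivative_mult_coord[OF has_derivative_coord(3)[of "- (4 * s * H)"] has_derivative_mult_coord[OF coord(1) D_d], of u]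
  has_derivative_mult_coord[OF has_derivative_coord(3)[of "- (4 * s * H)"] has_derivative_mult_coord[OF coord(2) D_d], of u]
 have "snd (dx X u) = - (4 * s * H) * (D + x * (- (2 * x * Qd u) * D^2))"
  by (subst snd_frechet[OF sm(1), where G' = "%v. v$1 * (- (4 * s * H) * (D + x * (- (2 * x * Qd u) * D^2))) + v$2 * (- (4 * s * H) * (x * (- (2 * y * Qd u) * D^2)))"])
   (rule has_derivative_transform[OF UNIV_I _ has_derivative_eq_rhs[OF m(1)]], simp_all add: X_def v axis_def)
 moreover have "snd (dy Y u) = - (4 * s * H) * (D + y * (- (2 * y * Qd u) * D^2))"
  by (subst snd_frechet[OF sm(2), where G' = "%v. v$1 * (- (4 * s * H) * (y * (- (2 * x * Qd u) * D^2))) + v$2 * (- (4 * s * H) * (D + y * (- (2 * y * Qd u) * D^2)))"])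
   (rule has_derivative_transform[OF UNIV_I _ has_derivative_eq_rhs[OF m(2)]], simp_all add: Y_def v axis_def)
 moreover have "2 * H * lam u * snd (N u) = - (8 * s * H^3 * W * (1 - R) * D^2)"
 proof -
  have "2 * H * lam u * snd (N u) = - (2 * H * (4 * H^2 * W^2 * D^2) * (s * (1 - R) / W))" by (simp add: N_def lam_def zeta_def v)
  also have "\<dots> = - (8 * s * H^3 * W * (1 - R) * D^2)" using W0 by (simp add: field_simps power2_eq_square power3_eq_cube)
  finally show ?thesis .
 qed
 moreover have "- (4 * s * H) * (D + x * (- (2 * x * (2 * H^2 * W + \<e>))) * D^2) + - (4 * s * H) * (D + y * (- (2 * y * (2 * H^2 * W + \<e>))) * D^2)
   = - (8 * s * H^3 * W * (1 - R) * D^2)"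
 proof -
  have 1: "- (4 * s * H) * (D + x * (- (2 * x * q)) * D^2) + - (4 * s * H) * (D + y * (- (2 * y * q)) * D^2)
   = - (8 * s * H) * (D - R * q * D^2)" for q unfolding R by algebra
  have "H^2 * W^2 + \<e> * R - R * (2 * H^2 * W + \<e>) = H^2 * W * (1 - R)" unfolding W by algebra
  then have "D - R * (2 * H^2 * W + \<e>) * D^2 = H^2 * W * (1 - R) * D^2" using D by algebra
  then show ?thesis unfolding 1 by (simp add: power2_eq_square power3_eq_cube)
 qed
 ultimately show "snd (dx (dx F) u) + snd (dy (dy F) u) = 2 * H * lam u * snd (N u)"
  unfolding XY by (simp only: Qd_def v[symmetric] mult.assoc)
 have z: "zeta u = 0 \<longleftrightarrow> rho u = 1" for u using w_pos[of u] s by (auto simp: zeta_def)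
 show "closure {u. snd (N u) \<noteq> 0} = UNIV"
 proof (intro set_eqI iffI UNIV_I)
  fix u :: "real^2"
  show "u \<in> closure {u. snd (N u) \<noteq> 0}"
  proof (cases "rho u = 1")
   case True
   \<comment> \<open>\<open>zeta\<close> vanishes only on the unit circle, which is left
     radially.\<close>
   have "\<exists>v\<in>{u. snd (N u) \<noteq> 0}. dist v u < e" if e: "e > 0" for e
   proof (intro bexI[of _ "(1 + e/2) *\<^sub>R u"])
    have "norm u = 1" using True by (simp add: norm_vec_def L2_set_def sum_2 rho_def)
    then have "norm ((e/2) *\<^sub>R u) < e" using e by simp
    then show "dist ((1 + e/2) *\<^sub>R u) u < e" by (simp add: dist_norm scaleR_left_distrib)
    have "rho ((1 + e/2) *\<^sub>R u) = (1 + e/2)^2 * rho u" by (simp add: rho_def power2_eq_square algebra_simps)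
    moreover have "(1 + e/2)^2 > 1" using e by (intro one_less_power) simp_all
    ultimately have "rho ((1 + e/2) *\<^sub>R u) \<noteq> 1" using True by simp
    then show "(1 + e/2) *\<^sub>R u \<in> {u. snd (N u) \<noteq> 0}" using z by (simp add: N_def)
   qed
   then show ?thesis unfolding closure_approachable by (intro allI impI)
  next
   case False
   then have "u \<in> {u. snd (N u) \<noteq> 0}" using z by (simp add: N_def)
   then show ?thesis by (rule subsetD[OF closure_subset])
  qed
 qed
qed (rule eps)

end

section \<open>The immersion as a map on the whole round sphere\<close>

locale round_sphere =
 fixes \<e> H :: real
 assumes eps: "\<e> \<in> {-1, 1}" and H: "H > 0" and disc: "4 * H^2 + \<e> > 0"
begin

abbreviation "SS \<equiv> sphere (0 :: real^3) 1"
definition "cc = sqrt (4 * H^2 + \<e>)"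
text \<open>Inverse stereographic projection from the pole
  \<open>- (s *\<^sub>R axis 3 1)\<close>.\<close>

definition "chart s u = (let r = (u$1)^2 + (u$2)^2 in vector [2 * u$1 / (1 + r), 2 * u$2 / (1 + r), s * (1 - r) / (1 + r)] :: real^3)"
 for u :: "real^2"
definition "unchart s X = (vector [X$1 / (1 + s * X$3), X$2 / (1 + s * X$3)] :: real^2)" for X :: "real^3"
definition "den X = 4 * H^2 + \<e> * ((X$1)^2 + (X$2)^2)" for X :: "real^3"
definition Phi :: "real^3 => ambient" where
 "Phi X = (vector [4 * H * X$1 / den X, 4 * H * X$2 / den X, (4 * H^2 - \<e> * ((X$1)^2 + (X$2)^2)) / den X], 4 * H / cc * hinv \<e> (X$3 / cc))"
definition Nu :: "real^3 => ambient" where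
 "Nu X = (vector [- (X$1 * (4 * H^2 - \<e> * ((X$1)^2 + (X$2)^2)) / den X), - (X$2 * (4 * H^2 - \<e> * ((X$1)^2 + (X$2)^2)) / den X),
   4 * \<e> * H * ((X$1)^2 + (X$2)^2) / den X], - (X$3))"
definition "ball_surface = \<lparr>dom = top_of_set SS, atlas = {(UNIV, chart 1), (UNIV, chart (-1))}, imm = Phi\<rparr>"

lemma sphere_iff: "X \<in> SS \<longleftrightarrow> (X$1)^2 + (X$2)^2 + (X$3)^2 = 1"
 by (simp add: norm_vec_def L2_set_def sum_3)

lemma cc_pos: "cc > 0" using disc by (simp add: cc_def)

lemma den_pos: "X \<in> SS ==> den X > 0" and z_le: "X \<in> SS ==> (X$3)^2 \<le> 1"
proof -
 assume "X \<in> SS"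
 then have r: "(X$1)^2 + (X$2)^2 \<le> 1" "0 \<le> (X$1)^2 + (X$2)^2" and z: "(X$3)^2 \<le> 1"
  using zero_le_power2[of "X$1"] zero_le_power2[of "X$2"] zero_le_power2[of "X$3"] unfolding sphere_iff by linarith+
 show "(X$3)^2 \<le> 1" by (rule z)
 show "den X > 0"
 proof (cases "\<e> = 1")
  case True
  then have e: "\<e> * ((X$1)^2 + (X$2)^2) = (X$1)^2 + (X$2)^2" by simp
  show ?thesis unfolding den_def e using r(2) H by (intro add_pos_nonneg) simp_all
 next
  case False
  then have e: "\<e> = -1" using eps by auto
  then have "\<e> * z = - z" for z by simp
  then show ?thesis using r disc e unfolding den_def by simp
 qed
qed

lemma arg_pos: "X \<in> SS ==> 1 - \<e> * (X$3 / cc)^2 > 0"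
proof -
 assume "X \<in> SS"
 interpret sphere_chart \<e> H 1 by unfold_locales (use eps H disc in simp_all)
 show ?thesis using hinv_arg[OF z_le[OF \<open>X \<in> SS\<close>]] by (simp add: c_def cc_def)
qed

text \<open>Links the global maps with the coordinate expressions of \<open>sphere_chart\<close>:
  with \<open>i = 1 / (1 + r)\<close> the denominators match through
  \<open>den = 4 i^2 Q\<close>.\<close>

lemma chart_props:
 assumes s: "s * s = 1"
 shows "chart s u \<in> SS" "Phi (chart s u) = sphere_chart.F \<e> H s u" "Nu (chart s u) = sphere_chart.N \<e> H s u"
  "unchart s (chart s u) = u" "1 + s * chart s u $ 3 > 0"
proof -
 interpret sphere_chart \<e> H s by unfold_locales (use eps H disc s in simp_all)
 define x y r i where v: "x = u$1" "y = u$2" "r = rho u" "i = inverse (1 + r)"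
 have r: "r = x^2 + y^2" by (simp add: v rho_def)
 have rr: "(u$1)^2 + (u$2)^2 = r" by (simp add: v rho_def)
 have p: "1 + r > 0" using rho_nonneg[of u] by (simp add: v)
 then have i: "i * (1 + r) = 1" "i > 0" by (simp_all add: v)
 have ch: "chart s u $ 1 = 2 * x * i" "chart s u $ 2 = 2 * y * i" "chart s u $ 3 = s * (1 - r) * i"
  unfolding chart_def Let_def rr by (simp_all add: v divide_inverse)
 have h: "(2 * x * i)^2 + (2 * y * i)^2 = 4 * r * i^2" unfolding r by algebra
 show "chart s u \<in> SS" unfolding sphere_iff ch h using i(1) s by algebra
 have w: "w u = 1 + r" by (simp add: w_def v)
 have den: "den (chart s u) = 4 * i^2 * Q u"
  unfolding den_def ch h Q_def w v(3)[symmetric] using i(1) by algebra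
 have d: "d u * Q u = 1" by (rule dQ)
 define q4 :: real where "q4 = 1 / 4"
 have q4: "4 * q4 = 1" by (simp add: q4_def)
 have inv: "inverse (den (chart s u)) = (1 + r)^2 * d u * q4"
 proof (rule inverse_unique)
  show "den (chart s u) * ((1 + r)^2 * d u * q4) = 1" unfolding den using i(1) d q4 by algebra
 qed
 have num: "4 * H^2 - \<e> * (4 * r * i^2) = 4 * i^2 * (H^2 * (1 + r)^2 - \<e> * r)" using i(1) by algebra
 have P3: "(H^2 * (1 + r)^2 - \<e> * r) * d u = 2 * H^2 * (1 + r)^2 * d u - 1"
  using d unfolding Q_def w v(3)[symmetric] by algebra
 have z: "chart s u $ 3 = zeta u" unfolding ch by (simp add: zeta_def w v divide_inverse)
 have e1: "4 * H * (2 * x * i) * ((1 + r)^2 * d u * q4) = 2 * H * (1 + r) * x * d u"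
  "4 * H * (2 * y * i) * ((1 + r)^2 * d u * q4) = 2 * H * (1 + r) * y * d u"
  "4 * i^2 * (H^2 * (1 + r)^2 - \<e> * r) * ((1 + r)^2 * d u * q4) = (H^2 * (1 + r)^2 - \<e> * r) * d u"
  using i(1) q4 by algebra+
 have e2: "2 * x * i * (4 * i^2 * (H^2 * (1 + r)^2 - \<e> * r)) * ((1 + r)^2 * d u * q4) = 2 * x * (H^2 * (1 + r)^2 - \<e> * r) * d u * i"
  "2 * y * i * (4 * i^2 * (H^2 * (1 + r)^2 - \<e> * r)) * ((1 + r)^2 * d u * q4) = 2 * y * (H^2 * (1 + r)^2 - \<e> * r) * d u * i"
  "4 * \<e> * H * (4 * r * i^2) * ((1 + r)^2 * d u * q4) = 4 * \<e> * H * r * d u"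
  using i(1) q4 by algebra+
 show "Phi (chart s u) = F u"
  unfolding Phi_def F_def hh_def z divide_inverse inv ch(1,2) h num e1 P3 w v(1,2)[symmetric] by (simp add: cc_def c_def divide_inverse)
 show "Nu (chart s u) = N u"
  unfolding Nu_def N_def z divide_inverse inv ch(1,2) h num e2 w v(1,2,3)[symmetric] v(4)[symmetric] ..
 have k: "1 + s * chart s u $ 3 = 2 * i" unfolding ch using i(1) s by algebra
 then show "1 + s * chart s u $ 3 > 0" using i(2) by simp
 show "unchart s (chart s u) = u" unfolding unchart_def k ch(1,2) using i(2) by (simp add: vec_eq_iff forall_2 v)
qed

lemma unchart_props:
 assumes s: "s * s = 1" and X: "X \<in> SS" "1 + s * X$3 \<noteq> 0"
 shows "chart s (unchart s X) = X"
proof -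
 define k where "k = 1 + s * X$3"
 have k: "k \<noteq> 0" "X$1 / k * k = X$1" "X$2 / k * k = X$2" using X(2) by (simp_all add: k_def)
 define j where "j = inverse k"
 have j: "j * k = 1" using k by (simp add: j_def)
 have u: "unchart s X $ 1 = X$1 * j" "unchart s X $ 2 = X$2 * j" by (simp_all add: unchart_def j_def k_def divide_inverse)
 have sp: "(X$1)^2 + (X$2)^2 = 1 - (X$3)^2" using X(1) unfolding sphere_iff by simp
 have r: "(X$1 * j)^2 + (X$2 * j)^2 = (1 - (X$3)^2) * j^2" unfolding sp[symmetric] by algebra
 have r': "(1 - (X$3)^2) * j^2 = (1 - s * X$3) * j"
 proof -
  have "1 - (X$3)^2 = (1 - s * X$3) * k" unfolding k_def using s by algebra
  then show ?thesis using j by algebra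
 qed
 have w: "1 + (1 - s * X$3) * j = 2 * j" "1 - (1 - s * X$3) * j = 2 * j * (s * X$3)"
  using j unfolding k_def by algebra+
 have j0: "j \<noteq> 0" using k(1) by (simp add: j_def)
 have "s * (2 * j * (s * X$3)) = X$3 * (2 * j)" using s by algebra
 then show ?thesis
  unfolding chart_def u Let_def r r' w using j0 by (simp add: vec_eq_iff forall_3)
qed

lemma chart_image:
 assumes s: "s * s = 1"
 shows "range (chart s) = {X \<in> SS. 1 + s * X$3 > 0}" "{X \<in> SS. 1 + s * X$3 > 0} = {X \<in> SS. X \<noteq> - (s *\<^sub>R axis 3 1)}"
proof -
 show "range (chart s) = {X \<in> SS. 1 + s * X$3 > 0}"
 proof (intro set_eqI iffI)
  fix X assume "X \<in> range (chart s)"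
  then obtain u where "X = chart s u" by blast
  then show "X \<in> {X \<in> SS. 1 + s * X$3 > 0}" using chart_props(1,5)[OF s, of u] by simp
 next
  fix X assume "X \<in> {X \<in> SS. 1 + s * X$3 > 0}"
  then have "chart s (unchart s X) = X" by (intro unchart_props[OF s]) auto
  then show "X \<in> range (chart s)" by (metis rangeI)
 qed
 have "1 + s * X$3 > 0 \<longleftrightarrow> X \<noteq> - (s *\<^sub>R axis 3 1)" if X: "X \<in> SS" for X
 proof -
  have z: "(X$3)^2 \<le> 1" by (rule z_le[OF X])
  have "(s * X$3)^2 = (s * s) * (X$3)^2" by algebra
  then have "(s * X$3)^2 \<le> 1" using z s by simp
  then have "-1 \<le> s * X$3" by (simp add: abs_square_le_1 abs_le_iff)
  moreover have "s * X$3 = -1 \<longleftrightarrow> X = - (s *\<^sub>R axis 3 1)"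
  proof
   assume h: "s * X$3 = -1"
   then have x3: "X$3 = - s" using s by algebra
   then have "(X$1)^2 + (X$2)^2 = 0" using X s unfolding sphere_iff by (simp add: power2_eq_square)
   then have "X$1 = 0" "X$2 = 0" by (simp_all add: sum_power2_eq_zero_iff)
   then show "X = - (s *\<^sub>R axis 3 1)" using x3 by (simp add: vec_eq_iff forall_3 axis_def)
  qed (use s in \<open>simp add: axis_def\<close>)
  ultimately show ?thesis by linarith
 qed
 then show "{X \<in> SS. 1 + s * X$3 > 0} = {X \<in> SS. X \<noteq> - (s *\<^sub>R axis 3 1)}" by (intro Collect_cong conj_cong refl)
qed

end

context round_sphere
begin

lemma cont_vector:
 "continuous_on S f ==> continuous_on S g ==> continuous_on S (%x. vector [f x, g x] :: real^2)"
 "continuous_on S f ==> continuous_on S g ==> continuous_on S h ==> continuous_on S (%x. vector [f x, g x, h x] :: real^3)"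
 for f g h :: "'a::topological_space => real"
proof -
 have v: "vector [p, q] = p *\<^sub>R axis 1 1 + q *\<^sub>R (axis 2 1 :: real^2)"
  "vector [p, q, r] = p *\<^sub>R axis 1 1 + q *\<^sub>R axis 2 1 + r *\<^sub>R (axis 3 1 :: real^3)" for p q r
  by (simp_all add: vec_eq_iff forall_2 forall_3 axis_def)
 show "continuous_on S f ==> continuous_on S g ==> continuous_on S (%x. vector [f x, g x] :: real^2)"
  "continuous_on S f ==> continuous_on S g ==> continuous_on S h ==> continuous_on S (%x. vector [f x, g x, h x] :: real^3)"
  unfolding v by (intro continuous_intros; assumption)+
qed

lemma one_r: "1 + ((u$1)^2 + (u$2)^2) \<noteq> 0" for u :: "real^2"
 using add_pos_nonneg[of 1 "(u$1)^2 + (u$2)^2"] by simp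

lemma cont_chart: "continuous_on S (chart s)"
 unfolding chart_def Let_def using one_r by (intro cont_vector(2) continuous_intros) simp_all

lemma cont_unchart: "continuous_on {X \<in> SS. 1 + s * X$3 > 0} (unchart s)"
 unfolding unchart_def by (intro cont_vector(1) continuous_intros) auto

lemma chart_homeomorphism:
 assumes s: "s * s = 1"
 shows "openin (top_of_set SS) (range (chart s))"
  "homeomorphic_map (top_of_set UNIV) (subtopology (top_of_set SS) (range (chart s))) (chart s)"
proof -
 have "open {X :: real^3. 0 < 1 + s * X$3}" by (intro open_Collect_less continuous_intros)
 moreover have "range (chart s) = SS \<inter> {X. 0 < 1 + s * X$3}" unfolding chart_image(1)[OF s] by auto
 ultimately show "openin (top_of_set SS) (range (chart s))" by (simp add: openin_open_Int)
 have sub: "subtopology (top_of_set SS) (range (chart s)) = top_of_set (range (chart s))"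
  using chart_image(1)[OF s] by (simp add: subtopology_subtopology) (rule arg_cong[of _ _ top_of_set], auto)
 have "homeomorphic_maps (top_of_set UNIV) (top_of_set (range (chart s))) (chart s) (unchart s)"
  unfolding homeomorphic_maps_def
 proof (intro conjI ballI)
  show "continuous_map (top_of_set UNIV) (top_of_set (range (chart s))) (chart s)"
   by (simp add: continuous_map_in_subtopology cont_chart)
  show "continuous_map (top_of_set (range (chart s))) (top_of_set UNIV) (unchart s)"
   using cont_unchart[of s] unfolding chart_image(1)[OF s] by simp
  show "chart s (unchart s X) = X" if "X \<in> topspace (top_of_set (range (chart s)))" for X
   using that chart_props(4)[OF s] by auto
 qed (simp add: chart_props(4)[OF s])
 then show "homeomorphic_map (top_of_set UNIV) (subtopology (top_of_set SS) (range (chart s))) (chart s)"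
  unfolding sub by (rule homeomorphic_maps_imp_map)
qed

lemma transition:
 assumes s: "s * s = 1" and t: "t * t = 1"
 shows "smooth_on (inv_into UNIV (chart t) \<circ> chart s) {u \<in> UNIV. chart s u \<in> range (chart t)}"
proof -
 define V where "V = {u. 0 < 1 + t * chart s u $ 3}"
 have V: "{u \<in> UNIV. chart s u \<in> range (chart t)} = V"
  unfolding chart_image(1)[OF t] V_def using chart_props(1)[OF s] by auto
 have oV: "open V" unfolding V_def by (intro open_Collect_less continuous_intros cont_chart)
 have eq: "unchart t (chart s u) = (inv_into UNIV (chart t) \<circ> chart s) u" if "u \<in> V" for u
 proof -
  have "chart t (unchart t (chart s u)) = chart s u"
   using that by (intro unchart_props[OF t] chart_props(1)[OF s]) (simp add: V_def)
  moreover have "inj (chart t)" using chart_props(4)[OF t] by (rule inj_on_inverseI)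
  ultimately show ?thesis by (metis comp_apply inv_f_f)
 qed
 have co: "smooth_on (%u::real^2. u$i) V" for i by (rule smooth_on_linear[OF oV bounded_linear_vec_nth])
 have n: "1 + ((u$1)^2 + (u$2)^2) \<noteq> 0" "u \<in> V ==> 1 + t * (s * (1 - ((u$1)^2 + (u$2)^2)) / (1 + ((u$1)^2 + (u$2)^2))) \<noteq> 0" for u :: "real^2"
  using one_r[of u] by (simp_all add: V_def chart_def Let_def)
 have v: "vector [p, q] = p *\<^sub>R axis 1 1 + q *\<^sub>R (axis 2 1 :: real^2)" for p q
  by (simp add: vec_eq_iff forall_2 axis_def)
 have "smooth_on (%u. unchart t (chart s u)) V"
  unfolding unchart_def chart_def Let_def vector_3 v
  by (intro smooth_on_add smooth_on_scaleR smooth_on_divide smooth_on_mult smooth_on_diff smooth_on_power smooth_on_const co oV n)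
 from smooth_on_cong[OF oV eq this] show ?thesis unfolding V .
qed

lemma chart_cases:
 assumes X: "X \<in> SS"
 obtains s u where "s * s = 1" "s = 1 \<or> s = -1" "X = chart s u"
proof (cases "1 + 1 * X$3 > 0")
 case True
 then have "chart 1 (unchart 1 X) = X" using unchart_props[of 1 X] X by simp
 then show ?thesis using that[of 1 "unchart 1 X"] by simp
next
 case False
 then have "chart (-1) (unchart (-1) X) = X" using unchart_props[of "-1" X] X by simp
 then show ?thesis using that[of "-1" "unchart (-1) X"] by simp
qed

lemma den_cont: "continuous_on SS den" and den_nz: "\<forall>X\<in>SS. den X \<noteq> 0"
proof -
 show "continuous_on SS den" unfolding den_def[abs_def] by (intro continuous_intros)
 show "\<forall>X\<in>SS. den X \<noteq> 0" using den_pos by fastforce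
qed

lemma Nu_cont: "continuous_on SS Nu"
 unfolding Nu_def[abs_def] using den_nz
 by (intro continuous_on_Pair cont_vector(2) continuous_on_minus continuous_on_divide continuous_on_mult continuous_on_diff
   continuous_on_add continuous_on_power continuous_on_const den_cont continuous_on_component continuous_on_id)

lemma atlas_ball: "(V, \<phi>) \<in> atlas ball_surface ==> \<exists>s. s * s = 1 & V = UNIV & \<phi> = chart s"
proof -
 assume "(V, \<phi>) \<in> atlas ball_surface"
 then have "V = UNIV" "\<phi> = chart 1 \<or> \<phi> = chart (-1)" by (auto simp: ball_surface_def)
 then show ?thesis by (elim disjE) (intro exI[of _ 1] exI[of _ "-1"], simp)+
qed

lemma dom_ball: "dom ball_surface = top_of_set SS" "imm ball_surface = Phi" "atlas ball_surface = {(UNIV, chart 1), (UNIV, chart (-1))}"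
 by (simp_all add: ball_surface_def)

lemma ball_manifold: "smooth_2_manifold (top_of_set SS) {(UNIV, chart 1), (UNIV, chart (-1))}"
 unfolding smooth_2_manifold_def
proof (intro conjI)
 have m: "(-1) * (-1) = (1::real)" "1 * 1 = (1::real)" by simp_all
 show "Hausdorff_space (top_of_set SS)" by (simp add: Hausdorff_space_subtopology)
 show "second_countable_space (top_of_set SS)" by (rule second_countable_top_of_set)
 show "\<forall>(V, \<phi>)\<in>{(UNIV, chart 1), (UNIV, chart (-1))}. open V & openin (top_of_set SS) (\<phi> ` V) &
   homeomorphic_map (top_of_set V) (subtopology (top_of_set SS) (\<phi> ` V)) \<phi>"
  unfolding ball_simps split_conv using chart_homeomorphism[OF m(1)] chart_homeomorphism[OF m(2)] by (intro conjI TrueI open_UNIV)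
 have "X \<in> range (chart 1) \<union> range (chart (-1))" if "X \<in> SS" for X
  by (rule chart_cases[OF that]) (elim disjE, simp_all)
 moreover have "range (chart 1) \<subseteq> SS" by (intro image_subsetI) (rule chart_props(1)[OF m(2)])
 moreover have "range (chart (-1)) \<subseteq> SS" by (intro image_subsetI) (rule chart_props(1)[OF m(1)])
 moreover have "(\<Union>(V, \<phi>)\<in>{(UNIV, chart 1), (UNIV, chart (-1))}. \<phi> ` V) = range (chart 1) \<union> range (chart (-1))" by simp
 ultimately show "(\<Union>(V, \<phi>)\<in>{(UNIV, chart 1), (UNIV, chart (-1))}. \<phi> ` V) = topspace (top_of_set SS)"
  unfolding topspace_euclidean_subtopology by (intro equalityI subsetI) (simp_all only:, erule UnE, erule (1) subsetD, erule (1) subsetD)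
 show "\<forall>(V, \<phi>)\<in>{(UNIV, chart 1), (UNIV, chart (-1))}. \<forall>(W, \<psi>)\<in>{(UNIV, chart 1), (UNIV, chart (-1))}.
   smooth_on (inv_into W \<psi> \<circ> \<phi>) {u \<in> V. \<phi> u \<in> \<psi> ` W}"
  unfolding ball_simps split_conv using transition[OF m(1) m(1)] transition[OF m(1) m(2)] transition[OF m(2) m(1)] transition[OF m(2) m(2)]
  by (intro conjI TrueI)
qed

lemma Phi_M2: "X \<in> SS ==> Phi X \<in> M2 \<e> \<times> UNIV"
proof (erule chart_cases)
 fix s u assume s: "s * s = 1" and X: "X = chart s u"
 interpret sphere_chart \<e> H s by unfold_locales (use eps H disc s in simp_all)
 interpret conformal_immersion \<e> H F N lam by (rule conformal_sphere)
 show ?thesis using in_M2[of u] unfolding X chart_props(2)[OF s] by (simp add: mem_Times_iff)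
qed

lemma ball_conformal: "conformal_surface \<e> H ball_surface"
 unfolding conformal_surface_def
proof (intro conjI)
 show "smooth_2_manifold (dom ball_surface) (atlas ball_surface)" unfolding dom_ball by (rule ball_manifold)
 have "connected SS" by (rule connected_sphere) simp
 then show "connected_space (dom ball_surface)" unfolding dom_ball by (simp add: connected_space_subtopology)
 show "topspace (dom ball_surface) \<noteq> {}" unfolding dom_ball by simp
 show "imm ball_surface ` topspace (dom ball_surface) \<subseteq> M2 \<e> \<times> UNIV"
  unfolding dom_ball topspace_euclidean_subtopology using Phi_M2 by (rule image_subsetI)
 have ex: "\<exists>F N lam. conformal_immersion \<e> H F N lam & (\<forall>u\<in>V. imm ball_surface (\<phi> u) = F u & Nu (\<phi> u) = N u)"
  if V: "(V, \<phi>) \<in> atlas ball_surface" for V \<phi>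
 proof -
  obtain s where s: "s * s = 1 & V = UNIV & \<phi> = chart s" using atlas_ball[OF V] by (rule exE)
  have s1: "s * s = 1" and p: "\<phi> = chart s" using s by simp_all
  interpret sphere_chart \<e> H s by unfold_locales (use eps H disc s1 in simp_all)
  show ?thesis using conformal_sphere chart_props(2,3)[OF s1] unfolding dom_ball p
   by (rule_tac exI[of _ F], rule_tac exI[of _ N], rule_tac exI[of _ lam]) simp
 qed
 show "\<exists>NN. continuous_map (dom ball_surface) euclidean NN & (\<forall>V \<phi>. (V, \<phi>) \<in> atlas ball_surface -->
    (\<exists>F N lam. conformal_immersion \<e> H F N lam & (\<forall>u\<in>V. imm ball_surface (\<phi> u) = F u & NN (\<phi> u) = N u)))"
 proof (intro exI[of _ Nu] conjI allI impI)
  show "continuous_map (dom ball_surface) euclidean Nu" unfolding dom_ball using Nu_cont by simp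
 qed (rule ex)
qed

text \<open>The height determines the third coordinate, this fixes the denominator, and then the
  other two coordinates can be read off.\<close>

lemma Phi_inj: "inj_on Phi SS"
proof (rule inj_onI)
 fix X Y assume X: "X \<in> SS" and Y: "Y \<in> SS" and eq: "Phi X = Phi Y"
 have "hinv \<e> (X$3 / cc) = hinv \<e> (Y$3 / cc)" using eq H cc_pos by (simp add: Phi_def)
 then have "X$3 / cc = Y$3 / cc" by (rule hinv_inj[OF eps arg_pos[OF X] arg_pos[OF Y]])
 then have z: "X$3 = Y$3" using cc_pos by simp
 then have "(X$1)^2 + (X$2)^2 = (Y$1)^2 + (Y$2)^2" using X Y unfolding sphere_iff by simp
 then have d: "den X = den Y" unfolding den_def by simp
 have "fst (Phi X) $ 1 = fst (Phi Y) $ 1" "fst (Phi X) $ 2 = fst (Phi Y) $ 2" using eq by simp_all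
 then have "X$1 = Y$1" "X$2 = Y$2" using den_pos[OF Y] H by (simp_all add: Phi_def d)
 then show "X = Y" using z by (simp add: vec_eq_iff forall_3)
qed

lemma Phi_cont: "continuous_on SS Phi"
proof -
 have "continuous_on {z. 1 - \<e> * z^2 > 0} (hinv \<e>)" by (rule smooth_on_continuous[OF smooth_on_hinv[OF eps]])
 moreover have "continuous_on SS (%X. X$3 / cc)" by (intro continuous_on_divide continuous_on_component continuous_on_id continuous_on_const) (use cc_pos in simp)
 ultimately have h: "continuous_on SS (%X. hinv \<e> (X$3 / cc))" by (rule continuous_on_compose2) (use arg_pos in \<open>intro image_subsetI, simp\<close>)
 show ?thesis unfolding Phi_def[abs_def] using den_nz
  by (intro continuous_on_Pair cont_vector(2) continuous_on_divide continuous_on_mult continuous_on_diff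
   continuous_on_add continuous_on_power continuous_on_const den_cont continuous_on_component continuous_on_id h)
qed

text \<open>Invariance under the identity is recorded because at the sphere the cyclic group may be
  trivial, generated by the translation of length 0.\<close>

lemma sphere_surface:
 shows "\<exists>S :: (real^3) surface. cmc_surface \<e> H S & complete_surface \<e> S & is_cmc_sphere \<e> H S & embedded S &
  horizontally_symmetric S & invariant_under S (%a. a) & is_max_height S (4 * H / cc * hinv \<e> (1 / cc))"
proof -
 have top: "topspace (dom ball_surface) = SS" by (simp add: ball_surface_def)
 have ax: "axis 1 1 \<in> SS" "axis 2 1 \<in> SS" "axis 1 1 \<noteq> (axis 2 1 :: real^3)" by (simp_all add: norm_axis_1 axis_eq_axis)
 obtain \<beta> :: "real^3 => real^3" where "bij_betw \<beta> UNIV SS"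
  by (rule transport_bijection[OF _ ax]) (simp add: connected_sphere)
 then interpret st: surface_transport \<beta> ball_surface by unfold_locales (simp add: top)
 let ?S = "transport \<beta> ball_surface"
 have c: "cmc_surface \<e> H ?S" by (rule st.conformal_transport[OF ball_conformal])
 have "complete_surface \<e> ?S"
 proof (rule st.complete_transport[OF tame_proper])
  show "immersed_surface \<e> ball_surface" using conformal_surface_cmc[OF ball_conformal] by (simp add: cmc_surface_def)
  show "inj_on (imm ball_surface) (topspace (dom ball_surface))" using Phi_inj by (simp add: ball_surface_def)
  show "seq_compactin (dom ball_surface) {y \<in> topspace (dom ball_surface). norm (imm ball_surface y) \<le> R}" for R
  proof -
   have "closedin (top_of_set SS) {y \<in> SS. norm (Phi y) \<le> R}"
    using continuous_closedin_preimage[OF continuous_on_norm[OF Phi_cont] closed_atMost[of R]] by (simp add: vimage_def Int_def)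
   then have "compact {y \<in> SS. norm (Phi y) \<le> R}" by (rule closedin_compact[OF compact_sphere])
   then show ?thesis unfolding dom_ball topspace_euclidean_subtopology by (rule seq_compactin_top_of_set) (rule Collect_restrict)
  qed
  show "immersed_surface \<e> ?S" using c by (simp add: cmc_surface_def)
 qed (rule eps)
 moreover have "embedded ball_surface"
  unfolding embedded_def embedding_map_def ball_surface_def surface.simps topspace_euclidean_subtopology
  by (rule continuous_imp_homeomorphic_map)
   (use Phi_cont Phi_inj in \<open>auto simp: compact_space_subtopology Hausdorff_space_subtopology continuous_map_in_subtopology compactin_euclidean_iff\<close>)
 then have "embedded ?S" by (rule st.embedded_transport)
 moreover have inv: "invariant_under ?S g"
  if f: "continuous_on SS f" "continuous_on SS f'" "\<And>X. X \<in> SS ==> f X \<in> SS" "\<And>X. X \<in> SS ==> f' X \<in> SS"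
   "\<And>X. X \<in> SS ==> f (f' X) = X" "\<And>X. X \<in> SS ==> f' (f X) = X" "\<And>X. X \<in> SS ==> g (Phi X) = Phi (f X)" for f f' g
 proof (rule st.invariant_transport)
  have "homeomorphic_maps (top_of_set SS) (top_of_set SS) f f'"
   unfolding homeomorphic_maps_def using f(1-6) by (auto simp: continuous_map_in_subtopology)
  then have "homeomorphic_map (top_of_set SS) (top_of_set SS) f" by (rule homeomorphic_maps_imp_map)
  then show "invariant_under ball_surface g"
   unfolding invariant_under_def using f(7) by (intro exI[of _ f]) (simp add: ball_surface_def)
 qed
 have fl: "horizontally_symmetric ?S"
  unfolding horizontally_symmetric_def
 proof (rule inv)
  show "continuous_on SS (%X. vector [X$1, X$2, - X$3] :: real^3)" by (intro cont_vector(2) continuous_intros)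
  then show "continuous_on SS (%X. vector [X$1, X$2, - X$3] :: real^3)" .
  show "flip_height (Phi X) = Phi (vector [X$1, X$2, - X$3])" if "X \<in> SS" for X
  proof -
   have "hinv \<e> (- (X$3 / cc)) = - hinv \<e> (X$3 / cc)"
    using arg_pos[OF that] abs_square_less_1[of "X$3 / cc"] by (cases "\<e> = 1") (auto simp: hinv_def arctan_minus)
   then show ?thesis by (simp add: Phi_def flip_height_def den_def)
  qed
 qed (simp_all only: sphere_iff vec_eq_iff forall_3 vector_3 power2_minus minus_minus simp_thms)
 have rot: "invariant_under ?S (horizontal (rotation \<e> (axis 3 1) (axis 1 1) (axis 2 1) \<theta>))" for \<theta>
 proof (rule inv)
  define R where "R \<theta> X = (vector [X$1 * cos \<theta> - X$2 * sin \<theta>, X$1 * sin \<theta> + X$2 * cos \<theta>, X$3] :: real^3)" for \<theta> and X :: "real^3"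
  have sq: "(x * cos \<theta> - y * sin \<theta>)^2 + (x * sin \<theta> + y * cos \<theta>)^2 = x^2 + y^2" for x y \<theta> :: real
   using sin_cos_squared_add[of \<theta>] by algebra
  show "continuous_on SS (R \<theta>)" "continuous_on SS (R (- \<theta>))"
   unfolding R_def by (intro cont_vector(2) continuous_intros)+
  show "R \<theta> X \<in> SS" "R (- \<theta>) X \<in> SS" if "X \<in> SS" for X
   using that sq[of "X$1" \<theta> "X$2"] sq[of "X$1" "- \<theta>" "X$2"] unfolding sphere_iff R_def by simp_all
  have "(x * cos \<theta> - y * sin \<theta>) * cos \<theta> + (x * sin \<theta> + y * cos \<theta>) * sin \<theta> = x"
   "(x * sin \<theta> + y * cos \<theta>) * cos \<theta> - (x * cos \<theta> - y * sin \<theta>) * sin \<theta> = y" for x y \<theta> :: real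
   using sin_cos_squared_add[of \<theta>] by algebra+
  note cs = this this[of _ "- \<theta>"]
  show "R \<theta> (R (- \<theta>) X) = X" "R (- \<theta>) (R \<theta> X) = X" for X
   using cs(1)[of "X$1" \<theta> "X$2"] cs(2)[of "X$1" \<theta> "X$2"] cs(3)[of "X$1" "X$2"] cs(4)[of "X$1" "X$2"] unfolding R_def by (simp_all add: vec_eq_iff forall_3)
  show "horizontal (rotation \<e> (axis 3 1) (axis 1 1) (axis 2 1) \<theta>) (Phi X) = Phi (R \<theta> X)" for X
  proof -
   have ee: "\<e> * (\<e> * z) = z" for z using eps by auto
   have r: "rotation \<e> (axis 3 1) (axis 1 1) (axis 2 1) \<theta> x = R \<theta> x" for x
    by (simp add: rotation_def mform_def axis_def R_def vec_eq_iff forall_3 ee mult_ac)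
   have "den (R \<theta> X) = den X" "(R \<theta> X $ 1)^2 + (R \<theta> X $ 2)^2 = (X$1)^2 + (X$2)^2" unfolding den_def using sq[of "X$1" \<theta> "X$2"] by (simp_all add: R_def)
   then show ?thesis
    unfolding horizontal_def r Phi_def by (simp add: R_def vec_eq_iff forall_3 add_divide_distrib diff_divide_distrib algebra_simps)
  qed
 qed
 moreover have "invariant_under ?S (%a. a)" by (rule inv[of "%X. X" "%X. X"]) auto
 moreover have "is_max_height ?S (4 * H / cc * hinv \<e> (1 / cc))"
 proof -
  have im: "image_of ?S = Phi ` SS" unfolding st.image_of_transport by (simp add: image_of_def ball_surface_def)
  have a3: "axis 3 1 \<in> SS" by (simp add: norm_axis_1)
  have "4 * H / cc * hinv \<e> (X$3 / cc) \<le> 4 * H / cc * hinv \<e> (1 / cc)" if X: "X \<in> SS" for X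
  proof (rule mult_left_mono)
   have "X$3 \<le> 1" using z_le[OF X] by (simp add: abs_square_le_1)
   then have "X$3 = 1 \<or> X$3 / cc < 1 / cc" using cc_pos by (cases "X$3 = 1") (simp_all add: divide_less_cancel)
   moreover have "1 - \<e> * (1 / cc)^2 > 0" using arg_pos[OF a3] by (simp add: axis_def)
   ultimately show "hinv \<e> (X$3 / cc) \<le> hinv \<e> (1 / cc)" using hinv_strict_mono[OF eps arg_pos[OF X], of "1 / cc"] by (elim disjE) simp_all
  qed (use H cc_pos in simp)
  moreover have "snd (Phi (axis 3 1)) = 4 * H / cc * hinv \<e> (1 / cc)" by (simp add: Phi_def axis_def)
  ultimately show ?thesis unfolding is_max_height_def im image_image
   by (intro conjI rev_image_eqI[OF a3] ballI) (simp, elim imageE, simp add: Phi_def)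
 qed
 moreover have "is_cmc_sphere \<e> H ?S"
  unfolding is_cmc_sphere_def
  by (intro conjI c fl exI[of _ "axis 3 1"] exI[of _ "axis 1 1"] exI[of _ "axis 2 1"] frame_axes[OF eps] allI rot)
   (rule st.homeomorphic_space_transport[unfolded dom_ball])
 ultimately show ?thesis using c fl by (intro exI[of _ ?S] conjI)
qed

end

section \<open>The family\<close>

context delaunay
begin

lemma sigma_eq_tau:
 assumes t: "\<tau> * (c + 2 * H) = 1"
 shows "\<sigma> = \<tau>"
proof -
 have "\<tau> * (c - \<e> * \<tau>) = 1 - c * \<tau>" using t c2 by algebra
 then have "\<sigma> * (c - \<e> * \<tau>) = \<tau> * (c - \<e> * \<tau>)" using sigma_eq by simp
 then show ?thesis using den_pos by simp
qed

lemma delaunay_surface: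
 "\<exists>S :: (real^3) surface. cmc_surface \<e> H S & complete_surface \<e> S & image_of S = range FF &
  (\<forall>g. covers g --> invariant_under S g) & (\<e> = -1 --> embedded S) & (\<sigma> = \<tau> --> is_horizontal_cylinder \<e> H S)"
proof (cases "\<e> = -1")
 case True
 from model_hyp[OF this] obtain S :: "(real^3) surface" where
  "cmc_surface \<e> H S & complete_surface \<e> S & image_of S = range FF &
  (\<forall>g. covers g --> invariant_under S g) & embedded S &
  (\<forall>\<Omega>. upper_half_graph_over (psurf FF id Py) \<Omega> --> upper_half_graph_over S \<Omega>) &
  (orthogonal_to_slice \<e> (psurf FF id Py) --> orthogonal_to_slice \<e> S)" by (rule exE)
 then have S: "cmc_surface \<e> H S" "complete_surface \<e> S" "image_of S = range FF" "\<forall>g. covers g --> invariant_under S g" "embedded S"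
  "\<forall>\<Omega>. upper_half_graph_over (psurf FF id Py) \<Omega> --> upper_half_graph_over S \<Omega>"
  "orthogonal_to_slice \<e> (psurf FF id Py) --> orthogonal_to_slice \<e> S" by - (elim conjE, assumption)+
 have "is_horizontal_cylinder \<e> H S" if "\<sigma> = \<tau>"
  by (rule horizontal_cylinderI[OF that S(1,2) S(4)[THEN spec, THEN mp] S(6)[THEN spec, THEN mp] S(7)[THEN mp]])
 then show ?thesis using S(1-5) by (intro exI[of _ S] conjI impI)
next
 case False
 then have e: "\<e> = 1" using eps by simp
 show ?thesis
 proof (cases "\<sigma> = \<tau>")
  case True
  from model_cyl[OF this e] obtain S :: "(real^3) surface" where
   "cmc_surface \<e> H S & complete_surface \<e> S & image_of S = range FF &
   (\<forall>g. covers g --> invariant_under S g) & embedded S &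
   (\<forall>\<Omega>. upper_half_graph_over (psurf FF id (min (pi / sgm) Py)) \<Omega> --> upper_half_graph_over S \<Omega>) &
   (orthogonal_to_slice \<e> (psurf FF id (min (pi / sgm) Py)) --> orthogonal_to_slice \<e> S)" by (rule exE)
  then have S: "cmc_surface \<e> H S" "complete_surface \<e> S" "image_of S = range FF" "\<forall>g. covers g --> invariant_under S g" "embedded S"
   "\<forall>\<Omega>. upper_half_graph_over (psurf FF id (min (pi / sgm) Py)) \<Omega> --> upper_half_graph_over S \<Omega>"
   "orthogonal_to_slice \<e> (psurf FF id (min (pi / sgm) Py)) --> orthogonal_to_slice \<e> S" by - (elim conjE, assumption)+
  have "is_horizontal_cylinder \<e> H S"
   by (rule horizontal_cylinderI[OF True S(1,2) S(4)[THEN spec, THEN mp] S(6)[THEN spec, THEN mp] S(7)[THEN mp]])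
  then show ?thesis using S(1-5) by (intro exI[of _ S] conjI impI)
 next
  case no: False
  from model_sph[OF e] obtain S :: "(real^3) surface" where
   "cmc_surface \<e> H S & complete_surface \<e> S & image_of S = range FF & (\<forall>g. covers g --> invariant_under S g)" by (rule exE)
  then have S: "cmc_surface \<e> H S" "complete_surface \<e> S" "image_of S = range FF" "\<forall>g. covers g --> invariant_under S g"
   by - (elim conjE, assumption)+
  show ?thesis using S by (intro exI[of _ S] conjI impI) (use no False in simp_all)
 qed
qed

text \<open>For \<open>\<e> = 1\<close> the generator is the half turn, for \<open>\<e> = -1\<close>
  the translation by the length \<open>II Px\<close> of a period.\<close>

lemma delaunay_cyclic:
 fixes S :: "'a surface"
 assumes S: "\<And>g. covers g ==> invariant_under S g"
 shows "\<exists>p v n t. frame \<e> p v n & cyclic_invariant \<e> S p v n t & acts_nontrivially \<e> (along \<e> p v n t)"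
proof (cases "\<e> = 1")
 case True
 have "cyclic_invariant 1 S (axis 2 1) (axis 1 1) (axis 3 1) pi"
  unfolding cyclic_invariant_def by (intro allI S covers_half_turn[OF True])
 then show ?thesis unfolding True using frame_axes_1 along_nontrivial_sph by (intro exI conjI)
next
 case False
 then have e: "\<e> = -1" using eps by simp
 have "II Px \<noteq> 0" using strict_monoD[OF II_mono Px_pos] II(1) by simp
 then have "acts_nontrivially \<e> (along \<e> (axis 3 1) (axis 1 1) (axis 2 1) (II Px))"
  using along_nontrivial_hyp by (simp only: e simp_thms)
 moreover have "cyclic_invariant \<e> S (axis 3 1) (axis 1 1) (axis 2 1) (II Px)"
  unfolding cyclic_invariant_def by (intro allI S covers_translate)
 ultimately show ?thesis using frame_axes[OF eps] by (intro exI conjI)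
qed

end

text \<open>\<open>t\<close> is the maximum over the surface of the conformal parameter \<open>\<tau>\<close>.\<close>

definition family_member :: "real => real => real => (real^3) surface => bool" where
 "family_member \<e> H t S \<longleftrightarrow>
   cmc_surface \<e> H S & complete_surface \<e> S & horizontally_symmetric S &
   (\<exists>p v n s. frame \<e> p v n & cyclic_invariant \<e> S p v n s &
    (t < 1 / sqrt (4 * H^2 + \<e>) --> acts_nontrivially \<e> (along \<e> p v n s))) &
   (t = 1 / (sqrt (4 * H^2 + \<e>) + 2 * H) --> is_horizontal_cylinder \<e> H S) &
   (t = 1 / sqrt (4 * H^2 + \<e>) --> is_cmc_sphere \<e> H S) &
   (\<e> = -1 --> embedded S) &
   (\<e> = 1 & t < 1 / sqrt (4 * H^2 + \<e>) & (\<exists>x. delaunay.II 1 H t x = pi & delaunay.ts 1 H t x \<noteq> 0) -->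
    (\<forall>T :: (real^3) surface. immersed_surface \<e> T & image_of T = image_of S --> \<not> embedded T)) &
   is_max_height S (4 * H / sqrt (4 * H^2 + \<e>) * hinv \<e> t)"

lemma family_member_delaunay:
 assumes "delaunay \<e> H t"
 shows "\<exists>S. family_member \<e> H t S"
proof -
 interpret delaunay \<e> H t by (rule assms)
 from delaunay_surface obtain S :: "(real^3) surface" where
  "cmc_surface \<e> H S & complete_surface \<e> S & image_of S = range FF &
  (\<forall>g. covers g --> invariant_under S g) & (\<e> = -1 --> embedded S) & (\<sigma> = t --> is_horizontal_cylinder \<e> H S)" by (rule exE)
 then have S: "cmc_surface \<e> H S" "complete_surface \<e> S" "image_of S = range FF" "\<forall>g. covers g --> invariant_under S g"
  "\<e> = -1 --> embedded S" "\<sigma> = t --> is_horizontal_cylinder \<e> H S" by - (elim conjE, assumption)+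
 have cv: "covers g ==> invariant_under S g" for g by (rule S(4)[THEN spec, THEN mp])
 have sc: "sqrt (4 * H^2 + \<e>) = c" by (simp add: c_def)
 have cyl: "is_horizontal_cylinder \<e> H S" if "t = 1 / (c + 2 * H)"
 proof -
  have "c + 2 * H > 0" using c_pos H by simp
  then have "t * (c + 2 * H) = 1" unfolding that by simp
  then show ?thesis using S(6) sigma_eq_tau by simp
 qed
 have tc: "t < 1 / c" using tau(2) by (simp add: c_def)
 have cy: "\<exists>p v n s. frame \<e> p v n & cyclic_invariant \<e> S p v n s &
    (t < 1 / c --> acts_nontrivially \<e> (along \<e> p v n s))"
 proof -
  have "\<exists>p v n s. frame \<e> p v n & cyclic_invariant \<e> S p v n s & acts_nontrivially \<e> (along \<e> p v n s)"
   by (rule delaunay_cyclic) (rule cv)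
  then obtain p v n s where "frame \<e> p v n & cyclic_invariant \<e> S p v n s & acts_nontrivially \<e> (along \<e> p v n s)"
   by (elim exE)
  then show ?thesis by (intro exI[of _ p] exI[of _ v] exI[of _ n] exI[of _ s]) simp
 qed
 have ne: "\<not> embedded T" if e: "\<e> = 1" and x: "delaunay.II 1 H t x = pi" "delaunay.ts 1 H t x \<noteq> 0"
  and T: "immersed_surface \<e> T" "image_of T = image_of S" for T :: "(real^3) surface" and x
  by (rule not_embedded[OF e _ _ T(1) T(2)[unfolded S(3)]]) (use x e in simp_all)
 have mx: "is_max_height S (4 * H / c * hinv \<e> t)" using max_height[OF S(3)] by (simp only: \<eta>_def)
 show ?thesis
  unfolding family_member_def sc
 proof (intro exI[of _ S] conjI S(1,2,5) impI allI cyl cy mx)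
  show "horizontally_symmetric S" unfolding horizontally_symmetric_def by (rule cv[OF covers_flip])
  show "t = 1 / c ==> is_cmc_sphere \<e> H S" using tc by simp
 next
  fix T :: "(real^3) surface"
  assume "\<e> = 1 & t < 1 / c & (\<exists>x. delaunay.II 1 H t x = pi & delaunay.ts 1 H t x \<noteq> 0)"
   "immersed_surface \<e> T & image_of T = image_of S"
  then show "\<not> embedded T" by (elim conjE exE) (rule ne)
 qed
qed

lemma family_member_sphere:
 assumes eps: "\<e> \<in> {-1, 1}" and H: "H > 0" and disc: "4 * H^2 + \<e> > 0"
 shows "\<exists>S. family_member \<e> H (1 / sqrt (4 * H^2 + \<e>)) S"
proof -
 interpret round_sphere \<e> H by unfold_locales (use assms in simp_all)
 from sphere_surface obtain S :: "(real^3) surface" where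
  "cmc_surface \<e> H S & complete_surface \<e> S & is_cmc_sphere \<e> H S & embedded S &
  horizontally_symmetric S & invariant_under S (%a. a) & is_max_height S (4 * H / cc * hinv \<e> (1 / cc))" by (rule exE)
 then have S: "cmc_surface \<e> H S" "complete_surface \<e> S" "is_cmc_sphere \<e> H S" "embedded S"
  "horizontally_symmetric S" "invariant_under S (%a. a)" "is_max_height S (4 * H / cc * hinv \<e> (1 / cc))" by - (elim conjE, assumption)+
 have sc: "sqrt (4 * H^2 + \<e>) = cc" by (simp add: cc_def)
 have ee: "\<e> * (\<e> * z) = z" for z using eps by auto
 have "horizontal (along \<e> (axis 3 1) (axis 1 1) (axis 2 1) 0) = (%a. a)"
  by (rule ext) (simp add: horizontal_def along_def mform_def axis_def gcos_def gsin_def vec_eq_iff forall_3 ee prod_eq_iff)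
 then have cy: "cyclic_invariant \<e> S (axis 3 1) (axis 1 1) (axis 2 1) 0"
  unfolding cyclic_invariant_def using S(6) by simp
 have "1 / cc \<noteq> 1 / (cc + 2 * H)" using cc_pos H by (simp add: field_simps)
 then show ?thesis
  unfolding family_member_def sc using S cy frame_axes[OF eps]
  by (intro exI[of _ S] conjI exI[of _ "axis 3 1"] exI[of _ "axis 1 1"] exI[of _ "axis 2 1"] exI[of _ 0] impI) simp_all
qed

lemma mono_in_closed_segment:
 fixes h :: "real => real"
 assumes "mono_on {a..b} h" "x \<in> {a..b}"
 shows "h x \<in> closed_segment (h a) (h b)"
proof -
 have "h a \<le> h x" "h x \<le> h b" using assms by (auto intro: mono_onD[OF assms(1)])
 then show ?thesis by (simp add: closed_segment_eq_real_ivl)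
qed

theorem theorem1:
  fixes \<epsilon> H :: real
  assumes "\<epsilon> \<in> {-1, 1}" and "H > 0" and "4 * H\<^sup>2 + \<epsilon> > 0"
  shows "\<exists>S :: real \<Rightarrow> (real^3) surface.
    (\<forall>l\<in>{0..pi/2}.
       cmc_surface \<epsilon> H (S l) \<and> complete_surface \<epsilon> (S l) \<and> horizontally_symmetric (S l) \<and>
       (\<exists>p v n t. frame \<epsilon> p v n \<and> cyclic_invariant \<epsilon> (S l) p v n t \<and>
          (l < pi/2 \<longrightarrow> acts_nontrivially \<epsilon> (along \<epsilon> p v n t)))) \<and>
    is_horizontal_cylinder \<epsilon> H (S 0) \<and>
    is_cmc_sphere \<epsilon> H (S (pi/2)) \<and>
    (\<epsilon> = -1 \<longrightarrow> (\<forall>l\<in>{0..pi/2}. embedded (S l))) \<and>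
    (\<epsilon> = 1 \<and> H < 1/2 \<longrightarrow>
       (\<exists>l0\<in>{0..<pi/2}. \<forall>l\<in>{l0..<pi/2}.
          \<forall>T :: (real^3) surface.
            immersed_surface \<epsilon> T \<and> image_of T = image_of (S l) \<longrightarrow> \<not> embedded T)) \<and>
    (\<exists>h. (\<forall>l\<in>{0..pi/2}. is_max_height (S l) (h l)) \<and>
         continuous_on {0..pi/2} h \<and>
         (\<forall>l\<in>{0..pi/2}. h l \<in> closed_segment (h 0) (h (pi/2))))"
proof -
 define q where "q = sqrt (4 * H^2 + \<epsilon>)"
 define t0 t1 where "t0 = 1 / (q + 2 * H)" and "t1 = 1 / q"
 \<comment> \<open>Affine in \<open>l\<close>, so monotonicity and continuity of the height reduce
   to those of \<open>hinv\<close>.\<close>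
 define t where "t l = t0 + (t1 - t0) * (l / (pi/2))" for l
 have q: "q > 0" "q^2 = 4 * H^2 + \<epsilon>" using assms(3) by (simp_all add: q_def)
 have t01: "0 < t0" "t0 < t1" using q assms(2) by (simp_all add: t0_def t1_def divide_strict_left_mono)
 have t_ends: "t 0 = t0" "t (pi/2) = t1" by (simp_all add: t_def)
 have t_mono: "t l < t l'" if "l < l'" for l l'
  unfolding t_def using that t01 by (intro add_strict_left_mono mult_strict_left_mono divide_strict_right_mono) simp_all
 have t_le: "t l \<le> t l'" if "l \<le> l'" for l l' using t_mono[of l l'] that by (cases "l = l'") simp_all
 have t_range: "t0 \<le> t l \<and> t l \<le> t1" if "l \<in> {0..pi/2}" for l
  using that t_le[of 0 l] t_le[of l "pi/2"] unfolding t_ends by simp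
 \<comment> \<open>Off the interval nothing is required, so that the axiom of choice yields a
   function on all reals.\<close>
 have ex: "\<forall>l. \<exists>S. l \<in> {0..pi/2} \<longrightarrow> family_member \<epsilon> H (t l) S"
 proof
  fix l
  show "\<exists>S. l \<in> {0..pi/2} \<longrightarrow> family_member \<epsilon> H (t l) S"
  proof (cases "l \<in> {0..pi/2}")
   case True
   have "\<exists>S. family_member \<epsilon> H (t l) S"
   proof (cases "l = pi/2")
    case True
    show ?thesis unfolding True t_ends using family_member_sphere[OF assms] by (simp only: t1_def q_def)
   next
    case False
    then have "l < pi/2" using True by simp
    then have "t l < t1" using t_mono[of l "pi/2"] unfolding t_ends by simp
    moreover have "t0 \<le> t l" using t_range[OF True] by simp
    ultimately have "delaunay \<epsilon> H (t l)" by unfold_locales (use assms in \<open>simp_all add: t0_def t1_def q_def\<close>)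
    then show ?thesis by (rule family_member_delaunay)
   qed
   then obtain S where "family_member \<epsilon> H (t l) S" by (rule exE)
   then show ?thesis by (intro exI impI)
  next
   case False
   then show ?thesis by (intro exI impI) (rule notE)
  qed
 qed
 from choice[OF ex] obtain S where fS: "\<forall>l. l \<in> {0..pi/2} \<longrightarrow> family_member \<epsilon> H (t l) (S l)" by (rule exE)
 have fm: "family_member \<epsilon> H (t l) (S l)" if "l \<in> {0..pi/2}" for l by (rule fS[THEN spec, THEN mp, OF that])
 note fm' = fm[unfolded family_member_def q_def[symmetric] t0_def[symmetric] t1_def[symmetric]]
 have zero: "0 \<in> {0..pi/2}" and top: "pi/2 \<in> {0..pi/2}" by simp_all
 define h where "h l = 4 * H / q * hinv \<epsilon> (t l)" for l
 have arg: "1 - \<epsilon> * (t l)^2 > 0" if l: "l \<in> {0..pi/2}" for l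
 proof (cases "\<epsilon> = 1")
  case True
  have "1^2 < q^2" using q(2) True assms(2) by simp
  then have "1 < q" by (rule power_less_imp_less_base) (use q in simp)
  then have "t1 < 1" by (simp add: t1_def)
  then have "t l < 1" "0 \<le> t l" using t_range[OF l] t01 by simp_all
  then show ?thesis using True by (simp add: power_less_one_iff abs_square_less_1)
 next
  case False
  then have "\<epsilon> = -1" using assms(1) by simp
  then show ?thesis by (simp add: add_pos_nonneg)
 qed
 have "mono_on {0..pi/2} h"
 proof (rule mono_onI)
  fix l l' :: real assume l: "l \<in> {0..pi/2}" "l' \<in> {0..pi/2}" "l \<le> l'"
  have "hinv \<epsilon> (t l) \<le> hinv \<epsilon> (t l')"
   using hinv_strict_mono[OF assms(1) arg[OF l(1)] arg[OF l(2)]] t_mono[of l l'] l(3) by (cases "l = l'") simp_all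
  then show "h l \<le> h l'" unfolding h_def using assms(2) q by (intro mult_left_mono) simp_all
 qed
 then have seg: "h l \<in> closed_segment (h 0) (h (pi/2))" if "l \<in> {0..pi/2}" for l using that by (rule mono_in_closed_segment)
 have "continuous_on {z. 1 - \<epsilon> * z^2 > 0} (hinv \<epsilon>)" by (rule smooth_on_continuous[OF smooth_on_hinv[OF assms(1)]])
 moreover have "continuous_on {0..pi/2} t" unfolding t_def[abs_def] by (intro continuous_intros) simp_all
 ultimately have "continuous_on {0..pi/2} (\<lambda>l. hinv \<epsilon> (t l))"
  by (rule continuous_on_compose2) (use arg in \<open>intro image_subsetI, simp\<close>)
 then have cont: "continuous_on {0..pi/2} h" unfolding h_def[abs_def] by (intro continuous_on_mult continuous_on_const)
 have ne: "\<exists>l0\<in>{0..<pi/2}. \<forall>l\<in>{l0..<pi/2}. \<forall>T :: (real^3) surface.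
      immersed_surface \<epsilon> T \<and> image_of T = image_of (S l) \<longrightarrow> \<not> embedded T" if e: "\<epsilon> = 1 \<and> H < 1/2"
 proof -
  have qe: "sqrt (4 * H^2 + 1) = q" using e by (simp add: q_def)
  from crossing_near_sphere[OF assms(2) conjunct2[OF e]] obtain \<tau>0 where
   T0: "t0 < \<tau>0 \<and> \<tau>0 < t1 \<and> (\<forall>\<tau>. \<tau>0 \<le> \<tau> \<and> \<tau> < t1 \<longrightarrow> (\<exists>x. delaunay.II 1 H \<tau> x = pi \<and> delaunay.ts 1 H \<tau> x \<noteq> 0))"
   unfolding qe t0_def[symmetric] t1_def[symmetric] by (rule exE)
  \<comment> \<open>The preimage of \<open>\<tau>0\<close> under the affine map
    \<open>t\<close>.\<close>
  define l0 where "l0 = (\<tau>0 - t0) / (t1 - t0) * (pi/2)"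
  have "(t1 - t0) * (l0 / (pi/2)) = \<tau>0 - t0"
  proof -
   have "l0 / (pi/2) = (\<tau>0 - t0) / (t1 - t0)" unfolding l0_def by (rule nonzero_mult_div_cancel_right) simp
   then show ?thesis using t01 by simp
  qed
  then have tl0: "t l0 = \<tau>0" by (simp only: t_def)
  have "0 < l0" using T0 t01 by (simp add: l0_def)
  moreover have "l0 < pi/2"
  proof (rule ccontr)
   assume "\<not> l0 < pi/2"
   then have "t1 \<le> t l0" using t_le[of "pi/2" l0] unfolding t_ends by simp
   then show False using T0 tl0 by simp
  qed
  moreover have "\<not> embedded T" if l: "l \<in> {l0..<pi/2}" and T: "immersed_surface \<epsilon> T \<and> image_of T = image_of (S l)"
   for l and T :: "(real^3) surface"
  proof -
   have l': "l \<in> {0..pi/2}" using l \<open>0 < l0\<close> by simp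
   have "\<tau>0 \<le> t l" using t_le[of l0 l] l unfolding tl0 by simp
   moreover have tl: "t l < t1" using t_mono[of l "pi/2"] l unfolding t_ends by simp
   ultimately have "\<exists>x. delaunay.II 1 H (t l) x = pi \<and> delaunay.ts 1 H (t l) x \<noteq> 0"
    using T0[THEN conjunct2, THEN conjunct2, THEN spec, of "t l"] by simp
   then have "\<epsilon> = 1 \<and> t l < t1 \<and> (\<exists>x. delaunay.II 1 H (t l) x = pi \<and> delaunay.ts 1 H (t l) x \<noteq> 0)" using e tl by simp
   moreover have "\<epsilon> = 1 \<and> t l < t1 \<and> (\<exists>x. delaunay.II 1 H (t l) x = pi \<and> delaunay.ts 1 H (t l) x \<noteq> 0) \<longrightarrow>
    (\<forall>T :: (real^3) surface. immersed_surface \<epsilon> T \<and> image_of T = image_of (S l) \<longrightarrow> \<not> embedded T)"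
    using fm'[OF l'] by (elim conjE) assumption
   ultimately have nT: "\<forall>T :: (real^3) surface. immersed_surface \<epsilon> T \<and> image_of T = image_of (S l) \<longrightarrow> \<not> embedded T" by (rule rev_mp)
   show ?thesis by (rule nT[THEN spec, THEN mp, OF T])
  qed
  ultimately show ?thesis by (intro bexI[of _ l0] ballI allI impI) simp_all
 qed
 have main: "cmc_surface \<epsilon> H (S l) \<and> complete_surface \<epsilon> (S l) \<and> horizontally_symmetric (S l) \<and>
   (\<exists>p v n t. frame \<epsilon> p v n \<and> cyclic_invariant \<epsilon> (S l) p v n t \<and> (l < pi/2 \<longrightarrow> acts_nontrivially \<epsilon> (along \<epsilon> p v n t)))"
  if l: "l \<in> {0..pi/2}" for l
 proof -
  have "\<exists>p v n s. frame \<epsilon> p v n \<and> cyclic_invariant \<epsilon> (S l) p v n s \<and> (t l < t1 \<longrightarrow> acts_nontrivially \<epsilon> (along \<epsilon> p v n s))"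
   using fm'[OF l] by (elim conjE) assumption
  then obtain p v n s where "frame \<epsilon> p v n \<and> cyclic_invariant \<epsilon> (S l) p v n s \<and> (t l < t1 \<longrightarrow> acts_nontrivially \<epsilon> (along \<epsilon> p v n s))"
   by (elim exE)
  then have "frame \<epsilon> p v n \<and> cyclic_invariant \<epsilon> (S l) p v n s \<and> (l < pi/2 \<longrightarrow> acts_nontrivially \<epsilon> (along \<epsilon> p v n s))"
   using t_mono[of l "pi/2"] unfolding t_ends by simp
  then have "\<exists>p v n t. frame \<epsilon> p v n \<and> cyclic_invariant \<epsilon> (S l) p v n t \<and> (l < pi/2 \<longrightarrow> acts_nontrivially \<epsilon> (along \<epsilon> p v n t))"
   by (intro exI)
  moreover have "cmc_surface \<epsilon> H (S l)" "complete_surface \<epsilon> (S l)" "horizontally_symmetric (S l)"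
   using fm'[OF l] by - (elim conjE, assumption)+
  ultimately show ?thesis by (intro conjI)
 qed
 have "t 0 = t0 \<longrightarrow> is_horizontal_cylinder \<epsilon> H (S 0)" using fm'[OF zero] by (elim conjE) assumption
 then have cyl: "is_horizontal_cylinder \<epsilon> H (S 0)" using t_ends(1) by (rule mp)
 have "t (pi/2) = t1 \<longrightarrow> is_cmc_sphere \<epsilon> H (S (pi/2))" using fm'[OF top] by (elim conjE) assumption
 then have sph: "is_cmc_sphere \<epsilon> H (S (pi/2))" using t_ends(2) by (rule mp)
 have emb: "\<epsilon> = -1 \<longrightarrow> embedded (S l)" if "l \<in> {0..pi/2}" for l using fm'[OF that] by (elim conjE) assumption
 have mx: "is_max_height (S l) (h l)" if "l \<in> {0..pi/2}" for l
  unfolding h_def using fm'[OF that] by (elim conjE) assumption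
 show ?thesis
 proof (rule exI[of _ S], intro conjI impI)
  show "\<exists>h. (\<forall>l\<in>{0..pi/2}. is_max_height (S l) (h l)) \<and> continuous_on {0..pi/2} h \<and>
    (\<forall>l\<in>{0..pi/2}. h l \<in> closed_segment (h 0) (h (pi/2)))"
   by (intro exI[of _ h] conjI ballI mx cont seg)
 qed (rule ballI, erule main, rule cyl, rule sph, rule ballI, erule (1) emb[THEN mp, rotated], erule ne)
qed

end
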